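(* Let $\Omega\subset\mathbb{R}^n$ be a bounded connected domain with smooth boundary, let $\eta\in C^2(\mathbb{R}^n)$ be real-valued, let $T$ be a symmetric positive definite $(1,1)$-tensor on $\mathbb{R}^n$, let $\varepsilon,\delta>0$ satisfy $\varepsilon I\le T\le\delta I$ on $\Omega$, and let $\alpha\ge 0$ be a constant. Let $0<\sigma_1\le\sigma_2\le\cdots\to\infty$ be the eigenvalues, repeated according to multiplicity, of the problem $\mathscr{L}\mathbf{u}+\alpha\nabla(\mathrm{div}_\eta\mathbf{u})=-\sigma\mathbf{u}$ in $\Omega$, $\mathbf{u}=0$ on $\partial\Omega$, for vector-valued functions $\mathbf{u}:\Omega\to\mathbb{R}^n$, and let $\mathbf{u}_i$ be a normalized eigenfunction corresponding to $\sigma_i$, the $\mathbf{u}_i$ being chosen orthonormal: $\int_\Omega\mathbf{u}_i\cdot\mathbf{u}_j\,dm=\delta_{ij}$ (Kronecker delta). For a positive integer $k$ put $$D_0=-\alpha\min_{j=1,\dots,k}\|\mathrm{div}_\eta\mathbf{u}_j\|^2+\frac{T_0^2+4C_0}{4\delta},$$ where $$C_0=\sup_\Omega\Big\{\frac12\,\mathrm{div}\Big(T\big(T(\nabla\eta)-\mathrm{tr}(\nabla T)\big)\Big)-\frac14|T(\nabla\eta)|^2\Big\},\qquad T_0=\sup_\Omega|\mathrm{tr}(\nabla T)|.$$ Then $$\sigma_{k+1}+D_0\le\Big(1+\frac{4\delta(n\delta+\alpha)}{\varepsilon^2n^2}\Big)k^{\frac{2\delta(n\delta+\alpha)}{\v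arepsilon^2n^2}}(\sigma_1+D_0).$$
   Context: $\mathbb{R}^n$ carries its canonical metric; tensor fields are smooth, and $I$ is the identity $(1,1)$-tensor. For a vector field $X$, $\mathrm{div}_\eta X=\mathrm{div}X-\langle\nabla\eta,X\rangle$. For a real-valued function $f$, $\mathscr{L}f=\mathrm{div}_\eta(T(\nabla f))=\mathrm{div}(T(\nabla f))-\langle\nabla\eta,T(\nabla f)\rangle$. For $\mathbf{u}=(u^1,\dots,u^n):\Omega\to\mathbb{R}^n$, $\mathscr{L}\mathbf{u}=(\mathscr{L}u^1,\dots,\mathscr{L}u^n)$, and $\mathrm{div}_\eta\mathbf{u}$ is computed regarding $\mathbf{u}$ as a vector field. The measure is $dm=e^{-\eta}d\Omega$, with $d\Omega$ the Lebesgue measure; $\|f\|^2=\int_\Omega f^2\,dm$ for real-valued $f$, and $\|\mathbf{u}\|^2=\int_\Omega|\mathbf{u}|^2\,dm$; normalized means $\|\mathbf{u}_i\|=1$. The vector field $\mathrm{tr}(\nabla T)$ is $\sum_{j}(\nabla_{e_j}T)(e_j)$ for a local orthonormal frame $\{e_j\}$. The operator $\mathscr{L}+\alpha\nabla\mathrm{div}_\eta$ with the Dirichlet condition is formally self-adjoint in the space of vector-valued $L^2(\Omega,dm)$ functions vanishing on $\partial\Omega$ in the trace sense, and its spectrum is real and discrete. *)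

theory Defs
  imports "HOL-Analysis.Analysis"
begin

text \<open>Meant for open sets and a finite-dimensional domain, where it suffices to ask that all
  iterated directional derivatives exist and are continuous.\<close>

primrec Ck_on :: "nat \<Rightarrow> ('a::real_normed_vector \<Rightarrow> 'b::real_normed_vector) \<Rightarrow> 'a set \<Rightarrow> bool" where
  "Ck_on 0 f S \<longleftrightarrow> continuous_on S f"
| "Ck_on (Suc k) f S \<longleftrightarrow>
     (\<forall>x\<in>S. f differentiable (at x)) \<and> (\<forall>v. Ck_on k (\<lambda>x. frechet_derivative f (at x) v) S)"

definition smooth_on :: "('a::real_normed_vector \<Rightarrow> 'b::real_normed_vector) \<Rightarrow> 'a set \<Rightarrow> bool" where
  "smooth_on f S \<longleftrightarrow> (\<forall>k. Ck_on k f S)"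

definition grad :: "(real^'n \<Rightarrow> real) \<Rightarrow> real^'n \<Rightarrow> real^'n" where
  "grad f x = (\<chi> j. frechet_derivative f (at x) (axis j 1))"

definition divergence :: "(real^'n \<Rightarrow> real^'n) \<Rightarrow> real^'n \<Rightarrow> real" where
  "divergence V x = (\<Sum>j\<in>UNIV. frechet_derivative V (at x) (axis j 1) $ j)"

text \<open>A (1,1)-tensor is a matrix field acting by \<open>*v\<close>. The metric is flat, so \<open>\<nabla>\<^bsub>e\<^esub> T\<close> is the
  entrywise directional derivative.\<close>

definition tr_nabla :: "(real^'n \<Rightarrow> real^'n^'n) \<Rightarrow> real^'n \<Rightarrow> real^'n" where
  "tr_nabla T x = (\<Sum>j\<in>UNIV. frechet_derivative T (at x) (axis j 1) *v axis j 1)"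

definition symmetric_pos_def :: "real^'n^'n \<Rightarrow> bool" where
  "symmetric_pos_def A \<longleftrightarrow> transpose A = A \<and> (\<forall>v. v \<noteq> 0 \<longrightarrow> 0 < v \<bullet> (A *v v))"

text \<open>The order on symmetric endomorphisms, as in \<open>\<epsilon> I \<le> T\<close>.\<close>

definition tensor_le :: "real^'n^'n \<Rightarrow> real^'n^'n \<Rightarrow> bool" where
  "tensor_le A B \<longleftrightarrow> (\<forall>v. v \<bullet> (A *v v) \<le> v \<bullet> (B *v v))"

text \<open>Near each boundary point the set is the negative side of a regular level set.\<close>

definition smooth_boundary :: "(real^'n) set \<Rightarrow> bool" where
  "smooth_boundary \<Omega> \<longleftrightarrow>
     (\<forall>p\<in>frontier \<Omega>. \<exists>U \<rho>. open U \<and> p \<in> U \<and> smooth_on \<rho> U \<and> (\<forall>x\<in>U. grad \<rho> x \<noteq> 0) \<and>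
        \<Omega> \<inter> U = {x\<in>U. \<rho> x < (0::real)})"

definition smooth_bounded_domain :: "(real^'n) set \<Rightarrow> bool" where
  "smooth_bounded_domain \<Omega> \<longleftrightarrow>
     \<Omega> \<noteq> {} \<and> open \<Omega> \<and> connected \<Omega> \<and> bounded \<Omega> \<and> smooth_boundary \<Omega>"

definition test_fun :: "(real^'n) set \<Rightarrow> (real^'n \<Rightarrow> real) \<Rightarrow> bool" where
  "test_fun \<Omega> \<phi> \<longleftrightarrow>
     smooth_on \<phi> UNIV \<and> compact (closure {x. \<phi> x \<noteq> 0}) \<and> closure {x. \<phi> x \<noteq> 0} \<subseteq> \<Omega>"

definition loc_integrable :: "(real^'n) set \<Rightarrow> (real^'n \<Rightarrow> 'b::euclidean_space) \<Rightarrow> bool" where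
  "loc_integrable \<Omega> f \<longleftrightarrow> (\<forall>K. compact K \<longrightarrow> K \<subseteq> \<Omega> \<longrightarrow> f absolutely_integrable_on K)"

text \<open>Distributions on \<open>\<Omega>\<close> are functionals on test functions: the one given by a function,
  and the distributional gradient and divergence of a function or vector field.\<close>

definition dist_fun ::
  "(real^'n) set \<Rightarrow> (real^'n \<Rightarrow> 'b::euclidean_space) \<Rightarrow> (real^'n \<Rightarrow> real) \<Rightarrow> 'b" where
  "dist_fun \<Omega> f \<phi> = (LINT x|lebesgue_on \<Omega>. \<phi> x *\<^sub>R f x)"

definition dist_grad ::
  "(real^'n) set \<Rightarrow> (real^'n \<Rightarrow> real) \<Rightarrow> (real^'n \<Rightarrow> real) \<Rightarrow> real^'n" where
  "dist_grad \<Omega> f \<phi> = - (LINT x|lebesgue_on \<Omega>. f x *\<^sub>R grad \<phi> x)"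

definition dist_div ::
  "(real^'n) set \<Rightarrow> (real^'n \<Rightarrow> real^'n) \<Rightarrow> (real^'n \<Rightarrow> real) \<Rightarrow> real" where
  "dist_div \<Omega> V \<phi> = - (LINT x|lebesgue_on \<Omega>. V x \<bullet> grad \<phi> x)"

definition is_weak_grad ::
  "(real^'n) set \<Rightarrow> (real^'n \<Rightarrow> real) \<Rightarrow> (real^'n \<Rightarrow> real^'n) \<Rightarrow> bool" where
  "is_weak_grad \<Omega> f G \<longleftrightarrow> loc_integrable \<Omega> f \<and> loc_integrable \<Omega> G \<and>
     (\<forall>\<phi>. test_fun \<Omega> \<phi> \<longrightarrow> dist_grad \<Omega> f \<phi> = dist_fun \<Omega> G \<phi>)"

text \<open>Unique only almost everywhere in \<open>\<Omega>\<close>; it is used only below integrals over \<open>\<Omega>\<close> and for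
  weakly differentiable \<open>f\<close>.\<close>

definition weak_grad :: "(real^'n) set \<Rightarrow> (real^'n \<Rightarrow> real) \<Rightarrow> real^'n \<Rightarrow> real^'n" where
  "weak_grad \<Omega> f = (SOME G. is_weak_grad \<Omega> f G)"

definition weighted :: "(real^'n) set \<Rightarrow> (real^'n \<Rightarrow> real) \<Rightarrow> (real^'n) measure" where
  "weighted \<Omega> \<eta> = density (lebesgue_on \<Omega>) (\<lambda>x. ennreal (exp (- \<eta> x)))"

definition L2 :: "'a measure \<Rightarrow> ('a \<Rightarrow> 'b::euclidean_space) \<Rightarrow> bool" where
  "L2 M f \<longleftrightarrow> f \<in> borel_measurable M \<and> integrable M (\<lambda>x. (norm (f x))\<^sup>2)"

definition L2_sqnorm :: "'a measure \<Rightarrow> ('a \<Rightarrow> 'b::euclidean_space) \<Rightarrow> real" where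
  "L2_sqnorm M f = (LINT x|M. (norm (f x))\<^sup>2)"

definition L2_inner :: "'a measure \<Rightarrow> ('a \<Rightarrow> 'b::euclidean_space) \<Rightarrow> ('a \<Rightarrow> 'b) \<Rightarrow> real" where
  "L2_inner M f g = (LINT x|M. f x \<bullet> g x)"

text \<open>The functions in \<open>H\<^sup>1\<close> with vanishing trace, as the \<open>H\<^sup>1\<close>-closure of the test functions. On a
  bounded \<open>\<Omega>\<close> the weight is bounded above and below, so the space does not depend on \<open>\<eta>\<close>.\<close>

definition H10 :: "(real^'n) set \<Rightarrow> (real^'n \<Rightarrow> real) \<Rightarrow> (real^'n \<Rightarrow> real) \<Rightarrow> bool" where
  "H10 \<Omega> \<eta> f \<longleftrightarrow>
     (\<exists>G. is_weak_grad \<Omega> f G) \<and> L2 (weighted \<Omega> \<eta>) f \<and> L2 (weighted \<Omega> \<eta>) (weak_grad \<Omega> f) \<and>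
     (\<exists>\<phi> :: nat \<Rightarrow> real^'n \<Rightarrow> real. (\<forall>m. test_fun \<Omega> (\<phi> m)) \<and>
        (\<lambda>m. L2_sqnorm (weighted \<Omega> \<eta>) (\<lambda>x. f x - \<phi> m x)) \<longlonglongrightarrow> 0 \<and>
        (\<lambda>m. L2_sqnorm (weighted \<Omega> \<eta>) (\<lambda>x. weak_grad \<Omega> f x - grad (\<phi> m) x)) \<longlonglongrightarrow> 0)"

text \<open>\<open>div\<^sub>\<eta> u = div u - \<langle>\<nabla>\<eta>, u\<rangle>\<close>, where \<open>div u\<close> is the trace of the weak derivative.\<close>

definition weak_div_eta ::
  "(real^'n) set \<Rightarrow> (real^'n \<Rightarrow> real) \<Rightarrow> (real^'n \<Rightarrow> real^'n) \<Rightarrow> real^'n \<Rightarrow> real" where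
  "weak_div_eta \<Omega> \<eta> u x = (\<Sum>j\<in>UNIV. weak_grad \<Omega> (\<lambda>y. u y $ j) x $ j) - grad \<eta> x \<bullet> u x"

text \<open>\<open>\<L> f = div (T (\<nabla>f)) - \<langle>\<nabla>\<eta>, T (\<nabla>f)\<rangle>\<close>, as a distribution, and componentwise on vectors.\<close>

definition opL ::
  "(real^'n) set \<Rightarrow> (real^'n \<Rightarrow> real) \<Rightarrow> (real^'n \<Rightarrow> real^'n^'n) \<Rightarrow> (real^'n \<Rightarrow> real) \<Rightarrow>
   (real^'n \<Rightarrow> real) \<Rightarrow> real" where
  "opL \<Omega> \<eta> T f \<phi> =
     dist_div \<Omega> (\<lambda>x. T x *v weak_grad \<Omega> f x) \<phi>
     - dist_fun \<Omega> (\<lambda>x. grad \<eta> x \<bullet> (T x *v weak_grad \<Omega> f x)) \<phi>"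

definition opL_vec ::
  "(real^'n) set \<Rightarrow> (real^'n \<Rightarrow> real) \<Rightarrow> (real^'n \<Rightarrow> real^'n^'n) \<Rightarrow> (real^'n \<Rightarrow> real^'n) \<Rightarrow>
   (real^'n \<Rightarrow> real) \<Rightarrow> real^'n" where
  "opL_vec \<Omega> \<eta> T u \<phi> = (\<chi> l. opL \<Omega> \<eta> T (\<lambda>x. u x $ l) \<phi>)"

text \<open>All \<open>u \<in> H\<^sup>1\<^sub>0\<close> (including zero) with \<open>\<L> u + \<alpha> \<nabla>(div\<^sub>\<eta> u) = - s u\<close> in the sense of
  distributions. For \<open>\<eta>\<close> merely \<open>C\<^sup>2\<close> eigenfunctions need not be twice continuously
  differentiable.\<close>

definition eigenspace ::
  "(real^'n) set \<Rightarrow> (real^'n \<Rightarrow> real) \<Rightarrow> (real^'n \<Rightarrow> real^'n^'n) \<Rightarrow> real \<Rightarrow> real \<Rightarrow>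
   (real^'n \<Rightarrow> real^'n) set" where
  "eigenspace \<Omega> \<eta> T \<alpha> s =
     {u. (\<forall>l. H10 \<Omega> \<eta> (\<lambda>x. u x $ l)) \<and>
         (\<forall>\<phi>. test_fun \<Omega> \<phi> \<longrightarrow>
            opL_vec \<Omega> \<eta> T u \<phi> + \<alpha> *\<^sub>R dist_grad \<Omega> (weak_div_eta \<Omega> \<eta> u) \<phi>
            = - s *\<^sub>R dist_fun \<Omega> u \<phi>)}"

text \<open>\<open>E\<close> has dimension \<open>d\<close> after identifying functions that agree almost everywhere.\<close>

definition has_dim_ae ::
  "'a measure \<Rightarrow> ('a \<Rightarrow> 'b::real_vector) set \<Rightarrow> nat \<Rightarrow> bool" where
  "has_dim_ae M E d \<longleftrightarrow>
     (\<exists>w :: nat \<Rightarrow> 'a \<Rightarrow> 'b. (\<forall>i<d. w i \<in> E) \<and>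
        (\<forall>c. (AE x in M. (\<Sum>i<d. c i *\<^sub>R w i x) = 0) \<longrightarrow> (\<forall>i<d. c i = 0)) \<and>
        (\<forall>v\<in>E. \<exists>c. AE x in M. v x = (\<Sum>i<d. c i *\<^sub>R w i x)))"

text \<open>\<open>\<sigma> 1 \<le> \<sigma> 2 \<le> \<dots>\<close> lists the eigenvalues with multiplicity; \<open>\<sigma> 0\<close> is not used. The last clause
  says that each real \<open>s\<close> occurs exactly as often as its multiplicity, hence not at all if it is
  not an eigenvalue; the sets counted are finite as \<open>\<sigma>\<close> tends to infinity.\<close>

definition eigenvalue_sequence ::
  "(real^'n) set \<Rightarrow> (real^'n \<Rightarrow> real) \<Rightarrow> (real^'n \<Rightarrow> real^'n^'n) \<Rightarrow> real \<Rightarrow> (nat \<Rightarrow> real) \<Rightarrow> bool" where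
  "eigenvalue_sequence \<Omega> \<eta> T \<alpha> \<sigma> \<longleftrightarrow>
     0 < \<sigma> 1 \<and> (\<forall>i\<ge>1. \<sigma> i \<le> \<sigma> (Suc i)) \<and> filterlim \<sigma> at_top sequentially \<and>
     (\<forall>s. has_dim_ae (lebesgue_on \<Omega>) (eigenspace \<Omega> \<eta> T \<alpha> s) (card {i. 1 \<le> i \<and> \<sigma> i = s}))"

definition const_C0 :: "(real^'n) set \<Rightarrow> (real^'n \<Rightarrow> real) \<Rightarrow> (real^'n \<Rightarrow> real^'n^'n) \<Rightarrow> real" where
  "const_C0 \<Omega> \<eta> T =
     (SUP x\<in>\<Omega>. 1/2 * divergence (\<lambda>y. T y *v (T y *v grad \<eta> y - tr_nabla T y)) x
               - 1/4 * (norm (T x *v grad \<eta> x))\<^sup>2)"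

definition const_T0 :: "(real^'n) set \<Rightarrow> (real^'n \<Rightarrow> real^'n^'n) \<Rightarrow> real" where
  "const_T0 \<Omega> T = (SUP x\<in>\<Omega>. norm (tr_nabla T x))"

definition const_D0 ::
  "(real^'n) set \<Rightarrow> (real^'n \<Rightarrow> real) \<Rightarrow> (real^'n \<Rightarrow> real^'n^'n) \<Rightarrow> real \<Rightarrow> real \<Rightarrow>
   (nat \<Rightarrow> real^'n \<Rightarrow> real^'n) \<Rightarrow> nat \<Rightarrow> real" where
  "const_D0 \<Omega> \<eta> T \<alpha> \<delta> u k =
     - \<alpha> * Min ((\<lambda>j. L2_sqnorm (weighted \<Omega> \<eta>) (weak_div_eta \<Omega> \<eta> (u j))) ` {1..k})
     + ((const_T0 \<Omega> T)\<^sup>2 + 4 * const_C0 \<Omega> \<eta> T) / (4 * \<delta>)"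

end

theory Submission
  imports Defs
begin

text \<open>Fix a coordinate \<open>x\<^sub>p\<close> and put \<open>w\<^sub>i = x\<^sub>p u\<^sub>i - \<Sum>\<^sub>j a\<^sub>i\<^sub>j u\<^sub>j\<close> with \<open>a\<^sub>i\<^sub>j = \<langle>x\<^sub>p u\<^sub>i, u\<^sub>j\<rangle>\<close>, so that
  \<open>w\<^sub>i\<close> is orthogonal to \<open>u\<^sub>1, \<dots>, u\<^sub>k\<close> and its Rayleigh quotient is at least \<open>\<sigma>\<^sub>k\<^sub>+\<^sub>1\<close>. Pairing \<open>w\<^sub>i\<close> with
  the commutator \<open>[\<L>, x\<^sub>p] u\<^sub>i\<close>, a first order antisymmetric operator, and summing over \<open>p\<close> gives a
  Yang type inequality
  \<open>\<Sum>\<^sub>i (\<sigma>\<^sub>k\<^sub>+\<^sub>1 - \<sigma>\<^sub>i)\<^sup>2 \<le> 2 c \<Sum>\<^sub>i (\<sigma>\<^sub>k\<^sub>+\<^sub>1 - \<sigma>\<^sub>i) (\<sigma>\<^sub>i + D\<^sub>0)\<close>, where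
  \<open>c = 2 \<delta> (n \<delta> + \<alpha>) / (\<epsilon>\<^sup>2 n\<^sup>2)\<close>; the squared norms of the commutators sum, after
  integration by parts, to at most \<open>4 \<delta> (\<sigma>\<^sub>i + D\<^sub>0)\<close>. The same constant \<open>D\<^sub>0\<close> serves for all smaller
  \<open>k\<close>, so the recursion of Cheng and Yang applies to \<open>\<sigma>\<^sub>i + D\<^sub>0\<close>. The lower bound for Rayleigh
  quotients rests on the compact embedding of \<open>H\<^sup>1\<^sub>0\<close> into \<open>L\<^sup>2\<close>: if that bound failed, a minimizer would be
  an eigenfunction with eigenvalue \<open>\<mu> < \<sigma>\<^sub>k\<^sub>+\<^sub>1\<close> orthogonal to all \<open>u\<^sub>i\<close> with \<open>\<sigma>\<^sub>i = \<mu>\<close>,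
  contradicting the multiplicity of \<open>\<mu>\<close>.\<close>

subsection \<open>Cheng and Yang's recursion\<close>

text \<open>As \<eta> is only C2, eigenfunctions are known only to lie in H10, and L u_i is a priori
  a distribution. Hence the proof applies no operator: a function travels with its weak gradient as
  one L2 map (a jet), \<open>Nf\<close> and \<open>Qf\<close> are the densities of norm and energy
  on jets, and commutator identities become pointwise algebra of jets plus one integration by parts.
  With Z = tr(nabla T) - T(grad \<eta>), the commutator of L with x_p sends f to 2 (T grad f)_p +
  Z_p f. Its squares sum over p to |2 T grad f + f Z|^2. The bound |T v|^2 <= \<delta> <T v, v>
  gives the factor 4 \<delta>, and integrating the mixed term by parts leaves a zero order
  coefficient of at most T_0^2 + 4 C_0. In <T grad f, grad f> the energy lacks its \<alpha> part;
  this is where the minimum in D_0 comes from. Summed over p, the double commutators with x_p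
  produce the trace of T, between n \<epsilon> and n \<delta> on the domain, while \<alpha> enters
  only once because the squared components of u add up to |u|^2: hence n \<delta> +
  \<alpha>.\<close>

lemma sinh_superlinear:
  fixes a t :: real
  assumes "1 \<le> a" "0 \<le> t"
  shows "a * sinh t \<le> sinh (a * t)"
proof -
  have "(\<lambda>t. sinh (a * t) - a * sinh t) 0 \<le> (\<lambda>t. sinh (a * t) - a * sinh t) t"
  proof (rule DERIV_nonneg_imp_nondecreasing[OF assms(2)])
    fix s :: real assume s: "0 \<le> s" "s \<le> t"
    have "((\<lambda>t. sinh (a * t) - a * sinh t) has_real_derivative (cosh (a * s) * a - a * cosh s)) (at s)"
      by (auto intro!: derivative_eq_intros)
    moreover have "s \<le> a * s" using s assms mult_right_mono[of 1 a s] by simp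
    then have "cosh s \<le> cosh (a * s)" using s assms by (subst cosh_real_nonneg_le_iff) auto
    then have "0 \<le> cosh (a * s) * a - a * cosh s"
      using assms mult_left_mono[of "cosh s" "cosh (a * s)" a] by (simp add: mult.commute)
    ultimately show "\<exists>y. ((\<lambda>t. sinh (a * t) - a * sinh t) has_real_derivative y) (at s) \<and> 0 \<le> y"
      by blast
  qed
  then show ?thesis by simp
qed

text \<open>Put r = (j + 1) / j and t = (ln r) / 2. The claim is
  \<open>(1 + 2 * c) * sinh t \<le> sinh ((1 + 2 * c) * t)\<close> multiplied by 2 exp ((1 + 2 c) t)
  and then by j (j + 1). The square of l is (j + 1)^2 times the growth factor allowed in one step of
  the recursion.\<close>

lemma powr_ratio_bound:
  fixes c :: real and j :: nat
  assumes c: "0 < c" and "1 \<le> j"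
  defines "l \<equiv> (real j + 1) * ((real j + 1) / real j) powr c"
  shows "(1 + 2 * c) * l + real j * (real j + 1) \<le> l\<^sup>2"
proof -
  define r where "r = (real j + 1) / real j"
  define t where "t = ln r / 2"
  have j: "real j > 0" using assms by simp
  have r1: "r > 1" using j by (simp add: r_def field_simps)
  have r: "r = exp (2 * t)" using r1 by (simp add: t_def)
  have t: "t > 0" using r1 by (simp add: t_def)
  define x where "x = exp t"
  define y where "y = exp (2 * t * c)"
  have x0: "x > 0" and y0: "y > 0" by (auto simp: x_def y_def)
  have rx: "r = x\<^sup>2" using r by (simp add: x_def exp_double)
  have rc: "r powr c = y" using r by (simp add: powr_def y_def mult.commute mult.left_commute)
  have xy: "exp ((1 + 2 * c) * t) = x * y"
    by (simp add: x_def y_def exp_add[symmetric] algebra_simps)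
  have sht: "sinh t = (x - inverse x) / 2" by (simp add: sinh_def x_def exp_minus)
  have shat: "sinh ((1 + 2 * c) * t) = (x * y - inverse (x * y)) / 2"
    unfolding sinh_def exp_minus xy by simp
  have "(1 + 2 * c) * sinh t \<le> sinh ((1 + 2 * c) * t)"
    using sinh_superlinear[of "1 + 2 * c" t] c t by simp
  then have "((1 + 2 * c) * ((x - inverse x) / 2)) * (2 * (x * y)) \<le> ((x * y - inverse (x * y)) / 2) * (2 * (x * y))"
    unfolding sht shat using x0 y0 by (intro mult_right_mono) auto
  moreover have "((1 + 2 * c) * ((x - inverse x) / 2)) * (2 * (x * y)) = (1 + 2 * c) * (x\<^sup>2 - 1) * y"
    using x0 by (simp add: field_simps power2_eq_square)
  moreover have "((x * y - inverse (x * y)) / 2) * (2 * (x * y)) = x\<^sup>2 * y\<^sup>2 - 1"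
    using x0 y0 by (simp add: field_simps power2_eq_square)
  ultimately have *: "(1 + 2 * c) * (r - 1) * r powr c \<le> r * (r powr c)\<^sup>2 - 1"
    unfolding rc unfolding rx by argo
  have rr: "r - 1 = 1 / real j" using j by (simp add: r_def field_simps)
  have rj: "r * real j = real j + 1" using j by (simp add: r_def)
  have "(1 + 2 * c) * (1 / real j) * r powr c * real j \<le> (r * (r powr c)\<^sup>2 - 1) * real j"
    using mult_right_mono[OF *[unfolded rr], of "real j"] j by simp
  moreover have "(1 + 2 * c) * (1 / real j) * r powr c * real j = (1 + 2 * c) * r powr c" using j by simp
  moreover have "(r * (r powr c)\<^sup>2 - 1) * real j = (real j + 1) * (r powr c)\<^sup>2 - real j"
    unfolding rj[symmetric] by (simp add: algebra_simps)
  ultimately have "(1 + 2 * c) * r powr c \<le> (real j + 1) * (r powr c)\<^sup>2 - real j" by linarith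
  then have "(real j + 1) * ((1 + 2 * c) * r powr c) \<le> (real j + 1) * ((real j + 1) * (r powr c)\<^sup>2 - real j)"
    by (intro mult_left_mono) auto
  then show ?thesis unfolding l_def r_def[symmetric] by (simp add: power2_eq_square algebra_simps)
qed

text \<open>The difference of the two sides is a quadratic form in (m, s). It is nonnegative because
  A > 0 and A D - B^2 equals c (1 + c) times the slack in the hypothesis on l. In the recursion m is
  the new value, s the mean of the old ones, and l acts as the multiplier of the constraint given by
  Yang's inequality.\<close>

lemma quadratic_form_le:
  fixes c k l m s :: real
  assumes "0 < c" "1 \<le> k" "0 < l" and l: "(1 + 2 * c) * l + k * (k + 1) \<le> l\<^sup>2"
  shows "- k * (1 + c) * s\<^sup>2 + 2 * k * (1 + c) * s * m + (c - k) * m\<^sup>2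
    \<le> l * (m\<^sup>2 - 2 * (1 + c) * m * s + (1 + 2 * c) * (1 + c) * s\<^sup>2)"
proof -
  define A where "A = l + k - c"
  define B where "B = (1 + c) * (l + k)"
  define D where "D = (1 + c) * ((1 + 2 * c) * l + k)"
  have lc: "1 + 2 * c \<le> l"
  proof -
    have "(1 + 2 * c) * l \<le> l * l" 
    proof -
      have "0 \<le> k * (k + 1)" using assms(2) by simp
      then show ?thesis using l unfolding power2_eq_square by linarith
    qed
    then show ?thesis using assms by simp
  qed
  then have A: "0 < A" using assms by (simp add: A_def)
  have "A * D - B\<^sup>2 = (1 + c) * c * (l\<^sup>2 - (1 + 2 * c) * l - k * (k + 1))"
    unfolding A_def B_def D_def by algebra
  moreover have "\<dots> \<ge> 0" using l assms by (intro mult_nonneg_nonneg) auto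
  ultimately have disc: "B\<^sup>2 \<le> A * D" by linarith
  have "A * (A * m\<^sup>2 - 2 * B * m * s + D * s\<^sup>2) = (A * m - B * s)\<^sup>2 + (A * D - B\<^sup>2) * s\<^sup>2"
    by algebra
  also have "\<dots> \<ge> 0" using disc by simp
  finally have "0 \<le> A * m\<^sup>2 - 2 * B * m * s + D * s\<^sup>2" using A by (simp add: zero_le_mult_iff)
  also have "\<dots> = l * (m\<^sup>2 - 2 * (1 + c) * m * s + (1 + 2 * c) * (1 + c) * s\<^sup>2)
     - (- k * (1 + c) * s\<^sup>2 + 2 * k * (1 + c) * s * m + (c - k) * m\<^sup>2)"
    unfolding A_def B_def D_def by algebra
  finally show ?thesis by simp
qed

text \<open>Cheng and Yang's recursion. The quantity
  \<open>F\<^sub>j = (1 + c) \<Lambda>\<^sub>j\<^sup>2 - T\<^sub>j\<close>, with \<open>\<Lambda>\<^sub>j\<close> and \<open>T\<^sub>j\<close> the means of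
  \<open>v\<^sub>i\<close> and \<open>v\<^sub>i\<^sup>2\<close> over \<open>i \<le> j\<close>, grows by a factor of at most \<open>((j + 1) / j) powr (2 c)\<close>.\<close>

lemma cheng_yang_recursion:
  fixes v :: "nat \<Rightarrow> real" and c :: real
  assumes c: "0 < c" and k: "1 \<le> k" and v1: "0 \<le> v 1"
    and Y: "\<And>j. 1 \<le> j \<Longrightarrow> j \<le> k \<Longrightarrow>
      (\<Sum>i=1..j. (v (j + 1) - v i)\<^sup>2) \<le> 2 * c * (\<Sum>i=1..j. (v (j + 1) - v i) * v i)"
  shows "v (k + 1) \<le> (1 + 2 * c) * real k powr c * v 1"
proof -
  define S where "S j = (\<Sum>i=1..j. v i) / real j" for j
  define Q where "Q j = (\<Sum>i=1..j. (v i)\<^sup>2) / real j" for j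
  define F where "F j = (1 + c) * (S j)\<^sup>2 - Q j" for j
  define P where "P j = (v (j + 1))\<^sup>2 - 2 * (1 + c) * v (j + 1) * S j + (1 + 2 * c) * (1 + c) * (S j)\<^sup>2" for j
  \<comment> \<open>This is hypothesis \<open>Y\<close> divided by j and rewritten in the new value
    and the two means.\<close>
  have PF: "P j \<le> (1 + 2 * c) * F j" if j: "1 \<le> j" "j \<le> k" for j
  proof -
    have sv: "(\<Sum>i=1..j. v i) = real j * S j" and qv: "(\<Sum>i=1..j. (v i)\<^sup>2) = real j * Q j"
      using j by (auto simp: S_def Q_def)
    have "(\<Sum>i=1..j. (v (j + 1) - v i)\<^sup>2)
        = real j * (v (j+1))\<^sup>2 - 2 * v (j+1) * (\<Sum>i=1..j. v i) + (\<Sum>i=1..j. (v i)\<^sup>2)"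
      by (simp add: power2_diff sum.distrib sum_subtractf sum_distrib_left)
    moreover have "(\<Sum>i=1..j. (v (j + 1) - v i) * v i) = v (j+1) * (\<Sum>i=1..j. v i) - (\<Sum>i=1..j. (v i)\<^sup>2)"
      by (simp add: sum_subtractf sum_distrib_left left_diff_distrib power2_eq_square)
    ultimately have "real j * (v (j+1))\<^sup>2 - 2 * v (j+1) * (real j * S j) + real j * Q j
      \<le> 2 * c * (v (j+1) * (real j * S j) - real j * Q j)"
      using Y[OF j] by (simp only: sv qv)
    then have "real j * ((v (j+1))\<^sup>2 - 2 * v (j+1) * S j + Q j - 2 * c * (v (j+1) * S j - Q j)) \<le> 0"
      by (simp add: algebra_simps)
    then have "(v (j+1))\<^sup>2 - 2 * v (j+1) * S j + Q j - 2 * c * (v (j+1) * S j - Q j) \<le> 0"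
      using j by (simp add: mult_le_0_iff)
    then show ?thesis unfolding P_def F_def by (simp add: algebra_simps)
  qed
  have step: "F (j + 1) \<le> ((real j + 1) / real j) powr (2 * c) * F j" if j: "1 \<le> j" "j \<le> k" for j
  proof -
    define l where "l = (real j + 1) * ((real j + 1) / real j) powr c"
    have l0: "0 < l" using j by (simp add: l_def)
    have l: "(1 + 2 * c) * l + real j * (real j + 1) \<le> l\<^sup>2"
      using powr_ratio_bound[OF c j(1)] by (simp add: l_def)
    have "((real j + 1) / real j) powr (2 * c) = (((real j + 1) / real j) powr c)\<^sup>2"
      by (simp add: power2_eq_square powr_add[symmetric])
    then have l2: "l\<^sup>2 = (real j + 1)\<^sup>2 * ((real j + 1) / real j) powr (2 * c)"
      by (simp add: l_def power_mult_distrib)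
    \<comment> \<open>A sum of squares, so \<open>F j\<close> is nonnegative; the last estimate of
      this step multiplies an inequality by \<open>F j\<close>.\<close>
    have "P j = (v (j+1) - (1 + c) * S j)\<^sup>2 + c * (1 + c) * (S j)\<^sup>2"
      unfolding P_def by algebra
    then have "0 \<le> P j" using c by simp
    then have F0: "0 \<le> F j" 
    proof -
      have "0 \<le> (1 + 2 * c) * F j" using PF[OF j] \<open>0 \<le> P j\<close> by linarith
      then show ?thesis using c by (simp add: zero_le_mult_iff)
    qed
    have S1: "(real j + 1) * S (j+1) = real j * S j + v (j+1)" 
      using j by (simp add: S_def field_simps)
    have Q1: "(real j + 1) * Q (j+1) = real j * Q j + (v (j+1))\<^sup>2" 
      using j by (simp add: Q_def field_simps)
    have "(real j + 1)\<^sup>2 * F (j + 1) = (1 + c) * ((real j + 1) * S (j+1))\<^sup>2 - (real j + 1) * ((real j + 1) * Q (j+1))"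
      unfolding F_def by algebra
    also have "\<dots> = real j * (real j + 1) * F j + (- real j * (1 + c) * (S j)\<^sup>2
       + 2 * real j * (1 + c) * S j * v (j+1) + (c - real j) * (v (j+1))\<^sup>2)"
      unfolding S1 Q1 F_def by algebra
    also have "\<dots> \<le> real j * (real j + 1) * F j + l * P j"
      using quadratic_form_le[OF c _ l0 l, of "S j" "v (j+1)"] j unfolding P_def by simp
    also have "\<dots> \<le> real j * (real j + 1) * F j + l * ((1 + 2 * c) * F j)"
      using PF[OF j] l0 by simp
    also have "\<dots> = ((1 + 2 * c) * l + real j * (real j + 1)) * F j" by (simp add: algebra_simps)
    also have "\<dots> \<le> l\<^sup>2 * F j" using l F0 by (intro mult_right_mono)
    finally have "(real j + 1)\<^sup>2 * F (j + 1) \<le> (real j + 1)\<^sup>2 * (((real j + 1) / real j) powr (2 * c) * F j)"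
      unfolding l2 by (simp add: mult.assoc)
    then show ?thesis by (simp del: of_nat_Suc)
  qed
  have F: "F j \<le> real j powr (2 * c) * (c * (v 1)\<^sup>2)" if "1 \<le> j" "j \<le> k" for j
    using that
  proof (induction j rule: nat_induct_at_least)
    case base
    then show ?case by (simp add: F_def S_def Q_def algebra_simps)
  next
    case (Suc j)
    have "F (Suc j) \<le> ((real j + 1) / real j) powr (2 * c) * F j" using step[of j] Suc by simp
    also have "\<dots> \<le> ((real j + 1) / real j) powr (2 * c) * (real j powr (2 * c) * (c * (v 1)\<^sup>2))"
      using Suc by (intro mult_left_mono) auto
    also have "\<dots> = real (Suc j) powr (2 * c) * (c * (v 1)\<^sup>2)"
      using Suc by (simp add: powr_divide add.commute)
    finally show ?case .
  qed
  \<comment> \<open>Completing the square in the mean \<open>S k\<close> eliminates it and leaves a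
    bound for the new value alone.\<close>
  have "c * (v (k+1))\<^sup>2 \<le> (1 + 2 * c) * P k"
  proof -
    have "(1 + 2 * c) * P k - c * (v (k+1))\<^sup>2 = (1 + c) * (v (k+1) - (1 + 2 * c) * S k)\<^sup>2"
      unfolding P_def by algebra
    also have "\<dots> \<ge> 0" using c by simp
    finally show ?thesis by simp
  qed
  also have "\<dots> \<le> (1 + 2 * c) * ((1 + 2 * c) * (real k powr (2 * c) * (c * (v 1)\<^sup>2)))"
    using PF[of k] F[of k] k c by (intro mult_left_mono) (auto intro: order_trans mult_left_mono)
  also have "\<dots> = c * ((1 + 2 * c) * real k powr c * v 1)\<^sup>2"
  proof -
    have "real k powr (2 * c) = (real k powr c)\<^sup>2" by (simp add: power2_eq_square powr_add[symmetric])
    then show ?thesis by (simp add: power_mult_distrib power2_eq_square)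
  qed
  finally have "(v (k+1))\<^sup>2 \<le> ((1 + 2 * c) * real k powr c * v 1)\<^sup>2" using c by simp
  then show ?thesis by (rule power2_le_imp_le) (use v1 c in simp)
qed

subsection \<open>Smooth functions and bumps\<close>

lemma Ck_on_SucI:
  assumes "\<And>x. (f has_derivative D x) (at x)" "\<And>v. Ck_on k (\<lambda>x. D x v) UNIV"
  shows "Ck_on (Suc k) f UNIV"
proof -
  have "frechet_derivative f (at x) = D x" for x
    using assms(1) frechet_derivative_at by metis
  then show ?thesis using assms by (auto simp: differentiable_def)
qed

lemma Ck_on_SucD:
  assumes "Ck_on (Suc k) f UNIV"
  shows "(f has_derivative frechet_derivative f (at x)) (at x)"
    "Ck_on k (\<lambda>x. frechet_derivative f (at x) v) UNIV"
  using assms frechet_derivative_works by auto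

lemma Ck_on_imp_continuous: "Ck_on k f UNIV \<Longrightarrow> continuous_on UNIV f"
  by (cases k) (auto intro!: differentiable_imp_continuous_on simp: differentiable_on_def
      intro: differentiable_at_withinI)

lemma Ck_on_pred: "Ck_on (Suc k) f UNIV \<Longrightarrow> Ck_on k f UNIV"
proof (induction k arbitrary: f)
  case 0
  then show ?case using Ck_on_imp_continuous[of 1 f] by simp
next
  case (Suc k)
  show ?case
    by (rule Ck_on_SucI[OF Ck_on_SucD(1)[OF Suc.prems]]) (rule Suc.IH, rule Ck_on_SucD(2)[OF Suc.prems])
qed

lemma Ck_on_const [simp]: "Ck_on k (\<lambda>x. c) UNIV"
proof (induction k arbitrary: c)
  case (Suc k)
  show ?case by (rule Ck_on_SucI[where D="\<lambda>x v. 0"]) (use Suc in auto)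
qed simp

lemma Ck_on_add: "Ck_on k f UNIV \<Longrightarrow> Ck_on k g UNIV \<Longrightarrow> Ck_on k (\<lambda>x. f x + g x) UNIV"
proof (induction k arbitrary: f g)
  case (Suc k)
  show ?case
    by (rule Ck_on_SucI[OF has_derivative_add[OF Ck_on_SucD(1)[OF Suc.prems(1)] Ck_on_SucD(1)[OF Suc.prems(2)]]])
      (rule Suc.IH[OF Ck_on_SucD(2)[OF Suc.prems(1)] Ck_on_SucD(2)[OF Suc.prems(2)]])
qed (auto intro: continuous_intros)

lemma Ck_on_linear: "bounded_linear l \<Longrightarrow> Ck_on k f UNIV \<Longrightarrow> Ck_on k (\<lambda>x. l (f x)) UNIV"
proof (induction k arbitrary: f)
  case 0
  then show ?case by (auto intro: bounded_linear.continuous_on)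
next
  case (Suc k)
  show ?case
    by (rule Ck_on_SucI[OF bounded_linear.has_derivative[OF Suc.prems(1) Ck_on_SucD(1)[OF Suc.prems(2)]]])
      (rule Suc.IH[OF Suc.prems(1) Ck_on_SucD(2)[OF Suc.prems(2)]])
qed

lemma Ck_on_id: "bounded_linear l \<Longrightarrow> Ck_on k l UNIV"
proof (cases k)
  case (Suc j)
  assume "bounded_linear l"
  then show ?thesis unfolding Suc
    by (intro Ck_on_SucI[where D="\<lambda>x. l"]) (auto intro: bounded_linear_imp_has_derivative)
qed (auto intro: linear_continuous_on)

text \<open>Stated for any bounded bilinear map, so that one induction covers products, scalings and
  matrix fields acting on vector fields.\<close>

lemma Ck_on_bilinear:
  assumes "bounded_bilinear b"
  shows "Ck_on k f UNIV \<Longrightarrow> Ck_on k g UNIV \<Longrightarrow> Ck_on k (\<lambda>x. b (f x) (g x)) UNIV"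
proof (induction k arbitrary: f g)
  case 0
  then show ?case using assms by (auto intro: bounded_bilinear.continuous_on)
next
  case (Suc k)
  show ?case
    by (rule Ck_on_SucI[OF bounded_bilinear.FDERIV[OF assms Ck_on_SucD(1)[OF Suc.prems(1)] Ck_on_SucD(1)[OF Suc.prems(2)]]])
      (rule Ck_on_add; rule Suc.IH; auto intro: Suc.prems Ck_on_pred Ck_on_SucD(2))
qed

lemmas Ck_on_mult = Ck_on_bilinear[OF bounded_bilinear_mult]
lemmas Ck_on_scaleR = Ck_on_bilinear[OF bounded_bilinear_scaleR]

lemma Ck_on_uminus: "Ck_on k f UNIV \<Longrightarrow> Ck_on k (\<lambda>x. - f x) UNIV"
  by (rule Ck_on_linear) (auto intro: bounded_linear_minus bounded_linear_ident)

lemma Ck_on_diff: "Ck_on k f UNIV \<Longrightarrow> Ck_on k g UNIV \<Longrightarrow> Ck_on k (\<lambda>x. f x - g x) UNIV"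
  using Ck_on_add[OF _ Ck_on_uminus, of k f g] by simp

lemma Ck_on_sum: "(\<And>i. i \<in> I \<Longrightarrow> Ck_on k (f i) UNIV) \<Longrightarrow> Ck_on k (\<lambda>x. \<Sum>i\<in>I. f i x) UNIV"
  by (induction I rule: infinite_finite_induct) (auto intro: Ck_on_add)

lemma Ck_on_prod:
  fixes f :: "_ \<Rightarrow> _ \<Rightarrow> real"
  shows "(\<And>i. i \<in> I \<Longrightarrow> Ck_on k (f i) UNIV) \<Longrightarrow> Ck_on k (\<lambda>x. \<Prod>i\<in>I. f i x) UNIV"
  by (induction I rule: infinite_finite_induct) (auto intro: Ck_on_mult)

lemma Ck_on_affine_compose:
  assumes "bounded_linear l"
  shows "Ck_on k f UNIV \<Longrightarrow> Ck_on k (\<lambda>x. f (l x + c)) UNIV"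
proof (induction k arbitrary: f)
  case 0
  have "continuous_on UNIV (\<lambda>x. l x + c)" using assms by (intro continuous_intros linear_continuous_on)
  then show ?case using 0 by (auto intro: continuous_on_compose2)
next
  case (Suc k)
  have 1: "((\<lambda>x. l x + c) has_derivative l) (at x)" for x
    using assms by (auto intro!: derivative_eq_intros bounded_linear_imp_has_derivative)
  show ?case
  proof (rule Ck_on_SucI)
    show "((\<lambda>x. f (l x + c)) has_derivative (\<lambda>v. frechet_derivative f (at (l x + c)) (l v))) (at x)" for x
      using diff_chain_at[OF 1 Ck_on_SucD(1)[OF Suc.prems]] by (simp add: o_def)
    show "Ck_on k (\<lambda>x. frechet_derivative f (at (l x + c)) (l v)) UNIV" for v
      by (rule Suc.IH) (rule Ck_on_SucD(2)[OF Suc.prems])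
  qed
qed

lemma Ck_on_exp: 
  fixes f :: "'a::real_normed_vector \<Rightarrow> real"
  shows "Ck_on k f UNIV \<Longrightarrow> Ck_on k (\<lambda>x. exp (f x)) UNIV"
proof (induction k)
  case (Suc k)
  show ?case
  proof (rule Ck_on_SucI)
    show "((\<lambda>x. exp (f x)) has_derivative (\<lambda>v. exp (f x) * frechet_derivative f (at x) v)) (at x)" for x
      using Ck_on_SucD(1)[OF Suc.prems] by (auto intro!: derivative_eq_intros)
    show "Ck_on k (\<lambda>x. exp (f x) * frechet_derivative f (at x) v) UNIV" for v
      by (intro Ck_on_mult Suc.IH Ck_on_pred[OF Suc.prems] Ck_on_SucD(2)[OF Suc.prems])
  qed
qed (auto intro: continuous_intros)

text \<open>The derivatives of \<open>exp (-1/t)\<close>, extended by zero, are combinations of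
  functions of this shape.\<close>

definition bump_term :: "nat \<Rightarrow> real \<Rightarrow> real" where
  "bump_term m t = (if 0 < t then exp (- 1 / t) / t ^ m else 0)"

lemma exp_inverse_over_power_tendsto: "((\<lambda>t::real. exp (- 1 / t) / t ^ m) \<longlongrightarrow> 0) (at_right 0)"
proof -
  have "((\<lambda>x::real. x ^ m / exp x) \<longlongrightarrow> 0) at_top" by (rule tendsto_power_div_exp_0)
  then have "((\<lambda>t::real. inverse t ^ m / exp (inverse t)) \<longlongrightarrow> 0) (at_right 0)"
    using filterlim_compose[OF _ filterlim_inverse_at_top_right] by blast
  then show ?thesis by (simp add: divide_inverse exp_minus power_inverse mult.commute)
qed

lemma bump_term_tendsto: "((\<lambda>t. bump_term m t) \<longlongrightarrow> 0) (at 0)"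
  unfolding filterlim_at_split
proof
  show "(bump_term m \<longlongrightarrow> 0) (at_left 0)"
    by (rule Lim_transform_eventually[OF tendsto_const])
      (auto simp: eventually_at_left_field bump_term_def intro!: exI[of _ "-1"])
  show "(bump_term m \<longlongrightarrow> 0) (at_right 0)"
    by (rule Lim_transform_eventually[OF exp_inverse_over_power_tendsto[of m]])
      (auto simp: eventually_at_right_field bump_term_def intro!: exI[of _ "1"])
qed

text \<open>The family is closed under differentiation, with one rule for all t including 0; this
  drives the induction for smoothness.\<close>

lemma bump_term_deriv:
  "(bump_term m has_real_derivative (bump_term (m + 2) t - real m * bump_term (m + 1) t)) (at t)"
proof (cases t "0::real" rule: linorder_cases)
  case less
  have "(bump_term m has_real_derivative 0) (at t)"
    by (rule has_field_derivative_transform_within_open[of "\<lambda>_. 0" _ _ "{..<0}"])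
      (use less in \<open>auto simp: bump_term_def\<close>)
  then show ?thesis using less by (simp add: bump_term_def)
next
  case equal
  \<comment> \<open>The difference quotient of \<open>bump_term m\<close> at 0 is
    \<open>bump_term (Suc m)\<close>, which tends to 0.\<close>
  have "((\<lambda>y. (bump_term m y - bump_term m 0) / (y - 0)) \<longlongrightarrow> 0) (at 0)"
    by (rule Lim_transform_eventually[OF bump_term_tendsto[of "Suc m"]])
      (auto simp: bump_term_def eventually_at intro!: exI[of _ 1])
  then show ?thesis using equal by (simp add: has_field_derivative_iff bump_term_def)
next
  case greater
  have "((\<lambda>t. exp (- 1 / t) / t ^ m) has_real_derivative (bump_term (m + 2) t - real m * bump_term (m + 1) t)) (at t)"
    using greater by (auto intro!: derivative_eq_intros simp: bump_term_def field_simps power2_eq_square)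
      (cases m; simp add: field_simps)+
  then show ?thesis
    by (rule has_field_derivative_transform_within_open[of _ _ _ "{0<..}"])
      (use greater in \<open>auto simp: bump_term_def\<close>)
qed

lemma Ck_on_bump_term: "Ck_on k (bump_term m) UNIV"
proof (induction k arbitrary: m)
  case 0
  show ?case
    by (auto intro!: continuous_at_imp_continuous_on DERIV_isCont[OF bump_term_deriv])
next
  case (Suc k)
  show ?case
  proof (rule Ck_on_SucI)
    show "(bump_term m has_derivative (\<lambda>v. (bump_term (m + 2) t - real m * bump_term (m + 1) t) * v)) (at t)" for t
      using bump_term_deriv[of m t] by (simp add: has_field_derivative_def)
    show "Ck_on k (\<lambda>t. (bump_term (m + 2) t - real m * bump_term (m + 1) t) * v) UNIV" for v
      by (intro Ck_on_mult Ck_on_diff Ck_on_const Suc)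
  qed
qed

text \<open>A product of one-dimensional bumps, positive exactly on the open box. The scale
  \<open>s\<close> is a parameter because, as it grows, the bumps stay between 0 and 1 and tend to
  the indicator of the box.\<close>

definition box_bump :: "real \<Rightarrow> real^'n \<Rightarrow> real^'n \<Rightarrow> real^'n \<Rightarrow> real" where
  "box_bump s a b x = (\<Prod>j\<in>UNIV. bump_term 0 (s * (x $ j - a $ j)) * bump_term 0 (s * (b $ j - x $ j)))"

lemma bump_term_nonneg: "0 \<le> bump_term m t" by (simp add: bump_term_def)
lemma bump_term_le_1: "bump_term 0 t \<le> 1" by (simp add: bump_term_def)

lemma box_bump_nonneg: "0 \<le> box_bump s a b x"
  by (auto simp: box_bump_def intro!: prod_nonneg mult_nonneg_nonneg bump_term_nonneg)

lemma box_bump_le_1: "box_bump s a b x \<le> 1"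
  by (auto simp: box_bump_def intro!: prod_le_1 mult_nonneg_nonneg mult_le_one bump_term_nonneg bump_term_le_1)

lemma box_bump_pos_iff: 
  assumes "0 < s" shows "box_bump s a b x \<noteq> 0 \<longleftrightarrow> x \<in> box a b"
  using assms by (auto simp: box_bump_def bump_term_def mem_box_cart zero_less_mult_iff split: if_splits)

lemma smooth_box_bump:
  fixes a b :: "real^'n"
  shows "smooth_on (box_bump s a b) UNIV"
proof -
  have "Ck_on k (\<lambda>x. bump_term 0 (s * (x $ j - a $ j)) * bump_term 0 (s * (b $ j - x $ j))) UNIV" for k and j :: 'n
  proof (rule Ck_on_mult)
    have l: "bounded_linear (\<lambda>x::real^'n. s * (x $ j))" "bounded_linear (\<lambda>x::real^'n. (- s) * (x $ j))"
      by (intro bounded_linear_const_mult bounded_linear_vec_nth)+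
    show "Ck_on k (\<lambda>x. bump_term 0 (s * (x $ j - a $ j))) UNIV"
      using Ck_on_affine_compose[OF l(1) Ck_on_bump_term, of k 0 "- s * a $ j"] by (simp add: algebra_simps)
    show "Ck_on k (\<lambda>x. bump_term 0 (s * (b $ j - x $ j))) UNIV"
      using Ck_on_affine_compose[OF l(2) Ck_on_bump_term, of k 0 "s * b $ j"] by (simp add: algebra_simps)
  qed
  then show ?thesis unfolding smooth_on_def box_bump_def[abs_def] by (auto intro!: Ck_on_prod)
qed

lemma test_fun_box_bump:
  assumes "0 < s" "cbox a b \<subseteq> \<Omega>"
  shows "test_fun \<Omega> (box_bump s a b)"
proof -
  have "{x. box_bump s a b x \<noteq> 0} = box a b" using box_bump_pos_iff[OF assms(1)] by auto
  moreover have "closure (box a b) \<subseteq> cbox a b" by (rule closure_minimal) (auto simp: box_subset_cbox)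
  moreover have "compact (closure (box a b))" by (simp add: bounded_box)
  ultimately show ?thesis using assms smooth_box_bump by (auto simp: test_fun_def)
qed

lemma box_bump_tendsto:
  fixes a b :: "real^'n"
  shows "(\<lambda>m. box_bump (real (Suc m)) a b x) \<longlonglongrightarrow> indicator (box a b) x"
proof (cases "x \<in> box a b")
  case True
  have *: "(\<lambda>m. bump_term 0 (real (Suc m) * d)) \<longlonglongrightarrow> 1" if "d > 0" for d
  proof -
    have "(\<lambda>m. inverse (real (Suc m)) * (- 1 / d)) \<longlonglongrightarrow> 0 * (- 1 / d)"
      by (intro tendsto_mult LIMSEQ_inverse_real_of_nat tendsto_const)
    then have "(\<lambda>m. exp (inverse (real (Suc m)) * (- 1 / d))) \<longlonglongrightarrow> exp 0"
      by (intro tendsto_exp) simp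
    moreover have "bump_term 0 (real (Suc m) * d) = exp (inverse (real (Suc m)) * (- 1 / d))" for m
      using that by (simp add: bump_term_def divide_simps)
    ultimately show ?thesis by simp
  qed
  have "(\<lambda>m. box_bump (real (Suc m)) a b x) \<longlonglongrightarrow> (\<Prod>j\<in>(UNIV::'n set). 1 * 1)"
    unfolding box_bump_def
  proof (rule Limits.tendsto_prod)
    fix j
    have "0 < x $ j - a $ j" "0 < b $ j - x $ j" using True by (auto simp: mem_box_cart)
    then show "(\<lambda>m. bump_term 0 (real (Suc m) * (x $ j - a $ j)) * bump_term 0 (real (Suc m) * (b $ j - x $ j)))
      \<longlonglongrightarrow> 1 * 1"
      by (intro tendsto_mult *)
  qed
  then show ?thesis using True by simp
next
  case False
  then have "box_bump (real (Suc m)) a b x = 0" for m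
    using box_bump_pos_iff[of "real (Suc m)" a b x] by auto
  then show ?thesis using False by simp
qed

subsection \<open>Square integrable functions\<close>

lemma L2_measurable: "L2 M f \<Longrightarrow> f \<in> borel_measurable M"
  by (simp add: L2_def)

lemma L2_integrable_sq: "L2 M f \<Longrightarrow> integrable M (\<lambda>x. (norm (f x))\<^sup>2)"
  by (simp add: L2_def)

lemma L2_integrable_norm_mult:
  assumes "L2 M f" "L2 M g"
  shows "integrable M (\<lambda>x. norm (f x) * norm (g x))"
proof (rule Bochner_Integration.integrable_bound)
  show "integrable M (\<lambda>x. (norm (f x))\<^sup>2 + (norm (g x))\<^sup>2)"
    using assms by (auto simp: L2_def)
  show "(\<lambda>x. norm (f x) * norm (g x)) \<in> borel_measurable M"
    using assms by (auto simp: L2_def)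
  have "norm (f x) * norm (g x) \<le> (norm (f x))\<^sup>2 + (norm (g x))\<^sup>2" for x
    using sum_squares_bound[of "norm (f x)" "norm (g x)"]
      mult_nonneg_nonneg[OF norm_ge_zero[of "f x"] norm_ge_zero[of "g x"]] by linarith
  then show "AE x in M. norm (norm (f x) * norm (g x)) \<le> norm ((norm (f x))\<^sup>2 + (norm (g x))\<^sup>2)"
    by (intro AE_I2) (simp add: abs_mult)
qed

lemma L2_bound:
  assumes "L2 M f" "g \<in> borel_measurable M" "\<And>x. x \<in> space M \<Longrightarrow> norm (g x) \<le> K * norm (f x)"
  shows "L2 M g"
proof -
  have "integrable M (\<lambda>x. (norm (g x))\<^sup>2)"
  proof (rule Bochner_Integration.integrable_bound)
    show "integrable M (\<lambda>x. K\<^sup>2 * (norm (f x))\<^sup>2)" using assms(1) by (auto simp: L2_def)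
    show "(\<lambda>x. (norm (g x))\<^sup>2) \<in> borel_measurable M" using assms(2) by simp
    have "(norm (g x))\<^sup>2 \<le> K\<^sup>2 * (norm (f x))\<^sup>2" if "x \<in> space M" for x
      using power_mono[OF assms(3)[OF that], of 2] by (simp add: power_mult_distrib)
    then show "AE x in M. norm ((norm (g x))\<^sup>2) \<le> norm (K\<^sup>2 * (norm (f x))\<^sup>2)"
      by (intro AE_I2) simp
  qed
  then show ?thesis using assms(2) by (simp add: L2_def)
qed

lemma L2_zero [simp]: "L2 M (\<lambda>x. 0)"
  by (simp add: L2_def)

lemma L2_scaleR: "L2 M f \<Longrightarrow> L2 M (\<lambda>x. a *\<^sub>R f x)"
  by (rule L2_bound[where K="\<bar>a\<bar>"]) (auto simp: L2_def)

lemma L2_add: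
  assumes "L2 M f" "L2 M g" shows "L2 M (\<lambda>x. f x + g x)"
proof -
  have "integrable M (\<lambda>x. (norm (f x + g x))\<^sup>2)"
  proof (rule Bochner_Integration.integrable_bound)
    show "integrable M (\<lambda>x. 2 * (norm (f x))\<^sup>2 + 2 * (norm (g x))\<^sup>2)"
      using assms by (auto simp: L2_def)
    show "(\<lambda>x. (norm (f x + g x))\<^sup>2) \<in> borel_measurable M"
      using assms[THEN L2_measurable] by measurable
    have "(norm (f x + g x))\<^sup>2 \<le> 2 * (norm (f x))\<^sup>2 + 2 * (norm (g x))\<^sup>2" for x
      using power_mono[OF norm_triangle_ineq[of "f x" "g x"], of 2]
        sum_squares_bound[of "norm (f x)" "norm (g x)"] by (simp add: power2_sum)
    then show "AE x in M. norm ((norm (f x + g x))\<^sup>2) \<le> norm (2 * (norm (f x))\<^sup>2 + 2 * (norm (g x))\<^sup>2)"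
      by (intro AE_I2) simp
  qed
  then show ?thesis using assms[THEN L2_measurable] by (simp add: L2_def)
qed

lemma L2_uminus: "L2 M f \<Longrightarrow> L2 M (\<lambda>x. - f x)"
  by (rule L2_bound[where K=1]) (auto simp: L2_def)

lemma L2_diff: "L2 M f \<Longrightarrow> L2 M g \<Longrightarrow> L2 M (\<lambda>x. f x - g x)"
  using L2_add[OF _ L2_uminus, of M f g] by simp

lemma L2_sum: "(\<And>i. i \<in> I \<Longrightarrow> L2 M (f i)) \<Longrightarrow> L2 M (\<lambda>x. \<Sum>i\<in>I. f i x)"
  by (induction I rule: infinite_finite_induct) (auto intro: L2_add)

lemma L2_sqnorm_nonneg [simp]: "0 \<le> L2_sqnorm M f"
  by (simp add: L2_sqnorm_def)

lemma L2_sqnorm_diff_commute: "L2_sqnorm M (\<lambda>x. f x - g x) = L2_sqnorm M (\<lambda>x. g x - f x)"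
  by (simp add: L2_sqnorm_def norm_minus_commute)

lemma L2_sqnorm_cong_AE:
  assumes "f \<in> borel_measurable M" "g \<in> borel_measurable M" "AE x in M. f x = g x"
  shows "L2_sqnorm M f = L2_sqnorm M g"
  unfolding L2_sqnorm_def using assms by (intro integral_cong_AE) auto

lemma L2_sqnorm_scaleR: "L2_sqnorm M (\<lambda>x. a *\<^sub>R f x) = a\<^sup>2 * L2_sqnorm M f"
  by (simp add: L2_sqnorm_def power_mult_distrib)

lemma L2_sqnorm_bound:
  assumes "L2 M f" "g \<in> borel_measurable M" "\<And>x. x \<in> space M \<Longrightarrow> norm (g x) \<le> K * norm (f x)"
  shows "L2_sqnorm M g \<le> K\<^sup>2 * L2_sqnorm M f"
proof -
  have "L2_sqnorm M g \<le> (LINT x|M. K\<^sup>2 * (norm (f x))\<^sup>2)"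
    unfolding L2_sqnorm_def
  proof (rule integral_mono)
    show "integrable M (\<lambda>x. (norm (g x))\<^sup>2)" using L2_bound[OF assms] by (simp add: L2_def)
    show "integrable M (\<lambda>x. K\<^sup>2 * (norm (f x))\<^sup>2)" using assms(1) by (simp add: L2_def)
    show "(norm (g x))\<^sup>2 \<le> K\<^sup>2 * (norm (f x))\<^sup>2" if "x \<in> space M" for x
      using power_mono[OF assms(3)[OF that], of 2] by (simp add: power_mult_distrib)
  qed
  then show ?thesis by (simp add: L2_sqnorm_def)
qed

text \<open>For C = 0 the affine function is nonnegative everywhere and so has no slope. The lemma
  serves for the Cauchy-Schwarz inequality, for the bound of |T v|^2, and, with A = 0, for the first
  variation of the Rayleigh quotient.\<close>

lemma quadratic_nonneg_discriminant:
  fixes A B C :: real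
  assumes "\<And>t. 0 \<le> A - 2 * t * B + t\<^sup>2 * C" "0 \<le> C"
  shows "B\<^sup>2 \<le> A * C"
proof (cases "C = 0")
  case True
  have "B = 0"
  proof (rule ccontr)
    assume "B \<noteq> 0"
    then show False using assms(1)[of "(A + 1) / (2 * B)"] True by (simp add: field_simps)
  qed
  then show ?thesis using True by simp
next
  case False
  then have C: "C > 0" using assms(2) by simp
  have "0 \<le> A - B\<^sup>2 / C" using assms(1)[of "B / C"] C by (simp add: field_simps power2_eq_square)
  then show ?thesis using C by (simp add: field_simps)
qed

lemma L2_Cauchy_Schwarz:
  assumes "L2 M f" "L2 M g"
  shows "(LINT x|M. norm (f x) * norm (g x))\<^sup>2 \<le> L2_sqnorm M f * L2_sqnorm M g"
proof (rule quadratic_nonneg_discriminant)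
  note i = L2_integrable_sq[OF assms(1)] L2_integrable_sq[OF assms(2)] L2_integrable_norm_mult[OF assms]
  fix t :: real
  have "0 \<le> (LINT x|M. (norm (f x) - t * norm (g x))\<^sup>2)" by simp
  also have "(\<lambda>x. (norm (f x) - t * norm (g x))\<^sup>2)
      = (\<lambda>x. (norm (f x))\<^sup>2 - 2 * t * (norm (f x) * norm (g x)) + t\<^sup>2 * (norm (g x))\<^sup>2)"
    by (simp add: power2_diff power_mult_distrib algebra_simps)
  also have "(LINT x|M. \<dots> x) = L2_sqnorm M f - 2 * t * (LINT x|M. norm (f x) * norm (g x)) + t\<^sup>2 * L2_sqnorm M g"
    unfolding L2_sqnorm_def using i by simp
  finally show "0 \<le> L2_sqnorm M f - 2 * t * (LINT x|M. norm (f x) * norm (g x)) + t\<^sup>2 * L2_sqnorm M g" .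
qed simp

lemma L2_Cauchy_Schwarz_sqrt:
  assumes "L2 M f" "L2 M g"
  shows "(LINT x|M. norm (f x) * norm (g x)) \<le> sqrt (L2_sqnorm M f) * sqrt (L2_sqnorm M g)"
  using L2_Cauchy_Schwarz[OF assms] by (simp add: real_le_rsqrt real_sqrt_mult[symmetric])

lemma L2_sqnorm_triangle:
  assumes "L2 M f" "L2 M g"
  shows "L2_sqnorm M (\<lambda>x. f x + g x) \<le> 2 * L2_sqnorm M f + 2 * L2_sqnorm M g"
proof -
  have "L2_sqnorm M (\<lambda>x. f x + g x) \<le> (LINT x|M. 2 * (norm (f x))\<^sup>2 + 2 * (norm (g x))\<^sup>2)"
    unfolding L2_sqnorm_def
  proof (rule integral_mono)
    show "integrable M (\<lambda>x. (norm (f x + g x))\<^sup>2)" using L2_add[OF assms] by (simp add: L2_def)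
    show "integrable M (\<lambda>x. 2 * (norm (f x))\<^sup>2 + 2 * (norm (g x))\<^sup>2)"
      using assms by (auto simp: L2_def)
    show "(norm (f x + g x))\<^sup>2 \<le> 2 * (norm (f x))\<^sup>2 + 2 * (norm (g x))\<^sup>2" for x
      using power_mono[OF norm_triangle_ineq[of "f x" "g x"], of 2]
        sum_squares_bound[of "norm (f x)" "norm (g x)"] by (simp add: power2_sum)
  qed
  also have "\<dots> = 2 * L2_sqnorm M f + 2 * L2_sqnorm M g"
    using assms by (simp add: L2_sqnorm_def L2_def)
  finally show ?thesis .
qed

section \<open>Mean square limits and bounded forms\<close>

definition L2_lim :: "'a measure \<Rightarrow> (nat \<Rightarrow> 'a \<Rightarrow> 'b::euclidean_space) \<Rightarrow> ('a \<Rightarrow> 'b) \<Rightarrow> bool" where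
  "L2_lim M F f \<longleftrightarrow> (\<forall>m. L2 M (F m)) \<and> L2 M f \<and> (\<lambda>m. L2_sqnorm M (\<lambda>x. F m x - f x)) \<longlonglongrightarrow> 0"

lemma L2_lim_const: "L2 M f \<Longrightarrow> L2_lim M (\<lambda>m. f) f"
  by (simp add: L2_lim_def L2_sqnorm_def)

lemma L2_lim_scaleR: "L2_lim M F f \<Longrightarrow> L2_lim M (\<lambda>m x. a *\<^sub>R F m x) (\<lambda>x. a *\<^sub>R f x)"
  unfolding L2_lim_def scaleR_diff_right[symmetric] L2_sqnorm_scaleR
  by (auto intro: L2_scaleR intro!: tendsto_mult_right_zero)

lemma L2_lim_add:
  assumes "L2_lim M F f" "L2_lim M G g"
  shows "L2_lim M (\<lambda>m x. F m x + G m x) (\<lambda>x. f x + g x)"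
proof -
  have L: "L2 M (\<lambda>x. F m x - f x)" "L2 M (\<lambda>x. G m x - g x)" for m
    using assms by (auto simp: L2_lim_def intro: L2_diff)
  have "(\<lambda>m. L2_sqnorm M (\<lambda>x. F m x + G m x - (f x + g x))) \<longlonglongrightarrow> 0"
  proof (rule tendsto_sandwich[OF _ _ tendsto_const])
    show "\<forall>\<^sub>F m in sequentially. L2_sqnorm M (\<lambda>x. F m x + G m x - (f x + g x))
      \<le> 2 * L2_sqnorm M (\<lambda>x. F m x - f x) + 2 * L2_sqnorm M (\<lambda>x. G m x - g x)"
      using L2_sqnorm_triangle[OF L] by (auto simp: algebra_simps)
    have "(\<lambda>m. 2 * L2_sqnorm M (\<lambda>x. F m x - f x) + 2 * L2_sqnorm M (\<lambda>x. G m x - g x)) \<longlonglongrightarrow> 2 * 0 + 2 * 0"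
      using assms unfolding L2_lim_def by (intro tendsto_intros) auto
    then show "(\<lambda>m. 2 * L2_sqnorm M (\<lambda>x. F m x - f x) + 2 * L2_sqnorm M (\<lambda>x. G m x - g x)) \<longlonglongrightarrow> 0" by simp
  qed simp
  then show ?thesis using assms by (auto simp: L2_lim_def intro: L2_add)
qed

text \<open>Makes closures closed: a limit of approximable functions is itself a limit of members of
  \<open>P\<close>, taking one approximation with error below 1 / (m + 1) for each m.\<close>

lemma L2_lim_diagonal:
  assumes "L2_lim M F f" "\<And>m. \<exists>g. P g \<and> L2 M g \<and> L2_sqnorm M (\<lambda>x. g x - F m x) < inverse (real (Suc m))"
  obtains G where "\<And>m. P (G m)" "L2_lim M G f"
proof -
  obtain G where G: "\<And>m. P (G m)" "\<And>m. L2 M (G m)"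
      "\<And>m. L2_sqnorm M (\<lambda>x. G m x - F m x) < inverse (real (Suc m))"
    using assms(2) by metis
  have "L2_lim M (\<lambda>m x. G m x - F m x) (\<lambda>x. 0)"
    unfolding L2_lim_def
  proof (intro conjI allI L2_zero L2_diff G)
    show "L2 M (F m)" for m using assms(1) by (simp add: L2_lim_def)
    show "(\<lambda>m. L2_sqnorm M (\<lambda>x. G m x - F m x - 0)) \<longlonglongrightarrow> 0"
      using G(3) by (intro tendsto_sandwich[OF _ _ tendsto_const LIMSEQ_inverse_real_of_nat])
        (auto intro!: always_eventually less_imp_le)
  qed
  from L2_lim_add[OF this assms(1)] have "L2_lim M G f" by simp
  then show ?thesis using G(1) that by blast
qed

text \<open>\<open>L\<^sup>2\<close> limits are handled through pointwise bounded bilinear forms \<open>q\<^sub>x\<close> and linear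
  maps \<open>A\<^sub>x\<close> with measurable coefficients.\<close>

definition bform :: "'a measure \<Rightarrow> ('a \<Rightarrow> 'b::euclidean_space \<Rightarrow> 'c::euclidean_space \<Rightarrow> real) \<Rightarrow> bool" where
  "bform M q \<longleftrightarrow> (\<forall>x. bilinear (q x)) \<and> (\<forall>b c. (\<lambda>x. q x b c) \<in> borel_measurable M) \<and>
     (\<exists>K\<ge>0. \<forall>x\<in>space M. \<forall>b c. \<bar>q x b c\<bar> \<le> K * norm b * norm c)"

definition bop :: "'a measure \<Rightarrow> ('a \<Rightarrow> 'b::euclidean_space \<Rightarrow> 'c::euclidean_space) \<Rightarrow> bool" where
  "bop M A \<longleftrightarrow> (\<forall>x. linear (A x)) \<and> (\<forall>b. (\<lambda>x. A x b) \<in> borel_measurable M) \<and>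
     (\<exists>K\<ge>0. \<forall>x\<in>space M. \<forall>b. norm (A x b) \<le> K * norm b)"

definition ifm :: "'a measure \<Rightarrow> ('a \<Rightarrow> 'b \<Rightarrow> 'c \<Rightarrow> real) \<Rightarrow> ('a \<Rightarrow> 'b) \<Rightarrow> ('a \<Rightarrow> 'c) \<Rightarrow> real" where
  "ifm M q f g = (LINT x|M. q x (f x) (g x))"

lemma linear_basis_expand:
  assumes "linear A" shows "A b = (\<Sum>i\<in>Basis. (b \<bullet> i) *\<^sub>R A i)"
proof -
  interpret linear A by fact
  have "A b = A (\<Sum>i\<in>Basis. (b \<bullet> i) *\<^sub>R i)" by (simp add: euclidean_representation)
  also have "\<dots> = (\<Sum>i\<in>Basis. (b \<bullet> i) *\<^sub>R A i)" by (simp only: sum scaleR)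
  finally show ?thesis .
qed

lemma bilinear_basis_expand:
  fixes q :: "'b::euclidean_space \<Rightarrow> 'c::euclidean_space \<Rightarrow> real"
  assumes "bilinear q" shows "q b c = (\<Sum>i\<in>Basis. \<Sum>j\<in>Basis. (b \<bullet> i) * (c \<bullet> j) * q i j)"
proof -
  have 1: "linear (\<lambda>b. q b c)" "linear (\<lambda>c. q i c)" for i c using assms by (auto simp: bilinear_def)
  have "q b c = (\<Sum>i\<in>Basis. (b \<bullet> i) *\<^sub>R q i c)" by (rule linear_basis_expand[OF 1(1)])
  also have "\<dots> = (\<Sum>i\<in>Basis. (b \<bullet> i) *\<^sub>R (\<Sum>j\<in>Basis. (c \<bullet> j) *\<^sub>R q i j))"
    by (intro sum.cong refl arg_cong2[where f=scaleR] linear_basis_expand[OF 1(2)])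
  finally show ?thesis by (simp add: sum_distrib_left mult.assoc)
qed

lemma bform_measurable:
  assumes "bform M q" "f \<in> borel_measurable M" "g \<in> borel_measurable M"
  shows "(\<lambda>x. q x (f x) (g x)) \<in> borel_measurable M"
proof -
  have "(\<lambda>x. q x (f x) (g x)) = (\<lambda>x. \<Sum>i\<in>Basis. \<Sum>j\<in>Basis. (f x \<bullet> i) * (g x \<bullet> j) * q x i j)"
    by (rule ext, rule bilinear_basis_expand) (use assms(1) in \<open>simp add: bform_def\<close>)
  moreover have [measurable]: "(\<lambda>x. q x i j) \<in> borel_measurable M" for i j
    using assms(1) by (simp add: bform_def)
  ultimately show ?thesis using assms(2,3) by simp
qed

lemma bop_measurable:
  assumes "bop M A" "f \<in> borel_measurable M"
  shows "(\<lambda>x. A x (f x)) \<in> borel_measurable M"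
proof -
  have "(\<lambda>x. A x (f x)) = (\<lambda>x. \<Sum>i\<in>Basis. (f x \<bullet> i) *\<^sub>R A x i)"
    by (rule ext, rule linear_basis_expand) (use assms(1) in \<open>simp add: bop_def\<close>)
  moreover have [measurable]: "(\<lambda>x. A x i) \<in> borel_measurable M" for i
    using assms(1) by (simp add: bop_def)
  ultimately show ?thesis using assms(2) by simp
qed

lemma bop_L2:
  assumes "bop M A" "L2 M f"
  shows "L2 M (\<lambda>x. A x (f x))"
proof -
  obtain K where "\<forall>x\<in>space M. \<forall>b. norm (A x b) \<le> K * norm b" using assms(1) unfolding bop_def by blast
  then show ?thesis
    by (intro L2_bound[OF assms(2) bop_measurable[OF assms(1) L2_measurable[OF assms(2)]], of K]) blast
qed

lemma bop_L2_lim: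
  assumes A: "bop M A" and F: "L2_lim M F f"
  shows "L2_lim M (\<lambda>m x. A x (F m x)) (\<lambda>x. A x (f x))"
proof -
  obtain K where K: "\<And>x b. x \<in> space M \<Longrightarrow> norm (A x b) \<le> K * norm b"
    using A unfolding bop_def by blast
  have "linear (A x)" for x using A by (simp add: bop_def)
  then have d: "A x (F m x) - A x (f x) = A x (F m x - f x)" for m x by (simp add: linear_diff)
  have L: "L2 M (F m)" "L2 M f" for m using F by (auto simp: L2_lim_def)
  have "(\<lambda>m. L2_sqnorm M (\<lambda>x. A x (F m x) - A x (f x))) \<longlonglongrightarrow> 0"
  proof (rule tendsto_sandwich[OF _ _ tendsto_const])
    show "\<forall>\<^sub>F m in sequentially. L2_sqnorm M (\<lambda>x. A x (F m x) - A x (f x)) \<le> K\<^sup>2 * L2_sqnorm M (\<lambda>x. F m x - f x)"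
      unfolding d using K
      by (intro always_eventually allI L2_sqnorm_bound bop_measurable[OF A] L2_measurable L2_diff L) auto
    show "(\<lambda>m. K\<^sup>2 * L2_sqnorm M (\<lambda>x. F m x - f x)) \<longlonglongrightarrow> 0"
      using F by (auto simp: L2_lim_def intro: tendsto_mult_right_zero)
  qed simp
  then show ?thesis using L bop_L2[OF A] by (auto simp: L2_lim_def)
qed

lemma bform_integrable:
  assumes "bform M q" "L2 M f" "L2 M g"
  shows "integrable M (\<lambda>x. q x (f x) (g x))"
proof -
  obtain K where K: "K \<ge> 0" "\<And>x b c. x \<in> space M \<Longrightarrow> \<bar>q x b c\<bar> \<le> K * norm b * norm c"
    using assms(1) by (auto simp: bform_def)
  show ?thesis
  proof (rule Bochner_Integration.integrable_bound)
    show "integrable M (\<lambda>x. K * (norm (f x) * norm (g x)))"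
      using L2_integrable_norm_mult[OF assms(2,3)] by simp
    show "(\<lambda>x. q x (f x) (g x)) \<in> borel_measurable M"
      by (rule bform_measurable[OF assms(1) L2_measurable[OF assms(2)] L2_measurable[OF assms(3)]])
    show "AE x in M. norm (q x (f x) (g x)) \<le> norm (K * (norm (f x) * norm (g x)))"
      using K by (intro AE_I2) (simp add: abs_mult mult.assoc)
  qed
qed

lemma ifm_bound:
  assumes "bform M q"
  obtains K where "K \<ge> 0"
    "\<And>f g. L2 M f \<Longrightarrow> L2 M g \<Longrightarrow> \<bar>ifm M q f g\<bar> \<le> K * sqrt (L2_sqnorm M f) * sqrt (L2_sqnorm M g)"
proof -
  obtain K where K: "K \<ge> 0" "\<And>x b c. x \<in> space M \<Longrightarrow> \<bar>q x b c\<bar> \<le> K * norm b * norm c"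
    using assms(1) by (auto simp: bform_def)
  have "\<bar>ifm M q f g\<bar> \<le> K * sqrt (L2_sqnorm M f) * sqrt (L2_sqnorm M g)" if L: "L2 M f" "L2 M g" for f g
  proof -
    have "\<bar>ifm M q f g\<bar> \<le> (LINT x|M. \<bar>q x (f x) (g x)\<bar>)"
      unfolding ifm_def by (rule integral_abs_bound)
    also have "\<dots> \<le> (LINT x|M. K * (norm (f x) * norm (g x)))"
      using bform_integrable[OF assms L] L2_integrable_norm_mult[OF L] K
      by (intro integral_mono) (auto simp: mult.assoc)
    also have "\<dots> \<le> K * (sqrt (L2_sqnorm M f) * sqrt (L2_sqnorm M g))"
      using L2_Cauchy_Schwarz_sqrt[OF L] K(1) by (simp add: mult_left_mono)
    finally show ?thesis by (simp add: mult.assoc)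
  qed
  then show ?thesis using K(1) that by blast
qed

lemma bform_linear:
  assumes "bform M q"
  shows "q x (b + b') c = q x b c + q x b' c" "q x b (c + c') = q x b c + q x b c'"
    "q x (a *\<^sub>R b) c = a * q x b c" "q x b (a *\<^sub>R c) = a * q x b c"
    "q x (b - b') c = q x b c - q x b' c" "q x b (c - c') = q x b c - q x b c'"
    "q x 0 c = 0" "q x b 0 = 0"
  using assms unfolding bform_def
  by (auto simp: bilinear_ladd bilinear_radd bilinear_lmul bilinear_rmul bilinear_lsub bilinear_rsub
      bilinear_lzero bilinear_rzero)

lemma ifm_add_left:
  assumes "bform M q" "L2 M f" "L2 M f'" "L2 M g"
  shows "ifm M q (\<lambda>x. f x + f' x) g = ifm M q f g + ifm M q f' g"
  using assms by (simp add: ifm_def bform_linear bform_integrable)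

lemma ifm_add_right:
  assumes "bform M q" "L2 M f" "L2 M g" "L2 M g'"
  shows "ifm M q f (\<lambda>x. g x + g' x) = ifm M q f g + ifm M q f g'"
  using assms by (simp add: ifm_def bform_linear bform_integrable)

lemma ifm_diff_left:
  assumes "bform M q" "L2 M f" "L2 M f'" "L2 M g"
  shows "ifm M q (\<lambda>x. f x - f' x) g = ifm M q f g - ifm M q f' g"
  using assms by (simp add: ifm_def bform_linear bform_integrable)

lemma ifm_diff_right:
  assumes "bform M q" "L2 M f" "L2 M g" "L2 M g'"
  shows "ifm M q f (\<lambda>x. g x - g' x) = ifm M q f g - ifm M q f g'"
  using assms by (simp add: ifm_def bform_linear bform_integrable)

lemma ifm_scaleR_left:
  assumes "bform M q" shows "ifm M q (\<lambda>x. a *\<^sub>R f x) g = a * ifm M q f g"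
  using assms by (simp add: ifm_def bform_linear)

lemma ifm_scaleR_right:
  assumes "bform M q" shows "ifm M q f (\<lambda>x. a *\<^sub>R g x) = a * ifm M q f g"
  using assms by (simp add: ifm_def bform_linear)

lemma ifm_zero:
  assumes "bform M q" shows "ifm M q (\<lambda>x. 0) g = 0" "ifm M q f (\<lambda>x. 0) = 0"
  using assms by (simp_all add: ifm_def bform_linear)

lemma ifm_sum_left:
  assumes "bform M q" "\<And>i. i \<in> I \<Longrightarrow> L2 M (f i)" "L2 M g"
  shows "ifm M q (\<lambda>x. \<Sum>i\<in>I. c i *\<^sub>R f i x) g = (\<Sum>i\<in>I. c i * ifm M q (f i) g)"
  using assms(2)
  by (induction I rule: infinite_finite_induct)
    (auto simp: ifm_zero[OF assms(1)] ifm_add_left[OF assms(1)] ifm_scaleR_left[OF assms(1)]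
      assms(3) L2_scaleR L2_sum)

lemma ifm_sum_right:
  assumes "bform M q" "\<And>i. i \<in> I \<Longrightarrow> L2 M (g i)" "L2 M f"
  shows "ifm M q f (\<lambda>x. \<Sum>i\<in>I. c i *\<^sub>R g i x) = (\<Sum>i\<in>I. c i * ifm M q f (g i))"
  using assms(2)
  by (induction I rule: infinite_finite_induct)
    (auto simp: ifm_zero[OF assms(1)] ifm_add_right[OF assms(1)] ifm_scaleR_right[OF assms(1)]
      assms(3) L2_scaleR L2_sum)

lemma ifm_cong_AE:
  assumes "bform M q" "L2 M f" "L2 M g" "L2 M f'" "L2 M g'"
    "AE x in M. f x = f' x" "AE x in M. g x = g' x"
  shows "ifm M q f g = ifm M q f' g'"
  unfolding ifm_def
proof (rule integral_cong_AE)
  show "AE x in M. q x (f x) (g x) = q x (f' x) (g' x)" using assms(6,7) by eventually_elim simp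
qed (rule bform_measurable[OF assms(1)]; rule L2_measurable; rule assms)+

text \<open>After expanding in the errors \<open>df\<close> and \<open>dg\<close>, each of the three
  error terms contains a factor whose norm tends to 0. Identities proved for test functions reach
  their closure through this lemma.\<close>

lemma ifm_tendsto:
  assumes q: "bform M q" and F: "L2_lim M F f" and G: "L2_lim M G g"
  shows "(\<lambda>m. ifm M q (F m) (G m)) \<longlonglongrightarrow> ifm M q f g"
proof -
  obtain K where K: "K \<ge> 0"
    "\<And>f g. L2 M f \<Longrightarrow> L2 M g \<Longrightarrow> \<bar>ifm M q f g\<bar> \<le> K * sqrt (L2_sqnorm M f) * sqrt (L2_sqnorm M g)"
    using ifm_bound[OF q] by blast
  have L: "L2 M (F m)" "L2 M f" "L2 M (G m)" "L2 M g" for m using F G by (auto simp: L2_lim_def)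
  define df where "df m x = F m x - f x" for m x
  define dg where "dg m x = G m x - g x" for m x
  have Ld: "L2 M (df m)" "L2 M (dg m)" for m unfolding df_def dg_def using L by (auto intro: L2_diff)
  have df: "(\<lambda>m. sqrt (L2_sqnorm M (df m))) \<longlonglongrightarrow> 0" and dg: "(\<lambda>m. sqrt (L2_sqnorm M (dg m))) \<longlonglongrightarrow> 0"
    using tendsto_real_sqrt F G unfolding df_def dg_def L2_lim_def by fastforce+
  have bl: "(\<lambda>m. K * a m * b m) \<longlonglongrightarrow> 0" if "a \<longlonglongrightarrow> 0" "b \<longlonglongrightarrow> B" for a b :: "nat \<Rightarrow> real" and B
    using tendsto_mult[OF tendsto_mult[OF tendsto_const[of K] that(1)] that(2)] by simp
  have "(\<lambda>m. ifm M q (df m) (dg m)) \<longlonglongrightarrow> 0"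
    by (rule Lim_null_comparison[OF _ bl[OF df dg]]) (use K(2)[OF Ld] in auto)
  moreover have "(\<lambda>m. ifm M q (df m) g) \<longlonglongrightarrow> 0"
    by (rule Lim_null_comparison[OF _ bl[OF df tendsto_const[of "sqrt (L2_sqnorm M g)"]]]) (use K(2)[OF Ld(1) L(4)] in auto)
  moreover have "(\<lambda>m. ifm M q f (dg m)) \<longlonglongrightarrow> 0"
    by (rule Lim_null_comparison[OF _ bl[OF dg tendsto_const[of "sqrt (L2_sqnorm M f)"]]])
      (use K(2)[OF L(2) Ld(2)] in \<open>auto simp: mult_ac\<close>)
  ultimately have "(\<lambda>m. ifm M q (df m) (dg m) + ifm M q (df m) g + ifm M q f (dg m) + ifm M q f g)
     \<longlonglongrightarrow> 0 + 0 + 0 + ifm M q f g"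
    by (intro tendsto_add tendsto_const)
  moreover have "ifm M q (F m) (G m)
      = ifm M q (df m) (dg m) + ifm M q (df m) g + ifm M q f (dg m) + ifm M q f g" for m
  proof -
    have "F m = (\<lambda>x. df m x + f x)" "G m = (\<lambda>x. dg m x + g x)" by (auto simp: df_def dg_def)
    then show ?thesis using L Ld q by (simp add: ifm_add_left ifm_add_right L2_add)
  qed
  ultimately show ?thesis by simp
qed

section \<open>Completeness on finite measures\<close>

lemma (in finite_measure) L2_imp_integrable:
  fixes f :: "'a \<Rightarrow> 'c::euclidean_space"
  assumes "L2 M f" shows "integrable M f"
proof (rule Bochner_Integration.integrable_bound)
  show "integrable M (\<lambda>x. 1 + (norm (f x))\<^sup>2)" using assms by (auto simp: L2_def)
  show "f \<in> borel_measurable M" using assms by (simp add: L2_def)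
  have "norm b \<le> 1 + (norm b)\<^sup>2" for b :: 'c
    using sum_squares_bound[of 1 "norm b"] norm_ge_zero[of b]
    by (simp del: norm_ge_zero)
  then show "AE x in M. norm (f x) \<le> norm (1 + (norm (f x))\<^sup>2)" by (intro AE_I2) (simp add: abs_of_nonneg)
qed

lemma (in finite_measure) L2_integral_norm_le:
  assumes "L2 M f"
  shows "(LINT x|M. norm (f x)) \<le> sqrt (L2_sqnorm M f) * sqrt (measure M (space M))"
proof -
  have "L2 M (\<lambda>x. 1::real)" by (simp add: L2_def)
  from L2_Cauchy_Schwarz_sqrt[OF assms this] show ?thesis by (simp add: L2_sqnorm_def)
qed

text \<open>Finiteness of the measure makes the sequence Cauchy in mean, so a subsequence converges
  almost everywhere. Fatou's lemma along the subsequence then shows that the whole sequence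
  converges in square mean to the pointwise limit.\<close>

lemma (in finite_measure) L2_complete:
  fixes F :: "nat \<Rightarrow> 'a \<Rightarrow> 'b::euclidean_space"
  assumes L: "\<And>m. L2 M (F m)"
    and C: "\<And>e. e > 0 \<Longrightarrow> \<exists>N. \<forall>i\<ge>N. \<forall>j\<ge>N. L2_sqnorm M (\<lambda>x. F i x - F j x) < e"
  obtains f where "L2_lim M F f"
proof -
  have D: "L2 M (\<lambda>x. F i x - F j x)" for i j using L by (intro L2_diff)
  have "\<exists>N. \<forall>i\<ge>N. \<forall>j\<ge>N. (LINT x|M. norm (F i x - F j x)) < e" if "e > 0" for e
  proof -
    \<comment> \<open>The summand 1 permits division by V also for the zero measure.\<close>
    define V where "V = measure M (space M) + 1"
    have V: "V > 0" unfolding V_def by (simp add: add_nonneg_pos)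
    obtain N where N: "\<And>i j. i \<ge> N \<Longrightarrow> j \<ge> N \<Longrightarrow> L2_sqnorm M (\<lambda>x. F i x - F j x) < e\<^sup>2 / V"
      using C[of "e\<^sup>2 / V"] V \<open>e > 0\<close> by (meson divide_pos_pos zero_less_power)
    have "(LINT x|M. norm (F i x - F j x)) < e" if "i \<ge> N" "j \<ge> N" for i j
    proof -
      have "(LINT x|M. norm (F i x - F j x)) \<le> sqrt (L2_sqnorm M (\<lambda>x. F i x - F j x) * measure M (space M))"
        using L2_integral_norm_le[OF D[of i j]] by (simp add: real_sqrt_mult)
      also have "\<dots> \<le> sqrt (L2_sqnorm M (\<lambda>x. F i x - F j x) * V)"
        by (intro real_sqrt_le_mono mult_left_mono) (auto simp: V_def)
      also have "\<dots> < sqrt (e\<^sup>2)"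
        using N[OF that] V by (intro real_sqrt_less_mono) (simp add: field_simps)
      finally show ?thesis using \<open>e > 0\<close> by simp
    qed
    then show ?thesis by blast
  qed
  then obtain r where r: "strict_mono r" "AE x in M. Cauchy (\<lambda>i. F (r i) x)"
    using cauchy_L1_AE_cauchy_subseq[of M F] L2_imp_integrable[OF L] by blast
  define f where "f x = lim (\<lambda>i. F (r i) x)" for x
  have [measurable]: "F m \<in> borel_measurable M" for m using L by (simp add: L2_def)
  have f[measurable]: "f \<in> borel_measurable M" unfolding f_def by measurable
  have lim: "AE x in M. (\<lambda>i. F (r i) x) \<longlonglongrightarrow> f x"
    using r(2) by eventually_elim (simp add: f_def Cauchy_convergent_iff convergent_LIMSEQ_iff)
  have key: "(\<integral>\<^sup>+x. ennreal ((norm (F i x - f x))\<^sup>2) \<partial>M) \<le> ennreal e"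
    if N: "\<forall>i\<ge>N. \<forall>j\<ge>N. L2_sqnorm M (\<lambda>x. F i x - F j x) < e" and i: "i \<ge> N" for i N e
  proof -
    have "(\<integral>\<^sup>+x. ennreal ((norm (F i x - f x))\<^sup>2) \<partial>M)
        = (\<integral>\<^sup>+x. liminf (\<lambda>k. ennreal ((norm (F i x - F (r k) x))\<^sup>2)) \<partial>M)"
    proof (rule nn_integral_cong_AE, use lim in eventually_elim)
      case (elim x)
      have "(\<lambda>k. ennreal ((norm (F i x - F (r k) x))\<^sup>2)) \<longlonglongrightarrow> ennreal ((norm (F i x - f x))\<^sup>2)"
        by (intro tendsto_ennrealI tendsto_intros elim)
      then show ?case by (metis lim_imp_Liminf trivial_limit_sequentially)
    qed
    also have "\<dots> \<le> liminf (\<lambda>k. \<integral>\<^sup>+x. ennreal ((norm (F i x - F (r k) x))\<^sup>2) \<partial>M)"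
      by (rule nn_integral_liminf) measurable
    also have "\<dots> \<le> ennreal e"
    proof (rule Liminf_le, simp)
      show "\<forall>\<^sub>F k in sequentially. (\<integral>\<^sup>+x. ennreal ((norm (F i x - F (r k) x))\<^sup>2) \<partial>M) \<le> ennreal e"
      proof (rule eventually_sequentiallyI)
        fix k assume "N \<le> k"
        then have rk: "N \<le> r k" using seq_suble[OF r(1), of k] by simp
        have "(\<integral>\<^sup>+x. ennreal ((norm (F i x - F (r k) x))\<^sup>2) \<partial>M) = ennreal (L2_sqnorm M (\<lambda>x. F i x - F (r k) x))"
          unfolding L2_sqnorm_def by (rule nn_integral_eq_integral[OF L2_integrable_sq[OF D]]) simp
        then show "(\<integral>\<^sup>+x. ennreal ((norm (F i x - F (r k) x))\<^sup>2) \<partial>M) \<le> ennreal e"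
          using N i rk by (simp add: ennreal_leI less_imp_le)
      qed
    qed
    finally show ?thesis .
  qed
  have Ld: "L2 M (\<lambda>x. F i x - f x)" and sq: "L2_sqnorm M (\<lambda>x. F i x - f x) \<le> e"
    if N: "\<forall>i\<ge>N. \<forall>j\<ge>N. L2_sqnorm M (\<lambda>x. F i x - F j x) < e" "e > 0" and i: "i \<ge> N" for i N e
  proof -
    have k: "(\<integral>\<^sup>+x. ennreal ((norm (F i x - f x))\<^sup>2) \<partial>M) \<le> ennreal e" by (rule key[OF N(1) i])
    have int: "integrable M (\<lambda>x. (norm (F i x - f x))\<^sup>2)"
      using k by (intro integrableI_bounded) (auto intro: le_less_trans)
    then show "L2 M (\<lambda>x. F i x - f x)" by (simp add: L2_def)
    have "ennreal (L2_sqnorm M (\<lambda>x. F i x - f x)) \<le> ennreal e"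
      using k unfolding L2_sqnorm_def by (subst nn_integral_eq_integral[OF int, symmetric]) auto
    then show "L2_sqnorm M (\<lambda>x. F i x - f x) \<le> e" using N(2) by (simp add: ennreal_le_iff)
  qed
  have Lf: "L2 M f"
  proof -
    obtain N where "\<forall>i\<ge>N. \<forall>j\<ge>N. L2_sqnorm M (\<lambda>x. F i x - F j x) < 1" using C[of 1] by auto
    from Ld[OF this, of N] have "L2 M (\<lambda>x. F N x - f x)" by simp
    from L2_diff[OF L[of N] this] show ?thesis by simp
  qed
  have "(\<lambda>m. L2_sqnorm M (\<lambda>x. F m x - f x)) \<longlonglongrightarrow> 0"
  proof (rule LIMSEQ_I)
    fix e :: real assume "0 < e"
    then obtain N where "\<forall>i\<ge>N. \<forall>j\<ge>N. L2_sqnorm M (\<lambda>x. F i x - F j x) < e / 2" using C[of "e/2"] by auto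
    then have "\<forall>i\<ge>N. norm (L2_sqnorm M (\<lambda>x. F i x - f x) - 0) < e"
      using sq[of N "e/2"] \<open>0 < e\<close> by fastforce
    then show "\<exists>no. \<forall>n\<ge>no. norm (L2_sqnorm M (\<lambda>x. F n x - f x) - 0) < e" by blast
  qed
  then show ?thesis using that L Lf by (simp add: L2_lim_def)
qed

section \<open>Forms with continuous coefficients\<close>

lemma continuous_bounded_on_bounded:
  fixes f :: "'a::euclidean_space \<Rightarrow> 'b::real_normed_vector"
  assumes "bounded \<Omega>" "continuous_on UNIV f"
  obtains K where "K \<ge> 0" "\<And>x. x \<in> \<Omega> \<Longrightarrow> norm (f x) \<le> K"
proof -
  have "compact (f ` closure \<Omega>)"
    using assms by (intro compact_continuous_image) (auto intro: continuous_on_subset)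
  then have "bounded (f ` closure \<Omega>)" by (rule compact_imp_bounded)
  then obtain K where K: "\<And>x. x \<in> closure \<Omega> \<Longrightarrow> norm (f x) \<le> K" by (auto simp: bounded_iff)
  show ?thesis
  proof (rule that[of "max 0 K"])
    show "norm (f x) \<le> max 0 K" if "x \<in> \<Omega>" for x
      using K[of x] closure_subset that by fastforce
  qed simp
qed

lemma continuous_imp_measurable_lebesgue_on:
  fixes f :: "'a::euclidean_space \<Rightarrow> 'b::euclidean_space"
  assumes "continuous_on UNIV f" "\<Omega> \<in> sets lebesgue"
  shows "f \<in> borel_measurable (lebesgue_on \<Omega>)"
  using assms by (intro continuous_imp_measurable_on_sets_lebesgue continuous_on_subset[OF assms(1)]) auto

text \<open>In finite dimension the values on basis vectors control the whole map, so continuity for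
  each fixed argument gives both measurability and a uniform bound on the bounded set.\<close>

lemma bop_continuous:
  fixes A :: "'a::euclidean_space \<Rightarrow> 'b::euclidean_space \<Rightarrow> 'c::euclidean_space"
  assumes "bounded \<Omega>" "\<Omega> \<in> sets lebesgue" "\<And>x. linear (A x)" "\<And>b. continuous_on UNIV (\<lambda>x. A x b)"
  shows "bop (lebesgue_on \<Omega>) A"
proof -
  have "\<exists>K\<ge>0. \<forall>x\<in>\<Omega>. norm (A x b) \<le> K" for b
    by (rule continuous_bounded_on_bounded[OF assms(1) assms(4)[of b]]) auto
  then obtain K where K: "\<And>b. K b \<ge> 0" "\<And>b x. x \<in> \<Omega> \<Longrightarrow> norm (A x b) \<le> K b" by metis
  have "norm (A x b) \<le> (\<Sum>i\<in>Basis. K i) * norm b" if "x \<in> \<Omega>" for x b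
  proof -
    have "norm (A x b) \<le> (\<Sum>i\<in>Basis. norm ((b \<bullet> i) *\<^sub>R A x i))"
      unfolding linear_basis_expand[OF assms(3), of x b] by (rule norm_sum)
    also have "\<dots> \<le> (\<Sum>i\<in>Basis. norm b * K i)"
      using K that Basis_le_norm[of _ b] by (intro sum_mono) (auto intro!: mult_mono)
    finally show ?thesis by (simp add: sum_distrib_left mult.commute)
  qed
  moreover have "(\<Sum>i\<in>Basis. K i) \<ge> 0" using K by (intro sum_nonneg)
  ultimately show ?thesis unfolding bop_def
    using assms continuous_imp_measurable_lebesgue_on[OF assms(4,2)] by auto
qed

lemma bform_continuous:
  fixes q :: "'a::euclidean_space \<Rightarrow> 'b::euclidean_space \<Rightarrow> 'c::euclidean_space \<Rightarrow> real"
  assumes "bounded \<Omega>" "\<Omega> \<in> sets lebesgue" "\<And>x. bilinear (q x)" "\<And>b c. continuous_on UNIV (\<lambda>x. q x b c)"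
  shows "bform (lebesgue_on \<Omega>) q"
proof -
  have "\<exists>K\<ge>0. \<forall>x\<in>\<Omega>. norm (q x b c) \<le> K" for b c
    by (rule continuous_bounded_on_bounded[OF assms(1) assms(4)[of b c]]) auto
  then obtain K where K: "\<And>b c. K b c \<ge> 0" "\<And>b c x. x \<in> \<Omega> \<Longrightarrow> norm (q x b c) \<le> K b c" by metis
  have "\<bar>q x b c\<bar> \<le> (\<Sum>i\<in>Basis. \<Sum>j\<in>Basis. K i j) * norm b * norm c" if "x \<in> \<Omega>" for x b c
  proof -
    have "\<bar>q x b c\<bar> \<le> (\<Sum>i\<in>Basis. \<Sum>j\<in>Basis. \<bar>(b \<bullet> i) * (c \<bullet> j) * q x i j\<bar>)"
      unfolding bilinear_basis_expand[OF assms(3), of x b c]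
      by (intro order_trans[OF sum_abs] sum_mono sum_abs)
    also have "\<dots> \<le> (\<Sum>i\<in>Basis. \<Sum>j\<in>Basis. norm b * norm c * K i j)"
      using K that Basis_le_norm[of _ b] Basis_le_norm[of _ c]
      by (intro sum_mono) (auto simp: abs_mult intro!: mult_mono)
    finally show ?thesis by (simp add: sum_distrib_left sum_distrib_right mult_ac)
  qed
  moreover have "(\<Sum>i\<in>Basis. \<Sum>j\<in>Basis. K i j) \<ge> 0" using K by (intro sum_nonneg)
  ultimately show ?thesis unfolding bform_def
    using assms continuous_imp_measurable_lebesgue_on[OF assms(4,2)] by (auto simp: space_lebesgue_on)
qed

subsection \<open>Mollification\<close>

lemma integrable_compact_support:
  fixes h :: "'a::euclidean_space \<Rightarrow> 'b::euclidean_space"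
  assumes "continuous_on UNIV h" "compact K" "\<And>x. x \<notin> K \<Longrightarrow> h x = 0"
  shows "integrable lborel h"
proof -
  have "(\<lambda>x. indicator K x *\<^sub>R h x) = h" using assms(3) by (auto simp: indicator_def)
  then show ?thesis
    using borel_integrable_compact[OF assms(2) continuous_on_subset[OF assms(1) subset_UNIV]] by simp
qed

lemma integral_compact_support_cbox:
  fixes h :: "'a::euclidean_space \<Rightarrow> 'b::euclidean_space"
  assumes "continuous_on UNIV h" "\<And>x. x \<notin> cbox a b \<Longrightarrow> h x = 0"
  shows "(LINT x|lborel. h x) = integral (cbox a b) h"
proof -
  have i: "(\<lambda>x. indicator (cbox a b) x *\<^sub>R h x) = h" using assms(2) by (auto simp: indicator_def)
  have "set_integrable lborel (cbox a b) h"
    unfolding set_integrable_def i by (rule integrable_compact_support[OF assms(1) compact_cbox assms(2)])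
  from set_borel_integral_eq_integral(2)[OF this] show ?thesis
    by (simp add: set_lebesgue_integral_def i)
qed

lemma lebesgue_on_integral_support:
  fixes h :: "'a::euclidean_space \<Rightarrow> 'b::euclidean_space"
  assumes "h \<in> borel_measurable borel" "\<And>x. x \<notin> \<Omega> \<Longrightarrow> h x = 0" "\<Omega> \<in> sets lebesgue"
  shows "(LINT x|lebesgue_on \<Omega>. h x) = (LINT x|lborel. h x)"
proof -
  have i: "(\<lambda>x. indicator \<Omega> x *\<^sub>R h x) = h" using assms(2) by (auto simp: indicator_def)
  have "(LINT x|lebesgue_on \<Omega>. h x) = (LINT x|lebesgue. h x)"
    using integral_restrict_space[of \<Omega> lebesgue h] assms(3) by (simp add: i)
  then show ?thesis using assms(1) by (simp add: integral_completion)
qed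

lemma lborel_integral_affine:
  fixes h :: "'a::euclidean_space \<Rightarrow> 'b::euclidean_space"
  assumes [measurable]: "h \<in> borel_measurable borel" and c: "c \<noteq> 0"
  shows "(LINT x|lborel. h x) = \<bar>c\<bar> ^ DIM('a) *\<^sub>R (LINT x|lborel. h (t + c *\<^sub>R x))"
proof -
  have "(LINT x|lborel. h x)
      = (LINT x|density (distr lborel borel (\<lambda>x. t + c *\<^sub>R x)) (\<lambda>_. ennreal (\<bar>c\<bar> ^ DIM('a))). h x)"
    using lborel_affine[OF c, of t] by simp
  also have "\<dots> = (LINT x|distr lborel borel (\<lambda>x. t + c *\<^sub>R x). \<bar>c\<bar> ^ DIM('a) *\<^sub>R h x)"
    by (rule integral_density) auto
  also have "\<dots> = \<bar>c\<bar> ^ DIM('a) *\<^sub>R (LINT x|lborel. h (t + c *\<^sub>R x))"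
    by (subst integral_distr) auto
  finally show ?thesis .
qed

text \<open>Differentiation under the integral asks for a derivative that is continuous as a map
  into bounded linear functions. In finite dimension continuity in every fixed direction v is
  enough, and evaluation at v commutes with the integral.\<close>

lemma leibniz_rule_C1:
  fixes h :: "'a::euclidean_space \<Rightarrow> 'c::euclidean_space \<Rightarrow> 'd::euclidean_space"
  assumes d: "\<And>x t. ((\<lambda>x. h x t) has_derivative D x t) (at x)"
    and D: "\<And>v. continuous_on UNIV (\<lambda>(x, t). D x t v)"
    and h: "\<And>x. continuous_on UNIV (h x)"
  shows "((\<lambda>x. integral (cbox a b) (h x)) has_derivative (\<lambda>v. integral (cbox a b) (\<lambda>t. D x t v))) (at x)"
proof -
  define B where "B x t = Blinfun (D x t)" for x t
  have B: "blinfun_apply (B x t) = D x t" for x t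
    unfolding B_def by (rule bounded_linear_Blinfun_apply[OF has_derivative_bounded_linear[OF d]])
  have cB: "continuous_on UNIV (\<lambda>(x, t). B x t)"
    by (rule continuous_on_blinfun_componentwise) (use D in \<open>simp add: B split_beta\<close>)
  have "((\<lambda>x. integral (cbox a b) (h x)) has_derivative integral (cbox a b) (B x)) (at x within UNIV)"
  proof (rule leibniz_rule)
    show "((\<lambda>x. h x t) has_derivative blinfun_apply (B x t)) (at x within UNIV)" for x t
      using d by (simp add: B)
    show "h x integrable_on cbox a b" for x
      by (rule integrable_continuous[OF continuous_on_subset[OF h]]) simp
    show "continuous_on (UNIV \<times> cbox a b) (\<lambda>(x, t). B x t)" by (rule continuous_on_subset[OF cB]) simp
  qed auto
  moreover have "blinfun_apply (integral (cbox a b) (B x)) v = integral (cbox a b) (\<lambda>t. D x t v)" for v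
  proof -
    have "continuous_on UNIV (\<lambda>t. (x, t))" by (intro continuous_intros)
    from continuous_on_compose2[OF cB this] have "continuous_on UNIV (\<lambda>t. B x t)" by simp
    then have "B x integrable_on cbox a b"
      by (intro integrable_continuous) (auto intro: continuous_on_subset)
    then show ?thesis by (simp add: blinfun_apply_integral B)
  qed
  ultimately have "((\<lambda>x. integral (cbox a b) (h x)) has_derivative blinfun_apply (integral (cbox a b) (B x))) (at x)"
    and "blinfun_apply (integral (cbox a b) (B x)) = (\<lambda>v. integral (cbox a b) (\<lambda>t. D x t v))"
    by auto
  then show ?thesis by simp
qed

text \<open>The kernel is one order smoother than the conclusion, so that the base case reads
  continuity off differentiability. For a smooth kernel nothing is lost.\<close>

lemma Ck_on_convolution:
  fixes g :: "'a::euclidean_space \<Rightarrow> real" and f :: "'a \<Rightarrow> real"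
  assumes f: "continuous_on UNIV f"
  shows "Ck_on (Suc k) g UNIV \<Longrightarrow> Ck_on k (\<lambda>x. integral (cbox a b) (\<lambda>z. g (r *\<^sub>R (x - z)) * f z)) UNIV"
proof (induction k arbitrary: g)
  have d: "((\<lambda>x. integral (cbox a b) (\<lambda>z. g (r *\<^sub>R (x - z)) * f z)) has_derivative
      (\<lambda>v. integral (cbox a b) (\<lambda>z. frechet_derivative g (at (r *\<^sub>R (x - z))) (r *\<^sub>R v) * f z))) (at x)"
    if g: "Ck_on (Suc j) g UNIV" for g x j
  proof (rule leibniz_rule_C1)
    show "((\<lambda>x. g (r *\<^sub>R (x - z)) * f z) has_derivative
        (\<lambda>v. frechet_derivative g (at (r *\<^sub>R (x - z))) (r *\<^sub>R v) * f z)) (at x)" for x z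
    proof -
      have "((\<lambda>x. r *\<^sub>R (x - z)) has_derivative (\<lambda>v. r *\<^sub>R v)) (at x)"
        by (auto intro!: derivative_eq_intros)
      from diff_chain_at[OF this Ck_on_SucD(1)[OF g]]
      show ?thesis by (auto simp: o_def intro: has_derivative_mult_left)
    qed
    have c: "continuous_on UNIV (\<lambda>x. frechet_derivative g (at x) v)" for v
      by (rule Ck_on_imp_continuous[OF Ck_on_SucD(2)[OF g]])
    show "continuous_on UNIV (\<lambda>(x, z). frechet_derivative g (at (r *\<^sub>R (x - z))) (r *\<^sub>R v) * f z)" for v
      unfolding split_beta
      by (intro continuous_intros continuous_on_compose2[OF c] continuous_on_compose2[OF f]) auto
    show "continuous_on UNIV (\<lambda>z. g (r *\<^sub>R (x - z)) * f z)" for x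
      by (intro continuous_intros f continuous_on_compose2[OF Ck_on_imp_continuous[OF g]]) auto
  qed
  {
    case 0
    show ?case unfolding Ck_on.simps
      by (rule has_derivative_continuous_on[OF has_derivative_at_withinI[OF d[OF 0]]])
  next
    case (Suc k)
    show ?case
    proof (rule Ck_on_SucI[OF d[OF Suc.prems]])
      show "Ck_on k (\<lambda>x. integral (cbox a b) (\<lambda>z. frechet_derivative g (at (r *\<^sub>R (x - z))) (r *\<^sub>R v) * f z)) UNIV" for v
        using Suc.IH[OF Ck_on_SucD(2)[OF Suc.prems]] .
    qed
  }
qed

definition mollifier :: "real^'n \<Rightarrow> real" where
  "mollifier = box_bump 1 (\<chi> j. -1) (\<chi> j. 1)"

abbreviation unit_cube :: "(real^'n) set" where
  "unit_cube \<equiv> cbox (\<chi> j. -1) (\<chi> j. 1)"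

lemma continuous_mollifier: "continuous_on UNIV mollifier"
  using smooth_box_bump[of 1 "\<chi> j. -1" "\<chi> j. 1"] Ck_on_imp_continuous
  unfolding mollifier_def smooth_on_def by blast

lemma mollifier_support: "x \<notin> unit_cube \<Longrightarrow> mollifier x = 0"
  using box_bump_pos_iff[of 1 _ _ x] box_subset_cbox unfolding mollifier_def by fastforce

lemma mollifier_nonneg: "0 \<le> mollifier x"
  by (simp add: mollifier_def box_bump_nonneg)

lemma integral_mollifier_pos: "0 < integral unit_cube (mollifier :: real^'n \<Rightarrow> real)"
proof -
  have c: "continuous_on unit_cube (mollifier :: real^'n \<Rightarrow> real)"
    using continuous_mollifier continuous_on_subset by blast
  have "mollifier (0::real^'n) \<noteq> 0"
    unfolding mollifier_def by (subst box_bump_pos_iff) (auto simp: mem_box_cart)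
  moreover have "(0::real^'n) \<in> unit_cube" by (auto simp: mem_box_cart)
  moreover have "integral unit_cube (mollifier :: real^'n \<Rightarrow> real) \<ge> 0"
    by (intro integral_nonneg integrable_continuous c mollifier_nonneg)
  moreover have "box (\<chi> j. -1) (\<chi> j. 1) \<noteq> ({} :: (real^'n) set)"

  proof -
    have "(0::real^'n) \<in> box (\<chi> j. -1) (\<chi> j. 1)" by (auto simp: mem_box_cart)
    then show ?thesis by blast
  qed
  ultimately show ?thesis
    using integral_cbox_eq_0_iff[OF c] mollifier_nonneg by (metis less_eq_real_def)
qed

text \<open>The shift sits in \<open>h\<close>, so derivatives fall on \<open>h\<close> and
  mollification commutes with differentiation. The substitution in \<open>smooth_mollify\<close>
  moves the variable into the kernel when smoothness is wanted.\<close>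

definition mollify :: "real \<Rightarrow> (real^'n \<Rightarrow> real) \<Rightarrow> real^'n \<Rightarrow> real" where
  "mollify s h x = integral unit_cube (\<lambda>y. mollifier y * h (x - s *\<^sub>R y))
    / integral unit_cube (mollifier :: real^'n \<Rightarrow> real)"

lemma continuous_mollify_integrand:
  assumes "continuous_on UNIV h"
  shows "continuous_on S (\<lambda>y. mollifier y * h (x - s *\<^sub>R y))"
  by (rule continuous_on_subset[of UNIV])
    (auto intro!: continuous_intros continuous_mollifier continuous_on_compose2[OF assms])

lemma unit_cube_norm_le: "y \<in> unit_cube \<Longrightarrow> norm (y :: real^'n) \<le> real CARD('n)"
proof -
  assume y: "y \<in> unit_cube"
  have "norm y \<le> (\<Sum>j\<in>UNIV. \<bar>y $ j\<bar>)" by (rule norm_le_l1_cart)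
  also have "\<dots> \<le> (\<Sum>j\<in>(UNIV::'n set). 1)"
    using y by (intro sum_mono) (auto simp: mem_box_cart abs_le_iff minus_le_iff)
  finally show ?thesis by simp
qed

lemma mollify_close:
  fixes h :: "real^'n \<Rightarrow> real"
  assumes h: "continuous_on UNIV h" and e: "\<And>y. y \<in> unit_cube \<Longrightarrow> \<bar>h (x - s *\<^sub>R y) - h x\<bar> \<le> e"
  shows "\<bar>mollify s h x - h x\<bar> \<le> e"
proof -
  let ?c = "integral unit_cube (mollifier :: real^'n \<Rightarrow> real)"
  have i: "(mollifier :: real^'n \<Rightarrow> real) integrable_on unit_cube"
    using continuous_mollifier by (intro integrable_continuous) (auto intro: continuous_on_subset)
  have i2: "(\<lambda>y. mollifier y * h (x - s *\<^sub>R y)) integrable_on unit_cube"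
    by (intro integrable_continuous continuous_mollify_integrand h)
  have "integral unit_cube (\<lambda>y. mollifier y * h (x - s *\<^sub>R y)) - ?c * h x
      = integral unit_cube (\<lambda>y. mollifier y * h (x - s *\<^sub>R y) - mollifier y * h x)"

    using i2 integrable_on_mult_left[OF i, of "h x"]
    by (subst Henstock_Kurzweil_Integration.integral_diff) auto
  also have "norm \<dots> \<le> integral unit_cube (\<lambda>y::real^'n. mollifier y * e)"
  proof (rule Henstock_Kurzweil_Integration.integral_norm_bound_integral)
    show "(\<lambda>y. mollifier y * h (x - s *\<^sub>R y) - mollifier y * h x) integrable_on unit_cube"
      using i2 integrable_on_mult_left[OF i, of "h x"] by (intro integrable_diff) auto
    show "(\<lambda>y::real^'n. mollifier y * e) integrable_on unit_cube" using i by (rule integrable_on_mult_left)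
    show "norm (mollifier y * h (x - s *\<^sub>R y) - mollifier y * h x) \<le> mollifier y * e" if "y \<in> unit_cube" for y
      using e[OF that] mollifier_nonneg[of y] by (simp add: right_diff_distrib[symmetric] abs_mult mult_left_mono)
  qed
  also have "\<dots> = ?c * e" by simp
  finally have "\<bar>integral unit_cube (\<lambda>y. mollifier y * h (x - s *\<^sub>R y)) - ?c * h x\<bar> \<le> ?c * e" by simp
  moreover have "mollify s h x - h x = (integral unit_cube (\<lambda>y. mollifier y * h (x - s *\<^sub>R y)) - ?c * h x) / ?c"
    using integral_mollifier_pos[where 'n='n] by (simp add: mollify_def diff_divide_distrib)
  ultimately show ?thesis using integral_mollifier_pos[where 'n='n] by (simp add: abs_divide pos_divide_le_eq mult.commute)
qed

lemma mollify_uniform: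
  fixes h :: "real^'n \<Rightarrow> real"
  assumes h: "continuous_on UNIV h" and K: "compact K" "\<And>x. x \<notin> K \<Longrightarrow> h x = 0" and e: "e > 0"
  shows "\<exists>s0>0. \<forall>s. 0 < s \<and> s < s0 \<longrightarrow> (\<forall>x. \<bar>mollify s h x - h x\<bar> \<le> e)"
proof -
  \<comment> \<open>A compact neighbourhood on which h is uniformly continuous: if one of x and x -
    s y lies in K and |s y| < 1, both lie in it.\<close>
  define K2 where "K2 = {x + y |x y. x \<in> K \<and> y \<in> cball (0::real^'n) 2}"
  have "compact K2" unfolding K2_def by (intro compact_sums K(1) compact_cball)
  then have "uniformly_continuous_on K2 h"
    using h by (intro compact_uniformly_continuous) (auto intro: continuous_on_subset)
  then obtain d where d: "d > 0" "\<And>x y. x \<in> K2 \<Longrightarrow> y \<in> K2 \<Longrightarrow> dist y x < d \<Longrightarrow> dist (h y) (h x) < e"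
    using e unfolding uniformly_continuous_on_def by metis
  define N where "N = real CARD('n)"
  have N: "N > 0" by (simp add: N_def)
  define s0 where "s0 = min 1 d / N"
  have s0: "s0 > 0" using d N by (simp add: s0_def)
  have "\<bar>mollify s h x - h x\<bar> \<le> e" if s: "0 < s" "s < s0" for s x
  proof (rule mollify_close[OF h])
    fix y :: "real^'n" assume "y \<in> unit_cube"
    then have "norm (s *\<^sub>R y) \<le> s * N" using unit_cube_norm_le[of y] s by (simp add: N_def mult_left_mono)
    also have "\<dots> < s0 * N" using s N by simp
    also have "\<dots> = min 1 d" using N by (simp add: s0_def)
    finally have y: "norm (s *\<^sub>R y) < 1" "norm (s *\<^sub>R y) < d" by auto
    have yy: "y' \<in> cball (0::real^'n) 2" if "norm y' < 2" for y' using that by simp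
    consider "x \<in> K" | "x - s *\<^sub>R y \<in> K" | "x \<notin> K" "x - s *\<^sub>R y \<notin> K" by blast
    then show "\<bar>h (x - s *\<^sub>R y) - h x\<bar> \<le> e"
    proof cases
      case 1
      have "x \<in> K2" unfolding K2_def using 1 by (intro CollectI exI[of _ x] exI[of _ 0]) simp
      moreover have "x - s *\<^sub>R y \<in> K2"
        unfolding K2_def using 1 y by (intro CollectI exI[of _ x] exI[of _ "- (s *\<^sub>R y)"]) simp
      moreover have "dist (x - s *\<^sub>R y) x < d" using y by (simp add: dist_norm)
      ultimately show ?thesis using d(2) by (fastforce simp: dist_real_def)
    next
      case 2
      have "x - s *\<^sub>R y \<in> K2" unfolding K2_def 
        using 2 by (intro CollectI exI[of _ "x - s *\<^sub>R y"] exI[of _ 0]) simp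
      moreover have "x \<in> K2"
        unfolding K2_def using 2 y by (intro CollectI exI[of _ "x - s *\<^sub>R y"] exI[of _ "s *\<^sub>R y"]) simp
      moreover have "dist (x - s *\<^sub>R y) x < d" using y by (simp add: dist_norm)
      ultimately show ?thesis using d(2) by (fastforce simp: dist_real_def)
    next
      case 3
      then show ?thesis using K(2) e by simp
    qed
  qed
  then show ?thesis using s0 by blast
qed

text \<open>Substituting z = x - s y turns the average into a convolution whose smooth kernel
  carries the variable x; the Jacobian is the factor \<open>inverse (s ^ CARD('n))\<close>.\<close>

lemma smooth_mollify:
  fixes h :: "real^'n \<Rightarrow> real"
  assumes h: "continuous_on UNIV h" and K: "compact K" "\<And>x. x \<notin> K \<Longrightarrow> h x = 0" and s: "0 < s"
  shows "smooth_on (mollify s h) UNIV"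
proof -
  obtain a where a: "K \<subseteq> cbox (-a) a"
    using bounded_subset_cbox_symmetric[OF compact_imp_bounded[OF K(1)]] by blast
  have eq: "mollify s h x = integral (cbox (-a) a) (\<lambda>z. mollifier (inverse s *\<^sub>R (x - z)) * h z)
      * (inverse (s ^ CARD('n)) / integral unit_cube (mollifier :: real^'n \<Rightarrow> real))" for x
  proof -
    let ?g = "\<lambda>z. mollifier (inverse s *\<^sub>R (x - z)) * h z"
    have cg: "continuous_on UNIV ?g"
      by (intro continuous_intros h continuous_on_compose2[OF continuous_mollifier]) auto
    have "integral unit_cube (\<lambda>y. mollifier y * h (x - s *\<^sub>R y)) = (LINT y|lborel. mollifier y * h (x - s *\<^sub>R y))"
      by (intro integral_compact_support_cbox[symmetric] continuous_mollify_integrand h)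
        (simp add: mollifier_support)
    also have "(\<lambda>y. mollifier y * h (x - s *\<^sub>R y)) = (\<lambda>y. ?g (x + (- s) *\<^sub>R y))"
      using s by simp
    also have "(LINT y|lborel. ?g (x + (- s) *\<^sub>R y)) = inverse (s ^ CARD('n)) * (LINT z|lborel. ?g z)"
      using lborel_integral_affine[of ?g "- s" x] cg s
      by (simp add: borel_measurable_continuous_onI)
    also have "(LINT z|lborel. ?g z) = integral (cbox (-a) a) ?g"
      using a K(2) by (intro integral_compact_support_cbox cg) auto
    finally show ?thesis using s by (simp add: mollify_def divide_inverse)
  qed
  have "Ck_on k (mollifier :: real^'n \<Rightarrow> real) UNIV" for k
    using smooth_box_bump unfolding mollifier_def smooth_on_def by blast
  then show ?thesis unfolding smooth_on_def eq[abs_def]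
    by (intro allI Ck_on_mult Ck_on_convolution[OF h] Ck_on_const)
qed

lemma has_derivative_mollify:
  fixes h :: "real^'n \<Rightarrow> real"
  assumes "Ck_on 1 h UNIV"
  shows "(mollify s h has_derivative (\<lambda>v. mollify s (\<lambda>x. frechet_derivative h (at x) v) x)) (at x)"
proof -
  have h: "Ck_on (Suc 0) h UNIV" using assms by simp
  have c: "continuous_on UNIV (\<lambda>x. frechet_derivative h (at x) v)" for v
    by (rule Ck_on_imp_continuous[OF Ck_on_SucD(2)[OF h]])
  have "((\<lambda>x. integral unit_cube (\<lambda>y. mollifier y * h (x - s *\<^sub>R y))) has_derivative
     (\<lambda>v. integral unit_cube (\<lambda>y. mollifier y * frechet_derivative h (at (x - s *\<^sub>R y)) v))) (at x)"
  proof (rule leibniz_rule_C1)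
    show "((\<lambda>x. mollifier y * h (x - s *\<^sub>R y)) has_derivative
        (\<lambda>v. mollifier y * frechet_derivative h (at (x - s *\<^sub>R y)) v)) (at x)" for x y
    proof -
      have "((\<lambda>x. x - s *\<^sub>R y) has_derivative (\<lambda>v. v)) (at x)"
        by (auto intro!: derivative_eq_intros)
      from diff_chain_at[OF this Ck_on_SucD(1)[OF h]]
      show ?thesis by (auto simp: o_def intro: has_derivative_mult_right)
    qed
    show "continuous_on UNIV (\<lambda>(x, y). mollifier y * frechet_derivative h (at (x - s *\<^sub>R y)) v)" for v
      unfolding split_beta
      by (intro continuous_intros continuous_on_compose2[OF c] continuous_on_compose2[OF continuous_mollifier]) auto
    show "continuous_on UNIV (\<lambda>y. mollifier y * h (x - s *\<^sub>R y))" for x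
      by (rule continuous_mollify_integrand[OF Ck_on_imp_continuous[OF h]])
  qed
  from has_derivative_mult_left[OF this, of "inverse (integral unit_cube mollifier)"]
  show ?thesis unfolding mollify_def[abs_def] by (simp add: divide_inverse)
qed

text \<open>A test function times exp (\<eta> x) or exp (- \<eta> x) is in general not smooth, since
  \<eta> is only C2. This lemma lets such products be approximated by test functions again, in value
  and gradient.\<close>

lemma C1_approx_test_fun:
  fixes f :: "real^'n \<Rightarrow> real"
  assumes f: "Ck_on 1 f UNIV" and K: "compact K" "K \<subseteq> \<Omega>" "\<And>x. x \<notin> K \<Longrightarrow> f x = 0"
    and \<Omega>: "open \<Omega>" and e: "e > 0"
  obtains \<phi> where "test_fun \<Omega> \<phi>" "\<And>x. \<bar>\<phi> x - f x\<bar> \<le> e" "\<And>x. norm (grad \<phi> x - grad f x) \<le> e"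
proof -
  have f': "Ck_on (Suc 0) f UNIV" using f by simp
  have cf: "continuous_on UNIV f" by (rule Ck_on_imp_continuous[OF f])
  define df where "df j x = frechet_derivative f (at x) (axis j 1)" for j x
  have cdf: "continuous_on UNIV (df j)" for j
    unfolding df_def by (rule Ck_on_imp_continuous[OF Ck_on_SucD(2)[OF f']])
  have dfK: "df j x = 0" if "x \<notin> K" for j x
  proof -
    have "(f has_derivative (\<lambda>v. 0)) (at x)"
      by (rule has_derivative_transform_within_open[OF has_derivative_const[of 0], of "- K"])
        (use that K compact_imp_closed in auto)
    then show ?thesis unfolding df_def using frechet_derivative_at by metis
  qed
  define N where "N = real CARD('n)"
  have N: "N > 0" by (simp add: N_def)
  obtain s0 where s0: "s0 > 0" "\<And>s x. 0 < s \<Longrightarrow> s < s0 \<Longrightarrow> \<bar>mollify s f x - f x\<bar> \<le> e"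
    using mollify_uniform[OF cf K(1,3) e] by blast
  have "\<exists>s1>0. \<forall>s. 0 < s \<and> s < s1 \<longrightarrow> (\<forall>x. \<bar>mollify s (df j) x - df j x\<bar> \<le> e / N)" for j
    by (rule mollify_uniform[OF cdf K(1) dfK]) (use e N in auto)
  then obtain s1 where s1: "\<And>j. s1 j > 0"
    "\<And>j s x. 0 < s \<Longrightarrow> s < s1 j \<Longrightarrow> \<bar>mollify s (df j) x - df j x\<bar> \<le> e / N" by metis
  obtain r where r: "r > 0" "(\<Union>x\<in>K. ball x r) \<subseteq> \<Omega>"
    using compact_subset_open_imp_ball_epsilon_subset[OF K(1) \<Omega> K(2)] by blast
  \<comment> \<open>Half of the minimum makes all conditions strict: \<open>s0\<close> controls the
    values, each \<open>s1 j\<close> a partial derivative, and r / N keeps the enlarged support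
    inside the open set.\<close>
  define s where "s = Min ({s0, r / N} \<union> range s1) / 2"
  have m: "0 < Min ({s0, r / N} \<union> range s1)"
    by (subst Min_gr_iff) (use s0 s1 r N in auto)
  have le: "Min ({s0, r / N} \<union> range s1) \<le> s0" "Min ({s0, r / N} \<union> range s1) \<le> r / N"
      "Min ({s0, r / N} \<union> range s1) \<le> s1 j" for j
    by (rule Min_le; simp)+
  have s: "0 < s" "s < s0" "s < r / N" "\<And>j. s < s1 j"
  proof -
    have "s < Min ({s0, r / N} \<union> range s1)" "0 < s" using m unfolding s_def by linarith+
    then show "0 < s" "s < s0" "s < r / N" "\<And>j. s < s1 j" using le less_le_trans by blast+
  qed
  define K' where "K' = {x + y |x y. x \<in> K \<and> y \<in> (\<lambda>y. s *\<^sub>R y) ` unit_cube}"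
  have K': "compact K'" unfolding K'_def
    by (intro compact_sums K(1) compact_continuous_image) (auto intro: continuous_intros)
  have K'sub: "K' \<subseteq> \<Omega>"
  proof
    fix z assume "z \<in> K'"
    then obtain x y where xy: "z = x + s *\<^sub>R y" "x \<in> K" "y \<in> unit_cube" unfolding K'_def by auto
    have "norm (s *\<^sub>R y) \<le> s * N" using unit_cube_norm_le[OF xy(3)] s by (simp add: N_def mult_left_mono)
    also have "\<dots> < r" using s(3) N by (simp add: field_simps)
    finally have "z \<in> ball x r" using xy by (simp add: dist_norm)
    then show "z \<in> \<Omega>" using r xy by blast
  qed
  have z: "mollify s f x = 0" if "x \<notin> K'" for x
  proof -
    have "mollifier y * f (x - s *\<^sub>R y) = 0" if "y \<in> unit_cube" for y
    proof -
      have "x - s *\<^sub>R y \<notin> K"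
      proof
        assume "x - s *\<^sub>R y \<in> K"
        moreover have "s *\<^sub>R y \<in> (\<lambda>y. s *\<^sub>R y) ` unit_cube" using that by blast
        moreover have "x = (x - s *\<^sub>R y) + s *\<^sub>R y" by simp
        ultimately have "x \<in> K'" unfolding K'_def by blast
        then show False using \<open>x \<notin> K'\<close> by simp
      qed
      then show ?thesis using K(3) by simp
    qed
    then have "integral unit_cube (\<lambda>y. mollifier y * f (x - s *\<^sub>R y)) = integral unit_cube (\<lambda>y::real^'n. 0)"
      by (rule Henstock_Kurzweil_Integration.integral_cong)
    then show ?thesis by (simp add: mollify_def)
  qed
  have cl: "closure {x. mollify s f x \<noteq> 0} \<subseteq> K'"
    by (rule closure_minimal) (use z K' compact_imp_closed in auto)
  show ?thesis
  proof (rule that[of "mollify s f"])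
    have "bounded (closure {x. mollify s f x \<noteq> 0})"
      using compact_imp_bounded[OF K'] cl by (rule bounded_subset)
    then have "compact (closure {x. mollify s f x \<noteq> 0})" by (simp add: compact_eq_bounded_closed)
    then show "test_fun \<Omega> (mollify s f)" unfolding test_fun_def
      using smooth_mollify[OF cf K(1,3) s(1)] cl K'sub by blast
    show "\<bar>mollify s f x - f x\<bar> \<le> e" for x using s0 s by blast
    have "grad (mollify s f) x $ j = mollify s (df j) x" for x j
      unfolding grad_def df_def frechet_derivative_at[OF has_derivative_mollify[OF f, of s x], symmetric]
      by simp
    then have *: "(grad (mollify s f) x - grad f x) $ j = mollify s (df j) x - df j x" for x j
      by (simp add: grad_def df_def)
    show "norm (grad (mollify s f) x - grad f x) \<le> e" for x
    proof -
      have "norm (grad (mollify s f) x - grad f x) \<le> (\<Sum>j\<in>UNIV. \<bar>mollify s (df j) x - df j x\<bar>)"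
        using norm_le_l1_cart[of "grad (mollify s f) x - grad f x"] by (simp only: *)
      also have "\<dots> \<le> (\<Sum>j\<in>(UNIV::'n set). e / N)"
        using s1 s by (intro sum_mono) auto
      finally show ?thesis using N by (simp add: N_def)
    qed
  qed
qed

subsection \<open>Divergence and the fundamental lemma\<close>

lemma has_derivative_grad:
  fixes f :: "real^'n \<Rightarrow> real"
  assumes "f differentiable (at x)"
  shows "(f has_derivative (\<lambda>v. grad f x \<bullet> v)) (at x)"
proof -
  have d: "(f has_derivative frechet_derivative f (at x)) (at x)"
    using assms frechet_derivative_works by blast
  then have "linear (frechet_derivative f (at x))"
    using has_derivative_bounded_linear bounded_linear.linear by blast
  then have "frechet_derivative f (at x) v = grad f x \<bullet> v" for v
  proof -
    interpret linear "frechet_derivative f (at x)" by fact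
    have "frechet_derivative f (at x) v = frechet_derivative f (at x) (\<Sum>j\<in>UNIV. v $ j *\<^sub>R axis j 1)"
      using basis_expansion[of v] by (simp add: scalar_mult_eq_scaleR)
    also have "\<dots> = grad f x \<bullet> v" by (simp add: sum scaleR grad_def inner_vec_def mult.commute)
    finally show ?thesis .
  qed
  with d show ?thesis by (metis (no_types, lifting) ext)
qed

lemma grad_eqI:
  fixes f :: "real^'n \<Rightarrow> real"
  assumes "(f has_derivative (\<lambda>v. G \<bullet> v)) (at x)"
  shows "grad f x = G"
proof -
  have "frechet_derivative f (at x) = (\<lambda>v. G \<bullet> v)" using frechet_derivative_at[OF assms] by simp
  then show ?thesis by (simp add: grad_def vec_eq_iff inner_axis)
qed

lemma Ck_on_has_derivative_grad:
  fixes f :: "real^'n \<Rightarrow> real"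
  shows "Ck_on (Suc k) f UNIV \<Longrightarrow> (f has_derivative (\<lambda>v. grad f x \<bullet> v)) (at x)"
  by (rule has_derivative_grad) simp

lemma Ck_on_grad:
  fixes f :: "real^'n \<Rightarrow> real"
  assumes "Ck_on (Suc k) f UNIV" shows "Ck_on k (grad f) UNIV"
proof -
  have "grad f = (\<lambda>x. \<Sum>j\<in>UNIV. frechet_derivative f (at x) (axis j 1) *\<^sub>R axis j 1)"
    using basis_expansion[of "grad f _"] by (simp add: grad_def scalar_mult_eq_scaleR fun_eq_iff)
  then show ?thesis
    by (simp only:) (intro Ck_on_sum Ck_on_scaleR Ck_on_const Ck_on_SucD(2)[OF assms])
qed

lemma grad_mult:
  fixes f g :: "real^'n \<Rightarrow> real"
  assumes "Ck_on (Suc 0) f UNIV" "Ck_on (Suc 0) g UNIV"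
  shows "grad (\<lambda>x. f x * g x) x = f x *\<^sub>R grad g x + g x *\<^sub>R grad f x"
  by (rule grad_eqI)
    (use has_derivative_mult[OF Ck_on_has_derivative_grad[OF assms(1)] Ck_on_has_derivative_grad[OF assms(2)]]
      in \<open>simp add: inner_add_left mult.commute\<close>)

lemma grad_add:
  fixes f g :: "real^'n \<Rightarrow> real"
  assumes "Ck_on (Suc 0) f UNIV" "Ck_on (Suc 0) g UNIV"
  shows "grad (\<lambda>x. f x + g x) x = grad f x + grad g x"
  by (rule grad_eqI)
    (use has_derivative_add[OF Ck_on_has_derivative_grad[OF assms(1)] Ck_on_has_derivative_grad[OF assms(2)]]
      in \<open>simp add: inner_add_left\<close>)

lemma grad_cmult:
  fixes f :: "real^'n \<Rightarrow> real"
  assumes "Ck_on (Suc 0) f UNIV"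
  shows "grad (\<lambda>x. a * f x) x = a *\<^sub>R grad f x"
  by (rule grad_eqI)
    (use has_derivative_mult_right[OF Ck_on_has_derivative_grad[OF assms]] in simp)

lemma divergence_eq:
  assumes "(V has_derivative D) (at x)"
  shows "divergence V x = (\<Sum>j\<in>UNIV. D (axis j 1) $ j)"
  using frechet_derivative_at[OF assms] by (simp add: divergence_def)

lemma divergence_scaleR:
  fixes f :: "real^'n \<Rightarrow> real"
  assumes "Ck_on (Suc 0) f UNIV" "Ck_on (Suc 0) V UNIV"
  shows "divergence (\<lambda>x. f x *\<^sub>R V x) x = f x * divergence V x + grad f x \<bullet> V x"
proof -
  have "divergence (\<lambda>x. f x *\<^sub>R V x) x
    = (\<Sum>j\<in>UNIV. (f x *\<^sub>R frechet_derivative V (at x) (axis j 1) + (grad f x \<bullet> axis j 1) *\<^sub>R V x) $ j)"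
    by (rule divergence_eq)
      (rule has_derivative_scaleR[OF Ck_on_has_derivative_grad[OF assms(1)] Ck_on_SucD(1)[OF assms(2)]])
  then show ?thesis
    by (simp add: sum.distrib sum_distrib_left divergence_def inner_axis) (simp add: inner_vec_def)
qed

lemma Ck_on_divergence:
  assumes "Ck_on (Suc k) V UNIV" shows "Ck_on k (divergence V) UNIV"
proof -
  have "Ck_on k (\<lambda>x. frechet_derivative V (at x) (axis j 1) $ j) UNIV" for j
    by (intro Ck_on_linear[OF bounded_linear_vec_nth] Ck_on_SucD(2)[OF assms])
  then show ?thesis unfolding divergence_def[abs_def] by (intro Ck_on_sum)
qed

lemma frechet_derivative_zero_outside:
  fixes h :: "'a::real_normed_vector \<Rightarrow> 'b::real_normed_vector"
  assumes "closed K" "\<And>x. x \<notin> K \<Longrightarrow> h x = 0" "x \<notin> K"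
  shows "frechet_derivative h (at x) v = 0"
proof -
  have "(h has_derivative (\<lambda>v. 0)) (at x)"
    by (rule has_derivative_transform_within_open[OF has_derivative_const[of 0], of "- K"])
      (use assms in auto)
  then show ?thesis using frechet_derivative_at by metis
qed

text \<open>The integral of h (x + t v) over x does not depend on t. Its derivative at t = 0, taken
  under the integral, is the claimed integral.\<close>

lemma integral_directional_derivative_zero:
  fixes h :: "'a::euclidean_space \<Rightarrow> real"
  assumes h: "Ck_on (Suc 0) h UNIV" and K: "compact K" "\<And>x. x \<notin> K \<Longrightarrow> h x = 0"
  shows "(LINT x|lborel. frechet_derivative h (at x) v) = 0"
proof -
  have ch: "continuous_on UNIV h" by (rule Ck_on_imp_continuous[OF h])
  have cd: "continuous_on UNIV (\<lambda>x. frechet_derivative h (at x) w)" for w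
    by (rule Ck_on_imp_continuous[OF Ck_on_SucD(2)[OF h]])
  \<comment> \<open>For |t| < 1 all the translated supports lie in this set, so one box serves for
    all t near 0.\<close>
  define K1 where "K1 = {x + y |x y. x \<in> K \<and> y \<in> cball 0 (norm v)}"
  have "compact K1" unfolding K1_def by (intro compact_sums K(1) compact_cball)
  then obtain a where a: "K1 \<subseteq> cbox (-a) a"
    using bounded_subset_cbox_symmetric[OF compact_imp_bounded] by blast
  define \<Phi> where "\<Phi> t = integral (cbox (-a) a) (\<lambda>x. h (x + t *\<^sub>R v))" for t
  have ch': "continuous_on UNIV (\<lambda>x. h (x + t *\<^sub>R v))" for t
    by (intro continuous_on_compose2[OF ch] continuous_intros) auto
  have const: "\<Phi> t = (LINT x|lborel. h x)" if "\<bar>t\<bar> < 1" for t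
  proof -
    have "(LINT x|lborel. h x) = (LINT x|lborel. h (t *\<^sub>R v + 1 *\<^sub>R x))"
      using lborel_integral_affine[of h 1 "t *\<^sub>R v"] ch by (simp add: borel_measurable_continuous_onI)
    also have "\<dots> = (LINT x|lborel. h (x + t *\<^sub>R v))" by (simp add: add.commute)
    also have "\<dots> = \<Phi> t" unfolding \<Phi>_def
    proof (rule integral_compact_support_cbox[OF ch'])
      fix x assume x: "x \<notin> cbox (-a) a"
      have "x + t *\<^sub>R v \<notin> K"
      proof
        assume "x + t *\<^sub>R v \<in> K"
        moreover have "- (t *\<^sub>R v) \<in> cball 0 (norm v)" using that by (simp add: mult_left_le_one_le)
        moreover have "x = (x + t *\<^sub>R v) + - (t *\<^sub>R v)" by simp
        ultimately have "x \<in> K1" unfolding K1_def by blast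
        then show False using x a by blast
      qed
      then show "h (x + t *\<^sub>R v) = 0" by (rule K(2))
    qed
    finally show ?thesis by simp
  qed
  have "(\<Phi> has_derivative (\<lambda>s. integral (cbox (-a) a) (\<lambda>x. frechet_derivative h (at (x + 0 *\<^sub>R v)) (s *\<^sub>R v)))) (at 0)"
    unfolding \<Phi>_def
  proof (rule leibniz_rule_C1)
    show "((\<lambda>t. h (x + t *\<^sub>R v)) has_derivative (\<lambda>s. frechet_derivative h (at (x + t *\<^sub>R v)) (s *\<^sub>R v))) (at t)" for t x
    proof -
      have "((\<lambda>t. x + t *\<^sub>R v) has_derivative (\<lambda>s. s *\<^sub>R v)) (at t)"
        by (auto intro!: derivative_eq_intros)
      from diff_chain_at[OF this Ck_on_SucD(1)[OF h]] show ?thesis by (simp add: o_def)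
    qed
    show "continuous_on UNIV (\<lambda>(t, x). frechet_derivative h (at (x + t *\<^sub>R v)) (s *\<^sub>R v))" for s
      unfolding split_beta by (intro continuous_on_compose2[OF cd] continuous_intros) auto
  qed (rule ch')
  moreover have "(\<Phi> has_derivative (\<lambda>s. 0)) (at 0)"
    by (rule has_derivative_transform_within_open[OF has_derivative_const[of "LINT x|lborel. h x"], of "ball 0 1"])
      (auto simp: const)
  ultimately have "integral (cbox (-a) a) (\<lambda>x. frechet_derivative h (at (x + 0 *\<^sub>R v)) (1 *\<^sub>R v)) = 0"
    using has_derivative_unique by metis
  moreover have "(LINT x|lborel. frechet_derivative h (at x) v) = integral (cbox (-a) a) (\<lambda>x. frechet_derivative h (at x) v)"
  proof (rule integral_compact_support_cbox[OF cd])
    fix x assume x: "x \<notin> cbox (-a) a"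
    have "K \<subseteq> K1" unfolding K1_def by (force intro: exI[of _ 0])
    then have "x \<notin> K" using x a by blast
    then show "frechet_derivative h (at x) v = 0"

      by (intro frechet_derivative_zero_outside[OF compact_imp_closed[OF K(1)]] K(2))
  qed
  ultimately show ?thesis by simp
qed

lemma integral_divergence_zero:
  fixes V :: "real^'n \<Rightarrow> real^'n"
  assumes V: "Ck_on (Suc 0) V UNIV" and K: "compact K" "K \<subseteq> \<Omega>" "\<And>x. x \<notin> K \<Longrightarrow> V x = 0"
    and \<Omega>: "\<Omega> \<in> sets lebesgue"
  shows "(LINT x|lebesgue_on \<Omega>. divergence V x) = 0"
proof -
  have Vj: "Ck_on (Suc 0) (\<lambda>x. V x $ j) UNIV" for j by (rule Ck_on_linear[OF bounded_linear_vec_nth V])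
  have d: "((\<lambda>x. V x $ j) has_derivative (\<lambda>v. frechet_derivative V (at x) v $ j)) (at x)" for x j
    by (rule bounded_linear.has_derivative[OF bounded_linear_vec_nth Ck_on_SucD(1)[OF V]])
  have div: "divergence V x = (\<Sum>j\<in>UNIV. frechet_derivative (\<lambda>x. V x $ j) (at x) (axis j 1))" for x
    unfolding divergence_def frechet_derivative_at[OF d, symmetric] ..
  have cd: "continuous_on UNIV (\<lambda>x. frechet_derivative (\<lambda>x. V x $ j) (at x) (axis j 1))" for j
    by (rule Ck_on_imp_continuous[OF Ck_on_SucD(2)[OF Vj]])
  have z: "frechet_derivative (\<lambda>x. V x $ j) (at x) (axis j 1) = 0" if "x \<notin> K" for x j
    by (rule frechet_derivative_zero_outside[OF compact_imp_closed[OF K(1)] _ that]) (simp add: K(3))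
  have "(LINT x|lebesgue_on \<Omega>. divergence V x) = (LINT x|lborel. divergence V x)"
  proof (rule lebesgue_on_integral_support[OF _ _ \<Omega>])
    show "divergence V \<in> borel_measurable borel"
      by (rule borel_measurable_continuous_onI[OF Ck_on_imp_continuous[OF Ck_on_divergence[OF V]]])
    show "divergence V x = 0" if "x \<notin> \<Omega>" for x
      unfolding div by (rule sum.neutral) (use z that K(2) in blast)
  qed
  also have "\<dots> = (\<Sum>j\<in>UNIV. LINT x|lborel. frechet_derivative (\<lambda>x. V x $ j) (at x) (axis j 1))"
    unfolding div
    by (rule Bochner_Integration.integral_sum) (rule integrable_compact_support[OF cd K(1) z])
  also have "\<dots> = 0"
    by (intro sum.neutral ballI integral_directional_derivative_zero[OF Vj K(1)]) (simp add: K(3))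
  finally show ?thesis .
qed

section \<open>The fundamental lemma of the calculus of variations\<close>

text \<open>Lebesgue differentiation: for almost every x the averages over small cubes with corner x
  converge to f x, and here all of these averages are 0.\<close>

lemma integral_boxes_zero_imp_AE_zero:
  fixes f :: "'a::euclidean_space \<Rightarrow> 'b::euclidean_space"
  assumes f: "integrable lebesgue f"
    and z: "\<And>a b. (LINT x|lebesgue. indicator (box a b) x *\<^sub>R f x) = 0"
  shows "AE x in lebesgue. f x = 0"
proof -
  have S: "set_integrable lebesgue (cbox a b) f" for a b
    unfolding set_integrable_def by (rule integrable_mult_indicator[OF _ f]) simp
  have i0: "integral (cbox a b) f = 0" for a b
  proof -
    have "integral (cbox a b) f = (LINT x|lebesgue. indicator (cbox a b) x *\<^sub>R f x)"
      using set_lebesgue_integral_eq_integral(2)[OF S] by (simp add: set_lebesgue_integral_def)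
    also have "\<dots> = (LINT x|lebesgue. indicator (box a b) x *\<^sub>R f x)"
    proof (rule integral_cong_AE)
      have "cbox a b - box a b \<in> null_sets lebesgue"
        using negligible_frontier_interval[of a b] by (simp add: negligible_iff_null_sets)
      then have "AE x in lebesgue. x \<notin> cbox a b - box a b" by (rule AE_not_in)
      then show "AE x in lebesgue. indicat_real (cbox a b) x *\<^sub>R f x = indicator (box a b) x *\<^sub>R f x"
        by eventually_elim (use box_subset_cbox[of a b] in \<open>auto simp: indicator_def\<close>)
    qed (use f in \<open>auto intro!: borel_measurable_scaleR borel_measurable_indicator\<close>)
    finally show ?thesis using z by simp
  qed
  have "\<And>a b. f integrable_on cbox a b" using set_lebesgue_integral_eq_integral(1)[OF S] .
  then obtain N where N: "negligible N" "\<And>x e. x \<notin> N \<Longrightarrow> 0 < e \<Longrightarrow>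
      \<exists>d>0. \<forall>h. 0 < h \<and> h < d \<longrightarrow> norm (integral (cbox x (x + h *\<^sub>R One)) f /\<^sub>R h ^ DIM('a) - f x) < e"
    using integrable_ccontinuous_explicit by blast
  have "f x = 0" if "x \<notin> N" for x
  proof (rule ccontr)
    assume "f x \<noteq> 0"
    then have "0 < norm (f x)" by simp
    from N(2)[OF \<open>x \<notin> N\<close> this] obtain d where d: "d > 0" "\<And>h. 0 < h \<and> h < d \<longrightarrow>
        norm (integral (cbox x (x + h *\<^sub>R One)) f /\<^sub>R h ^ DIM('a) - f x) < norm (f x)" by blast
    from d(2)[of "d/2"] d(1) show False by (simp add: i0)
  qed
  then have "{x \<in> space lebesgue. f x \<noteq> 0} \<subseteq> N" by auto
  moreover have "N \<in> null_sets lebesgue" using N(1) by (simp add: negligible_iff_null_sets)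
  ultimately show ?thesis by (auto intro: AE_I')
qed

text \<open>Bumps increase the test class to indicators of boxes by dominated convergence.
  Intersections of boxes are boxes, so G cut off to a closed box has vanishing integral over every
  box, and countably many closed boxes cover the open set.\<close>

lemma AE_zero_of_test_fun:
  fixes G :: "real^'n \<Rightarrow> 'b::euclidean_space"
  assumes \<Omega>: "open \<Omega>" and G: "loc_integrable \<Omega> G"
    and z: "\<And>\<phi>. test_fun \<Omega> \<phi> \<Longrightarrow> (LINT x|lebesgue_on \<Omega>. \<phi> x *\<^sub>R G x) = 0"
  shows "AE x in lebesgue_on \<Omega>. G x = 0"
proof -
  have \<Omega>m: "\<Omega> \<in> sets lebesgue" using \<Omega> by auto
  have I: "integrable lebesgue (\<lambda>x. indicator (cbox a b) x *\<^sub>R G x)" if "cbox a b \<subseteq> \<Omega>" for a b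
    using G that by (auto simp: loc_integrable_def set_integrable_def)
  have box0: "(LINT x|lebesgue. indicator (box a b) x *\<^sub>R G x) = 0" if ab: "cbox a b \<subseteq> \<Omega>" for a b
  proof -
    have sup: "box_bump (real (Suc m)) a b x \<noteq> 0 \<Longrightarrow> x \<in> box a b" for m x
      using box_bump_pos_iff[of "real (Suc m)" a b x] by auto
    have eq: "indicator \<Omega> x *\<^sub>R (box_bump (real (Suc m)) a b x *\<^sub>R G x)
        = box_bump (real (Suc m)) a b x *\<^sub>R (indicator (cbox a b) x *\<^sub>R G x)" for m x
      using sup[of m x] ab box_subset_cbox[of a b] by (auto simp: indicator_def)
    have m0: "(LINT x|lebesgue. box_bump (real (Suc m)) a b x *\<^sub>R (indicator (cbox a b) x *\<^sub>R G x)) = 0" for m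

    proof -
      have "(LINT x|lebesgue_on \<Omega>. box_bump (real (Suc m)) a b x *\<^sub>R G x) = 0"
        by (rule z[OF test_fun_box_bump[OF _ ab]]) simp
      then show ?thesis
        using integral_restrict_space[of \<Omega> lebesgue "\<lambda>x. box_bump (real (Suc m)) a b x *\<^sub>R G x"] \<Omega>m
        unfolding eq by simp
    qed
    have bm: "box_bump (real (Suc m)) a b \<in> borel_measurable lebesgue" for m
      using smooth_box_bump[of "real (Suc m)" a b] Ck_on_imp_continuous
      by (intro measurable_completion) (auto simp: smooth_on_def intro!: borel_measurable_continuous_onI)
    have "(\<lambda>m. LINT x|lebesgue. box_bump (real (Suc m)) a b x *\<^sub>R (indicator (cbox a b) x *\<^sub>R G x))
      \<longlonglongrightarrow> (LINT x|lebesgue. indicator (box a b) x *\<^sub>R (indicator (cbox a b) x *\<^sub>R G x))"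
    proof (rule integral_dominated_convergence[where w="\<lambda>x. norm (indicator (cbox a b) x *\<^sub>R G x)"])
      show "integrable lebesgue (\<lambda>x. norm (indicator (cbox a b) x *\<^sub>R G x))" using I[OF ab] by (rule integrable_norm)
      show "(\<lambda>x. indicat_real (box a b) x *\<^sub>R (indicator (cbox a b) x *\<^sub>R G x)) \<in> borel_measurable lebesgue"
        by (rule borel_measurable_scaleR[OF borel_measurable_indicator borel_measurable_integrable[OF I[OF ab]]]) simp
      show "(\<lambda>x. box_bump (real (Suc m)) a b x *\<^sub>R (indicator (cbox a b) x *\<^sub>R G x)) \<in> borel_measurable lebesgue" for m
        by (rule borel_measurable_scaleR[OF bm borel_measurable_integrable[OF I[OF ab]]])
      show "AE x in lebesgue. (\<lambda>m. box_bump (real (Suc m)) a b x *\<^sub>R (indicator (cbox a b) x *\<^sub>R G x))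
         \<longlonglongrightarrow> indicator (box a b) x *\<^sub>R (indicator (cbox a b) x *\<^sub>R G x)"
        by (intro AE_I2 tendsto_scaleR box_bump_tendsto tendsto_const)
      show "AE x in lebesgue. norm (box_bump (real (Suc m)) a b x *\<^sub>R (indicator (cbox a b) x *\<^sub>R G x))
         \<le> norm (indicator (cbox a b) x *\<^sub>R G x)" for m
        using box_bump_nonneg[of "real (Suc m)" a b] box_bump_le_1[of "real (Suc m)" a b]
        by (intro AE_I2, subst norm_scaleR, intro mult_left_le_one_le) (simp_all only: norm_ge_zero abs_ge_zero abs_of_nonneg)
    qed
    then have "(LINT x|lebesgue. indicator (box a b) x *\<^sub>R (indicator (cbox a b) x *\<^sub>R G x)) = 0"
      unfolding m0 using LIMSEQ_unique tendsto_const by blast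
    moreover have "indicat_real (box a b) x *\<^sub>R (indicator (cbox a b) x *\<^sub>R G x) = indicator (box a b) x *\<^sub>R G x" for x
      using box_subset_cbox[of a b] by (auto simp: indicator_def)
    ultimately show ?thesis by (simp only:)
  qed
  have AEbox: "AE x in lebesgue. x \<in> cbox c d \<longrightarrow> G x = 0" if cd: "cbox c d \<subseteq> \<Omega>" for c d
  proof -
    have "AE x in lebesgue. indicat_real (cbox c d) x *\<^sub>R G x = 0"
    proof (rule integral_boxes_zero_imp_AE_zero[OF I[OF cd]])
      fix a b :: "real^'n"
      obtain a' b' where ab: "box a b \<inter> box c d = box a' b'" "cbox a' b' \<subseteq> cbox c d"
      proof (cases "box a b \<inter> box c d = {}")
        case True
        have "box (\<chi> j. 1) (\<chi> j. 0) = ({} :: (real^'n) set)" "cbox (\<chi> j. 1) (\<chi> j. 0) = ({} :: (real^'n) set)"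
          by (auto simp: set_eq_iff mem_box_cart)
        then show ?thesis using that True by (metis empty_subsetI)
      next
        case False
        define a' where "a' = (\<chi> j. max (a $ j) (c $ j))"
        define b' where "b' = (\<chi> j. min (b $ j) (d $ j))"
        have "box a b \<inter> box c d = box a' b'" by (auto simp: a'_def b'_def mem_box_cart)
        moreover have "cbox a' b' \<subseteq> cbox c d" by (auto simp: a'_def b'_def mem_box_cart)
        ultimately show ?thesis using that by blast
      qed
      have "AE x in lebesgue. x \<notin> cbox c d - box c d"
        using negligible_frontier_interval[of c d] by (intro AE_not_in) (simp add: negligible_iff_null_sets)
      then have "AE x in lebesgue. indicat_real (box a b) x *\<^sub>R (indicator (cbox c d) x *\<^sub>R G x)
          = indicator (box a' b') x *\<^sub>R G x"
        by eventually_elim (use ab(1) box_subset_cbox[of c d] in \<open>auto simp: indicator_def\<close>)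
      then have "(LINT x|lebesgue. indicat_real (box a b) x *\<^sub>R (indicator (cbox c d) x *\<^sub>R G x))
          = (LINT x|lebesgue. indicator (box a' b') x *\<^sub>R G x)"
      proof (rule integral_cong_AE[rotated 2])
        show "(\<lambda>x. indicat_real (box a b) x *\<^sub>R (indicator (cbox c d) x *\<^sub>R G x)) \<in> borel_measurable lebesgue"
          by (rule borel_measurable_scaleR[OF borel_measurable_indicator borel_measurable_integrable[OF I[OF cd]]]) simp
        have "(\<lambda>x. indicator (box a' b') x *\<^sub>R (indicator (cbox c d) x *\<^sub>R G x)) \<in> borel_measurable lebesgue"
          by (rule borel_measurable_scaleR[OF borel_measurable_indicator borel_measurable_integrable[OF I[OF cd]]]) simp
        also have "(\<lambda>x. indicat_real (box a' b') x *\<^sub>R (indicator (cbox c d) x *\<^sub>R G x))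
            = (\<lambda>x. indicator (box a' b') x *\<^sub>R G x)"
          using ab(2) box_subset_cbox[of a' b'] by (auto simp: indicator_def fun_eq_iff)
        finally show "(\<lambda>x. indicat_real (box a' b') x *\<^sub>R G x) \<in> borel_measurable lebesgue" .
      qed
      then show "(LINT x|lebesgue. indicat_real (box a b) x *\<^sub>R (indicator (cbox c d) x *\<^sub>R G x)) = 0"
        using box0 ab(2) cd by auto
    qed
    then show ?thesis by eventually_elim (auto simp: indicator_def)
  qed
  obtain \<D> where D: "countable \<D>" "\<And>X. X \<in> \<D> \<Longrightarrow> X \<subseteq> \<Omega> \<and> (\<exists>a b. X = cbox a b)" "\<Union>\<D> = \<Omega>"
    using open_countable_Union_open_cbox[OF \<Omega>] by (metis Pow_iff subsetD)
  have "AE x in lebesgue. \<forall>X\<in>\<D>. x \<in> X \<longrightarrow> G x = 0"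
    using AEbox D(2) by (intro AE_ball_countable[THEN iffD2] D(1)) blast
  then have "AE x in lebesgue. x \<in> \<Omega> \<longrightarrow> G x = 0"
    by eventually_elim (use D(3) in blast)
  then show ?thesis using \<Omega>m by (simp add: AE_restrict_space_iff)
qed

subsection \<open>Sobolev functions with vanishing trace\<close>

definition sjet :: "(real^'n \<Rightarrow> real) \<Rightarrow> real^'n \<Rightarrow> real \<times> (real^'n)" where
  "sjet f x = (f x, grad f x)"

text \<open>The functions of \<open>H\<^sup>1\<^sub>0\<close>, paired with their weak gradients.\<close>

definition S0 :: "(real^'n) set \<Rightarrow> (real^'n \<Rightarrow> real \<times> (real^'n)) \<Rightarrow> bool" where
  "S0 \<Omega> J \<longleftrightarrow> (\<exists>\<phi>. (\<forall>m. test_fun \<Omega> (\<phi> m)) \<and> L2_lim (lebesgue_on \<Omega>) (\<lambda>m. sjet (\<phi> m)) J)"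

lemma test_fun_Ck: "test_fun \<Omega> \<phi> \<Longrightarrow> Ck_on k \<phi> UNIV"
  by (simp add: test_fun_def smooth_on_def)

lemma test_fun_zero: "test_fun \<Omega> (\<lambda>x. 0)"
  by (simp add: test_fun_def smooth_on_def)

lemma test_funI:
  assumes "\<And>k. Ck_on k \<phi> UNIV" "compact K" "K \<subseteq> \<Omega>" "\<And>x. x \<notin> K \<Longrightarrow> \<phi> x = 0"
  shows "test_fun \<Omega> \<phi>"
proof -
  have cl: "closure {x. \<phi> x \<noteq> 0} \<subseteq> K"
    by (rule closure_minimal) (use assms compact_imp_closed in auto)
  then have "bounded (closure {x. \<phi> x \<noteq> 0})"
    using compact_imp_bounded[OF assms(2)] bounded_subset by blast
  then show ?thesis
    using assms cl by (auto simp: test_fun_def smooth_on_def compact_eq_bounded_closed)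
qed

lemma test_funE:
  assumes "test_fun \<Omega> \<phi>"
  obtains K where "compact K" "K \<subseteq> \<Omega>" "\<And>x. x \<notin> K \<Longrightarrow> \<phi> x = 0"
proof
  show "compact (closure {x. \<phi> x \<noteq> 0})" "closure {x. \<phi> x \<noteq> 0} \<subseteq> \<Omega>"
    using assms by (auto simp: test_fun_def)
  show "\<phi> x = 0" if "x \<notin> closure {x. \<phi> x \<noteq> 0}" for x
    using that closure_subset[of "{x. \<phi> x \<noteq> 0}"] by auto
qed

lemma test_fun_add:
  assumes "test_fun \<Omega> \<phi>" "test_fun \<Omega> \<psi>"
  shows "test_fun \<Omega> (\<lambda>x. \<phi> x + \<psi> x)"
proof -
  obtain K where K: "compact K" "K \<subseteq> \<Omega>" "\<And>x. x \<notin> K \<Longrightarrow> \<phi> x = 0" by (rule test_funE[OF assms(1)]) blast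
  obtain K' where K': "compact K'" "K' \<subseteq> \<Omega>" "\<And>x. x \<notin> K' \<Longrightarrow> \<psi> x = 0" by (rule test_funE[OF assms(2)]) blast
  show ?thesis
  proof (rule test_funI[of _ "K \<union> K'"])
    show "Ck_on k (\<lambda>x. \<phi> x + \<psi> x) UNIV" for k
      by (rule Ck_on_add[OF test_fun_Ck[OF assms(1)] test_fun_Ck[OF assms(2)]])
  qed (use K K' in auto)
qed

lemma test_fun_cmult:
  assumes "test_fun \<Omega> \<phi>" shows "test_fun \<Omega> (\<lambda>x. a * \<phi> x)"
proof -
  obtain K where K: "compact K" "K \<subseteq> \<Omega>" "\<And>x. x \<notin> K \<Longrightarrow> \<phi> x = 0" by (rule test_funE[OF assms(1)]) blast
  show ?thesis
  proof (rule test_funI[of _ K])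
    show "Ck_on k (\<lambda>x. a * \<phi> x) UNIV" for k
      by (rule Ck_on_mult[OF Ck_on_const test_fun_Ck[OF assms]])
  qed (use K in auto)
qed

lemma sjet_add: "Ck_on (Suc 0) f UNIV \<Longrightarrow> Ck_on (Suc 0) g UNIV \<Longrightarrow> sjet (\<lambda>x. f x + g x) x = sjet f x + sjet g x"
  by (simp add: sjet_def grad_add)

lemma sjet_cmult: "Ck_on (Suc 0) f UNIV \<Longrightarrow> sjet (\<lambda>x. a * f x) x = a *\<^sub>R sjet f x"
  by (simp add: sjet_def grad_cmult)

lemma C1_continuous: "Ck_on (Suc 0) f UNIV \<Longrightarrow> continuous_on UNIV f"
  by (rule Ck_on_imp_continuous)

lemma C1_continuous_grad: "Ck_on (Suc 0) f UNIV \<Longrightarrow> continuous_on UNIV (grad f)"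
  by (rule Ck_on_imp_continuous[OF Ck_on_grad])

lemma C1_continuous_divergence: "Ck_on (Suc 0) V UNIV \<Longrightarrow> continuous_on UNIV (divergence V)"
  by (rule Ck_on_imp_continuous[OF Ck_on_divergence])

lemma continuous_sjet: "Ck_on (Suc 0) f UNIV \<Longrightarrow> continuous_on UNIV (sjet f)"
  unfolding sjet_def[abs_def]
  by (intro continuous_on_Pair C1_continuous C1_continuous_grad)

definition jet_mult :: "(real^'n \<Rightarrow> real) \<Rightarrow> real^'n \<Rightarrow> real \<times> (real^'n) \<Rightarrow> real \<times> (real^'n)" where
  "jet_mult g x j = (g x * fst j, g x *\<^sub>R snd j + fst j *\<^sub>R grad g x)"

lemma sjet_mult: "Ck_on (Suc 0) f UNIV \<Longrightarrow> Ck_on (Suc 0) g UNIV \<Longrightarrow> sjet (\<lambda>x. g x * f x) x = jet_mult g x (sjet f x)"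
  by (simp add: sjet_def grad_mult jet_mult_def)

lemma S0_L2: "S0 \<Omega> J \<Longrightarrow> L2 (lebesgue_on \<Omega>) J"
  by (auto simp: S0_def L2_lim_def)

locale bounded_open =
  fixes \<Omega> :: "(real^'n) set"
  assumes open_\<Omega>: "open \<Omega>" and bounded_\<Omega>: "bounded \<Omega>"
begin

abbreviation "L \<equiv> lebesgue_on \<Omega>"

lemma sets_\<Omega>: "\<Omega> \<in> sets lebesgue" using open_\<Omega> by auto

sublocale L: finite_measure L
  by (rule finite_measure_lebesgue_on) (use open_\<Omega> bounded_\<Omega> in \<open>simp add: lmeasurable_open\<close>)

lemma L2_continuous:
  fixes f :: "real^'n \<Rightarrow> 'b::euclidean_space"
  assumes "continuous_on UNIV f" shows "L2 L f"
proof -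
  have m: "f \<in> borel_measurable L" by (rule continuous_imp_measurable_lebesgue_on[OF assms sets_\<Omega>])
  obtain K where K: "\<And>x. x \<in> \<Omega> \<Longrightarrow> norm (f x) \<le> K"
    by (rule continuous_bounded_on_bounded[OF bounded_\<Omega> assms]) blast
  have "L2 L (\<lambda>x. 1::real)" by (simp add: L2_def)
  from L2_bound[OF this m, of K] show ?thesis using K by simp
qed

lemma S0_test: "test_fun \<Omega> \<phi> \<Longrightarrow> S0 \<Omega> (sjet \<phi>)"
  unfolding S0_def
  by (intro exI[of _ "\<lambda>m. \<phi>"] conjI allI L2_lim_const L2_continuous continuous_sjet test_fun_Ck)

lemma S0_approx:
  assumes J: "L2 L J"
    and a: "\<And>e. 0 < e \<Longrightarrow> \<exists>\<phi>. test_fun \<Omega> \<phi> \<and> L2_sqnorm L (\<lambda>x. sjet \<phi> x - J x) < e"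
  shows "S0 \<Omega> J"
proof -
  have "\<exists>g. (\<exists>\<phi>. test_fun \<Omega> \<phi> \<and> g = sjet \<phi>) \<and> L2 L g \<and> L2_sqnorm L (\<lambda>x. g x - J x) < inverse (real (Suc m))" for m
  proof -
    obtain \<phi> where "test_fun \<Omega> \<phi>" "L2_sqnorm L (\<lambda>x. sjet \<phi> x - J x) < inverse (real (Suc m))"
      using a[of "inverse (real (Suc m))"] by auto
    then show ?thesis by (intro exI[of _ "sjet \<phi>"] conjI exI[of _ \<phi>] S0_L2[OF S0_test] refl)
  qed
  from L2_lim_diagonal[OF L2_lim_const[OF J], of "\<lambda>g. \<exists>\<phi>. test_fun \<Omega> \<phi> \<and> g = sjet \<phi>", OF this]
  obtain G where G: "\<And>m. \<exists>\<phi>. test_fun \<Omega> \<phi> \<and> G m = sjet \<phi>" "L2_lim L G J" by blast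
  then obtain \<phi> where "\<And>m. test_fun \<Omega> (\<phi> m)" "G = (\<lambda>m. sjet (\<phi> m))" by metis
  then show ?thesis using G(2) by (auto simp: S0_def)
qed

lemma S0_closed:
  assumes "\<And>m. S0 \<Omega> (F m)" "L2_lim L F J" shows "S0 \<Omega> J"
proof (rule S0_approx)
  show "L2 L J" using assms(2) by (simp add: L2_lim_def)
  fix e :: real assume e: "0 < e"
  have "(\<lambda>m. L2_sqnorm L (\<lambda>x. F m x - J x)) \<longlonglongrightarrow> 0" using assms(2) by (simp add: L2_lim_def)
  from order_tendstoD(2)[OF this, of "e/4"] e
  obtain m where m: "L2_sqnorm L (\<lambda>x. F m x - J x) < e / 4" by (auto simp: eventually_sequentially)
  obtain \<phi> where \<phi>: "\<And>i. test_fun \<Omega> (\<phi> i)" "L2_lim L (\<lambda>i. sjet (\<phi> i)) (F m)"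
    using assms(1)[of m] by (auto simp: S0_def)
  have "(\<lambda>i. L2_sqnorm L (\<lambda>x. sjet (\<phi> i) x - F m x)) \<longlonglongrightarrow> 0" using \<phi>(2) by (simp add: L2_lim_def)
  from order_tendstoD(2)[OF this, of "e/4"] e
  obtain i where i: "L2_sqnorm L (\<lambda>x. sjet (\<phi> i) x - F m x) < e / 4" by (auto simp: eventually_sequentially)
  have l: "L2 L (\<lambda>x. sjet (\<phi> i) x - F m x)" "L2 L (\<lambda>x. F m x - J x)"
    using \<phi>(2) assms(2) by (auto simp: L2_lim_def intro!: L2_diff)
  have "L2_sqnorm L (\<lambda>x. sjet (\<phi> i) x - J x) < e"
    using L2_sqnorm_triangle[OF l] m i by simp
  then show "\<exists>\<phi>. test_fun \<Omega> \<phi> \<and> L2_sqnorm L (\<lambda>x. sjet \<phi> x - J x) < e" using \<phi>(1) by blast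
qed

lemma S0_add:
  assumes "S0 \<Omega> J" "S0 \<Omega> K" shows "S0 \<Omega> (\<lambda>x. J x + K x)"
proof -
  obtain \<phi> where p: "\<And>i. test_fun \<Omega> (\<phi> i)" "L2_lim L (\<lambda>i. sjet (\<phi> i)) J" using assms(1) by (auto simp: S0_def)
  obtain \<psi> where q: "\<And>i. test_fun \<Omega> (\<psi> i)" "L2_lim L (\<lambda>i. sjet (\<psi> i)) K" using assms(2) by (auto simp: S0_def)
  have "sjet (\<lambda>x. \<phi> i x + \<psi> i x) = (\<lambda>x. sjet (\<phi> i) x + sjet (\<psi> i) x)" for i
    using p(1) q(1) by (auto intro!: sjet_add test_fun_Ck)
  then show ?thesis unfolding S0_def
    using L2_lim_add[OF p(2) q(2)] test_fun_add[OF p(1) q(1)]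
    by (intro exI[of _ "\<lambda>i x. \<phi> i x + \<psi> i x"]) simp
qed

lemma S0_scaleR:
  assumes "S0 \<Omega> J" shows "S0 \<Omega> (\<lambda>x. a *\<^sub>R J x)"
proof -
  obtain \<phi> where p: "\<And>i. test_fun \<Omega> (\<phi> i)" "L2_lim L (\<lambda>i. sjet (\<phi> i)) J" using assms(1) by (auto simp: S0_def)
  have "sjet (\<lambda>x. a * \<phi> i x) = (\<lambda>x. a *\<^sub>R sjet (\<phi> i) x)" for i
    using p(1) by (auto intro!: sjet_cmult test_fun_Ck)
  then show ?thesis unfolding S0_def
    using L2_lim_scaleR[OF p(2), of a] test_fun_cmult[OF p(1), of a]
    by (intro exI[of _ "\<lambda>i x. a * \<phi> i x"]) simp
qed

lemma S0_zero: "S0 \<Omega> (\<lambda>x. 0)"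
proof -
  have "sjet (\<lambda>x. 0) = (\<lambda>x::real^'n. 0)" by (simp add: sjet_def fun_eq_iff zero_prod_def grad_eqI)
  then show ?thesis using S0_test[OF test_fun_zero] by simp
qed

lemma S0_C1:
  assumes f: "Ck_on (Suc 0) f UNIV" and K: "compact K" "K \<subseteq> \<Omega>" "\<And>x. x \<notin> K \<Longrightarrow> f x = 0"
  shows "S0 \<Omega> (sjet f)"
proof (rule S0_approx)
  show Lf: "L2 L (sjet f)" by (rule L2_continuous[OF continuous_sjet[OF f]])
  fix e :: real assume e: "0 < e"
  define V where "V = measure L (space L) + 1"
  have V: "V > 0" unfolding V_def by (simp add: add_nonneg_pos)
  \<comment> \<open>Value and gradient are each approximated within d, so the jets differ by at most
    2 d. The measure is V - 1, and (2 d)^2 (V - 1) = e (V - 1) / V < e.\<close>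
  define d where "d = sqrt (e / (4 * V))"
  have d: "d > 0" using e V by (simp add: d_def)
  obtain \<phi> where p: "test_fun \<Omega> \<phi>" "\<And>x. \<bar>\<phi> x - f x\<bar> \<le> d" "\<And>x. norm (grad \<phi> x - grad f x) \<le> d"
    using C1_approx_test_fun[OF f[folded One_nat_def] K open_\<Omega> d] by blast
  have "norm (sjet \<phi> x - sjet f x) \<le> (2 * d) * norm (1::real)" for x
    using norm_Pair_le[of "\<phi> x - f x" "grad \<phi> x - grad f x"] p(2)[of x] p(3)[of x] by (simp add: sjet_def)
  moreover have L1: "L2 L (\<lambda>x. 1::real)" by (simp add: L2_def)
  moreover have Lp: "L2 L (sjet \<phi>)" by (rule S0_L2[OF S0_test[OF p(1)]])
  ultimately have "L2_sqnorm L (\<lambda>x. sjet \<phi> x - sjet f x) \<le> (2 * d)\<^sup>2 * L2_sqnorm L (\<lambda>x. 1::real)"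
    using Lf by (intro L2_sqnorm_bound L2_measurable[OF L2_diff]) auto
  also have "\<dots> = (4 * d\<^sup>2) * (V - 1)" by (simp add: L2_sqnorm_def V_def power_mult_distrib)
  also have "\<dots> = e * ((V - 1) / V)" using e V by (simp add: d_def)
  also have "\<dots> < e" using e V by (simp add: field_simps)
  finally show "\<exists>\<phi>. test_fun \<Omega> \<phi> \<and> L2_sqnorm L (\<lambda>x. sjet \<phi> x - sjet f x) < e" using p(1) by blast
qed

lemma bop_jet_mult: "Ck_on (Suc 0) g UNIV \<Longrightarrow> bop L (jet_mult g)"
proof (rule bop_continuous[OF bounded_\<Omega> sets_\<Omega>])
  assume g: "Ck_on (Suc 0) g UNIV"
  show "linear (jet_mult g x)" for x by (auto simp: jet_mult_def linear_iff algebra_simps)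
  show "continuous_on UNIV (\<lambda>x. jet_mult g x b)" for b
    unfolding jet_mult_def
    by (intro continuous_on_Pair continuous_intros C1_continuous[OF g] C1_continuous_grad[OF g])
qed

text \<open>For a test function the product is C1 with compact support in the domain, hence in the
  closure. The product rule is a bounded linear map of jets, so the general case follows by taking
  limits.\<close>

lemma S0_mult:
  assumes g: "Ck_on (Suc 0) g UNIV" and J: "S0 \<Omega> J"
  shows "S0 \<Omega> (\<lambda>x. jet_mult g x (J x))"
proof -
  obtain \<phi> where p: "\<And>i. test_fun \<Omega> (\<phi> i)" "L2_lim L (\<lambda>i. sjet (\<phi> i)) J" using J by (auto simp: S0_def)
  show ?thesis
  proof (rule S0_closed[OF _ bop_L2_lim[OF bop_jet_mult[OF g] p(2)]])
    fix m
    obtain K where K: "compact K" "K \<subseteq> \<Omega>" "\<And>x. x \<notin> K \<Longrightarrow> \<phi> m x = 0" by (rule test_funE[OF p(1)[of m]]) blast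
    have "S0 \<Omega> (sjet (\<lambda>x. g x * \<phi> m x))"
      by (rule S0_C1[OF _ K(1,2)]) (use K(3) Ck_on_mult[OF g test_fun_Ck[OF p(1)]] in \<open>simp_all del: Ck_on.simps\<close>)
    moreover have "sjet (\<lambda>x. g x * \<phi> m x) = (\<lambda>x. jet_mult g x (sjet (\<phi> m) x))"
      by (rule ext, rule sjet_mult) (rule test_fun_Ck[OF p(1)], rule g)
    ultimately show "S0 \<Omega> (\<lambda>x. jet_mult g x (sjet (\<phi> m) x))" by simp
  qed
qed

text \<open>The divergence of f g W, expressed in the jets of f and g.\<close>

definition ibp_form :: "(real^'n \<Rightarrow> real^'n) \<Rightarrow> real^'n \<Rightarrow> real \<times> (real^'n) \<Rightarrow> real \<times> (real^'n) \<Rightarrow> real" where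
  "ibp_form W x j k = (W x \<bullet> snd j) * fst k + fst j * (W x \<bullet> snd k) + divergence W x * (fst j * fst k)"

lemma bform_ibp:
  assumes "Ck_on (Suc 0) W UNIV" shows "bform L (ibp_form W)"
proof (rule bform_continuous[OF bounded_\<Omega> sets_\<Omega>])
  show "bilinear (ibp_form W x)" for x
    by (auto simp: bilinear_def ibp_form_def linear_iff algebra_simps inner_add_right)
  show "continuous_on UNIV (\<lambda>x. ibp_form W x b c)" for b c
    unfolding ibp_form_def
    by (intro continuous_intros C1_continuous C1_continuous_divergence assms)
qed

text \<open>For test functions the field f g W has compact support and its divergence integrates to
  0; both arguments then pass to the limit. Every later integration by parts is an instance with a
  suitable field W.\<close>

lemma integration_by_parts:
  assumes W: "Ck_on (Suc 0) W UNIV" and J: "S0 \<Omega> J" and K: "S0 \<Omega> K"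
  shows "ifm L (ibp_form W) J K = 0"
proof -
  obtain \<phi> where p: "\<And>i. test_fun \<Omega> (\<phi> i)" "L2_lim L (\<lambda>i. sjet (\<phi> i)) J" using J by (auto simp: S0_def)
  obtain \<psi> where q: "\<And>i. test_fun \<Omega> (\<psi> i)" "L2_lim L (\<lambda>i. sjet (\<psi> i)) K" using K by (auto simp: S0_def)
  have "ifm L (ibp_form W) (sjet (\<phi> i)) (sjet (\<psi> i)) = 0" for i
  proof -
    obtain A where A: "compact A" "A \<subseteq> \<Omega>" "\<And>x. x \<notin> A \<Longrightarrow> \<phi> i x = 0" by (rule test_funE[OF p(1)[of i]]) blast
    have C: "Ck_on (Suc 0) (\<lambda>x. \<phi> i x * \<psi> i x) UNIV" by (rule Ck_on_mult[OF test_fun_Ck[OF p(1)] test_fun_Ck[OF q(1)]])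
    have "divergence (\<lambda>x. (\<phi> i x * \<psi> i x) *\<^sub>R W x) x = ibp_form W x (sjet (\<phi> i) x) (sjet (\<psi> i) x)" for x
      unfolding divergence_scaleR[OF C W] grad_mult[OF test_fun_Ck[OF p(1)] test_fun_Ck[OF q(1)]]
      by (simp add: ibp_form_def sjet_def inner_add_left inner_add_right inner_commute mult_ac)
    moreover have "(LINT x|L. divergence (\<lambda>x. (\<phi> i x * \<psi> i x) *\<^sub>R W x) x) = 0"
      by (rule integral_divergence_zero[OF Ck_on_scaleR[OF C W] A(1,2) _ sets_\<Omega>]) (simp add: A(3))
    ultimately show ?thesis by (simp add: ifm_def)
  qed
  then have "(\<lambda>i. 0) \<longlonglongrightarrow> ifm L (ibp_form W) J K" using ifm_tendsto[OF bform_ibp[OF W] p(2) q(2)] by simp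
  then show ?thesis using LIMSEQ_unique tendsto_const by blast
qed

lemma loc_integrable_L2:
  fixes f :: "real^'n \<Rightarrow> 'b::euclidean_space"
  assumes "L2 L f" shows "loc_integrable \<Omega> f"
  unfolding loc_integrable_def
proof (intro allI impI)
  fix K :: "(real^'n) set" assume K: "compact K" "K \<subseteq> \<Omega>"
  have "set_integrable lebesgue \<Omega> f"
    using L.L2_imp_integrable[OF assms] integrable_restrict_space[of \<Omega> lebesgue f] sets_\<Omega>
    by (simp add: set_integrable_def)
  then show "f absolutely_integrable_on K"
    by (rule set_integrable_subset) (use K compact_imp_closed in \<open>auto intro: lmeasurable_compact fmeasurableD\<close>)
qed

lemma S0_weak_grad:
  assumes J: "S0 \<Omega> J" shows "is_weak_grad \<Omega> (\<lambda>x. fst (J x)) (\<lambda>x. snd (J x))"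
proof -
  have bl: "bop L (\<lambda>x. fst :: real \<times> (real^'n) \<Rightarrow> real)" "bop L (\<lambda>x. snd :: real \<times> (real^'n) \<Rightarrow> real^'n)"
    by (rule bop_continuous[OF bounded_\<Omega> sets_\<Omega>]; auto simp: linear_iff)+
  have L: "L2 L (\<lambda>x. fst (J x))" "L2 L (\<lambda>x. snd (J x))"
    using bop_L2[OF bl(1) S0_L2[OF J]] bop_L2[OF bl(2) S0_L2[OF J]] by auto
  have "dist_grad \<Omega> (\<lambda>x. fst (J x)) \<phi> = dist_fun \<Omega> (\<lambda>x. snd (J x)) \<phi>" if p: "test_fun \<Omega> \<phi>" for \<phi>
  proof -
    have c: "continuous_on UNIV \<phi>" "continuous_on UNIV (grad \<phi>)"
      using Ck_on_imp_continuous[OF test_fun_Ck[OF p, of 0]]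
        Ck_on_imp_continuous[OF Ck_on_grad[OF test_fun_Ck[OF p, of "Suc 0"]]] by auto
    have b: "bform L (\<lambda>x f (g::real^'n). f * (g \<bullet> w))" for w
      by (rule bform_continuous[OF bounded_\<Omega> sets_\<Omega>])
        (auto simp: bilinear_def linear_iff algebra_simps inner_add_left)
    have b1: "bop L (\<lambda>x (f::real). f *\<^sub>R grad \<phi> x)" and b2: "bop L (\<lambda>x (F::real^'n). \<phi> x *\<^sub>R F)"
      by (rule bop_continuous[OF bounded_\<Omega> sets_\<Omega>];
          use c in \<open>auto simp: linear_iff algebra_simps intro!: continuous_intros\<close>)+
    have i1: "integrable L (\<lambda>x. fst (J x) *\<^sub>R grad \<phi> x)" and i2: "integrable L (\<lambda>x. \<phi> x *\<^sub>R snd (J x))"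
      using L.L2_imp_integrable[OF bop_L2[OF b1 L(1)]] L.L2_imp_integrable[OF bop_L2[OF b2 L(2)]] by auto
    have "(LINT x|L. \<phi> x *\<^sub>R snd (J x)) + (LINT x|L. fst (J x) *\<^sub>R grad \<phi> x) = 0"
    \<comment> \<open>The vector identity is tested against each constant vector w, with w itself as
      the divergence free field in the integration by parts.\<close>
    proof (rule vector_eq_ldot[THEN iffD1], rule allI)
      fix w :: "real^'n"
      have "frechet_derivative (\<lambda>x::real^'n. w) (at x) = (\<lambda>v. 0)" for x :: "real^'n"
        using frechet_derivative_at[OF has_derivative_const[of w "at x"]] by simp
      then have "ibp_form (\<lambda>x. w) x j k = (w \<bullet> snd j) * fst k + fst j * (w \<bullet> snd k)" for x j k
        by (simp add: ibp_form_def divergence_def)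
      then have "(LINT x|L. (w \<bullet> snd (J x)) * \<phi> x + fst (J x) * (w \<bullet> grad \<phi> x)) = 0"
        using integration_by_parts[OF Ck_on_const[of "Suc 0" w] J S0_test[OF p]] by (simp add: ifm_def sjet_def)
      also have "(\<lambda>x. (w \<bullet> snd (J x)) * \<phi> x + fst (J x) * (w \<bullet> grad \<phi> x))
          = (\<lambda>x. w \<bullet> (\<phi> x *\<^sub>R snd (J x) + fst (J x) *\<^sub>R grad \<phi> x))"
        by (simp add: inner_add_right mult.commute)
      also have "(LINT x|L. \<dots> x) = w \<bullet> (LINT x|L. \<phi> x *\<^sub>R snd (J x) + fst (J x) *\<^sub>R grad \<phi> x)"
        using i1 i2 by (intro integral_inner_right) auto
      finally show "w \<bullet> ((LINT x|L. \<phi> x *\<^sub>R snd (J x)) + (LINT x|L. fst (J x) *\<^sub>R grad \<phi> x)) = w \<bullet> 0"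
        using i1 i2 by simp
    qed
    then show ?thesis unfolding dist_grad_def dist_fun_def by (simp add: add_eq_0_iff2)
  qed
  then show ?thesis using loc_integrable_L2[OF L(1)] loc_integrable_L2[OF L(2)] by (auto simp: is_weak_grad_def)
qed

text \<open>\<open>weak_grad\<close> is a choice among all weak gradients; this makes every integral
  containing it independent of the choice.\<close>

lemma weak_grad_unique:
  assumes "is_weak_grad \<Omega> f G" "is_weak_grad \<Omega> f G'"
  shows "AE x in L. G x = G' x"
proof -
  have lG: "loc_integrable \<Omega> G" "loc_integrable \<Omega> G'" using assms by (auto simp: is_weak_grad_def)
  have i: "integrable L (\<lambda>x. \<phi> x *\<^sub>R H x)" if p: "test_fun \<Omega> \<phi>" and H: "loc_integrable \<Omega> H"
    for \<phi> and H :: "real^'n \<Rightarrow> real^'n"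
  proof -
    obtain K where K: "compact K" "K \<subseteq> \<Omega>" "\<And>x. x \<notin> K \<Longrightarrow> \<phi> x = 0" by (rule test_funE[OF p]) blast
    have c: "continuous_on UNIV \<phi>" by (rule Ck_on_imp_continuous[OF test_fun_Ck[OF p, of 0]])
    obtain B where B: "B \<ge> 0" "\<And>x. x \<in> \<Omega> \<Longrightarrow> norm (\<phi> x) \<le> B" by (rule continuous_bounded_on_bounded[OF bounded_\<Omega> c]) blast
    have HK: "integrable lebesgue (\<lambda>x. indicator K x *\<^sub>R H x)"
      using H K by (auto simp: loc_integrable_def set_integrable_def)
    have "integrable lebesgue (\<lambda>x. \<phi> x *\<^sub>R (indicator K x *\<^sub>R H x))"
    proof (rule Bochner_Integration.integrable_bound)
      show "integrable lebesgue (\<lambda>x. B *\<^sub>R (indicator K x *\<^sub>R H x))" by (rule integrable_scaleR_right[OF HK])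
      have "\<phi> \<in> borel_measurable lebesgue"
        by (intro measurable_completion) (simp add: borel_measurable_continuous_onI[OF c])
      then show "(\<lambda>x. \<phi> x *\<^sub>R (indicator K x *\<^sub>R H x)) \<in> borel_measurable lebesgue"
        by (rule borel_measurable_scaleR[OF _ borel_measurable_integrable[OF HK]])
      show "AE x in lebesgue. norm (\<phi> x *\<^sub>R (indicator K x *\<^sub>R H x)) \<le> norm (B *\<^sub>R (indicator K x *\<^sub>R H x))"
        using B K by (intro AE_I2) (auto simp: indicator_def intro!: mult_right_mono)
    qed
    moreover have "\<phi> x *\<^sub>R (indicator K x *\<^sub>R H x) = indicator \<Omega> x *\<^sub>R (\<phi> x *\<^sub>R H x)" for x
      using K by (auto simp: indicator_def)
    ultimately have "integrable lebesgue (\<lambda>x. indicator \<Omega> x *\<^sub>R (\<phi> x *\<^sub>R H x))" by (simp only:)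
    then show ?thesis
      using integrable_restrict_space[of \<Omega> lebesgue "\<lambda>x. \<phi> x *\<^sub>R H x"] sets_\<Omega> by simp
  qed
  have "AE x in L. G x - G' x = 0"
  proof (rule AE_zero_of_test_fun[OF open_\<Omega>])
    show "loc_integrable \<Omega> (\<lambda>x. G x - G' x)"
      using lG by (auto simp: loc_integrable_def intro: set_integral_diff)
    fix \<phi> assume p: "test_fun \<Omega> \<phi>"
    have "dist_fun \<Omega> G \<phi> = dist_fun \<Omega> G' \<phi>" using assms p by (auto simp: is_weak_grad_def)
    then show "(LINT x|L. \<phi> x *\<^sub>R (G x - G' x)) = 0"
      using i[OF p lG(1)] i[OF p lG(2)] by (simp add: dist_fun_def scaleR_diff_right)
  qed
  then show ?thesis by simp
qed

end

lemma L2_cong_AE: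
  assumes "L2 M f" "g \<in> borel_measurable M" "AE x in M. f x = g x"
  shows "L2 M g"
proof -
  have "integrable M (\<lambda>x. (norm (f x))\<^sup>2) \<longleftrightarrow> integrable M (\<lambda>x. (norm (g x))\<^sup>2)"
    using assms by (intro integrable_cong_AE) (auto simp: L2_def)
  then show ?thesis using assms by (simp add: L2_def)
qed

text \<open>A weak gradient comes with local integrability only, whereas membership in L2 asks for
  measurability on the whole domain; pieces over a countable cover by closed boxes are
  glued.\<close>

lemma loc_integrable_measurable:
  fixes f :: "real^'n \<Rightarrow> 'b::euclidean_space"
  assumes \<Omega>: "open \<Omega>" and f: "loc_integrable \<Omega> f"
  shows "f \<in> borel_measurable (lebesgue_on \<Omega>)"
proof -
  obtain \<D> where D: "countable \<D>" "\<And>X. X \<in> \<D> \<Longrightarrow> X \<subseteq> \<Omega> \<and> (\<exists>a b. X = cbox a b)" "\<Union>\<D> = \<Omega>"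
    using open_countable_Union_open_cbox[OF \<Omega>] by (metis Pow_iff subsetD)
  have m: "f \<in> borel_measurable (restrict_space (lebesgue_on \<Omega>) X)" if X: "X \<in> \<D>" for X
  proof -
    obtain a b where ab: "X = cbox a b" "cbox a b \<subseteq> \<Omega>" using D(2)[OF X] by blast
    have "integrable lebesgue (\<lambda>x. indicator X x *\<^sub>R f x)"
      using f ab by (auto simp: loc_integrable_def set_integrable_def)
    then have "integrable (lebesgue_on X) f"
      using integrable_restrict_space[of X lebesgue f] ab by simp
    moreover have "restrict_space (lebesgue_on \<Omega>) X = lebesgue_on X"
      using ab by (subst restrict_restrict_space) (auto simp: Int_absorb1 \<Omega>)
    ultimately show ?thesis by auto
  qed
  have sX: "X \<inter> \<Omega> \<in> sets lebesgue" if "X \<in> \<D>" for X using D(2)[OF that] \<Omega> by auto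
  show ?thesis
    by (rule measurable_piecewise_restrict[OF D(1)])
      (use D(3) m sX \<Omega> in \<open>auto simp: sets_restrict_space_iff\<close>)
qed

section \<open>The weighted measure and its Sobolev space\<close>

locale weighted_open = bounded_open \<Omega> for \<Omega> :: "(real^'n) set" +
  fixes \<eta> :: "real^'n \<Rightarrow> real"
  assumes C1_\<eta>: "Ck_on (Suc 0) \<eta> UNIV"
begin

abbreviation "M \<equiv> weighted \<Omega> \<eta>"
definition "w x = exp (- \<eta> x)"

lemma w_pos: "w x > 0" by (simp add: w_def)

lemma C1_w: "Ck_on (Suc 0) w UNIV"
  unfolding w_def[abs_def] by (rule Ck_on_exp[OF Ck_on_uminus[OF C1_\<eta>]])

lemma continuous_w: "continuous_on UNIV w"
  by (rule C1_continuous[OF C1_w])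

lemma w_measurable [measurable]: "w \<in> borel_measurable L"
  by (rule continuous_imp_measurable_lebesgue_on[OF continuous_w sets_\<Omega>])

lemma grad_w: "grad w x = - w x *\<^sub>R grad \<eta> x"
proof (rule grad_eqI)
  show "(w has_derivative (\<lambda>v. (- w x *\<^sub>R grad \<eta> x) \<bullet> v)) (at x)"
    unfolding w_def[abs_def] using Ck_on_has_derivative_grad[OF C1_\<eta>, of x]
    by (auto intro!: derivative_eq_intros)
qed

lemma M_eq: "M = density L (\<lambda>x. ennreal (w x))"
  by (simp add: weighted_def w_def)

lemma measurable_M: "borel_measurable M = borel_measurable L"
  unfolding M_eq by (rule measurable_cong_sets) simp_all

lemma integral_M:
  fixes f :: "real^'n \<Rightarrow> 'b::euclidean_space"
  assumes "f \<in> borel_measurable L"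
  shows "(LINT x|M. f x) = (LINT x|L. w x *\<^sub>R f x)"
  unfolding M_eq using w_pos by (intro integral_density assms) (auto intro: less_imp_le)

lemma integrable_M:
  fixes f :: "real^'n \<Rightarrow> 'b::euclidean_space"
  assumes "f \<in> borel_measurable L"
  shows "integrable M f \<longleftrightarrow> integrable L (\<lambda>x. w x *\<^sub>R f x)"
  unfolding M_eq using w_pos by (intro integrable_density assms) (auto intro: less_imp_le)

lemma w_bounds:
  obtains c d where "0 < c" "0 < d" "\<And>x. x \<in> \<Omega> \<Longrightarrow> c \<le> w x" "\<And>x. x \<in> \<Omega> \<Longrightarrow> w x \<le> d"
proof -
  obtain K where K: "\<And>x. x \<in> \<Omega> \<Longrightarrow> norm (\<eta> x) \<le> K"
    by (rule continuous_bounded_on_bounded[OF bounded_\<Omega> C1_continuous[OF C1_\<eta>]]) blast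
  show ?thesis
  proof (rule that[of "exp (- K)" "exp K"])
    show "exp (- K) \<le> w x" if "x \<in> \<Omega>" for x using K[OF that] by (simp add: w_def)
    show "w x \<le> exp K" if "x \<in> \<Omega>" for x using K[OF that] by (simp add: w_def)
  qed auto
qed

text \<open>On a bounded domain the continuous weight lies between two positive constants. Limits
  and closures can therefore be taken in Lebesgue measure, and the weight survives only as the
  coefficient \<open>w\<close> of the forms.\<close>

lemma L2_M_iff:
  fixes f :: "real^'n \<Rightarrow> 'b::euclidean_space"
  shows "L2 M f \<longleftrightarrow> L2 L f"
proof (cases "f \<in> borel_measurable L")
  case True
  then have m: "(\<lambda>x. (norm (f x))\<^sup>2) \<in> borel_measurable L" by measurable
  obtain c d where cd: "0 < c" "0 < d" "\<And>x. x \<in> \<Omega> \<Longrightarrow> c \<le> w x" "\<And>x. x \<in> \<Omega> \<Longrightarrow> w x \<le> d"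
    by (rule w_bounds) blast
  have "integrable L (\<lambda>x. w x *\<^sub>R (norm (f x))\<^sup>2) \<longleftrightarrow> integrable L (\<lambda>x. (norm (f x))\<^sup>2)"
  proof
    assume i: "integrable L (\<lambda>x. w x *\<^sub>R (norm (f x))\<^sup>2)"
    show "integrable L (\<lambda>x. (norm (f x))\<^sup>2)"
    proof (rule Bochner_Integration.integrable_bound[OF integrable_scaleR_right[OF i, of "1 / c"] m])
      have "(norm (f x))\<^sup>2 \<le> (1 / c) * (w x * (norm (f x))\<^sup>2)" if "x \<in> \<Omega>" for x
        using mult_right_mono[OF cd(3)[OF that], of "(norm (f x))\<^sup>2"] cd(1) by (simp add: field_simps)
      then show "AE x in L. norm ((norm (f x))\<^sup>2) \<le> norm ((1 / c) *\<^sub>R (w x *\<^sub>R (norm (f x))\<^sup>2))"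
        using w_pos cd(1) by (intro AE_I2) (simp add: abs_mult abs_of_pos)
    qed
  next
    assume i: "integrable L (\<lambda>x. (norm (f x))\<^sup>2)"
    show "integrable L (\<lambda>x. w x *\<^sub>R (norm (f x))\<^sup>2)"
    proof (rule Bochner_Integration.integrable_bound[OF integrable_scaleR_right[OF i, of d]])
      show "(\<lambda>x. w x *\<^sub>R (norm (f x))\<^sup>2) \<in> borel_measurable L" using m by measurable
      show "AE x in L. norm (w x *\<^sub>R (norm (f x))\<^sup>2) \<le> norm (d *\<^sub>R (norm (f x))\<^sup>2)"
        using cd w_pos by (intro AE_I2) (auto simp: abs_mult abs_of_pos intro!: mult_right_mono)
    qed
  qed
  then show ?thesis unfolding L2_def measurable_M integrable_M[OF m] by simp
next
  case False then show ?thesis by (simp add: L2_def measurable_M)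
qed

lemma bform_w: "bform L (\<lambda>x b c. w x * (b \<bullet> (c :: 'b::euclidean_space)))"
  by (rule bform_continuous[OF bounded_\<Omega> sets_\<Omega>])
    (auto simp: bilinear_def linear_iff algebra_simps inner_add_left inner_add_right
      intro!: continuous_intros continuous_w)

lemma L2_inner_M:
  fixes f g :: "real^'n \<Rightarrow> 'b::euclidean_space"
  assumes "L2 L f" "L2 L g"
  shows "L2_inner M f g = ifm L (\<lambda>x b c. w x * (b \<bullet> c)) f g"
  unfolding L2_inner_def ifm_def
  by (subst integral_M) (use assms[THEN L2_measurable] in auto)

lemma L2_sqnorm_M:
  fixes f :: "real^'n \<Rightarrow> 'b::euclidean_space"
  assumes "L2 L f"
  shows "L2_sqnorm M f = ifm L (\<lambda>x b c. w x * (b \<bullet> c)) f f"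
  unfolding L2_sqnorm_def ifm_def
  by (subst integral_M) (use assms[THEN L2_measurable] in \<open>auto simp: power2_norm_eq_inner\<close>)

lemma L2_sqnorm_M_bounds:
  obtains c d where "0 < c" "0 < d"
    "\<And>f :: real^'n \<Rightarrow> 'b::euclidean_space. L2 L f \<Longrightarrow> c * L2_sqnorm L f \<le> L2_sqnorm M f"
    "\<And>f :: real^'n \<Rightarrow> 'b::euclidean_space. L2 L f \<Longrightarrow> L2_sqnorm M f \<le> d * L2_sqnorm L f"
proof -
  obtain c d where cd: "0 < c" "0 < d" "\<And>x. x \<in> \<Omega> \<Longrightarrow> c \<le> w x" "\<And>x. x \<in> \<Omega> \<Longrightarrow> w x \<le> d"
    by (rule w_bounds) blast
  show ?thesis
  proof (rule that[OF cd(1,2)])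
    fix f :: "real^'n \<Rightarrow> 'b" assume f: "L2 L f"
    have i: "integrable L (\<lambda>x. w x * (f x \<bullet> f x))" by (rule bform_integrable[OF bform_w f f])
    have i2: "integrable L (\<lambda>x. a * (norm (f x))\<^sup>2)" for a using f by (simp add: L2_def)
    show "c * L2_sqnorm L f \<le> L2_sqnorm M f"
      unfolding L2_sqnorm_M[OF f] unfolding ifm_def L2_sqnorm_def
      by (subst integral_mult_right_zero[symmetric], rule integral_mono[OF i2 i]) (use cd in \<open>auto simp: power2_norm_eq_inner intro!: mult_right_mono\<close>)
    show "L2_sqnorm M f \<le> d * L2_sqnorm L f"
      unfolding L2_sqnorm_M[OF f] unfolding ifm_def L2_sqnorm_def
      by (subst integral_mult_right_zero[symmetric], rule integral_mono[OF i i2]) (use cd in \<open>auto simp: power2_norm_eq_inner intro!: mult_right_mono\<close>)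
  qed
qed

lemma L2_sqnorm_M_tendsto:
  fixes f :: "nat \<Rightarrow> real^'n \<Rightarrow> 'b::euclidean_space"
  assumes "\<And>m. L2 L (f m)"
  shows "(\<lambda>m. L2_sqnorm M (f m)) \<longlonglongrightarrow> 0 \<longleftrightarrow> (\<lambda>m. L2_sqnorm L (f m)) \<longlonglongrightarrow> 0"
proof -
  obtain c d where cd: "0 < c" "0 < d"
    "\<And>f :: real^'n \<Rightarrow> 'b. L2 L f \<Longrightarrow> c * L2_sqnorm L f \<le> L2_sqnorm M f"
    "\<And>f :: real^'n \<Rightarrow> 'b. L2 L f \<Longrightarrow> L2_sqnorm M f \<le> d * L2_sqnorm L f"
    by (rule L2_sqnorm_M_bounds) blast
  show ?thesis
  proof
    assume l: "(\<lambda>m. L2_sqnorm M (f m)) \<longlonglongrightarrow> 0"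
    show "(\<lambda>m. L2_sqnorm L (f m)) \<longlonglongrightarrow> 0"
    proof (rule tendsto_sandwich[OF _ _ tendsto_const])
      show "\<forall>\<^sub>F m in sequentially. L2_sqnorm L (f m) \<le> inverse c * L2_sqnorm M (f m)"
        using cd(1) cd(3)[OF assms] by (auto simp: field_simps)
      show "(\<lambda>m. inverse c * L2_sqnorm M (f m)) \<longlonglongrightarrow> 0" using tendsto_mult_right_zero[OF l] .
    qed simp
  next
    assume l: "(\<lambda>m. L2_sqnorm L (f m)) \<longlonglongrightarrow> 0"
    show "(\<lambda>m. L2_sqnorm M (f m)) \<longlonglongrightarrow> 0"
    proof (rule tendsto_sandwich[OF _ _ tendsto_const])
      show "\<forall>\<^sub>F m in sequentially. L2_sqnorm M (f m) \<le> d * L2_sqnorm L (f m)"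
        using cd(4)[OF assms] by auto
      show "(\<lambda>m. d * L2_sqnorm L (f m)) \<longlonglongrightarrow> 0" using tendsto_mult_right_zero[OF l] .
    qed simp
  qed
qed

lemma L2_Pair:
  fixes f :: "real^'n \<Rightarrow> real" and F :: "real^'n \<Rightarrow> real^'n"
  shows "L2 L (\<lambda>x. (f x, F x)) \<longleftrightarrow> L2 L f \<and> L2 L F"
proof
  assume l: "L2 L (\<lambda>x. (f x, F x))"
  have "(\<lambda>x. fst (f x, F x)) \<in> borel_measurable L" "(\<lambda>x. snd (f x, F x)) \<in> borel_measurable L"
    by (rule borel_measurable_continuous_on[OF _ L2_measurable[OF l]]; intro continuous_intros)+
  then show "L2 L f \<and> L2 L F"
    using norm_fst_le[of "f _" "F _"] norm_snd_le[of "F _" "f _"] by (auto intro!: L2_bound[OF l, of _ 1])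
next
  assume l: "L2 L f \<and> L2 L F"
  then have [measurable]: "f \<in> borel_measurable L" "F \<in> borel_measurable L" by (auto simp: L2_def)
  have "(\<lambda>x. (f x, F x)) \<in> borel_measurable L" by measurable
  moreover have "(norm (f x, F x))\<^sup>2 = (norm (f x))\<^sup>2 + (norm (F x))\<^sup>2" for x by (simp add: norm_Pair)
  ultimately show "L2 L (\<lambda>x. (f x, F x))" using l by (simp add: L2_def)
qed

lemma L2_sqnorm_Pair:
  fixes f :: "real^'n \<Rightarrow> real" and F :: "real^'n \<Rightarrow> real^'n"
  assumes "L2 L f" "L2 L F"
  shows "L2_sqnorm L (\<lambda>x. (f x, F x)) = L2_sqnorm L f + L2_sqnorm L F"
proof -
  have "(norm (f x, F x))\<^sup>2 = (norm (f x))\<^sup>2 + (norm (F x))\<^sup>2" for x by (simp add: norm_Pair)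
  then show ?thesis using assms by (simp add: L2_sqnorm_def L2_def)
qed

lemma H10_imp_S0:
  assumes "H10 \<Omega> \<eta> f" shows "S0 \<Omega> (\<lambda>x. (f x, weak_grad \<Omega> f x))"
proof -
  have L: "L2 L f" "L2 L (weak_grad \<Omega> f)" using assms by (auto simp: H10_def L2_M_iff)
  obtain \<phi> where p: "\<And>m. test_fun \<Omega> (\<phi> m)"
    "(\<lambda>m. L2_sqnorm M (\<lambda>x. f x - \<phi> m x)) \<longlonglongrightarrow> 0"
    "(\<lambda>m. L2_sqnorm M (\<lambda>x. weak_grad \<Omega> f x - grad (\<phi> m) x)) \<longlonglongrightarrow> 0"
    using assms by (auto simp: H10_def)
  have Lp: "L2 L (\<phi> m)" "L2 L (grad (\<phi> m))" for m
    using L2_continuous[OF C1_continuous[OF test_fun_Ck[OF p(1)]]]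
      L2_continuous[OF C1_continuous_grad[OF test_fun_Ck[OF p(1)]]] by auto
  have D: "L2 L (\<lambda>x. f x - \<phi> m x)" "L2 L (\<lambda>x. weak_grad \<Omega> f x - grad (\<phi> m) x)" for m
    using L Lp by (auto intro: L2_diff)
  have "(\<lambda>m. L2_sqnorm L (\<lambda>x. f x - \<phi> m x) + L2_sqnorm L (\<lambda>x. weak_grad \<Omega> f x - grad (\<phi> m) x)) \<longlonglongrightarrow> 0 + 0"
    using p(2,3) L2_sqnorm_M_tendsto[OF D(1)] L2_sqnorm_M_tendsto[OF D(2)] by (intro tendsto_add) auto
  moreover have "L2_sqnorm L (\<lambda>x. sjet (\<phi> m) x - (f x, weak_grad \<Omega> f x))
      = L2_sqnorm L (\<lambda>x. f x - \<phi> m x) + L2_sqnorm L (\<lambda>x. weak_grad \<Omega> f x - grad (\<phi> m) x)" for m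
    using L2_sqnorm_Pair[OF D] by (subst L2_sqnorm_diff_commute) (simp add: sjet_def)
  ultimately have "L2_lim L (\<lambda>m. sjet (\<phi> m)) (\<lambda>x. (f x, weak_grad \<Omega> f x))"
    using L Lp by (simp add: L2_lim_def L2_Pair sjet_def[abs_def])
  then show ?thesis using p(1) by (auto simp: S0_def)
qed

text \<open>The limit of the gradients is a weak gradient, so it agrees almost everywhere with the
  chosen one. The chosen one is measurable by local integrability and inherits square integrability
  and the approximation.\<close>

lemma S0_imp_H10:
  assumes "S0 \<Omega> J"
  shows "H10 \<Omega> \<eta> (\<lambda>x. fst (J x))" and "AE x in L. weak_grad \<Omega> (\<lambda>x. fst (J x)) x = snd (J x)"
proof -
  let ?f = "\<lambda>x. fst (J x)" and ?F = "\<lambda>x. snd (J x)"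
  have wg: "is_weak_grad \<Omega> ?f ?F" by (rule S0_weak_grad[OF assms])
  then have wg': "is_weak_grad \<Omega> ?f (weak_grad \<Omega> ?f)"
    unfolding weak_grad_def by (rule someI[of "is_weak_grad \<Omega> ?f"])
  show AE: "AE x in L. weak_grad \<Omega> ?f x = ?F x" by (rule weak_grad_unique[OF wg' wg])
  have LF: "L2 L ?f" "L2 L ?F" using S0_L2[OF assms] L2_Pair[of ?f ?F] by auto
  have wm: "weak_grad \<Omega> ?f \<in> borel_measurable L"
    using wg' by (intro loc_integrable_measurable[OF open_\<Omega>]) (simp add: is_weak_grad_def)
  have Lw: "L2 L (weak_grad \<Omega> ?f)"
    by (rule L2_cong_AE[OF LF(2) wm]) (use AE in auto)
  obtain \<phi> where p: "\<And>i. test_fun \<Omega> (\<phi> i)" "L2_lim L (\<lambda>i. sjet (\<phi> i)) J" using assms by (auto simp: S0_def)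
  have Lp: "L2 L (\<phi> m)" "L2 L (grad (\<phi> m))" for m
    using L2_continuous[OF C1_continuous[OF test_fun_Ck[OF p(1)]]]
      L2_continuous[OF C1_continuous_grad[OF test_fun_Ck[OF p(1)]]] by auto
  have D: "L2 L (\<lambda>x. fst (J x) - \<phi> m x)" "L2 L (\<lambda>x. snd (J x) - grad (\<phi> m) x)"
    "L2 L (\<lambda>x. weak_grad \<Omega> ?f x - grad (\<phi> m) x)" for m
    using LF Lp Lw by (auto intro: L2_diff)
  have "L2_sqnorm L (\<lambda>x. sjet (\<phi> m) x - J x)
      = L2_sqnorm L (\<lambda>x. fst (J x) - \<phi> m x) + L2_sqnorm L (\<lambda>x. snd (J x) - grad (\<phi> m) x)" for m
    using L2_sqnorm_Pair[OF D(1,2)] by (subst L2_sqnorm_diff_commute) (simp add: sjet_def minus_prod_def)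
  then have lim: "(\<lambda>m. L2_sqnorm L (\<lambda>x. fst (J x) - \<phi> m x) + L2_sqnorm L (\<lambda>x. snd (J x) - grad (\<phi> m) x)) \<longlonglongrightarrow> 0"
    using p(2) by (simp add: L2_lim_def)
  have l1: "(\<lambda>m. L2_sqnorm L (\<lambda>x. fst (J x) - \<phi> m x)) \<longlonglongrightarrow> 0"
    by (rule tendsto_sandwich[OF _ _ tendsto_const lim]) auto
  have l2: "(\<lambda>m. L2_sqnorm L (\<lambda>x. snd (J x) - grad (\<phi> m) x)) \<longlonglongrightarrow> 0"
    by (rule tendsto_sandwich[OF _ _ tendsto_const lim]) auto
  have "L2_sqnorm L (\<lambda>x. weak_grad \<Omega> ?f x - grad (\<phi> m) x) = L2_sqnorm L (\<lambda>x. snd (J x) - grad (\<phi> m) x)" for m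
    using AE by (intro L2_sqnorm_cong_AE D[THEN L2_measurable]) auto
  with l2 have l3: "(\<lambda>m. L2_sqnorm L (\<lambda>x. weak_grad \<Omega> ?f x - grad (\<phi> m) x)) \<longlonglongrightarrow> 0" by simp
  show "H10 \<Omega> \<eta> ?f"
    unfolding H10_def L2_M_iff
  proof (intro conjI exI[of _ \<phi>] allI p(1) LF(1) Lw)
    show "\<exists>G. is_weak_grad \<Omega> ?f G" by (rule exI[of _ "\<lambda>x. snd (J x)"]) (rule wg)
    show "(\<lambda>m. L2_sqnorm M (\<lambda>x. fst (J x) - \<phi> m x)) \<longlonglongrightarrow> 0"
      by (rule L2_sqnorm_M_tendsto[OF D(1), THEN iffD2, OF l1])
    show "(\<lambda>m. L2_sqnorm M (\<lambda>x. weak_grad \<Omega> ?f x - grad (\<phi> m) x)) \<longlonglongrightarrow> 0"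
      by (rule L2_sqnorm_M_tendsto[OF D(3), THEN iffD2, OF l3])
  qed
qed

end

subsection \<open>Compactness\<close>

lemma integral_square_le:
  fixes g :: "real \<Rightarrow> real"
  assumes g: "continuous_on {0..1} g"
  shows "(integral {0..1} g)\<^sup>2 \<le> integral {0..1} (\<lambda>t. (g t)\<^sup>2)"
proof -
  define c where "c = integral {0..1} g"
  have i: "g integrable_on {0..1}" "(\<lambda>t. (g t)\<^sup>2) integrable_on {0..1}"
    using g by (auto intro!: integrable_continuous_real continuous_intros)
  have h1: "((\<lambda>t. (g t)\<^sup>2) has_integral integral {0..1} (\<lambda>t. (g t)\<^sup>2)) {0..1}"
    by (rule integrable_integral[OF i(2)])
  have h2: "((\<lambda>t. 2 * c * g t) has_integral 2 * c * c) {0..1}"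
    using has_integral_mult_right[OF integrable_integral[OF i(1)], of "2 * c"] by (simp add: c_def)
  have h3: "((\<lambda>t. c\<^sup>2) has_integral c\<^sup>2) {0..1::real}"
    using has_integral_const_real[of "c\<^sup>2" 0 1] by simp
  have "((\<lambda>t. (g t)\<^sup>2 - 2 * c * g t + c\<^sup>2) has_integral integral {0..1} (\<lambda>t. (g t)\<^sup>2) - 2 * c * c + c\<^sup>2) {0..1}"
    by (intro has_integral_add has_integral_diff h1 h2 h3)
  moreover have "0 \<le> (g t)\<^sup>2 - 2 * c * g t + c\<^sup>2" for t
    using zero_le_power2[of "g t - c"] by (simp add: power2_diff algebra_simps)
  ultimately have "0 \<le> integral {0..1} (\<lambda>t. (g t)\<^sup>2) - 2 * c * c + c\<^sup>2"
    by (rule has_integral_nonneg)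
  then show ?thesis by (simp add: c_def power2_eq_square)
qed

lemma nn_integral_lborel_translate:
  fixes f :: "'a::euclidean_space \<Rightarrow> ennreal"
  assumes "f \<in> borel_measurable borel"
  shows "(\<integral>\<^sup>+x. f (c + x) \<partial>lborel) = (\<integral>\<^sup>+x. f x \<partial>lborel)"
  using nn_integral_distr[of "(+) c" lborel borel f] assms by (simp add: lborel_distr_plus)

lemma translation_estimate:
  fixes \<phi> :: "real^'n \<Rightarrow> real"
  assumes p: "Ck_on (Suc 0) \<phi> UNIV"
  shows "(\<integral>\<^sup>+x. ennreal ((\<phi> x - \<phi> (x + h))\<^sup>2) \<partial>lborel)
    \<le> ennreal ((norm h)\<^sup>2) * (\<integral>\<^sup>+x. ennreal ((norm (grad \<phi> x))\<^sup>2) \<partial>lborel)"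
proof -
  define G where "G x = (norm (grad \<phi> x))\<^sup>2" for x
  have cg: "continuous_on UNIV (grad \<phi>)" by (rule C1_continuous_grad[OF p])
  have cG: "continuous_on UNIV G" unfolding G_def[abs_def] by (intro continuous_intros cg)
  have [measurable]: "G \<in> borel_measurable borel" by (rule borel_measurable_continuous_onI[OF cG])
  have pw: "ennreal ((\<phi> x - \<phi> (x + h))\<^sup>2)
      \<le> ennreal ((norm h)\<^sup>2) * (\<integral>\<^sup>+t. ennreal (G (x + t *\<^sub>R h)) * indicator {0..1} t \<partial>lborel)" for x
  proof -
    define g where "g t = grad \<phi> (x + t *\<^sub>R h) \<bullet> h" for t
    have cgt: "continuous_on UNIV g" unfolding g_def[abs_def]
      by (intro continuous_intros continuous_on_compose2[OF cg]) auto
    have cGt: "continuous_on {0..1} (\<lambda>t. G (x + t *\<^sub>R h))"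
      by (intro continuous_on_compose2[OF cG] continuous_intros) auto
    have "(g has_integral \<phi> (x + 1 *\<^sub>R h) - \<phi> (x + 0 *\<^sub>R h)) {0..1}"
    proof (rule fundamental_theorem_of_calculus)
      fix t :: real
      have "((\<lambda>t. x + t *\<^sub>R h) has_derivative (\<lambda>s. s *\<^sub>R h)) (at t)"
        by (auto intro!: derivative_eq_intros)
      from diff_chain_at[OF this Ck_on_has_derivative_grad[OF p]]
      have "((\<lambda>t. \<phi> (x + t *\<^sub>R h)) has_derivative (\<lambda>s. s *\<^sub>R g t)) (at t)"
        by (simp add: o_def g_def)
      then show "((\<lambda>t. \<phi> (x + t *\<^sub>R h)) has_vector_derivative g t) (at t within {0..1})"
        unfolding has_vector_derivative_def by (rule has_derivative_at_withinI)
    qed simp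
    then have "(\<phi> x - \<phi> (x + h))\<^sup>2 = (integral {0..1} g)\<^sup>2"
      by (simp add: integral_unique power2_commute)
    also have "\<dots> \<le> integral {0..1} (\<lambda>t. (g t)\<^sup>2)"
      by (rule integral_square_le[OF continuous_on_subset[OF cgt]]) simp
    also have "\<dots> \<le> integral {0..1} (\<lambda>t. (norm h)\<^sup>2 * G (x + t *\<^sub>R h))"
    proof (rule integral_le)
      show "(\<lambda>t. (g t)\<^sup>2) integrable_on {0..1}"
        by (intro integrable_continuous_real continuous_intros continuous_on_subset[OF cgt]) simp
      show "(\<lambda>t. (norm h)\<^sup>2 * G (x + t *\<^sub>R h)) integrable_on {0..1}"
        by (intro integrable_continuous_real continuous_intros cGt)
      show "(g t)\<^sup>2 \<le> (norm h)\<^sup>2 * G (x + t *\<^sub>R h)" for t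
        using power_mono[OF Cauchy_Schwarz_ineq2[of "grad \<phi> (x + t *\<^sub>R h)" h] abs_ge_zero, of 2]
        by (simp add: g_def G_def power_mult_distrib mult.commute)
    qed
    also have "\<dots> = (norm h)\<^sup>2 * integral {0..1} (\<lambda>t. G (x + t *\<^sub>R h))" by simp
    finally have "ennreal ((\<phi> x - \<phi> (x + h))\<^sup>2) \<le> ennreal ((norm h)\<^sup>2 * integral {0..1} (\<lambda>t. G (x + t *\<^sub>R h)))"
      by (rule ennreal_leI)
    also have "\<dots> = ennreal ((norm h)\<^sup>2) * ennreal (integral {0..1} (\<lambda>t. G (x + t *\<^sub>R h)))"
      by (rule ennreal_mult) (auto simp: G_def intro!: integral_nonneg integrable_continuous_real cGt[unfolded G_def])
    also have "ennreal (integral {0..1} (\<lambda>t. G (x + t *\<^sub>R h)))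
        = (\<integral>\<^sup>+t. ennreal (G (x + t *\<^sub>R h)) * indicator {0..1} t \<partial>lborel)"
      by (rule nn_integral_has_integral_lebesgue'[symmetric])
        (auto simp: G_def[symmetric] intro!: integrable_integral integrable_continuous_real cGt, simp add: G_def)
    finally show ?thesis .
  qed
  have "(\<integral>\<^sup>+x. ennreal ((\<phi> x - \<phi> (x + h))\<^sup>2) \<partial>lborel)
      \<le> (\<integral>\<^sup>+x. ennreal ((norm h)\<^sup>2) * (\<integral>\<^sup>+t. ennreal (G (x + t *\<^sub>R h)) * indicator {0..1} t \<partial>lborel) \<partial>lborel)"
    by (rule nn_integral_mono) (rule pw)
  also have "\<dots> = ennreal ((norm h)\<^sup>2) * (\<integral>\<^sup>+x. (\<integral>\<^sup>+t. ennreal (G (x + t *\<^sub>R h)) * indicator {0..1::real} t \<partial>lborel) \<partial>lborel)"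
    by (rule nn_integral_cmult) measurable
  also have "(\<integral>\<^sup>+x. (\<integral>\<^sup>+t. ennreal (G (x + t *\<^sub>R h)) * indicator {0..1::real} t \<partial>lborel) \<partial>lborel)
      = (\<integral>\<^sup>+t. (\<integral>\<^sup>+x. ennreal (G (x + t *\<^sub>R h)) * indicator {0..1::real} t \<partial>lborel) \<partial>lborel)"
    by (rule lborel_pair.Fubini') measurable
  also have "\<dots> = (\<integral>\<^sup>+t. (\<integral>\<^sup>+x. ennreal (G x) \<partial>lborel) * indicator {0..1::real} t \<partial>lborel)"
  proof (rule nn_integral_cong)
    fix t :: real
    have "(\<integral>\<^sup>+x. ennreal (G (x + t *\<^sub>R h)) * indicator {0..1::real} t \<partial>lborel)
        = (\<integral>\<^sup>+x. ennreal (G (x + t *\<^sub>R h)) \<partial>lborel) * indicator {0..1::real} t"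
      by (rule nn_integral_multc) measurable
    also have "(\<integral>\<^sup>+x. ennreal (G (x + t *\<^sub>R h)) \<partial>lborel) = (\<integral>\<^sup>+x. ennreal (G x) \<partial>lborel)"
      using nn_integral_lborel_translate[of "\<lambda>x. ennreal (G x)" "t *\<^sub>R h"] by (simp add: add.commute)
    finally show "(\<integral>\<^sup>+x. ennreal (G (x + t *\<^sub>R h)) * indicator {0..1::real} t \<partial>lborel)
        = (\<integral>\<^sup>+x. ennreal (G x) \<partial>lborel) * indicator {0..1::real} t" .
  qed
  also have "\<dots> = (\<integral>\<^sup>+x. ennreal (G x) \<partial>lborel)"
    by (subst nn_integral_cmult) auto
  finally show ?thesis unfolding G_def .
qed

text \<open>Expresses the deviation of f from its mean by differences f x - f y, which is the
  quantity that translation estimates control.\<close>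

lemma (in finite_measure) variance_double_integral:
  fixes f :: "'a \<Rightarrow> real"
  assumes f: "L2 M f"
  shows "(\<integral>\<^sup>+x. (\<integral>\<^sup>+y. ennreal ((f x - f y)\<^sup>2) \<partial>M) \<partial>M)
    = ennreal (2 * measure M (space M) * L2_sqnorm M f - 2 * (LINT x|M. f x)\<^sup>2)"
proof -
  define V where "V = measure M (space M)"
  define A where "A = (LINT x|M. (f x)\<^sup>2)"
  define m where "m = (LINT x|M. f x)"
  have A: "A = L2_sqnorm M f" by (simp add: A_def L2_sqnorm_def)
  have i: "integrable M f" "integrable M (\<lambda>x. (f x)\<^sup>2)" "integrable M (\<lambda>x. c)" for c :: real
    using L2_imp_integrable[OF f] f by (auto simp: L2_def)
  have inner: "(\<integral>\<^sup>+y. ennreal ((f x - f y)\<^sup>2) \<partial>M) = ennreal (V * (f x)\<^sup>2 - 2 * m * f x + A)"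
    and inner0: "0 \<le> V * (f x)\<^sup>2 - 2 * m * f x + A" for x
  proof -
    have e: "(f x - f y)\<^sup>2 = (f x)\<^sup>2 - 2 * f x * f y + (f y)\<^sup>2" for y by (simp add: power2_diff)
    have "(LINT y|M. (f x)\<^sup>2 - 2 * f x * f y + (f y)\<^sup>2) = V * (f x)\<^sup>2 - 2 * m * f x + A"
      using i by (simp add: V_def A_def m_def)
    moreover have "(\<integral>\<^sup>+y. ennreal ((f x - f y)\<^sup>2) \<partial>M) = ennreal (LINT y|M. (f x - f y)\<^sup>2)"
    proof (rule nn_integral_eq_integral)
      show "integrable M (\<lambda>y. (f x - f y)\<^sup>2)" unfolding e using i by auto
    qed simp
    moreover have "0 \<le> (LINT y|M. (f x - f y)\<^sup>2)" by simp
    ultimately show "(\<integral>\<^sup>+y. ennreal ((f x - f y)\<^sup>2) \<partial>M) = ennreal (V * (f x)\<^sup>2 - 2 * m * f x + A)"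
      "0 \<le> V * (f x)\<^sup>2 - 2 * m * f x + A" unfolding e by simp_all
  qed
  have "(\<integral>\<^sup>+x. (\<integral>\<^sup>+y. ennreal ((f x - f y)\<^sup>2) \<partial>M) \<partial>M) = ennreal (LINT x|M. V * (f x)\<^sup>2 - 2 * m * f x + A)"
    unfolding inner by (rule nn_integral_eq_integral) (use i inner0 in auto)
  also have "(LINT x|M. V * (f x)\<^sup>2 - 2 * m * f x + A) = V * A - 2 * m * m + A * V"
    using i by (simp add: A_def m_def V_def)
  also have "\<dots> = 2 * V * A - 2 * m\<^sup>2" by (simp add: power2_eq_square)
  finally show ?thesis unfolding V_def m_def A .
qed

text \<open>Half-open cubes indexed by integer vectors: they partition the space, so every point
  lies in exactly one cell.\<close>

definition grid_cell :: "real \<Rightarrow> ('n \<Rightarrow> int) \<Rightarrow> (real^'n) set" where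
  "grid_cell s i = {x. \<forall>j. \<lfloor>x $ j / s\<rfloor> = i j}"

lemma grid_cell_borel [measurable]:
  fixes i :: "'n::finite \<Rightarrow> int"
  shows "grid_cell s i \<in> sets borel"
proof -
  have "(\<lambda>x::real^'n. \<lfloor>x $ j / s\<rfloor>) \<in> borel \<rightarrow>\<^sub>M count_space UNIV" for j
    by measurable
  then have "{x::real^'n. \<lfloor>x $ j / s\<rfloor> = i j} \<in> sets borel" for j
    using measurable_sets[of _ borel "count_space UNIV" "{i j}"] by (simp add: vimage_def)
  then have "(\<Inter>j. {x::real^'n. \<lfloor>x $ j / s\<rfloor> = i j}) \<in> sets borel" by (intro sets.finite_INT) auto
  also have "(\<Inter>j. {x::real^'n. \<lfloor>x $ j / s\<rfloor> = i j}) = grid_cell s i" by (auto simp: grid_cell_def)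
  finally show ?thesis .
qed

lemma grid_cell_iff:
  assumes "0 < s"
  shows "x \<in> grid_cell s i \<longleftrightarrow> (\<forall>j. s * of_int (i j) \<le> x $ j \<and> x $ j < s * of_int (i j) + s)"
  using assms by (auto simp: grid_cell_def floor_eq_iff field_simps)

lemma emeasure_grid_cell:
  fixes i :: "'n::finite \<Rightarrow> int"
  assumes s: "0 < s"
  shows "emeasure lborel (grid_cell s i) = ennreal (s ^ CARD('n))"
proof -
  define l :: "real^'n" where "l = (\<chi> j. s * of_int (i j))"
  define u :: "real^'n" where "u = l + (\<chi> j. s)"
  have ul: "(u - l) \<bullet> b = s" "l \<bullet> b \<le> u \<bullet> b" if "b \<in> Basis" for b :: "real^'n"
    using that s by (auto simp: u_def Basis_vec_def inner_axis inner_add_left)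
  have p: "ennreal (\<Prod>b\<in>Basis. (u - l) \<bullet> b) = ennreal (s ^ CARD('n))"
    by (simp add: ul cong: prod.cong)
  have "box l u \<subseteq> grid_cell s i" "grid_cell s i \<subseteq> cbox l u"
    unfolding grid_cell_iff[OF s] by (auto simp: mem_box_cart l_def u_def grid_cell_iff[OF s] less_imp_le)
  then have "emeasure lborel (box l u) \<le> emeasure lborel (grid_cell s i)"
    "emeasure lborel (grid_cell s i) \<le> emeasure lborel (cbox l u)"
    by (auto intro!: emeasure_mono)
  then show ?thesis using p ul(2) by (simp add: emeasure_lborel_box emeasure_lborel_cbox)
qed

text \<open>A Poincare inequality on every cell, summed. By the variance identity a cell contributes
  the integral of \<open>(\<phi> x - \<phi> y)\<^sup>2\<close> over pairs of its points. Points of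
  one cell differ by a vector h of the cube [-s, s]^n, and for fixed h the translation estimate
  applies. Integration over h yields (n s)^2 (2 s)^n times the energy, and division by 2 s^n gives
  the constant.\<close>

lemma grid_estimate:
  fixes \<phi> :: "real^'n \<Rightarrow> real"
  assumes p: "Ck_on (Suc 0) \<phi> UNIV" and K: "compact K" "\<And>x. x \<notin> K \<Longrightarrow> \<phi> x = 0"
    and s: "0 < s" and I: "finite I" "K \<subseteq> (\<Union>i\<in>I. grid_cell s i)"
  shows "(LINT x|lborel. (\<phi> x)\<^sup>2) \<le> (\<Sum>i\<in>I. (LINT x|lborel. indicator (grid_cell s i) x * \<phi> x)\<^sup>2 / s ^ CARD('n))
    + (real CARD('n) * s)\<^sup>2 * 2 ^ CARD('n) / 2 * (LINT x|lborel. (norm (grad \<phi> x))\<^sup>2)"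
proof -
  define N where "N = CARD('n)"
  define G where "G = (LINT x|lborel. (norm (grad \<phi> x))\<^sup>2)"
  define Q where "Q i = grid_cell s i" for i :: "'n \<Rightarrow> int"
  define m where "m i = (LINT x|lborel. indicator (Q i) x * \<phi> x)" for i
  define A where "A i = (LINT x|lborel. indicator (Q i) x * (\<phi> x)\<^sup>2)" for i
  have cp: "continuous_on UNIV \<phi>" by (rule C1_continuous[OF p])
  have cg: "continuous_on UNIV (grad \<phi>)" by (rule C1_continuous_grad[OF p])
  have [measurable]: "\<phi> \<in> borel_measurable borel" "grad \<phi> \<in> borel_measurable borel"
    using cp cg by (auto intro: borel_measurable_continuous_onI)
  have [measurable]: "Q i \<in> sets borel" for i by (simp add: Q_def)
  have i2: "integrable lborel (\<lambda>x. (\<phi> x)\<^sup>2)"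
    by (rule integrable_compact_support[OF _ K(1)]) (auto intro!: continuous_intros cp simp: K(2))
  have gK: "grad \<phi> x = 0" if "x \<notin> K" for x
    using frechet_derivative_zero_outside[OF compact_imp_closed[OF K(1)] K(2) that]
    by (simp add: grad_def vec_eq_iff)
  have ig: "integrable lborel (\<lambda>x. (norm (grad \<phi> x))\<^sup>2)"
    by (rule integrable_compact_support[OF _ K(1)]) (auto intro!: continuous_intros cg simp: gK)
  have nG: "(\<integral>\<^sup>+x. ennreal ((norm (grad \<phi> x))\<^sup>2) \<partial>lborel) = ennreal G"
    unfolding G_def by (rule nn_integral_eq_integral[OF ig]) simp
  have G0: "G \<ge> 0" by (simp add: G_def)
  define C :: "(real^'n) set" where "C = cbox (\<chi> j. - s) (\<chi> j. s)"
  define \<mu> where "\<mu> i = restrict_space lborel (Q i)" for i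
  have fin: "finite_measure (\<mu> i)" and mV: "measure (\<mu> i) (space (\<mu> i)) = s ^ N"
    and L2: "L2 (\<mu> i) \<phi>" and A: "L2_sqnorm (\<mu> i) \<phi> = A i" and m: "(LINT x|\<mu> i. \<phi> x) = m i" for i
  proof -
    have e: "emeasure (\<mu> i) (space (\<mu> i)) = ennreal (s ^ N)"
      using emeasure_grid_cell[OF s, of i] by (simp add: \<mu>_def emeasure_restrict_space space_restrict_space Q_def N_def)
    then show "finite_measure (\<mu> i)" by (intro finite_measureI) simp
    show "measure (\<mu> i) (space (\<mu> i)) = s ^ N" using e s by (simp add: measure_def)
    have "integrable (\<mu> i) (\<lambda>x. (\<phi> x)\<^sup>2)"
      using integrable_mult_indicator[OF _ i2, of "Q i"] unfolding \<mu>_def by (subst integrable_restrict_space) auto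
    then show "L2 (\<mu> i) \<phi>" by (simp add: L2_def \<mu>_def measurable_restrict_space1)
    show "L2_sqnorm (\<mu> i) \<phi> = A i" "(LINT x|\<mu> i. \<phi> x) = m i"
      unfolding L2_sqnorm_def A_def m_def \<mu>_def by (subst integral_restrict_space; auto)+
  qed
  have cell: "ennreal (2 * s ^ N * A i - 2 * (m i)\<^sup>2)
      = (\<integral>\<^sup>+x. (\<integral>\<^sup>+y. ennreal ((\<phi> x - \<phi> y)\<^sup>2) * indicator (Q i) y \<partial>lborel) * indicator (Q i) x \<partial>lborel)" for i
    using finite_measure.variance_double_integral[OF fin L2, of i] unfolding mV A m
    by (simp add: \<mu>_def nn_integral_restrict_space)
  have var0: "0 \<le> 2 * s ^ N * A i - 2 * (m i)\<^sup>2" for i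
  proof -
    have "(LINT x|\<mu> i. norm (\<phi> x))\<^sup>2 \<le> A i * s ^ N"
      using power_mono[OF finite_measure.L2_integral_norm_le[OF fin L2, of i], of 2] s
      unfolding mV A by (simp add: power_mult_distrib A[symmetric])
    moreover have "(m i)\<^sup>2 \<le> (LINT x|\<mu> i. norm (\<phi> x))\<^sup>2"
      using power_mono[OF integral_norm_bound[of "\<mu> i" \<phi>], of 2] by (simp add: m)
    ultimately show ?thesis by (simp add: mult.commute)
  qed
  \<comment> \<open>The cells are disjoint, so at most one summand is nonzero, and then y - x lies
    in the cube C.\<close>
  have sum_ind: "(\<Sum>i\<in>I. indicator (Q i) x * indicator (Q i) y :: ennreal) \<le> indicator C (y - x)" for x y
  proof (cases "\<exists>i\<in>I. x \<in> Q i \<and> y \<in> Q i")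
    case True
    then obtain i where i: "i \<in> I" "x \<in> Q i" "y \<in> Q i" by blast
    have un: "j = i" if "x \<in> Q j" for j using i that by (intro ext) (simp add: Q_def grid_cell_def)
    have "(\<Sum>i\<in>I. indicator (Q i) x * indicator (Q i) y :: ennreal) = (\<Sum>j\<in>I. if j = i then 1 else 0)"
    proof (rule sum.cong[OF refl])
      fix j
      show "indicator (Q j) x * indicator (Q j) y = (if j = i then 1 else (0::ennreal))"
      proof (cases "j = i")
        case False
        then have "x \<notin> Q j" using un by blast
        then show ?thesis using False by simp
      qed (use i in simp)
    qed
    also have "\<dots> = 1" using i I by simp
    also have "y - x \<in> C"
    proof -
      have "- s \<le> y $ j - x $ j \<and> y $ j - x $ j \<le> s" for j
        using i(2,3) unfolding Q_def grid_cell_iff[OF s] by (smt (verit))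
      then show ?thesis by (simp add: C_def mem_box_cart)
    qed
    then have "(1::ennreal) \<le> indicator C (y - x)" by simp
    finally show ?thesis .
  next
    case False
    then have "(\<Sum>i\<in>I. indicator (Q i) x * indicator (Q i) y :: ennreal) = 0"
      by (intro sum.neutral) (auto simp: indicator_def)
    then show ?thesis by simp
  qed
  have [measurable]: "C \<in> sets borel" by (simp add: C_def)
  have eC: "emeasure lborel C = ennreal ((2 * s) ^ N)"
  proof -
    have ul: "((\<chi> j. s) - (\<chi> j. - s)) \<bullet> b = 2 * s" "(\<chi> j. - s) \<bullet> b \<le> (\<chi> j. s) \<bullet> b" if "b \<in> Basis" for b :: "real^'n"
      using that s by (auto simp: Basis_vec_def inner_axis)
    then have "ennreal (\<Prod>b\<in>(Basis::(real^'n) set). ((\<chi> j. s) - (\<chi> j. - s)) \<bullet> b) = ennreal ((2 * s) ^ N)"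
      by (simp add: N_def cong: prod.cong)
    then show ?thesis unfolding C_def using ul(2) by (subst emeasure_lborel_cbox) auto
  qed
  have hC: "(norm h)\<^sup>2 \<le> (real N * s)\<^sup>2" if "h \<in> C" for h
  proof -
    have "norm h \<le> (\<Sum>j\<in>UNIV. \<bar>h $ j\<bar>)" by (rule norm_le_l1_cart)
    also have "\<dots> \<le> (\<Sum>j\<in>(UNIV::'n set). s)"
      using that by (intro sum_mono) (auto simp: C_def mem_box_cart abs_le_iff minus_le_iff)
    finally show ?thesis by (intro power_mono) (auto simp: N_def)
  qed
  have "ennreal (\<Sum>i\<in>I. 2 * s ^ N * A i - 2 * (m i)\<^sup>2) = (\<Sum>i\<in>I. ennreal (2 * s ^ N * A i - 2 * (m i)\<^sup>2))"
    using var0 by (intro sum_ennreal[symmetric])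
  also have "\<dots> = (\<Sum>i\<in>I. \<integral>\<^sup>+x. (\<integral>\<^sup>+y. ennreal ((\<phi> x - \<phi> y)\<^sup>2) * (indicator (Q i) x * indicator (Q i) y) \<partial>lborel) \<partial>lborel)"
    unfolding cell by (intro sum.cong refl nn_integral_cong, subst nn_integral_multc[symmetric])
      (auto simp: mult_ac)
  also have "\<dots> = (\<integral>\<^sup>+x. (\<Sum>i\<in>I. \<integral>\<^sup>+y. ennreal ((\<phi> x - \<phi> y)\<^sup>2) * (indicator (Q i) x * indicator (Q i) y) \<partial>lborel) \<partial>lborel)"
    by (rule nn_integral_sum[symmetric]) measurable
  also have "\<dots> = (\<integral>\<^sup>+x. (\<integral>\<^sup>+y. (\<Sum>i\<in>I. ennreal ((\<phi> x - \<phi> y)\<^sup>2) * (indicator (Q i) x * indicator (Q i) y)) \<partial>lborel) \<partial>lborel)"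
    by (intro nn_integral_cong nn_integral_sum[symmetric]) measurable
  also have "\<dots> \<le> (\<integral>\<^sup>+x. (\<integral>\<^sup>+y. ennreal ((\<phi> x - \<phi> y)\<^sup>2) * indicator C (y - x) \<partial>lborel) \<partial>lborel)"
    unfolding sum_distrib_left[symmetric] by (intro nn_integral_mono mult_left_mono sum_ind) auto
  \<comment> \<open>Substituting y = x + h decouples the condition on h from x and prepares for
    exchanging the integrals.\<close>
  also have "\<dots> = (\<integral>\<^sup>+x. (\<integral>\<^sup>+h. ennreal ((\<phi> x - \<phi> (x + h))\<^sup>2) * indicator C h \<partial>lborel) \<partial>lborel)"
  proof (rule nn_integral_cong)
    fix x :: "real^'n"
    have "(\<lambda>y. ennreal ((\<phi> x - \<phi> y)\<^sup>2) * indicator C (y - x)) \<in> borel_measurable borel" by measurable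
    from nn_integral_lborel_translate[OF this, of x]
    show "(\<integral>\<^sup>+y. ennreal ((\<phi> x - \<phi> y)\<^sup>2) * indicator C (y - x) \<partial>lborel)
        = (\<integral>\<^sup>+h. ennreal ((\<phi> x - \<phi> (x + h))\<^sup>2) * indicator C h \<partial>lborel)" by simp
  qed
  also have "\<dots> = (\<integral>\<^sup>+h. (\<integral>\<^sup>+x. ennreal ((\<phi> x - \<phi> (x + h))\<^sup>2) * indicator C h \<partial>lborel) \<partial>lborel)"
    by (rule lborel_pair.Fubini') measurable
  also have "\<dots> \<le> (\<integral>\<^sup>+h. ennreal ((real N * s)\<^sup>2 * G) * indicator C h \<partial>lborel)"
  proof (rule nn_integral_mono)
    fix h :: "real^'n"
    have "(\<integral>\<^sup>+x. ennreal ((\<phi> x - \<phi> (x + h))\<^sup>2) * indicator C h \<partial>lborel)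
        = (\<integral>\<^sup>+x. ennreal ((\<phi> x - \<phi> (x + h))\<^sup>2) \<partial>lborel) * indicator C h"
      by (rule nn_integral_multc) measurable
    also have "\<dots> \<le> ennreal ((norm h)\<^sup>2) * ennreal G * indicator C h"
      using translation_estimate[OF p, of h] unfolding nG by (rule mult_right_mono) simp
    also have "\<dots> \<le> ennreal ((real N * s)\<^sup>2 * G) * indicator C h"
      using hC[of h] G0 by (auto simp: indicator_def ennreal_mult[symmetric] intro!: ennreal_leI mult_right_mono)
    finally show "(\<integral>\<^sup>+x. ennreal ((\<phi> x - \<phi> (x + h))\<^sup>2) * indicator C h \<partial>lborel)
        \<le> ennreal ((real N * s)\<^sup>2 * G) * indicator C h" .
  qed
  also have "\<dots> = ennreal ((real N * s)\<^sup>2 * G * (2 * s) ^ N)"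
    using G0 s by (simp add: nn_integral_cmult_indicator eC ennreal_mult)
  finally have "(\<Sum>i\<in>I. 2 * s ^ N * A i - 2 * (m i)\<^sup>2) \<le> (real N * s)\<^sup>2 * G * (2 * s) ^ N"
    using G0 s by (subst (asm) ennreal_le_iff) auto
  then have main: "2 * s ^ N * (\<Sum>i\<in>I. A i) \<le> 2 * (\<Sum>i\<in>I. (m i)\<^sup>2) + (real N * s)\<^sup>2 * G * (2 * s) ^ N"
    by (simp add: sum_subtractf sum_distrib_left)
  have "(LINT x|lborel. (\<phi> x)\<^sup>2) \<le> (LINT x|lborel. (\<Sum>i\<in>I. indicator (Q i) x * (\<phi> x)\<^sup>2))"
  proof (rule integral_mono[OF i2])
    have ii: "integrable lborel (\<lambda>x. indicator (Q i) x * (\<phi> x)\<^sup>2)" for i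
      using integrable_mult_indicator[OF _ i2, of "Q i"] by auto
    then show "integrable lborel (\<lambda>x. \<Sum>i\<in>I. indicator (Q i) x * (\<phi> x)\<^sup>2)" by auto
    fix x
    show "(\<phi> x)\<^sup>2 \<le> (\<Sum>i\<in>I. indicator (Q i) x * (\<phi> x)\<^sup>2)"
    proof (cases "x \<in> K")
      case True
      then obtain i where "i \<in> I" "x \<in> Q i" using I(2) by (auto simp: Q_def)
      then have "(\<phi> x)\<^sup>2 = indicator (Q i) x * (\<phi> x)\<^sup>2" by simp
      also have "\<dots> \<le> (\<Sum>i\<in>I. indicator (Q i) x * (\<phi> x)\<^sup>2)"
        by (rule member_le_sum[OF \<open>i \<in> I\<close> _ I(1)]) simp
      finally show ?thesis .
    next
      case False
      then show ?thesis using K(2) by (simp add: sum_nonneg)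
    qed
  qed
  also have "\<dots> = (\<Sum>i\<in>I. A i)"
    unfolding A_def using integrable_mult_indicator[OF _ i2, of "Q _"] by (intro Bochner_Integration.integral_sum) auto
  finally have "2 * s ^ N * (LINT x|lborel. (\<phi> x)\<^sup>2) \<le> 2 * s ^ N * (\<Sum>i\<in>I. A i)" using s by simp
  also note main
  also have "2 * (\<Sum>i\<in>I. (m i)\<^sup>2) + (real N * s)\<^sup>2 * G * (2 * s) ^ N
      = 2 * s ^ N * ((\<Sum>i\<in>I. (m i)\<^sup>2 / s ^ N) + (real N * s)\<^sup>2 * 2 ^ N / 2 * G)"
    using s by (simp add: sum_divide_distrib[symmetric] distrib_left power_mult_distrib)
  finally have "(LINT x|lborel. (\<phi> x)\<^sup>2) \<le> (\<Sum>i\<in>I. (m i)\<^sup>2 / s ^ N) + (real N * s)\<^sup>2 * 2 ^ N / 2 * G"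
    using s by simp
  then show ?thesis unfolding m_def Q_def N_def G_def .
qed

context bounded_open
begin

text \<open>Compactness of the embedding in quantitative form: the L2 norm is controlled by finitely
  many linear functionals, namely normalized integrals over grid cells, up to a small multiple of
  the gradient energy. Finitely many bounded functionals can later be made convergent along a
  subsequence.\<close>

lemma S0_compactness:
  assumes e: "0 < e"
  obtains I :: "('n \<Rightarrow> int) set" and g :: "('n \<Rightarrow> int) \<Rightarrow> real^'n \<Rightarrow> real"
  where "finite I" "\<And>i. L2 L (g i)"
    "\<And>J. S0 \<Omega> J \<Longrightarrow> L2_sqnorm L (\<lambda>x. fst (J x))
      \<le> (\<Sum>i\<in>I. (LINT x|L. g i x * fst (J x))\<^sup>2) + e * L2_sqnorm L (\<lambda>x. snd (J x))"
proof -
  define N where "N = CARD('n)"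
  have N: "real N > 0" by (simp add: N_def)
  \<comment> \<open>The side length for which (n s)^2 2^n / 2, the constant of
    \<open>grid_estimate\<close>, equals e.\<close>
  define s where "s = sqrt (2 * e / 2 ^ N) / real N"
  have s: "0 < s" using e N by (simp add: s_def)
  have se: "(real N * s)\<^sup>2 * 2 ^ N / 2 = e" using e N by (simp add: s_def)
  obtain B where B: "\<And>x. x \<in> \<Omega> \<Longrightarrow> norm x \<le> B" using bounded_\<Omega> by (auto simp: bounded_iff)
  define I :: "('n \<Rightarrow> int) set" where "I = {f. \<forall>j. f j \<in> {\<lfloor>- B / s\<rfloor>..\<lfloor>B / s\<rfloor>}}"
  have "I = PiE UNIV (\<lambda>j. {\<lfloor>- B / s\<rfloor>..\<lfloor>B / s\<rfloor>})" by (auto simp: I_def PiE_UNIV_domain)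
  then have fI: "finite I" by (simp add: finite_PiE)
  have cover: "\<Omega> \<subseteq> (\<Union>i\<in>I. grid_cell s i)"
  proof
    fix x assume x: "x \<in> \<Omega>"
    have "\<bar>x $ j\<bar> \<le> B" for j using component_le_norm_cart[of x j] B[OF x] by linarith
    then have "- B / s \<le> x $ j / s" "x $ j / s \<le> B / s" for j
      using s by (intro divide_right_mono; simp add: abs_le_iff minus_le_iff)+
    then have "(\<lambda>j. \<lfloor>x $ j / s\<rfloor>) \<in> I" by (auto simp: I_def intro!: floor_mono)
    moreover have "x \<in> grid_cell s (\<lambda>j. \<lfloor>x $ j / s\<rfloor>)" by (simp add: grid_cell_def)
    ultimately show "x \<in> (\<Union>i\<in>I. grid_cell s i)" by blast
  qed
  define g where "g i x = indicator (grid_cell s i) x / sqrt (s ^ N)" for i :: "'n \<Rightarrow> int" and x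
  have gm: "g i \<in> borel_measurable borel" for i unfolding g_def[abs_def] by measurable
  then have gL: "g i \<in> borel_measurable L" for i
    by (intro measurable_restrict_space1 measurable_completion) simp
  have Lg: "L2 L (g i)" for i
  proof -
    have "L2 L (\<lambda>x. 1::real)" by (simp add: L2_def)
    from L2_bound[OF this gL, of i "1 / sqrt (s ^ N)"] show ?thesis
      using s by (simp add: g_def indicator_def)
  qed
  have b1: "bform L (\<lambda>x (b::real \<times> (real^'n)) (c::real \<times> (real^'n)). fst b * fst c)"
    and b2: "bform L (\<lambda>x (b::real \<times> (real^'n)) (c::real \<times> (real^'n)). snd b \<bullet> snd c)"
    and b3: "bform L (\<lambda>x (b::real) (c::real \<times> (real^'n)). b * fst c)"
    by (rule bform_continuous[OF bounded_\<Omega> sets_\<Omega>];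
        auto simp: bilinear_def linear_iff algebra_simps inner_add_left inner_add_right)+
  have n1: "L2_sqnorm L (\<lambda>x. fst (J x)) = ifm L (\<lambda>x b c. fst b * fst c) J J" for J :: "real^'n \<Rightarrow> real \<times> (real^'n)"
    by (simp add: L2_sqnorm_def ifm_def power2_eq_square)
  have n2: "L2_sqnorm L (\<lambda>x. snd (J x)) = ifm L (\<lambda>x b c. snd b \<bullet> snd c) J J" for J :: "real^'n \<Rightarrow> real \<times> (real^'n)"
    by (simp add: L2_sqnorm_def ifm_def power2_norm_eq_inner)
  have n3: "(LINT x|L. g i x * fst (J x)) = ifm L (\<lambda>x b c. b * fst c) (g i) J" for i and J :: "real^'n \<Rightarrow> real \<times> (real^'n)"
    by (simp add: ifm_def)
  have test: "L2_sqnorm L (\<lambda>x. fst (sjet \<phi> x)) \<le> (\<Sum>i\<in>I. (LINT x|L. g i x * fst (sjet \<phi> x))\<^sup>2)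
      + e * L2_sqnorm L (\<lambda>x. snd (sjet \<phi> x))" if p: "test_fun \<Omega> \<phi>" for \<phi>
  proof -
    obtain K where K: "compact K" "K \<subseteq> \<Omega>" "\<And>x. x \<notin> K \<Longrightarrow> \<phi> x = 0" by (rule test_funE[OF p]) blast
    have C1: "Ck_on (Suc 0) \<phi> UNIV" by (rule test_fun_Ck[OF p])
    have [measurable]: "\<phi> \<in> borel_measurable borel" "grad \<phi> \<in> borel_measurable borel"
      using C1_continuous[OF C1] C1_continuous_grad[OF C1] by (auto intro: borel_measurable_continuous_onI)
    note [measurable] = gm
    have out: "\<phi> x = 0" "grad \<phi> x = 0" if "x \<notin> \<Omega>" for x
    proof -
      have "x \<notin> K" using that K(2) by blast
      then have "frechet_derivative \<phi> (at x) v = 0" for v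
        by (intro frechet_derivative_zero_outside[OF compact_imp_closed[OF K(1)]] K(3))
      then show "\<phi> x = 0" "grad \<phi> x = 0" using K(3)[OF \<open>x \<notin> K\<close>] by (auto simp: grad_def vec_eq_iff)
    qed
    have "(LINT x|L. (\<phi> x)\<^sup>2) = (LINT x|lborel. (\<phi> x)\<^sup>2)"
      "(LINT x|L. (norm (grad \<phi> x))\<^sup>2) = (LINT x|lborel. (norm (grad \<phi> x))\<^sup>2)"
      by (rule lebesgue_on_integral_support[OF _ _ sets_\<Omega>]; simp add: out)+
    moreover have "(LINT x|L. g i x * \<phi> x)\<^sup>2 = (LINT x|lborel. indicator (grid_cell s i) x * \<phi> x)\<^sup>2 / s ^ N" for i
    proof -
      have "(LINT x|L. g i x * \<phi> x) = (LINT x|lborel. g i x * \<phi> x)"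
        by (rule lebesgue_on_integral_support[OF _ _ sets_\<Omega>]) (auto simp: out)
      also have "\<dots> = (LINT x|lborel. indicator (grid_cell s i) x * \<phi> x) / sqrt (s ^ N)"
        by (simp add: g_def)
      finally show ?thesis using s by (simp add: power_divide)
    qed
    moreover have "K \<subseteq> (\<Union>i\<in>I. grid_cell s i)" using K(2) cover by blast
    from grid_estimate[OF C1 K(1,3) s fI this, folded N_def, unfolded se]
    have "(LINT x|lborel. (\<phi> x)\<^sup>2) \<le> (\<Sum>i\<in>I. (LINT x|lborel. indicator (grid_cell s i) x * \<phi> x)\<^sup>2 / s ^ N)
      + e * (LINT x|lborel. (norm (grad \<phi> x))\<^sup>2)" .
    ultimately show ?thesis by (simp add: L2_sqnorm_def sjet_def)
  qed
  show ?thesis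
  proof (rule that[OF fI Lg])
    fix J assume "S0 \<Omega> J"
    then obtain \<phi> where p: "\<And>i. test_fun \<Omega> (\<phi> i)" "L2_lim L (\<lambda>i. sjet (\<phi> i)) J" by (auto simp: S0_def)
    show "L2_sqnorm L (\<lambda>x. fst (J x))
      \<le> (\<Sum>i\<in>I. (LINT x|L. g i x * fst (J x))\<^sup>2) + e * L2_sqnorm L (\<lambda>x. snd (J x))"
      unfolding n1 n2 n3
    proof (rule LIMSEQ_le)
      show "(\<lambda>m. ifm L (\<lambda>x b c. fst b * fst c) (sjet (\<phi> m)) (sjet (\<phi> m))) \<longlonglongrightarrow> ifm L (\<lambda>x b c. fst b * fst c) J J"
        by (rule ifm_tendsto[OF b1 p(2) p(2)])
      show "(\<lambda>m. (\<Sum>i\<in>I. (ifm L (\<lambda>x b c. b * fst c) (g i) (sjet (\<phi> m)))\<^sup>2)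
          + e * ifm L (\<lambda>x b c. snd b \<bullet> snd c) (sjet (\<phi> m)) (sjet (\<phi> m)))
        \<longlonglongrightarrow> (\<Sum>i\<in>I. (ifm L (\<lambda>x b c. b * fst c) (g i) J)\<^sup>2) + e * ifm L (\<lambda>x b c. snd b \<bullet> snd c) J J"
        by (intro tendsto_add tendsto_sum tendsto_power tendsto_mult tendsto_const
            ifm_tendsto[OF b2 p(2) p(2)] ifm_tendsto[OF b3 L2_lim_const[OF Lg] p(2)])
    qed (use test[OF p(1)] in \<open>simp add: n1 n2 n3\<close>)
  qed
qed

end

section \<open>Minimizing the Rayleigh quotient\<close>

lemma finite_family_convergent_subseq:
  fixes a :: "'i \<Rightarrow> nat \<Rightarrow> real"
  assumes "finite I" "\<And>i. i \<in> I \<Longrightarrow> bounded (range (a i))"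
  shows "\<exists>r::nat \<Rightarrow> nat. strict_mono r \<and> (\<forall>i\<in>I. convergent (\<lambda>m. a i (r m)))"
  using assms
proof (induction I rule: finite_induct)
  case empty
  show ?case by (rule exI[of _ id]) (simp add: strict_mono_def)
next
  case (insert k I)
  then obtain r where r: "strict_mono r" "\<And>i. i \<in> I \<Longrightarrow> convergent (\<lambda>m. a i (r m))" by auto
  have "bounded (range (\<lambda>m. a k (r m)))"
    using insert.prems[of k] by (rule bounded_subset) auto
  from bounded_imp_convergent_subsequence[OF this] obtain l t
    where t: "strict_mono t" "((\<lambda>m. a k (r m)) \<circ> t) \<longlonglongrightarrow> l" by auto
  have "convergent (\<lambda>m. a i (r (t m)))" if "i \<in> I" for i
    using r(2)[OF that] LIMSEQ_subseq_LIMSEQ[OF _ t(1), of "\<lambda>m. a i (r m)"]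
    by (auto simp: convergent_def o_def)
  moreover have "convergent (\<lambda>m. a k (r (t m)))" using t(2) by (auto simp: convergent_def o_def)
  moreover have "strict_mono (\<lambda>m. r (t m))" using r(1) t(1) by (simp add: strict_mono_def)
  ultimately show ?case by (intro exI[of _ "\<lambda>m. r (t m)"]) auto
qed

text \<open>The infimum \<open>\<mu>\<close> of the Rayleigh quotient on the orthogonal complement is attained: the
  parallelogram law gives \<open>Q (f - g) \<le> o(1) + \<mu> N (f - g)\<close> along a minimizing sequence, and the
  compactness hypothesis, used for a single \<open>e\<close> with \<open>\<mu> e \<le> 1/4\<close>, absorbs the last term after
  finitely many functionals have been made to converge.\<close>

lemma (in finite_measure) Rayleigh_minimizer:
  fixes V :: "('a \<Rightarrow> 'b::euclidean_space) \<Rightarrow> bool" and N Q :: "'a \<Rightarrow> 'b \<Rightarrow> 'b \<Rightarrow> real"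
    and u :: "'j \<Rightarrow> 'a \<Rightarrow> 'b" and s :: "'j \<Rightarrow> real"
  assumes V_L2: "\<And>f. V f \<Longrightarrow> L2 M f"
    and V_add: "\<And>f g. V f \<Longrightarrow> V g \<Longrightarrow> V (\<lambda>x. f x + g x)"
    and V_scaleR: "\<And>f c. V f \<Longrightarrow> V (\<lambda>x. c *\<^sub>R f x)"
    and V_closed: "\<And>F f. (\<And>m. V (F m)) \<Longrightarrow> L2_lim M F f \<Longrightarrow> V f"
    and N: "bform M N" and Q: "bform M Q"
    and N_sym: "\<And>x b c. N x b c = N x c b" and Q_sym: "\<And>x b c. Q x b c = Q x c b"
    and N_nonneg: "\<And>f. V f \<Longrightarrow> 0 \<le> ifm M N f f" and Q_nonneg: "\<And>f. V f \<Longrightarrow> 0 \<le> ifm M Q f f"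
    and c: "0 < c" and coercive: "\<And>f. V f \<Longrightarrow> c * L2_sqnorm M f \<le> ifm M Q f f + ifm M N f f"
    and compact: "\<And>e. 0 < e \<Longrightarrow> \<exists>(I :: 'i set) g. finite I \<and> (\<forall>i. L2 M (g i)) \<and>
      (\<forall>f. V f \<longrightarrow> ifm M N f f \<le> (\<Sum>i\<in>I. (LINT x|M. g i x \<bullet> f x)\<^sup>2) + e * ifm M Q f f)"
    and A: "finite A" and uV: "\<And>j. j \<in> A \<Longrightarrow> V (u j)"
    and uQ: "\<And>j v. j \<in> A \<Longrightarrow> V v \<Longrightarrow> ifm M Q (u j) v = s j * ifm M N (u j) v"
    and uN: "\<And>i j. i \<in> A \<Longrightarrow> j \<in> A \<Longrightarrow> ifm M N (u i) (u j) = (if i = j then 1 else 0)"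
    and w0: "V w0" "\<And>j. j \<in> A \<Longrightarrow> ifm M N w0 (u j) = 0" "ifm M Q w0 w0 < t * ifm M N w0 w0"
  obtains w \<mu> where "V w" "\<mu> < t" "ifm M N w w = 1" "\<And>j. j \<in> A \<Longrightarrow> ifm M N w (u j) = 0"
    "\<And>v. V v \<Longrightarrow> ifm M Q w v = \<mu> * ifm M N w v"
proof -
  have Nsym: "ifm M N f g = ifm M N g f" and Qsym: "ifm M Q f g = ifm M Q g f" for f g
    using N_sym Q_sym by (simp_all add: ifm_def)
  define P where "P f \<longleftrightarrow> V f \<and> (\<forall>j\<in>A. ifm M N f (u j) = 0)" for f
  define q where "q f = ifm M Q f f" for f
  define n where "n f = ifm M N f f" for f
  have PL: "L2 M f" if "P f" for f using that V_L2 by (simp add: P_def)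
  have PV: "V f" if "P f" for f using that by (simp add: P_def)
  have q0: "0 \<le> q f" and n0: "0 \<le> n f" if "P f" for f using that Q_nonneg N_nonneg by (auto simp: P_def q_def n_def)
  have P_add: "P (\<lambda>x. f x + g x)" if "P f" "P g" for f g
    using that V_add V_L2 uV N by (simp add: P_def ifm_add_left)
  have P_scaleR: "P (\<lambda>x. a *\<^sub>R f x)" if "P f" for f a
    using that V_scaleR N by (simp add: P_def ifm_scaleR_left)
  have P_diff: "P (\<lambda>x. f x - g x)" if "P f" "P g" for f g
    using P_add[OF that(1) P_scaleR[OF that(2), of "-1"]] by simp
  have q_scale: "q (\<lambda>x. a *\<^sub>R f x) = a\<^sup>2 * q f" and n_scale: "n (\<lambda>x. a *\<^sub>R f x) = a\<^sup>2 * n f" for a f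
    by (simp_all add: q_def n_def ifm_scaleR_left[OF Q] ifm_scaleR_right[OF Q] ifm_scaleR_left[OF N]
        ifm_scaleR_right[OF N] power2_eq_square)
  have q_add: "q (\<lambda>x. f x + g x) = q f + 2 * ifm M Q f g + q g" and n_add: "n (\<lambda>x. f x + g x) = n f + 2 * ifm M N f g + n g"
    and q_diff: "q (\<lambda>x. f x - g x) = q f - 2 * ifm M Q f g + q g" and n_diff: "n (\<lambda>x. f x - g x) = n f - 2 * ifm M N f g + n g"
    if "P f" "P g" for f g
    using PL[OF that(1)] PL[OF that(2)] Qsym[of g f] Nsym[of g f] Q N
    by (simp_all add: q_def n_def ifm_add_left ifm_add_right ifm_diff_left ifm_diff_right L2_add L2_diff)
  define R where "R = {q f |f. P f \<and> n f = 1}"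
  define \<mu> where "\<mu> = Inf R"
  have bdd: "bdd_below R" unfolding R_def by (rule bdd_belowI[of _ 0]) (auto simp: q0)
  have Pw0: "P w0" using w0 by (simp add: P_def)
  have norm1: "n (\<lambda>x. (1 / sqrt (n f)) *\<^sub>R f x) = 1" "q (\<lambda>x. (1 / sqrt (n f)) *\<^sub>R f x) = q f / n f"
    if "n f > 0" for f using that by (auto simp: n_scale q_scale power_divide)
  have inR: "q f / n f \<in> R" if f: "P f" "n f > 0" for f
    unfolding R_def mem_Collect_eq
    by (rule exI[of _ "\<lambda>x. (1 / sqrt (n f)) *\<^sub>R f x"])
      (simp only: norm1[OF f(2)] P_scaleR[OF f(1)] simp_thms)
  have nw0: "n w0 > 0"
    using q0[OF Pw0] n0[OF Pw0] w0(3) unfolding q_def[symmetric] n_def[symmetric] by (cases "n w0 = 0") auto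
  have R0: "q w0 / n w0 \<in> R" by (rule inR[OF Pw0 nw0])
  have Rne: "R \<noteq> {}" using R0 by blast
  have \<mu>t: "\<mu> < t"
  proof -
    have "\<mu> \<le> q w0 / n w0" unfolding \<mu>_def by (rule cInf_lower[OF R0 bdd])
    also have "\<dots> < t" using w0(3) nw0 by (simp add: q_def n_def field_simps)
    finally show ?thesis .
  qed
  have \<mu>0: "0 \<le> \<mu>" unfolding \<mu>_def by (rule cInf_greatest[OF Rne]) (auto simp: R_def q0)
  have \<mu>_le: "\<mu> * n f \<le> q f" if "P f" for f
  proof (cases "n f = 0")
    case True then show ?thesis using q0[OF that] by simp
  next
    case False
    then have nf: "n f > 0" using n0[OF that] by simp
    have "\<mu> \<le> q f / n f" unfolding \<mu>_def by (rule cInf_lower[OF inR[OF that nf] bdd])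
    then show ?thesis using nf by (simp add: field_simps)
  qed
  have "\<exists>f. P f \<and> n f = 1 \<and> q f < \<mu> + inverse (real (Suc m))" for m

  proof -
    have "Inf R < \<mu> + inverse (real (Suc m))" by (simp add: \<mu>_def[symmetric])
    from cInf_lessD[OF Rne this] show ?thesis by (auto simp: R_def)
  qed
  then obtain F where F: "\<And>m. P (F m)" "\<And>m. n (F m) = 1" "\<And>m. q (F m) < \<mu> + inverse (real (Suc m))" by metis
  \<comment> \<open>The summand 1 keeps the quotient meaningful for \<mu> = 0 and also gives e <= 1,
    so that e q d can be absorbed in the coercivity estimate below.\<close>
  define e where "e = 1 / (4 * (\<mu> + 1))"
  have e: "0 < e" "\<mu> * e \<le> 1 / 4" using \<mu>0 by (auto simp: e_def field_simps)
  obtain I :: "'i set" and g where I: "finite I" "\<And>i. L2 M (g i)"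
    "\<And>f. V f \<Longrightarrow> n f \<le> (\<Sum>i\<in>I. (LINT x|M. g i x \<bullet> f x)\<^sup>2) + e * q f"
    using compact[OF e(1)] unfolding n_def q_def by blast
  define l where "l i f = (LINT x|M. g i x \<bullet> f x)" for i f
  have inn: "bform M (\<lambda>x (b::'b) c. b \<bullet> c)"
    unfolding bform_def
    by (auto simp: bilinear_def linear_iff inner_add_left inner_add_right Cauchy_Schwarz_ineq2 intro!: exI[of _ 1])
  have l_ifm: "l i f = ifm M (\<lambda>x b c. b \<bullet> c) (g i) f" for i f by (simp add: l_def ifm_def)
  have l_diff: "l i (\<lambda>x. f x - h x) = l i f - l i h" if "L2 M f" "L2 M h" for i f h
    unfolding l_ifm by (rule ifm_diff_right[OF inn I(2) that])
  have bF: "L2_sqnorm M (F m) \<le> (\<mu> + 2) / c" for m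
  proof -
    have "inverse (real (Suc m)) \<le> 1" by (simp add: field_simps)
    then have "c * L2_sqnorm M (F m) \<le> \<mu> + 2"
      using coercive[OF PV[OF F(1)], of m] F(2,3)[of m] unfolding q_def n_def by linarith
    then show ?thesis using c by (simp add: field_simps)
  qed
  have "bounded (range (\<lambda>m. l i (F m)))" if "i \<in> I" for i
  proof -
    obtain K where K: "K \<ge> 0" "\<And>f g. L2 M f \<Longrightarrow> L2 M g \<Longrightarrow>
      \<bar>ifm M (\<lambda>x (b::'b) c. b \<bullet> c) f g\<bar> \<le> K * sqrt (L2_sqnorm M f) * sqrt (L2_sqnorm M g)"
      using ifm_bound[OF inn] by blast
    have "\<bar>l i (F m)\<bar> \<le> K * sqrt (L2_sqnorm M (g i)) * sqrt ((\<mu> + 2) / c)" for m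
      unfolding l_ifm
      by (rule order_trans[OF K(2)[OF I(2) PL[OF F(1)]]])
        (use K(1) bF in \<open>auto intro!: mult_left_mono real_sqrt_le_mono\<close>)
    then show ?thesis by (auto simp: bounded_iff)
  qed
  from finite_family_convergent_subseq[OF I(1), of "\<lambda>i m. l i (F m)", OF this]
  obtain r :: "nat \<Rightarrow> nat" where r: "strict_mono r" "\<And>i. i \<in> I \<Longrightarrow> convergent (\<lambda>m. l i (F (r m)))" by blast
  define h where "h m = F (r m)" for m
  have h: "P (h m)" "n (h m) = 1" "q (h m) < \<mu> + inverse (real (Suc m))" for m
  proof -
    show "P (h m)" "n (h m) = 1" using F by (auto simp: h_def)
    have "inverse (real (Suc (r m))) \<le> inverse (real (Suc m))"
      using seq_suble[OF r(1), of m] by (simp add: field_simps)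
    with F(3)[of "r m"] show "q (h m) < \<mu> + inverse (real (Suc m))" unfolding h_def by linarith
  qed
  \<comment> \<open>With d the difference, E the sum of the two reciprocals and S the sum of squared
    differences of the functionals, q d <= 2 E + \<mu> n d and n d <= S + e q d combine to q d <= 4
    E + 2 \<mu> S. Coercivity turns this into a bound for the L2 norm; the constants are
    generous.\<close>
  have diff_bound: "c * L2_sqnorm M (\<lambda>x. h a x - h b x)
      \<le> (1 + \<mu> + 1) * (4 * (inverse (real (Suc a)) + inverse (real (Suc b))) + 4 * (\<mu> + 1) * (\<Sum>i\<in>I. (l i (h a) - l i (h b))\<^sup>2))" for a b
  proof -
    define d where "d x = h a x - h b x" for x
    define S where "S = (\<Sum>i\<in>I. (l i (h a) - l i (h b))\<^sup>2)"
    define E where "E = inverse (real (Suc a)) + inverse (real (Suc b))"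
    have S0: "S \<ge> 0" by (simp add: S_def sum_nonneg)
    have E0: "E \<ge> 0" by (simp add: E_def)
    have Pd: "P d" unfolding d_def[abs_def] by (rule P_diff[OF h(1) h(1)])
    have nd: "n d \<le> S + e * q d"
      using I(3)[OF PV[OF Pd]] l_diff[OF PL[OF h(1)] PL[OF h(1)]]
      unfolding S_def l_def[symmetric] d_def[abs_def] by simp
    have "q d = 2 * q (h a) + 2 * q (h b) - q (\<lambda>x. h a x + h b x)"
      unfolding d_def[abs_def] q_diff[OF h(1) h(1)] q_add[OF h(1) h(1)] by simp
    moreover have "\<mu> * n (\<lambda>x. h a x + h b x) \<le> q (\<lambda>x. h a x + h b x)"
      by (rule \<mu>_le[OF P_add[OF h(1) h(1)]])
    moreover have "n (\<lambda>x. h a x + h b x) = 4 - n d"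
      unfolding d_def[abs_def] n_diff[OF h(1) h(1)] n_add[OF h(1) h(1)] h(2) by simp
    ultimately have qd: "q d \<le> 2 * E + \<mu> * n d"
      using h(3)[of a] h(3)[of b] unfolding E_def by (simp add: algebra_simps)
    have "\<mu> * n d \<le> \<mu> * S + (\<mu> * e) * q d"
      using mult_left_mono[OF nd \<mu>0] by (simp add: algebra_simps)
    also have "(\<mu> * e) * q d \<le> (1 / 4) * q d" using e(2) q0[OF Pd] by (intro mult_right_mono) auto
    finally have q1: "q d \<le> 4 * E + 2 * \<mu> * S" using qd E0 S0 \<mu>0 q0[OF Pd] mult_nonneg_nonneg[OF \<mu>0 S0] by simp
    have "e \<le> 1" using \<mu>0 by (simp add: e_def field_simps)
    then have "e * q d \<le> q d" using q0[OF Pd] mult_right_mono[of e 1 "q d"] by simp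
    then have "c * L2_sqnorm M d \<le> 2 * q d + S"
      using coercive[OF PV[OF Pd]] nd unfolding q_def n_def by linarith
    also have "\<dots> \<le> 2 * (4 * E + 4 * (\<mu> + 1) * S)"
    proof -
      have "2 * (4 * E + 4 * (\<mu> + 1) * S) = 8 * E + 8 * (\<mu> * S) + 8 * S" by (simp add: algebra_simps)
      moreover have "2 * \<mu> * S = 2 * (\<mu> * S)" by simp
      ultimately show ?thesis using q1 E0 S0 mult_nonneg_nonneg[OF \<mu>0 S0] by linarith
    qed
    also have "\<dots> \<le> (1 + \<mu> + 1) * (4 * E + 4 * (\<mu> + 1) * S)"
      using E0 S0 \<mu>0 by (intro mult_right_mono) (auto intro!: add_nonneg_nonneg mult_nonneg_nonneg)
    finally show ?thesis unfolding d_def[abs_def] E_def S_def .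
  qed
  have Cauchy: "\<exists>B. \<forall>a\<ge>B. \<forall>b\<ge>B. L2_sqnorm M (\<lambda>x. h a x - h b x) < \<epsilon>" if \<epsilon>: "\<epsilon> > 0" for \<epsilon>
  proof -
    \<comment> \<open>Collects the right side of \<open>diff_bound\<close> once each reciprocal and
      each squared difference is at most \<gamma>.\<close>
    define \<kappa> where "\<kappa> = (1 + \<mu> + 1) * (8 + 4 * (\<mu> + 1) * real (card I))"
    have \<kappa>: "\<kappa> > 0" unfolding \<kappa>_def using \<mu>0 by (intro mult_pos_pos) (auto intro!: add_pos_nonneg mult_nonneg_nonneg)
    define \<gamma> where "\<gamma> = min 1 (c * \<epsilon> / (2 * \<kappa>))"
    have \<gamma>: "\<gamma> > 0" "\<gamma> \<le> 1" "\<kappa> * \<gamma> < c * \<epsilon>"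
    proof -
      show "\<gamma> > 0" "\<gamma> \<le> 1" using \<kappa> c \<epsilon> by (auto simp: \<gamma>_def)
      have "\<kappa> * \<gamma> \<le> \<kappa> * (c * \<epsilon> / (2 * \<kappa>))" using \<kappa> by (intro mult_left_mono) (auto simp: \<gamma>_def)
      also have "\<dots> < c * \<epsilon>" using \<kappa> c \<epsilon> by (simp add: field_simps)
      finally show "\<kappa> * \<gamma> < c * \<epsilon>" .
    qed
    have "\<forall>i\<in>I. \<exists>B. \<forall>a\<ge>B. \<forall>b\<ge>B. \<bar>l i (h a) - l i (h b)\<bar> < \<gamma>"
    proof
      fix i assume "i \<in> I"
      then have "Cauchy (\<lambda>m. l i (h m))" using r(2) by (simp add: h_def convergent_Cauchy)
      then show "\<exists>B. \<forall>a\<ge>B. \<forall>b\<ge>B. \<bar>l i (h a) - l i (h b)\<bar> < \<gamma>"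
        using \<gamma>(1) by (auto simp: Cauchy_def dist_real_def)
    qed
    then obtain B where B: "\<And>i a b. i \<in> I \<Longrightarrow> a \<ge> B i \<Longrightarrow> b \<ge> B i \<Longrightarrow> \<bar>l i (h a) - l i (h b)\<bar> < \<gamma>" by metis
    obtain B0 where B0: "inverse (real (Suc B0)) < \<gamma>" using reals_Archimedean[OF \<gamma>(1)] by blast
    define B1 where "B1 = B0 + (\<Sum>i\<in>I. B i)"
    have BB: "B i \<le> B1" if "i \<in> I" for i
      using member_le_sum[OF that _ I(1), of B] by (simp add: B1_def trans_le_add2)
    show ?thesis
    proof (intro exI[of _ B1] allI impI)
      fix a b assume ab: "B1 \<le> a" "B1 \<le> b"
      have inv: "inverse (real (Suc a)) \<le> \<gamma>" if "B1 \<le> a" for a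
      proof -
        have "inverse (real (Suc a)) \<le> inverse (real (Suc B0))" using that by (simp add: B1_def field_simps)
        with B0 show ?thesis by linarith
      qed
      have "(\<Sum>i\<in>I. (l i (h a) - l i (h b))\<^sup>2) \<le> (\<Sum>i\<in>I. \<gamma>)"
      proof (rule sum_mono)
        fix i assume i: "i \<in> I"
        have "\<bar>l i (h a) - l i (h b)\<bar> \<le> \<gamma>" using B[OF i, of a b] BB[OF i] ab by simp
        then have "(l i (h a) - l i (h b))\<^sup>2 \<le> \<gamma>\<^sup>2" using \<gamma>(1) by (simp add: abs_le_square_iff[symmetric])
        also have "\<dots> \<le> \<gamma>" using \<gamma> by (simp add: power2_eq_square mult_left_le)
        finally show "(l i (h a) - l i (h b))\<^sup>2 \<le> \<gamma>" .
      qed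
      then have S: "(\<Sum>i\<in>I. (l i (h a) - l i (h b))\<^sup>2) \<le> real (card I) * \<gamma>" by simp
      have "c * L2_sqnorm M (\<lambda>x. h a x - h b x) \<le> (1 + \<mu> + 1) * (4 * (\<gamma> + \<gamma>) + 4 * (\<mu> + 1) * (real (card I) * \<gamma>))"
        by (rule order_trans[OF diff_bound])
          (intro mult_left_mono add_mono S inv ab; use \<mu>0 in simp)
      also have "\<dots> = \<kappa> * \<gamma>" by (simp add: \<kappa>_def algebra_simps)
      finally have "c * L2_sqnorm M (\<lambda>x. h a x - h b x) < c * \<epsilon>" using \<gamma>(3) by linarith
      then show "L2_sqnorm M (\<lambda>x. h a x - h b x) < \<epsilon>" using c by simp
    qed
  qed
  obtain w where w: "L2_lim M h w"
    by (rule L2_complete[of h]) (use PL[OF h(1)] Cauchy in blast)+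
  have Vw: "V w" by (rule V_closed[OF PV[OF h(1)] w])
  have wort: "ifm M N w (u j) = 0" if j: "j \<in> A" for j
  proof -
    have "(\<lambda>m. ifm M N (h m) (u j)) \<longlonglongrightarrow> ifm M N w (u j)"
      by (rule ifm_tendsto[OF N w L2_lim_const[OF V_L2[OF uV[OF j]]]])
    moreover have "ifm M N (h m) (u j) = 0" for m using h(1)[of m] j by (simp add: P_def)
    ultimately show ?thesis by (simp add: LIMSEQ_const_iff)
  qed
  have Pw: "P w" using Vw wort by (simp add: P_def)
  have nw: "n w = 1"
    using ifm_tendsto[OF N w w] h(2) unfolding n_def by (simp add: LIMSEQ_const_iff)
  have qw: "q w = \<mu>"
  proof (rule antisym)
    have "(\<lambda>m. q (h m)) \<longlonglongrightarrow> q w" unfolding q_def by (rule ifm_tendsto[OF Q w w])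
    moreover have "(\<lambda>m. \<mu> + inverse (real (Suc m))) \<longlonglongrightarrow> \<mu> + 0"
      by (intro tendsto_add tendsto_const LIMSEQ_inverse_real_of_nat)
    ultimately have "q w \<le> \<mu> + 0"
      by (rule LIMSEQ_le) (use h(3) in \<open>auto intro!: exI[of _ 0] less_imp_le simp del: of_nat_Suc\<close>)
    then show "q w \<le> \<mu>" by simp
    show "\<mu> \<le> q w" using \<mu>_le[OF Pw] nw by simp
  qed
  \<comment> \<open>By minimality q - \<mu> n is nonnegative at w - t v for every t, and it vanishes
    at t = 0. The discriminant bound with constant term 0 forces the linear coefficient to
    vanish.\<close>
  have EL: "ifm M Q w v = \<mu> * ifm M N w v" if v: "P v" for v
  proof -
    define B where "B = ifm M Q w v - \<mu> * ifm M N w v"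
    define C where "C = q v - \<mu> * n v"
    have "0 \<le> 0 - 2 * t * B + t\<^sup>2 * C" for t
    proof -
      have Pv: "P (\<lambda>x. (- t) *\<^sub>R v x)" by (rule P_scaleR[OF v])
      have "\<mu> * n (\<lambda>x. w x + (- t) *\<^sub>R v x) \<le> q (\<lambda>x. w x + (- t) *\<^sub>R v x)" by (rule \<mu>_le[OF P_add[OF Pw Pv]])
      then show ?thesis unfolding q_add[OF Pw Pv] n_add[OF Pw Pv] n_scale q_scale nw qw
          ifm_scaleR_right[OF N] ifm_scaleR_right[OF Q] B_def C_def
        by (simp add: algebra_simps)
    qed
    moreover have "0 \<le> C" using \<mu>_le[OF v] by (simp add: C_def)
    ultimately have "B\<^sup>2 \<le> 0 * C" by (rule quadratic_nonneg_discriminant)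
    then show ?thesis by (simp add: B_def)
  qed
  show ?thesis
  proof (rule that[OF Vw \<mu>t nw[unfolded n_def] wort])
    fix v assume v: "V v"
    \<comment> \<open>The projection of v to the span of the u j. The equation is known for v - p.
      For p both sides vanish, because the u j satisfy their own eigenvalue equations and w is
      orthogonal to them.\<close>
    define p where "p x = (\<Sum>j\<in>A. ifm M N v (u j) *\<^sub>R u j x)" for x
    have LA: "L2 M (u j)" if "j \<in> A" for j by (rule V_L2[OF uV[OF that]])
    have V_sum: "V (\<lambda>x. \<Sum>j\<in>B. a j *\<^sub>R u j x)" if "B \<subseteq> A" for B a
      using finite_subset[OF that A] that
    proof (induction B rule: finite_induct)
      case empty
      show ?case using V_scaleR[OF v, of 0] by simp
    next
      case (insert j B)
      then show ?case using V_add[OF V_scaleR[OF uV[of j], of "a j"]] by simp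
    qed
    have Vp: "V p" unfolding p_def[abs_def] by (rule V_sum) simp
    have "V (\<lambda>x. v x + (-1) *\<^sub>R p x)" by (rule V_add[OF v V_scaleR[OF Vp]])
    then have Vd: "V (\<lambda>x. v x - p x)" by simp
    have "ifm M N (\<lambda>x. v x - p x) (u j) = 0" if j: "j \<in> A" for j
    proof -
      have "ifm M N p (u j) = (\<Sum>i\<in>A. ifm M N v (u i) * ifm M N (u i) (u j))"
        unfolding p_def[abs_def] by (rule ifm_sum_left[OF N LA LA[OF j]])
      also have "\<dots> = (\<Sum>i\<in>A. if i = j then ifm M N v (u j) else 0)"
        by (rule sum.cong) (use uN j in auto)
      also have "\<dots> = ifm M N v (u j)" using A j by simp
      finally show ?thesis using ifm_diff_left[OF N V_L2[OF v] V_L2[OF Vp] LA[OF j]] by simp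
    qed
    then have "P (\<lambda>x. v x - p x)" using Vd by (simp add: P_def)
    from EL[OF this] have "ifm M Q w v - ifm M Q w p = \<mu> * (ifm M N w v - ifm M N w p)"
      by (simp add: ifm_diff_right[OF Q V_L2[OF Vw] V_L2[OF v] V_L2[OF Vp]]
          ifm_diff_right[OF N V_L2[OF Vw] V_L2[OF v] V_L2[OF Vp]])
    moreover have "ifm M N w p = 0"
      unfolding p_def[abs_def] by (subst ifm_sum_right[OF N LA V_L2[OF Vw]]) (auto simp: wort)
    moreover have "ifm M Q w p = 0"
      unfolding p_def[abs_def]
      by (subst ifm_sum_right[OF Q LA V_L2[OF Vw]])
        (auto intro!: sum.neutral simp: Qsym[of w] Nsym[of _ w] uQ[OF _ Vw] wort)
    ultimately show "ifm M Q w v = \<mu> * ifm M N w v" by simp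
  qed
qed

subsection \<open>The weak eigenvalue problem\<close>

type_synonym 'n vjet = "(real \<times> (real^'n))^'n"

definition val :: "('n::finite) vjet \<Rightarrow> real^'n" where
  "val j = (\<chi> l. fst (j $ l))"

definition unit_jet :: "'n::finite \<Rightarrow> real \<times> (real^'n) \<Rightarrow> 'n vjet" where
  "unit_jet l k = (\<chi> m. if m = l then k else 0)"

lemma val_linear: "val (a + b) = val a + val b" "val (c *\<^sub>R a) = c *\<^sub>R val a" "val 0 = 0"
  by (simp_all add: val_def vec_eq_iff)

lemma val_unit_jet: "val (unit_jet l k) = fst k *\<^sub>R axis l 1"
  by (simp add: val_def unit_jet_def vec_eq_iff axis_def)

lemma linear_unit_jet: "linear (unit_jet l)"
  by (auto simp: linear_iff unit_jet_def vec_eq_iff)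

lemma unit_jet_sum: "j = (\<Sum>l\<in>UNIV. unit_jet l (j $ l))"
  by (simp add: unit_jet_def vec_eq_iff)

text \<open>Vector fields on \<open>\<Omega>\<close> with components in \<open>H\<^sup>1\<^sub>0\<close>, together with their weak gradients.\<close>

definition V0 :: "(real^'n) set \<Rightarrow> (real^'n \<Rightarrow> 'n vjet) \<Rightarrow> bool" where
  "V0 \<Omega> J \<longleftrightarrow> (\<forall>l. S0 \<Omega> (\<lambda>x. J x $ l))"

definition weak_jet :: "(real^'n) set \<Rightarrow> (real^'n \<Rightarrow> real^'n) \<Rightarrow> real^'n \<Rightarrow> 'n vjet" where
  "weak_jet \<Omega> u x = (\<chi> l. (u x $ l, weak_grad \<Omega> (\<lambda>y. u y $ l) x))"

lemma val_weak_jet: "val (weak_jet \<Omega> u x) = u x"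
  by (simp add: val_def weak_jet_def vec_eq_iff)

context bounded_open
begin

lemma bop_const: "linear A \<Longrightarrow> bop L (\<lambda>x. A)"
  by (rule bop_continuous[OF bounded_\<Omega> sets_\<Omega>]) auto

lemma linear_vec_nth: "linear (\<lambda>j::'b::real_vector^'m. j $ l)"
  by (auto simp: linear_iff)

lemma L2_vjet:
  fixes J :: "real^'n \<Rightarrow> 'n vjet"
  assumes "\<And>l. L2 L (\<lambda>x. J x $ l)" shows "L2 L J"
proof -
  have "J = (\<lambda>x. \<Sum>l\<in>UNIV. unit_jet l (J x $ l))" using unit_jet_sum by (intro ext)
  moreover have "L2 L (\<lambda>x. \<Sum>l\<in>UNIV. unit_jet l (J x $ l))"
    by (intro L2_sum bop_L2[OF bop_const[OF linear_unit_jet]] assms)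
  ultimately show ?thesis by simp
qed

lemma V0_L2: "V0 \<Omega> J \<Longrightarrow> L2 L J"
  by (rule L2_vjet) (auto simp: V0_def intro: S0_L2)

lemma V0_add: "V0 \<Omega> J \<Longrightarrow> V0 \<Omega> K \<Longrightarrow> V0 \<Omega> (\<lambda>x. J x + K x)"
  by (auto simp: V0_def intro: S0_add)

lemma V0_scaleR: "V0 \<Omega> J \<Longrightarrow> V0 \<Omega> (\<lambda>x. c *\<^sub>R J x)"
  by (auto simp: V0_def intro: S0_scaleR)

lemma V0_zero: "V0 \<Omega> (\<lambda>x. 0)"
  by (simp add: V0_def S0_zero)

lemma V0_diff: "V0 \<Omega> J \<Longrightarrow> V0 \<Omega> K \<Longrightarrow> V0 \<Omega> (\<lambda>x. J x - K x)"
  using V0_add[OF _ V0_scaleR, of J K "-1"] by simp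

lemma V0_sum: "(\<And>i. i \<in> I \<Longrightarrow> V0 \<Omega> (J i)) \<Longrightarrow> V0 \<Omega> (\<lambda>x. \<Sum>i\<in>I. c i *\<^sub>R J i x)"
  by (induction I rule: infinite_finite_induct) (simp_all add: V0_add V0_scaleR V0_zero)

lemma V0_closed:
  assumes "\<And>m. V0 \<Omega> (F m)" "L2_lim L F J" shows "V0 \<Omega> J"
  unfolding V0_def
proof
  fix l
  show "S0 \<Omega> (\<lambda>x. J x $ l)"
    by (rule S0_closed[OF _ bop_L2_lim[OF bop_const[OF linear_vec_nth] assms(2)]])
      (use assms(1) in \<open>simp add: V0_def\<close>)
qed

lemma V0_unit_jet: "S0 \<Omega> k \<Longrightarrow> V0 \<Omega> (\<lambda>x. unit_jet l (k x))"
proof -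
  assume k: "S0 \<Omega> k"
  have "S0 \<Omega> (\<lambda>x. if m = l then k x else 0)" for m
    by (cases "m = l") (simp_all add: k S0_zero)
  then show ?thesis by (simp add: V0_def unit_jet_def)
qed

end

section \<open>The operator as a bilinear form on jets\<close>

locale elliptic = weighted_open \<Omega> \<eta> for \<Omega> :: "(real^'n) set" and \<eta> +
  fixes T :: "real^'n \<Rightarrow> real^'n^'n" and \<epsilon> \<delta> \<alpha> :: real
  assumes C2_\<eta>: "Ck_on (Suc (Suc 0)) \<eta> UNIV"
    and smooth_T: "smooth_on T UNIV"
    and T_spd: "\<And>x. symmetric_pos_def (T x)"
    and \<epsilon>_pos: "0 < \<epsilon>" and \<delta>_pos: "0 < \<delta>" and \<alpha>_nonneg: "0 \<le> \<alpha>"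
    and T_bounds: "\<And>x. x \<in> \<Omega> \<Longrightarrow> tensor_le (\<epsilon> *\<^sub>R mat 1) (T x) \<and> tensor_le (T x) (\<delta> *\<^sub>R mat 1)"
begin

lemma T_sym: "(T x *v a) \<bullet> b = a \<bullet> (T x *v b)"
proof -
  have "transpose (T x) = T x" using T_spd by (simp add: symmetric_pos_def_def)
  then show ?thesis by (metis dot_lmul_matrix vector_transpose_matrix inner_commute)
qed

lemma T_lower: "x \<in> \<Omega> \<Longrightarrow> \<epsilon> * (v \<bullet> v) \<le> v \<bullet> (T x *v v)"
  using T_bounds by (fastforce simp: tensor_le_def scaleR_matrix_vector_assoc[symmetric])

lemma T_upper: "x \<in> \<Omega> \<Longrightarrow> v \<bullet> (T x *v v) \<le> \<delta> * (v \<bullet> v)"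
  using T_bounds by (fastforce simp: tensor_le_def scaleR_matrix_vector_assoc[symmetric])

lemma bounded_bilinear_mv: "bounded_bilinear (\<lambda>(A::real^'n^'n) v. A *v v)"
  by (rule bilinear_conv_bounded_bilinear[THEN iffD1])
    (auto simp: bilinear_def linear_iff matrix_vector_mult_add_rdistrib matrix_vector_right_distrib
      scaleR_matrix_vector_assoc[symmetric] matrix_vector_mult_scaleR)

lemma Ck_T: "Ck_on k T UNIV"
  using smooth_T by (simp add: smooth_on_def)

lemma continuous_T: "continuous_on UNIV T"
  by (rule Ck_on_imp_continuous[OF Ck_T])

lemma continuous_mv [continuous_intros]:
  fixes f :: "'c::topological_space \<Rightarrow> real^'n^'n" and g :: "'c \<Rightarrow> real^'n"
  shows "continuous_on S f \<Longrightarrow> continuous_on S g \<Longrightarrow> continuous_on S (\<lambda>x. f x *v g x)"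
  by (rule bounded_bilinear.continuous_on[OF bounded_bilinear_mv])

lemma continuous_grad_\<eta>: "continuous_on UNIV (grad \<eta>)"
  by (rule C1_continuous_grad[OF C1_\<eta>])

lemma C1_grad_\<eta>: "Ck_on (Suc 0) (grad \<eta>) UNIV"
  by (rule Ck_on_grad[OF C2_\<eta>])

definition dv :: "real^'n \<Rightarrow> 'n vjet \<Rightarrow> real" where
  "dv x j = (\<Sum>l\<in>UNIV. snd (j $ l) $ l) - grad \<eta> x \<bullet> val j"

definition Nf :: "real^'n \<Rightarrow> 'n vjet \<Rightarrow> 'n vjet \<Rightarrow> real" where
  "Nf x j k = w x * (val j \<bullet> val k)"

text \<open>Density, in Lebesgue measure, of the form belonging to minus the operator. Since the
  weighted divergence is minus the adjoint of the gradient for the weighted measure, the \<alpha>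
  term becomes a product of two weighted divergences.\<close>

definition Qf :: "real^'n \<Rightarrow> 'n vjet \<Rightarrow> 'n vjet \<Rightarrow> real" where
  "Qf x j k = w x * ((\<Sum>l\<in>UNIV. (T x *v snd (j $ l)) \<bullet> snd (k $ l)) + \<alpha> * dv x j * dv x k)"

lemma dv_linear: "dv x (a + b) = dv x a + dv x b" "dv x (c *\<^sub>R a) = c * dv x a" "dv x 0 = 0"
  by (simp_all add: dv_def val_linear sum.distrib inner_add_right sum_distrib_left algebra_simps)

lemma continuous_dv: "continuous_on UNIV (\<lambda>x. dv x j)"
  unfolding dv_def by (intro continuous_intros continuous_grad_\<eta>)

lemma bform_Nf: "bform L Nf"
proof (rule bform_continuous[OF bounded_\<Omega> sets_\<Omega>])
  show "bilinear (Nf x)" for x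
    by (auto simp: bilinear_def linear_iff Nf_def val_linear inner_add_left inner_add_right algebra_simps)
  show "continuous_on UNIV (\<lambda>x. Nf x b c)" for b c
    unfolding Nf_def by (intro continuous_intros continuous_w)
qed

lemma bform_Qf: "bform L Qf"
proof (rule bform_continuous[OF bounded_\<Omega> sets_\<Omega>])
  show "bilinear (Qf x)" for x
    by (auto simp: bilinear_def linear_iff Qf_def dv_linear inner_add_left inner_add_right
        matrix_vector_right_distrib matrix_vector_mult_scaleR sum.distrib sum_distrib_left algebra_simps)
  show "continuous_on UNIV (\<lambda>x. Qf x b c)" for b c
    unfolding Qf_def by (intro continuous_intros continuous_w continuous_T continuous_dv)
qed

lemma Nf_sym: "Nf x b c = Nf x c b"
  by (simp add: Nf_def inner_commute)

lemma Qf_sym: "Qf x b c = Qf x c b"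
proof -
  have "(T x *v snd (b $ l)) \<bullet> snd (c $ l) = (T x *v snd (c $ l)) \<bullet> snd (b $ l)" for l
    using T_sym[of x "snd (b $ l)" "snd (c $ l)"] by (simp add: inner_commute)
  then show ?thesis by (simp add: Qf_def mult_ac)
qed

lemma Nf_nonneg: "0 \<le> Nf x b b"
  using w_pos[of x] by (simp add: Nf_def)

lemma T_psd: "0 \<le> (T x *v v) \<bullet> v"
  using T_spd[of x] by (cases "v = 0") (auto simp: symmetric_pos_def_def inner_commute intro: less_imp_le)

lemma Qf_nonneg: "0 \<le> Qf x b b"
proof -
  have "0 \<le> (\<Sum>l\<in>UNIV. (T x *v snd (b $ l)) \<bullet> snd (b $ l))" by (intro sum_nonneg T_psd)
  moreover have "0 \<le> \<alpha> * dv x b * dv x b" using \<alpha>_nonneg by (simp add: mult.assoc)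
  ultimately show ?thesis using w_pos[of x] by (simp add: Qf_def)
qed

lemma ifm_Nf_nonneg: "0 \<le> ifm L Nf J J" and ifm_Qf_nonneg: "0 \<le> ifm L Qf J J"
  by (simp_all add: ifm_def Nf_nonneg Qf_nonneg)

lemma ifm_Nf_sym: "ifm L Nf J K = ifm L Nf K J" and ifm_Qf_sym: "ifm L Qf J K = ifm L Qf K J"
  unfolding ifm_def using Nf_sym Qf_sym by metis+

lemma coercive_pointwise:
  obtains c where "0 < c" "\<And>x b. x \<in> \<Omega> \<Longrightarrow> c * (norm b)\<^sup>2 \<le> Qf x b b + Nf x b b"
proof -
  obtain c d where cd: "0 < c" "0 < d" "\<And>x. x \<in> \<Omega> \<Longrightarrow> c \<le> w x" "\<And>x. x \<in> \<Omega> \<Longrightarrow> w x \<le> d"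
    by (rule w_bounds) blast
  define m where "m = min \<epsilon> 1"
  have m: "0 < m" "m \<le> \<epsilon>" "m \<le> 1" using \<epsilon>_pos by (auto simp: m_def)
  show ?thesis
  proof (rule that[of "c * m"])
    fix x and b :: "'n vjet" assume x: "x \<in> \<Omega>"
    have "m * (norm (b $ l))\<^sup>2 \<le> (T x *v snd (b $ l)) \<bullet> snd (b $ l) + (fst (b $ l))\<^sup>2" for l
    proof -
      have "m * (norm (snd (b $ l)))\<^sup>2 \<le> \<epsilon> * (norm (snd (b $ l)))\<^sup>2" using m by (intro mult_right_mono) auto
      also have "\<dots> \<le> (T x *v snd (b $ l)) \<bullet> snd (b $ l)"
        using T_lower[OF x, of "snd (b $ l)"] by (simp add: power2_norm_eq_inner inner_commute)
      finally have 1: "m * (norm (snd (b $ l)))\<^sup>2 \<le> (T x *v snd (b $ l)) \<bullet> snd (b $ l)" .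
      have 2: "m * (fst (b $ l))\<^sup>2 \<le> (fst (b $ l))\<^sup>2" using m mult_right_mono[of m 1 "(fst (b $ l))\<^sup>2"] by simp
      show ?thesis using 1 2 by (simp add: norm_prod_def distrib_left)
    qed
    then have "(\<Sum>l\<in>UNIV. m * (norm (b $ l))\<^sup>2) \<le> (\<Sum>l\<in>UNIV. (T x *v snd (b $ l)) \<bullet> snd (b $ l) + (fst (b $ l))\<^sup>2)"
      by (intro sum_mono)
    also have "(\<Sum>l\<in>UNIV. m * (norm (b $ l))\<^sup>2) = m * (norm b)\<^sup>2"
      by (simp add: norm_vec_def L2_set_def sum_nonneg sum_distrib_left)
    also have "(\<Sum>l\<in>UNIV. (T x *v snd (b $ l)) \<bullet> snd (b $ l) + (fst (b $ l))\<^sup>2)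
        \<le> (\<Sum>l\<in>UNIV. (T x *v snd (b $ l)) \<bullet> snd (b $ l)) + \<alpha> * dv x b * dv x b + val b \<bullet> val b"
      using \<alpha>_nonneg by (simp add: sum.distrib val_def inner_vec_def power2_eq_square mult.assoc)
    finally have "c * (m * (norm b)\<^sup>2)
        \<le> w x * ((\<Sum>l\<in>UNIV. (T x *v snd (b $ l)) \<bullet> snd (b $ l)) + \<alpha> * dv x b * dv x b + val b \<bullet> val b)"
      using cd(3)[OF x] cd(1) m by (intro mult_mono) (auto intro: less_imp_le[OF w_pos])
    then show "c * m * (norm b)\<^sup>2 \<le> Qf x b b + Nf x b b"
      by (simp add: Qf_def Nf_def algebra_simps)
  qed (use cd m in simp)
qed

lemma coercive:
  obtains c where "0 < c" "\<And>J. L2 L J \<Longrightarrow> c * L2_sqnorm L J \<le> ifm L Qf J J + ifm L Nf J J"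
proof -
  obtain c where c: "0 < c" "\<And>x b. x \<in> \<Omega> \<Longrightarrow> c * (norm b)\<^sup>2 \<le> Qf x b b + Nf x b b"
    by (rule coercive_pointwise) blast
  show ?thesis
  proof (rule that[OF c(1)])
    fix J :: "real^'n \<Rightarrow> 'n vjet" assume J: "L2 L J"
    have i: "integrable L (\<lambda>x. Qf x (J x) (J x))" "integrable L (\<lambda>x. Nf x (J x) (J x))"
      by (rule bform_integrable[OF bform_Qf J J], rule bform_integrable[OF bform_Nf J J])
    have "c * L2_sqnorm L J = (LINT x|L. c * (norm (J x))\<^sup>2)" by (simp add: L2_sqnorm_def)
    also have "\<dots> \<le> (LINT x|L. Qf x (J x) (J x) + Nf x (J x) (J x))"
      by (rule integral_mono) (use i J c(2) in \<open>auto simp: L2_def\<close>)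
    also have "\<dots> = ifm L Qf J J + ifm L Nf J J" using i by (simp add: ifm_def)
    finally show "c * L2_sqnorm L J \<le> ifm L Qf J J + ifm L Nf J J" .
  qed
qed

lemma V0_compactness:
  assumes e: "0 < e"
  shows "\<exists>(I :: ('n \<times> ('n \<Rightarrow> int)) set) g. finite I \<and> (\<forall>i. L2 L (g i)) \<and>
    (\<forall>J. V0 \<Omega> J \<longrightarrow> ifm L Nf J J \<le> (\<Sum>i\<in>I. (LINT x|L. g i x \<bullet> J x)\<^sup>2) + e * ifm L Qf J J)"
proof -
  obtain c d where cd: "0 < c" "0 < d" "\<And>x. x \<in> \<Omega> \<Longrightarrow> c \<le> w x" "\<And>x. x \<in> \<Omega> \<Longrightarrow> w x \<le> d"
    by (rule w_bounds) blast
  \<comment> \<open>The weight is at most d in the norm and the energy density is at least c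
    \<epsilon> times the squared gradients, so d e' = e c \<epsilon> gives the error e in terms of
    the energy.\<close>
  define e' where "e' = e * c * \<epsilon> / d"
  have e': "0 < e'" using e cd \<epsilon>_pos by (simp add: e'_def)
  obtain I :: "('n \<Rightarrow> int) set" and g where I: "finite I" "\<And>i. L2 L (g i)"
    "\<And>k. S0 \<Omega> k \<Longrightarrow> L2_sqnorm L (\<lambda>x. fst (k x))
      \<le> (\<Sum>i\<in>I. (LINT x|L. g i x * fst (k x))\<^sup>2) + e' * L2_sqnorm L (\<lambda>x. snd (k x))"
    by (rule S0_compactness[OF e']) blast
  \<comment> \<open>The factor \<open>sqrt d\<close> puts the bound d of the weight inside the
    squared functionals.\<close>
  define G where "G p x = unit_jet (fst p) (sqrt d * g (snd p) x, 0)" for p :: "'n \<times> ('n \<Rightarrow> int)" and x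
  have LG: "L2 L (G p)" for p
  proof -
    have "linear (\<lambda>r::real. unit_jet (fst p) (sqrt d * r, 0))"
      by (auto simp: linear_iff unit_jet_def vec_eq_iff algebra_simps)
    from bop_L2[OF bop_const[OF this] I(2)[of "snd p"]] show ?thesis by (simp add: G_def[abs_def])
  qed
  have main: "ifm L Nf J J \<le> (\<Sum>i\<in>UNIV \<times> I. (LINT x|L. G i x \<bullet> J x)\<^sup>2) + e * ifm L Qf J J"
    if J: "V0 \<Omega> J" for J
  proof -
    have LJ: "L2 L J" by (rule V0_L2[OF J])
    have Lf: "L2 L (\<lambda>x. fst (J x $ l))" and Ls: "L2 L (\<lambda>x. snd (J x $ l))" for l
      using bop_L2[OF bop_const LJ, of "\<lambda>j. fst (j $ l)"] bop_L2[OF bop_const LJ, of "\<lambda>j. snd (j $ l)"]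
      by (auto simp: linear_iff)
    have "ifm L Nf J J \<le> (LINT x|L. (\<Sum>l\<in>UNIV. d * (norm (fst (J x $ l)))\<^sup>2))"
      unfolding ifm_def
    proof (rule integral_mono[OF bform_integrable[OF bform_Nf LJ LJ]])
      show "integrable L (\<lambda>x. \<Sum>l\<in>UNIV. d * (norm (fst (J x $ l)))\<^sup>2)" using Lf by (auto simp: L2_def)
      fix x assume "x \<in> space L"
      then have "Nf x (J x) (J x) \<le> d * (val (J x) \<bullet> val (J x))"
        unfolding Nf_def using cd(4)[of x] by (intro mult_right_mono) auto
      then show "Nf x (J x) (J x) \<le> (\<Sum>l\<in>UNIV. d * (norm (fst (J x $ l)))\<^sup>2)"
        by (simp add: val_def inner_vec_def sum_distrib_left power2_eq_square)
    qed
    also have "\<dots> = (\<Sum>l\<in>UNIV. d * L2_sqnorm L (\<lambda>x. fst (J x $ l)))"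
      using Lf by (simp add: L2_def L2_sqnorm_def)
    also have "\<dots> \<le> (\<Sum>l\<in>UNIV. d * ((\<Sum>i\<in>I. (LINT x|L. g i x * fst (J x $ l))\<^sup>2) + e' * L2_sqnorm L (\<lambda>x. snd (J x $ l))))"
      using J cd(2) by (intro sum_mono mult_left_mono I(3)) (auto simp: V0_def)
    also have "\<dots> = (\<Sum>l\<in>UNIV. \<Sum>i\<in>I. d * (LINT x|L. g i x * fst (J x $ l))\<^sup>2) + d * e' * (\<Sum>l\<in>UNIV. L2_sqnorm L (\<lambda>x. snd (J x $ l)))"
      by (simp add: sum.distrib sum_distrib_left distrib_left mult.assoc)
    also have "(\<Sum>l\<in>UNIV. \<Sum>i\<in>I. d * (LINT x|L. g i x * fst (J x $ l))\<^sup>2) = (\<Sum>p\<in>UNIV \<times> I. (LINT x|L. G p x \<bullet> J x)\<^sup>2)"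
    proof -
      have "G (l, i) x \<bullet> J x = sqrt d * (g i x * fst (J x $ l))" for l i x
      proof -
        have "unit_jet l k \<bullet> J x = k \<bullet> J x $ l" for k
        proof -
          have "unit_jet l k \<bullet> J x = (\<Sum>m\<in>UNIV. if m = l then k \<bullet> J x $ l else 0)"
            unfolding inner_vec_def unit_jet_def by (intro sum.cong) auto
          then show ?thesis by simp
        qed
        then show ?thesis by (cases "J x $ l") (simp add: G_def)
      qed
      then have "(LINT x|L. G (l, i) x \<bullet> J x)\<^sup>2 = d * (LINT x|L. g i x * fst (J x $ l))\<^sup>2" for l i
        using cd(2) by (simp add: power_mult_distrib)
      then show ?thesis by (auto simp: sum.cartesian_product intro!: sum.cong)
    qed
    also have "d * e' * (\<Sum>l\<in>UNIV. L2_sqnorm L (\<lambda>x. snd (J x $ l))) \<le> e * ifm L Qf J J"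
    proof -
      have "(\<Sum>l\<in>UNIV. c * \<epsilon> * L2_sqnorm L (\<lambda>x. snd (J x $ l))) = (LINT x|L. (\<Sum>l\<in>UNIV. c * \<epsilon> * (norm (snd (J x $ l)))\<^sup>2))"
        using Ls by (simp add: L2_def L2_sqnorm_def)
      also have "\<dots> \<le> ifm L Qf J J" unfolding ifm_def
      proof (rule integral_mono[OF _ bform_integrable[OF bform_Qf LJ LJ]])
        show "integrable L (\<lambda>x. \<Sum>l\<in>UNIV. c * \<epsilon> * (norm (snd (J x $ l)))\<^sup>2)" using Ls by (auto simp: L2_def)
        fix x assume "x \<in> space L"
        then have x: "x \<in> \<Omega>" by simp
        have "\<epsilon> * (\<Sum>l\<in>UNIV. (norm (snd (J x $ l)))\<^sup>2) \<le> (\<Sum>l\<in>UNIV. (T x *v snd (J x $ l)) \<bullet> snd (J x $ l))"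
          unfolding sum_distrib_left using T_lower[OF x]
          by (intro sum_mono) (simp add: power2_norm_eq_inner inner_commute)
        also have "\<dots> \<le> (\<Sum>l\<in>UNIV. (T x *v snd (J x $ l)) \<bullet> snd (J x $ l)) + \<alpha> * dv x (J x) * dv x (J x)"
          using \<alpha>_nonneg by (simp add: mult.assoc)
        finally have "c * (\<epsilon> * (\<Sum>l\<in>UNIV. (norm (snd (J x $ l)))\<^sup>2)) \<le> Qf x (J x) (J x)"
          unfolding Qf_def using cd(3)[OF x] cd(1) w_pos[of x] \<epsilon>_pos
          by (intro mult_mono) (auto intro!: mult_nonneg_nonneg sum_nonneg)
        then show "(\<Sum>l\<in>UNIV. c * \<epsilon> * (norm (snd (J x $ l)))\<^sup>2) \<le> Qf x (J x) (J x)"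
          by (simp add: sum_distrib_left mult.assoc)
      qed
      finally have "(e / (c * \<epsilon>) * (c * \<epsilon>)) * (\<Sum>l\<in>UNIV. c * \<epsilon> * L2_sqnorm L (\<lambda>x. snd (J x $ l))) \<le> e * ifm L Qf J J"
        using e cd(1) \<epsilon>_pos by (simp add: mult_left_mono)
      moreover have "d * e' * (\<Sum>l\<in>UNIV. L2_sqnorm L (\<lambda>x. snd (J x $ l)))
          = e * (\<Sum>l\<in>UNIV. c * \<epsilon> * L2_sqnorm L (\<lambda>x. snd (J x $ l)))"
        using cd(2) by (simp add: e'_def sum_distrib_left mult_ac)
      ultimately show ?thesis using cd(1) \<epsilon>_pos by simp
    qed
    finally show ?thesis by simp
  qed
  have "finite ((UNIV :: 'n set) \<times> I)" using I(1) by simp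
  with LG main show ?thesis by blast
qed

end

section \<open>Distributional equation and weak formulation\<close>

context elliptic
begin

definition "gam x = exp (\<eta> x)"

lemma C1_gam: "Ck_on (Suc 0) gam UNIV"
  unfolding gam_def[abs_def] by (rule Ck_on_exp[OF C1_\<eta>])

lemma grad_gam: "grad gam x = gam x *\<^sub>R grad \<eta> x"
proof (rule grad_eqI)
  show "(gam has_derivative (\<lambda>v. (gam x *\<^sub>R grad \<eta> x) \<bullet> v)) (at x)"
    unfolding gam_def[abs_def] using Ck_on_has_derivative_grad[OF C1_\<eta>, of x]
    by (auto intro!: derivative_eq_intros)
qed

lemma w_gam: "w x * gam x = 1" "gam x * w x = 1"
  by (simp_all add: w_def gam_def exp_minus)

lemma dv_unit_jet: "dv x (unit_jet l k) = snd k $ l - grad \<eta> x $ l * fst k"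
proof -
  have "(\<Sum>m\<in>UNIV. snd (unit_jet l k $ m) $ m) = (\<Sum>m\<in>UNIV. if m = l then snd k $ l else 0)"
    by (rule sum.cong) (auto simp: unit_jet_def)
  then show ?thesis by (simp add: dv_def val_unit_jet inner_axis mult.commute)
qed

text \<open>The substitution \<open>\<psi> = e\<^sup>\<eta> \<theta>\<close> turns distributional pairings with \<open>\<theta>\<close> against Lebesgue
  measure into weak formulations with test function \<open>\<psi>\<close> against the weighted measure.\<close>

definition wtest :: "'n \<Rightarrow> (real^'n \<Rightarrow> real \<times> (real^'n)) \<Rightarrow> real^'n \<Rightarrow> 'n vjet" where
  "wtest l c x = unit_jet l (jet_mult gam x (c x))"

lemma Nf_wtest: "Nf x j (wtest l c x) = fst (c x) * val j $ l"
proof -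
  have "Nf x j (wtest l c x) = (w x * gam x) * (fst (c x) * val j $ l)"
    by (simp add: Nf_def wtest_def val_unit_jet jet_mult_def inner_axis mult_ac)
  then show ?thesis by (simp add: w_gam)
qed

text \<open>The factor exp (\<eta> x) of the test jet cancels \<open>w\<close>. Its derivative
  survives in the T part as the \<nabla>\<eta> term of \<open>opL\<close>. In the divergence it is
  cancelled by the \<nabla>\<eta> term of \<open>dv\<close>, so the \<alpha> part carries the plain
  derivative, as \<open>dist_grad\<close> does.\<close>

lemma Qf_wtest:
  "Qf x j (wtest l c x) = (T x *v snd (j $ l)) \<bullet> snd (c x) + fst (c x) * (grad \<eta> x \<bullet> (T x *v snd (j $ l)))
    + \<alpha> * (dv x j * snd (c x) $ l)"
proof -
  define k where "k = jet_mult gam x (c x)"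
  have k: "fst k = gam x * fst (c x)" "snd k = gam x *\<^sub>R (snd (c x) + fst (c x) *\<^sub>R grad \<eta> x)"
    by (simp_all add: k_def jet_mult_def grad_gam scaleR_add_right)
  have "(\<Sum>m\<in>UNIV. (T x *v snd (j $ m)) \<bullet> snd (unit_jet l k $ m)) = (\<Sum>m\<in>UNIV. if m = l then (T x *v snd (j $ l)) \<bullet> snd k else 0)"
    by (rule sum.cong) (auto simp: unit_jet_def)
  then have "Qf x j (wtest l c x) = w x * ((T x *v snd (j $ l)) \<bullet> snd k + \<alpha> * dv x j * (snd k $ l - grad \<eta> x $ l * fst k))"
    by (simp add: Qf_def wtest_def k_def[symmetric] dv_unit_jet)
  also have "\<dots> = (w x * gam x) * ((T x *v snd (j $ l)) \<bullet> (snd (c x) + fst (c x) *\<^sub>R grad \<eta> x) + \<alpha> * (dv x j * snd (c x) $ l))"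
    unfolding k by (simp add: algebra_simps inner_add_right)
  finally show ?thesis by (simp add: w_gam inner_add_right inner_commute)
qed

lemma dv_weak_jet: "dv x (weak_jet \<Omega> u x) = weak_div_eta \<Omega> \<eta> u x"
proof -
  have "(\<Sum>l\<in>UNIV. snd (weak_jet \<Omega> u x $ l) $ l) = (\<Sum>l\<in>UNIV. weak_grad \<Omega> (\<lambda>y. u y $ l) x $ l)"
    by (simp add: weak_jet_def)
  then show ?thesis by (simp add: dv_def val_weak_jet weak_div_eta_def)
qed

lemma bop_dv: "bop L dv"
  by (rule bop_continuous[OF bounded_\<Omega> sets_\<Omega>]) (auto simp: linear_iff dv_linear continuous_dv)

lemma eigen_equation_test:
  assumes J: "V0 \<Omega> (weak_jet \<Omega> u)" and p: "test_fun \<Omega> \<theta>"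
  shows "(opL_vec \<Omega> \<eta> T u \<theta> + \<alpha> *\<^sub>R dist_grad \<Omega> (weak_div_eta \<Omega> \<eta> u) \<theta>) $ l
      = - ifm L Qf (weak_jet \<Omega> u) (wtest l (sjet \<theta>))"
    and "dist_fun \<Omega> u \<theta> $ l = ifm L Nf (weak_jet \<Omega> u) (wtest l (sjet \<theta>))"
proof -
  define W where "W = weak_jet \<Omega> u"
  have LW: "L2 L W" unfolding W_def by (rule V0_L2[OF J])
  have C1: "Ck_on (Suc 0) \<theta> UNIV" by (rule test_fun_Ck[OF p])
  note c = C1_continuous[OF C1] C1_continuous_grad[OF C1]
  have I: "integrable L (\<lambda>x. A x (W x))" if "\<And>x. linear (A x)" "\<And>b. continuous_on UNIV (\<lambda>x. A x b)"
    for A :: "real^'n \<Rightarrow> 'n vjet \<Rightarrow> 'c::euclidean_space"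
    by (rule L.L2_imp_integrable[OF bop_L2[OF bop_continuous[OF bounded_\<Omega> sets_\<Omega> that] LW]])
  have i1: "integrable L (\<lambda>x. (T x *v snd (W x $ l)) \<bullet> grad \<theta> x)"
    by (rule I[of "\<lambda>x j. (T x *v snd (j $ l)) \<bullet> grad \<theta> x"])
      (auto simp: linear_iff matrix_vector_right_distrib matrix_vector_mult_scaleR inner_add_left
        intro!: continuous_intros c continuous_T)
  have i2: "integrable L (\<lambda>x. \<theta> x * (grad \<eta> x \<bullet> (T x *v snd (W x $ l))))"
    by (rule I[of "\<lambda>x j. \<theta> x * (grad \<eta> x \<bullet> (T x *v snd (j $ l)))"])
      (auto simp: linear_iff matrix_vector_right_distrib matrix_vector_mult_scaleR inner_add_right algebra_simps
        intro!: continuous_intros c continuous_T continuous_grad_\<eta>)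
  have i3: "integrable L (\<lambda>x. dv x (W x) *\<^sub>R grad \<theta> x)"
    by (rule I[of "\<lambda>x j. dv x j *\<^sub>R grad \<theta> x"])
      (auto simp: linear_iff dv_linear algebra_simps intro!: continuous_intros c continuous_dv)
  have i3l: "(LINT x|L. dv x (W x) *\<^sub>R grad \<theta> x) $ l = (LINT x|L. dv x (W x) * grad \<theta> x $ l)"
    "integrable L (\<lambda>x. dv x (W x) * grad \<theta> x $ l)"
    using integral_bounded_linear[OF bounded_linear_vec_nth i3, of l]
      integrable_bounded_linear[OF bounded_linear_vec_nth i3, of l] by simp_all
  have i4: "integrable L (\<lambda>x. \<theta> x *\<^sub>R val (W x))"
    by (rule I[of "\<lambda>x j. \<theta> x *\<^sub>R val j"])
      (auto simp: linear_iff val_linear algebra_simps intro!: continuous_intros c)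
  have wg: "weak_grad \<Omega> (\<lambda>y. u y $ l) = (\<lambda>x. snd (W x $ l))" by (simp add: W_def weak_jet_def)
  have wd: "weak_div_eta \<Omega> \<eta> u = (\<lambda>x. dv x (W x))" by (simp add: W_def dv_weak_jet)
  have "(opL_vec \<Omega> \<eta> T u \<theta> + \<alpha> *\<^sub>R dist_grad \<Omega> (weak_div_eta \<Omega> \<eta> u) \<theta>) $ l
      = - (LINT x|L. (T x *v snd (W x $ l)) \<bullet> grad \<theta> x) - (LINT x|L. \<theta> x * (grad \<eta> x \<bullet> (T x *v snd (W x $ l))))
        - \<alpha> * (LINT x|L. dv x (W x) * grad \<theta> x $ l)"
    by (simp add: opL_vec_def opL_def dist_div_def dist_fun_def dist_grad_def wg wd i3l)
  also have "\<dots> = - ifm L Qf W (wtest l (sjet \<theta>))"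
    unfolding ifm_def Qf_wtest using i1 i2 i3l(2) by (simp add: sjet_def)
  finally show "(opL_vec \<Omega> \<eta> T u \<theta> + \<alpha> *\<^sub>R dist_grad \<Omega> (weak_div_eta \<Omega> \<eta> u) \<theta>) $ l
      = - ifm L Qf (weak_jet \<Omega> u) (wtest l (sjet \<theta>))" unfolding W_def .
  have u: "u x = val (W x)" for x by (simp add: W_def val_weak_jet)
  show "dist_fun \<Omega> u \<theta> $ l = ifm L Nf (weak_jet \<Omega> u) (wtest l (sjet \<theta>))"
    unfolding W_def[symmetric] ifm_def Nf_wtest dist_fun_def u
    using integral_bounded_linear[OF bounded_linear_vec_nth i4, of l] by (simp add: sjet_def)
qed

lemma V0_wtest: "S0 \<Omega> k \<Longrightarrow> V0 \<Omega> (wtest l k)"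
  unfolding wtest_def[abs_def] by (intro V0_unit_jet S0_mult[OF C1_gam])

lemma H10_imp_V0: "(\<And>l. H10 \<Omega> \<eta> (\<lambda>x. u x $ l)) \<Longrightarrow> V0 \<Omega> (weak_jet \<Omega> u)"
  unfolding V0_def weak_jet_def by (simp add: H10_imp_S0)

lemma eigenspace_V0: "u \<in> eigenspace \<Omega> \<eta> T \<alpha> s \<Longrightarrow> V0 \<Omega> (weak_jet \<Omega> u)"
  by (rule H10_imp_V0) (simp add: eigenspace_def)

text \<open>The distributional equation covers only test jets of the form exp (\<eta> x) times a
  smooth function. They are dense: components and the density of test functions reduce a general K
  to these.\<close>

lemma eigenspace_weak_form:
  assumes u: "u \<in> eigenspace \<Omega> \<eta> T \<alpha> s" and K: "V0 \<Omega> K"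
  shows "ifm L Qf (weak_jet \<Omega> u) K = s * ifm L Nf (weak_jet \<Omega> u) K"
proof -
  have J: "V0 \<Omega> (weak_jet \<Omega> u)" by (rule eigenspace_V0[OF u])
  have LJ: "L2 L (weak_jet \<Omega> u)" by (rule V0_L2[OF J])
  have test: "ifm L Qf (weak_jet \<Omega> u) (wtest l (sjet \<theta>)) = s * ifm L Nf (weak_jet \<Omega> u) (wtest l (sjet \<theta>))"
    if p: "test_fun \<Omega> \<theta>" for l \<theta>
  proof -
    have "opL_vec \<Omega> \<eta> T u \<theta> + \<alpha> *\<^sub>R dist_grad \<Omega> (weak_div_eta \<Omega> \<eta> u) \<theta> = - s *\<^sub>R dist_fun \<Omega> u \<theta>"
      using u p by (simp add: eigenspace_def)
    from arg_cong[OF this, of "\<lambda>v. v $ l"]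
    show ?thesis unfolding eigen_equation_test(1)[OF J p]
      using eigen_equation_test(2)[OF J p, of l] by simp
  qed
  have comp: "ifm L Qf (weak_jet \<Omega> u) (\<lambda>x. unit_jet l (k x)) = s * ifm L Nf (weak_jet \<Omega> u) (\<lambda>x. unit_jet l (k x))"
    if k: "S0 \<Omega> k" for l k
  proof -
    \<comment> \<open>Test functions approximate w k, not k itself; multiplied by 1 / w = exp
      (\<eta> x) they approximate k.\<close>
    have "S0 \<Omega> (\<lambda>x. jet_mult w x (k x))" by (rule S0_mult[OF C1_w k])
    then obtain \<phi> where p: "\<And>m. test_fun \<Omega> (\<phi> m)" "L2_lim L (\<lambda>m. sjet (\<phi> m)) (\<lambda>x. jet_mult w x (k x))"
      by (auto simp: S0_def)
    have inv: "jet_mult gam x (jet_mult w x j) = j" for x j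
    proof -
      have "gam x * (w x * fst j) = fst j" using w_gam(2)[of x] by (metis mult.assoc mult_1)
      moreover have "gam x *\<^sub>R (w x *\<^sub>R snd j + fst j *\<^sub>R grad w x) + (w x * fst j) *\<^sub>R grad gam x = snd j"
      proof -
        have "gam x *\<^sub>R (w x *\<^sub>R snd j + fst j *\<^sub>R grad w x) + (w x * fst j) *\<^sub>R grad gam x
            = (gam x * w x) *\<^sub>R snd j"
          unfolding grad_w grad_gam by (simp add: scaleR_add_right scaleR_diff_right mult_ac)
        then show ?thesis by (simp add: w_gam)
      qed
      ultimately show ?thesis by (simp add: jet_mult_def prod_eq_iff)
    qed
    have "L2_lim L (\<lambda>m x. unit_jet l (jet_mult gam x (sjet (\<phi> m) x))) (\<lambda>x. unit_jet l (jet_mult gam x (jet_mult w x (k x))))"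
      by (rule bop_L2_lim[OF bop_const[OF linear_unit_jet] bop_L2_lim[OF bop_jet_mult[OF C1_gam] p(2)]])
    then have lim: "L2_lim L (\<lambda>m. wtest l (sjet (\<phi> m))) (\<lambda>x. unit_jet l (k x))"
      by (simp add: inv wtest_def[abs_def])
    have "(\<lambda>m. ifm L Qf (weak_jet \<Omega> u) (wtest l (sjet (\<phi> m)))) \<longlonglongrightarrow> ifm L Qf (weak_jet \<Omega> u) (\<lambda>x. unit_jet l (k x))"
      by (rule ifm_tendsto[OF bform_Qf L2_lim_const[OF LJ] lim])
    moreover have "(\<lambda>m. ifm L Qf (weak_jet \<Omega> u) (wtest l (sjet (\<phi> m)))) \<longlonglongrightarrow> s * ifm L Nf (weak_jet \<Omega> u) (\<lambda>x. unit_jet l (k x))"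
      unfolding test[OF p(1)] by (intro tendsto_mult tendsto_const ifm_tendsto[OF bform_Nf L2_lim_const[OF LJ] lim])
    ultimately show ?thesis by (rule LIMSEQ_unique)
  qed
  have Kl: "S0 \<Omega> (\<lambda>x. K x $ l)" for l using K by (simp add: V0_def)
  have LK: "L2 L (\<lambda>x. unit_jet l (K x $ l))" for l by (rule V0_L2[OF V0_unit_jet[OF Kl]])
  have Keq: "K = (\<lambda>x. \<Sum>l\<in>UNIV. 1 *\<^sub>R unit_jet l (K x $ l))" using unit_jet_sum by (intro ext) simp
  have "ifm L Qf (weak_jet \<Omega> u) K = (\<Sum>l\<in>UNIV. 1 * ifm L Qf (weak_jet \<Omega> u) (\<lambda>x. unit_jet l (K x $ l)))"
    by (subst Keq) (rule ifm_sum_right[OF bform_Qf LK LJ])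
  also have "\<dots> = s * (\<Sum>l\<in>UNIV. 1 * ifm L Nf (weak_jet \<Omega> u) (\<lambda>x. unit_jet l (K x $ l)))"
    by (simp add: comp[OF Kl] sum_distrib_left)
  also have "(\<Sum>l\<in>UNIV. 1 * ifm L Nf (weak_jet \<Omega> u) (\<lambda>x. unit_jet l (K x $ l))) = ifm L Nf (weak_jet \<Omega> u) K"
    by (subst (2) Keq) (rule ifm_sum_right[OF bform_Nf LK LJ, symmetric])
  finally show ?thesis .
qed

text \<open>Recognizes the minimizer of the Rayleigh quotient as a member of an eigenspace. Its
  gradient part and the chosen weak gradient differ on a null set only, which the forms do not
  see.\<close>

lemma weak_form_eigenspace:
  assumes W: "V0 \<Omega> W" and eq: "\<And>K. V0 \<Omega> K \<Longrightarrow> ifm L Qf W K = s * ifm L Nf W K"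
  shows "(\<lambda>x. val (W x)) \<in> eigenspace \<Omega> \<eta> T \<alpha> s"
proof -
  let ?u = "\<lambda>x. val (W x)"
  have S: "S0 \<Omega> (\<lambda>x. W x $ l)" for l using W by (simp add: V0_def)
  have u: "(\<lambda>x. ?u x $ l) = (\<lambda>x. fst (W x $ l))" for l by (simp add: val_def)
  have H: "H10 \<Omega> \<eta> (\<lambda>x. ?u x $ l)" for l unfolding u by (rule S0_imp_H10(1)[OF S])
  have J: "V0 \<Omega> (weak_jet \<Omega> ?u)" by (rule H10_imp_V0[OF H])
  have "AE x in L. \<forall>l\<in>UNIV. weak_grad \<Omega> (\<lambda>y. ?u y $ l) x = snd (W x $ l)"
    unfolding u by (rule AE_finite_allI) (auto intro: S0_imp_H10(2)[OF S])
  then have AE: "AE x in L. weak_jet \<Omega> ?u x = W x"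
    by eventually_elim (auto simp: weak_jet_def vec_eq_iff val_def prod_eq_iff)
  have eq': "ifm L Qf (weak_jet \<Omega> ?u) K = s * ifm L Nf (weak_jet \<Omega> ?u) K" if K: "V0 \<Omega> K" for K
    using eq[OF K] ifm_cong_AE[OF bform_Qf V0_L2[OF J] V0_L2[OF K] V0_L2[OF W] V0_L2[OF K] AE]
      ifm_cong_AE[OF bform_Nf V0_L2[OF J] V0_L2[OF K] V0_L2[OF W] V0_L2[OF K] AE] by simp
  have "opL_vec \<Omega> \<eta> T ?u \<phi> + \<alpha> *\<^sub>R dist_grad \<Omega> (weak_div_eta \<Omega> \<eta> ?u) \<phi> = - s *\<^sub>R dist_fun \<Omega> ?u \<phi>"
    if p: "test_fun \<Omega> \<phi>" for \<phi>
  proof (rule vec_eq_iff[THEN iffD2], rule allI)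
    fix l
    show "(opL_vec \<Omega> \<eta> T ?u \<phi> + \<alpha> *\<^sub>R dist_grad \<Omega> (weak_div_eta \<Omega> \<eta> ?u) \<phi>) $ l = (- s *\<^sub>R dist_fun \<Omega> ?u \<phi>) $ l"
      unfolding eigen_equation_test(1)[OF J p] eq'[OF V0_wtest[OF S0_test[OF p]]]
      using eigen_equation_test(2)[OF J p, of l] by simp
  qed
  then show ?thesis using H by (simp add: eigenspace_def)
qed

end

text \<open>Elimination: an unknown p with nonzero coefficient in the last equation is solved for,
  which lowers both counts by one. It will show that d + 1 functions in a space of dimension d are
  linearly dependent almost everywhere.\<close>

lemma homogeneous_system_nontrivial:
  fixes c :: "'i \<Rightarrow> nat \<Rightarrow> real"
  assumes "finite I" "d < card I"
  shows "\<exists>b. (\<exists>i\<in>I. b i \<noteq> 0) \<and> (\<forall>j<d. (\<Sum>i\<in>I. b i * c i j) = 0)"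
  using assms
proof (induction d arbitrary: I c)
  case 0
  then obtain i where "i \<in> I" by fastforce
  then show ?case by (intro exI[of _ "\<lambda>_. 1"]) auto
next
  case (Suc d)
  show ?case
  proof (cases "\<forall>i\<in>I. c i d = 0")
    case True
    obtain b where b: "\<exists>i\<in>I. b i \<noteq> 0" "\<forall>j<d. (\<Sum>i\<in>I. b i * c i j) = 0"
      using Suc.IH[of I c] Suc.prems by auto
    have "(\<Sum>i\<in>I. b i * c i j) = 0" if "j < Suc d" for j
      using b(2) True that by (cases "j = d") (auto intro!: sum.neutral)
    then show ?thesis using b(1) by blast
  next
    case False
    then obtain p where p: "p \<in> I" "c p d \<noteq> 0" by blast
    define I' where "I' = I - {p}"
    define c' where "c' i j = c i j - c i d / c p d * c p j" for i j
    have fI': "finite I'" "d < card I'" using Suc.prems p by (auto simp: I'_def)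
    obtain b where b: "\<exists>i\<in>I'. b i \<noteq> 0" "\<forall>j<d. (\<Sum>i\<in>I'. b i * c' i j) = 0"
      using Suc.IH[OF fI', of c'] by auto
    define b' where "b' i = (if i = p then - (\<Sum>i\<in>I'. b i * c i d / c p d) else b i)" for i
    have sum': "(\<Sum>i\<in>I. b' i * c i j) = (\<Sum>i\<in>I'. b i * c' i j)" for j
    proof -
      have "(\<Sum>i\<in>I. b' i * c i j) = b' p * c p j + (\<Sum>i\<in>I'. b' i * c i j)"
        using sum.remove[OF Suc.prems(1) p(1)] by (simp add: I'_def)
      also have "(\<Sum>i\<in>I'. b' i * c i j) = (\<Sum>i\<in>I'. b i * c i j)"
        by (rule sum.cong) (auto simp: I'_def b'_def)
      also have "b' p * c p j = - (\<Sum>i\<in>I'. b i * (c i d / c p d * c p j))"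
        by (simp add: b'_def sum_distrib_right) (simp add: mult.assoc)
      finally show ?thesis by (simp add: c'_def right_diff_distrib sum_subtractf)
    qed
    have "(\<Sum>i\<in>I. b' i * c i j) = 0" if "j < Suc d" for j
      unfolding sum' using b(2) that p by (cases "j = d") (auto simp: c'_def)
    moreover have "\<exists>i\<in>I. b' i \<noteq> 0" using b(1) by (auto simp: b'_def I'_def)
    ultimately show ?thesis by blast
  qed
qed

subsection \<open>Commutators with the coordinates\<close>

lemma divergence_uminus:
  assumes "Ck_on (Suc 0) V UNIV"
  shows "divergence (\<lambda>x. - V x) x = - divergence V x"
  using divergence_eq[OF has_derivative_minus[OF Ck_on_SucD(1)[OF assms]], of x]
  by (simp add: divergence_def sum_negf)

lemma eigenvalue_sequence_mono:
  assumes "eigenvalue_sequence \<Omega> \<eta> T \<alpha> \<sigma>" "1 \<le> i" "i \<le> j"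
  shows "\<sigma> i \<le> \<sigma> j"
  using assms(3,2)
proof (induction j rule: dec_induct)
  case (step j)
  then show ?case using assms(1) by (auto simp: eigenvalue_sequence_def intro: order_trans)
qed simp

context elliptic
begin

abbreviation bw :: "real^'n \<Rightarrow> real^'n \<Rightarrow> real^'n \<Rightarrow> real" where
  "bw \<equiv> \<lambda>x b c. w x * (b \<bullet> c)"

lemma ifm_bw_val: "ifm L bw (\<lambda>x. val (J x)) (\<lambda>x. val (K x)) = ifm L Nf J K"
  by (simp add: ifm_def Nf_def)

lemma bop_val: "bop L (\<lambda>x. val)"
  by (rule bop_const) (simp add: linear_iff val_linear)

lemma val_nth: "val j $ l = fst (j $ l)"
  by (simp add: val_def)

lemma inner_val: "a \<bullet> val k = (\<Sum>l\<in>UNIV. a $ l * fst (k $ l))"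
  by (simp add: val_def inner_vec_def)

lemma L2_val: "L2 L J \<Longrightarrow> L2 L (\<lambda>x. val (J x))"
  by (rule bop_L2[OF bop_val])

section \<open>Lower bound for Rayleigh quotients\<close>

lemma spectral_bound:
  assumes ev: "eigenvalue_sequence \<Omega> \<eta> T \<alpha> \<sigma>"
    and u: "\<And>i. i \<ge> 1 \<Longrightarrow> u i \<in> eigenspace \<Omega> \<eta> T \<alpha> (\<sigma> i)"
    and on: "\<And>i j. i \<ge> 1 \<Longrightarrow> j \<ge> 1 \<Longrightarrow> ifm L Nf (weak_jet \<Omega> (u i)) (weak_jet \<Omega> (u j)) = (if i = j then 1 else 0)"
    and W: "V0 \<Omega> W" and orth: "\<And>j. 1 \<le> j \<Longrightarrow> j \<le> k \<Longrightarrow> ifm L Nf W (weak_jet \<Omega> (u j)) = 0"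
  shows "\<sigma> (k + 1) * ifm L Nf W W \<le> ifm L Qf W W"
proof (rule ccontr)
  assume "\<not> \<sigma> (k + 1) * ifm L Nf W W \<le> ifm L Qf W W"
  then have lt: "ifm L Qf W W < \<sigma> (k + 1) * ifm L Nf W W" by simp
  define J where "J j = weak_jet \<Omega> (u j)" for j
  have VJ: "V0 \<Omega> (J j)" if "1 \<le> j" for j unfolding J_def by (rule eigenspace_V0[OF u[OF that]])
  obtain c where c: "0 < c" "\<And>J. L2 L J \<Longrightarrow> c * L2_sqnorm L J \<le> ifm L Qf J J + ifm L Nf J J"
    by (rule coercive) blast
  obtain v \<mu> where v: "V0 \<Omega> v" "\<mu> < \<sigma> (k + 1)" "ifm L Nf v v = 1"
    "\<And>j. j \<in> {1..k} \<Longrightarrow> ifm L Nf v (J j) = 0" "\<And>K. V0 \<Omega> K \<Longrightarrow> ifm L Qf v K = \<mu> * ifm L Nf v K"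
  proof (rule L.Rayleigh_minimizer[where V="V0 \<Omega>" and N=Nf and Q=Qf and A="{1..k}" and u=J and s=\<sigma>
        and c=c and t="\<sigma> (k + 1)" and ?w0.0=W and 'i="'n \<times> ('n \<Rightarrow> int)"])
    show "ifm L Qf (J j) K = \<sigma> j * ifm L Nf (J j) K" if "j \<in> {1..k}" "V0 \<Omega> K" for j K
      unfolding J_def using that by (intro eigenspace_weak_form u) auto
    show "ifm L Nf (J i) (J j) = (if i = j then 1 else 0)" if "i \<in> {1..k}" "j \<in> {1..k}" for i j
      unfolding J_def using that by (intro on) auto
    show "ifm L Nf W (J j) = 0" if "j \<in> {1..k}" for j unfolding J_def using that by (intro orth) auto
    show "c * L2_sqnorm L f \<le> ifm L Qf f f + ifm L Nf f f" if "V0 \<Omega> f" for f by (rule c(2)[OF V0_L2[OF that]])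
    show "V0 \<Omega> (J j)" if "j \<in> {1..k}" for j using that by (intro VJ) auto
    show "\<exists>(I :: ('n \<times> ('n \<Rightarrow> int)) set) g. finite I \<and> (\<forall>i. L2 L (g i)) \<and>
      (\<forall>f. V0 \<Omega> f \<longrightarrow> ifm L Nf f f \<le> (\<Sum>i\<in>I. (LINT x|L. g i x \<bullet> f x)\<^sup>2) + e * ifm L Qf f f)" if "0 < e" for e
      by (rule V0_compactness[OF that])
    show "ifm L Qf W W < \<sigma> (k + 1) * ifm L Nf W W" by (rule lt)
  qed (auto intro: V0_L2 V0_add V0_scaleR V0_closed bform_Nf bform_Qf Nf_sym Qf_sym ifm_Nf_nonneg ifm_Qf_nonneg c(1) W)
  define E where "E = eigenspace \<Omega> \<eta> T \<alpha> \<mu>"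
  define B where "B = {i. 1 \<le> i \<and> \<sigma> i = \<mu>}"
  \<comment> \<open>As \<mu> < \<sigma> (k + 1) and the sequence increases, all occurrences of \<mu>
    have index at most k, so \<open>v\<close> is orthogonal to all of their eigenfunctions.\<close>
  have Bk: "B \<subseteq> {1..k}"
  proof
    fix i assume i: "i \<in> B"
    have "\<not> k + 1 \<le> i"
    proof
      assume "k + 1 \<le> i"
      from eigenvalue_sequence_mono[OF ev _ this] have "\<sigma> (k + 1) \<le> \<sigma> i" by simp
      then show False using i v(2) by (simp add: B_def)
    qed
    then show "i \<in> {1..k}" using i by (simp add: B_def)
  qed
  have fB: "finite B" using Bk finite_subset by blast
  have "has_dim_ae L E (card B)" using ev by (simp add: eigenvalue_sequence_def E_def B_def)
  then obtain b where b: "\<And>f. f \<in> E \<Longrightarrow> \<exists>a. AE x in L. f x = (\<Sum>i<card B. a i *\<^sub>R b i x)"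
    unfolding has_dim_ae_def by (elim exE conjE) (rule that, erule (1) bspec)
  \<comment> \<open>Index 0 belongs to no eigenvalue of the sequence and is free for the additional
    eigenfunction \<open>v\<close>.\<close>
  define F where "F i = (if i = 0 then v else J i)" for i
  define f where "f i x = val (F i x)" for i x
  define I where "I = insert 0 B"
  have I: "finite I" "card B < card I" using fB by (auto simp: I_def B_def)
  have VF: "V0 \<Omega> (F i)" if "i \<in> I" for i using that v(1) VJ by (auto simp: F_def I_def B_def)
  have fE: "f i \<in> E" if "i \<in> I" for i
  proof (cases "i = 0")
    case True
    then show ?thesis using weak_form_eigenspace[OF v(1,5)] by (simp add: f_def[abs_def] F_def E_def)
  next
    case False
    then have "i \<in> B" using that by (simp add: I_def)
    then show ?thesis using u[of i] by (simp add: f_def[abs_def] F_def J_def val_weak_jet E_def B_def False)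
  qed
  have Lf: "L2 L (f i)" if "i \<in> I" for i
    unfolding f_def[abs_def] by (rule L2_val[OF V0_L2[OF VF[OF that]]])
  have fon: "ifm L bw (f i) (f j) = (if i = j then 1 else 0)" if i: "i \<in> I" and j: "j \<in> I" for i j
  proof -
    have vJ: "ifm L Nf v (J j) = 0" "ifm L Nf (J j) v = 0" if "j \<in> B" for j
      using v(4)[of j] that Bk ifm_Nf_sym[of "J j" v] by auto
    have JJ: "ifm L Nf (J i) (J j) = (if i = j then 1 else 0)" if "i \<in> B" "j \<in> B" for i j
      using that on unfolding J_def B_def by auto
    have "0 \<notin> B" by (simp add: B_def)
    then show ?thesis unfolding f_def[abs_def] ifm_bw_val
      using i j vJ JJ v(3) by (auto simp: F_def I_def)
  qed
  have "\<forall>i\<in>I. \<exists>a. AE x in L. f i x = (\<Sum>j<card B. a j *\<^sub>R b j x)"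
    by (intro ballI b fE)
  from bchoice[OF this] obtain a where a: "\<And>i. i \<in> I \<Longrightarrow> AE x in L. f i x = (\<Sum>j<card B. a i j *\<^sub>R b j x)"
    by (elim exE) (rule that, erule (1) bspec)
  \<comment> \<open>The card B + 1 functions have only card B coordinates each, so they satisfy a
    nontrivial relation; orthonormality then makes every coefficient 0.\<close>
  obtain t where t: "\<exists>i\<in>I. t i \<noteq> 0" "\<And>j. j < card B \<Longrightarrow> (\<Sum>i\<in>I. t i * a i j) = 0"
    using homogeneous_system_nontrivial[OF I, of a] by blast
  have "AE x in L. \<forall>i\<in>I. f i x = (\<Sum>j<card B. a i j *\<^sub>R b j x)"
    by (rule AE_finite_allI[OF I(1) a])
  then have z: "AE x in L. (\<Sum>i\<in>I. t i *\<^sub>R f i x) = 0"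
  proof eventually_elim
    case (elim x)
    then have "(\<Sum>i\<in>I. t i *\<^sub>R f i x) = (\<Sum>i\<in>I. \<Sum>j<card B. (t i * a i j) *\<^sub>R b j x)"
      by (simp add: scaleR_sum_right)
    also have "\<dots> = (\<Sum>j<card B. (\<Sum>i\<in>I. t i * a i j) *\<^sub>R b j x)"
      by (subst sum.swap) (simp add: scaleR_sum_left)
    also have "\<dots> = 0" using t(2) by simp
    finally show ?case .
  qed
  have "t i = 0" if i: "i \<in> I" for i
  proof -
    have Ls: "L2 L (\<lambda>x. \<Sum>i\<in>I. t i *\<^sub>R f i x)" by (intro L2_sum L2_scaleR Lf)
    have "ifm L bw (\<lambda>x. \<Sum>i\<in>I. t i *\<^sub>R f i x) (f i) = ifm L bw (\<lambda>x. 0) (f i)"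
      by (rule ifm_cong_AE[OF bform_w Ls Lf[OF i] L2_zero Lf[OF i] z]) simp
    also have "\<dots> = 0" by (rule ifm_zero(1)[OF bform_w])
    also have "ifm L bw (\<lambda>x. \<Sum>i\<in>I. t i *\<^sub>R f i x) (f i) = (\<Sum>j\<in>I. t j * ifm L bw (f j) (f i))"
      by (rule ifm_sum_left[OF bform_w Lf Lf[OF i]])
    also have "\<dots> = (\<Sum>j\<in>I. if j = i then t i else 0)"
      by (rule sum.cong) (use fon i in auto)
    also have "\<dots> = t i" using I i by simp
    finally show ?thesis .
  qed
  then show False using t(1) by blast
qed

section \<open>The commutator with a coordinate as a first order operator\<close>

definition tp :: "'n \<Rightarrow> real^'n \<Rightarrow> real^'n" where
  "tp p x = T x *v axis p 1"

text \<open>Component p is L applied to the coordinate x_p, that is, the weighted divergence of T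
  e_p. The negative of this field is what T acts on under the divergence in
  \<open>const_C0\<close>.\<close>

definition Zf :: "real^'n \<Rightarrow> real^'n" where
  "Zf x = tr_nabla T x - T x *v grad \<eta> x"

lemma tp_inner: "tp p x \<bullet> v = (T x *v v) $ p"
  unfolding tp_def T_sym by (simp add: inner_axis inner_commute[of "axis p 1"])

lemma Ck_tp: "Ck_on k (tp p) UNIV"
  unfolding tp_def[abs_def] by (rule Ck_on_bilinear[OF bounded_bilinear_mv Ck_T Ck_on_const])

lemma Ck_tr_nabla: "Ck_on k (tr_nabla T) UNIV"
  unfolding tr_nabla_def[abs_def]
  by (intro Ck_on_sum Ck_on_bilinear[OF bounded_bilinear_mv] Ck_on_const Ck_on_SucD(2)[OF Ck_T])

lemma C1_Zf: "Ck_on (Suc 0) Zf UNIV"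
  unfolding Zf_def[abs_def]
  by (intro Ck_on_diff Ck_tr_nabla Ck_on_bilinear[OF bounded_bilinear_mv Ck_T C1_grad_\<eta>])

text \<open>The two sums differ by a transposition of the derivative of T in each direction, and
  this derivative is symmetric because T is.\<close>

lemma divergence_tp: "divergence (tp p) x = tr_nabla T x $ p"
proof -
  define D where "D = frechet_derivative T (at x)"
  have D: "(T has_derivative D) (at x)" unfolding D_def by (rule Ck_on_SucD(1)[OF Ck_T])
  have comp: "((\<lambda>x. T x $ i $ j) has_derivative (\<lambda>v. D v $ i $ j)) (at x)" for i j
    by (intro bounded_linear.has_derivative[OF bounded_linear_vec_nth] D)
  have "T x $ i $ j = T x $ j $ i" for x i j
  proof -
    have "transpose (T x) = T x" using T_spd[of x] by (simp add: symmetric_pos_def_def)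
    from arg_cong[OF this, of "\<lambda>A. A $ j $ i"] show ?thesis by (simp add: transpose_def)
  qed
  then have "(\<lambda>x. T x $ i $ j) = (\<lambda>x. T x $ j $ i)" for i j by (intro ext)
  then have "((\<lambda>x. T x $ i $ j) has_derivative (\<lambda>v. D v $ j $ i)) (at x)" for i j
    using comp[of j i] by simp
  from has_derivative_unique[OF comp this] have sym: "D v $ i $ j = D v $ j $ i" for v i j
    by (rule fun_cong)
  have "(tp p has_derivative (\<lambda>v. D v *v axis p 1)) (at x)"
    unfolding tp_def[abs_def] using bounded_bilinear.FDERIV[OF bounded_bilinear_mv D has_derivative_const[of "axis p 1"]]
    by simp
  then have "divergence (tp p) x = (\<Sum>j\<in>UNIV. (D (axis j 1) *v axis p 1) $ j)" by (rule divergence_eq)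
  also have "\<dots> = (\<Sum>j\<in>UNIV. D (axis j 1) $ j $ p)"
    by (simp add: matrix_vector_mult_basis column_def)
  also have "\<dots> = (\<Sum>j\<in>UNIV. D (axis j 1) $ p $ j)" by (simp add: sym)
  also have "\<dots> = tr_nabla T x $ p"
    by (simp add: tr_nabla_def D_def matrix_vector_mult_basis column_def)
  finally show ?thesis .
qed

lemma divergence_w_scaleR:
  assumes "Ck_on (Suc 0) V UNIV"
  shows "divergence (\<lambda>x. w x *\<^sub>R V x) x = w x * (divergence V x - grad \<eta> x \<bullet> V x)"
  unfolding divergence_scaleR[OF C1_w assms] grad_w by (simp add: algebra_simps)

lemma divergence_w_tp: "divergence (\<lambda>x. w x *\<^sub>R tp p x) x = w x * Zf x $ p"
  unfolding divergence_w_scaleR[OF Ck_tp] divergence_tp inner_commute[of "grad \<eta> x"] tp_inner Zf_def by simp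

text \<open>\<open>Ap p\<close> is the commutator of \<open>\<L>\<close> with multiplication by the coordinate \<open>x\<^sub>p\<close>, as a first
  order operator on jets.\<close>

definition Ap :: "'n \<Rightarrow> real^'n \<Rightarrow> 'n vjet \<Rightarrow> real^'n" where
  "Ap p x j = (\<chi> l. 2 * (tp p x \<bullet> snd (j $ l)) + Zf x $ p * fst (j $ l))"

text \<open>The antisymmetric density of the commutator: half of the derivative has been moved to
  the second argument, which removes the zero order coefficient \<open>Zf\<close>.\<close>

definition Cf :: "'n \<Rightarrow> real^'n \<Rightarrow> 'n vjet \<Rightarrow> 'n vjet \<Rightarrow> real" where
  "Cf p x j k = w x * (\<Sum>l\<in>UNIV. (tp p x \<bullet> snd (j $ l)) * fst (k $ l) - fst (j $ l) * (tp p x \<bullet> snd (k $ l)))"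

definition Xj :: "'n \<Rightarrow> real^'n \<Rightarrow> 'n vjet \<Rightarrow> 'n vjet" where
  "Xj p x j = (\<chi> l. jet_mult (\<lambda>y. y $ p) x (j $ l))"

lemma C1_coord: "Ck_on k (\<lambda>y::real^'n. y $ p) UNIV"
  by (rule Ck_on_id[OF bounded_linear_vec_nth])

lemma grad_coord: "grad (\<lambda>y::real^'n. y $ p) x = axis p 1"
  by (rule grad_eqI)
    (simp add: inner_axis' bounded_linear_imp_has_derivative[OF bounded_linear_vec_nth])

lemma fst_Xj: "fst (Xj p x j $ l) = x $ p * fst (j $ l)"
  and snd_Xj: "snd (Xj p x j $ l) = (x $ p) *\<^sub>R snd (j $ l) + fst (j $ l) *\<^sub>R axis p 1"
  by (simp_all add: Xj_def jet_mult_def grad_coord)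

lemma val_Xj: "val (Xj p x j) = (x $ p) *\<^sub>R val j"
  by (simp add: val_def fst_Xj vec_eq_iff)

lemma V0_Xj: "V0 \<Omega> J \<Longrightarrow> V0 \<Omega> (\<lambda>x. Xj p x (J x))"
  unfolding V0_def Xj_def by (simp add: S0_mult[OF C1_coord])

lemma dv_Xj: "dv x (Xj p x j) = x $ p * dv x j + val j $ p"
proof -
  have "(\<Sum>l\<in>UNIV. snd (Xj p x j $ l) $ l) = x $ p * (\<Sum>l\<in>UNIV. snd (j $ l) $ l) + (\<Sum>l\<in>UNIV. if l = p then fst (j $ p) else 0)"
    unfolding sum_distrib_left sum.distrib[symmetric] by (intro sum.cong) (auto simp: snd_Xj axis_def)
  then show ?thesis by (simp add: dv_def val_Xj val_nth algebra_simps)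
qed

lemma bop_Ap: "bop L (Ap p)"
proof (rule bop_continuous[OF bounded_\<Omega> sets_\<Omega>])
  show "linear (Ap p x)" for x
    by (auto simp: linear_iff Ap_def vec_eq_iff inner_add_right algebra_simps)
  show "continuous_on UNIV (\<lambda>x. Ap p x b)" for b
    unfolding Ap_def by (intro continuous_intros C1_continuous[OF C1_Zf] C1_continuous[OF Ck_tp])
qed

lemma bform_Cf: "bform L (Cf p)"
proof (rule bform_continuous[OF bounded_\<Omega> sets_\<Omega>])
  show "bilinear (Cf p x)" for x
    by (auto simp: bilinear_def linear_iff Cf_def inner_add_right sum.distrib sum_distrib_left sum_subtractf algebra_simps)
  show "continuous_on UNIV (\<lambda>x. Cf p x b c)" for b c
    unfolding Cf_def by (intro continuous_intros continuous_w C1_continuous[OF Ck_tp])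
qed

lemma Cf_antisym: "Cf p x j k = - Cf p x k j"
  by (simp add: Cf_def sum_subtractf algebra_simps)

text \<open>Componentwise the two integrands differ by the divergence of f g w T e_p, because the
  divergence of w T e_p is w times component p of \<open>Zf\<close>.\<close>

lemma Ap_weak_form:
  assumes J: "V0 \<Omega> J" and K: "V0 \<Omega> K"
  shows "ifm L bw (\<lambda>x. Ap p x (J x)) (\<lambda>x. val (K x)) = ifm L (Cf p) J K"
proof -
  note LJ = V0_L2[OF J] and LK = V0_L2[OF K]
  define W where "W x = w x *\<^sub>R tp p x" for x
  have C1W: "Ck_on (Suc 0) W UNIV" unfolding W_def[abs_def] by (rule Ck_on_scaleR[OF C1_w Ck_tp])
  have SJ: "S0 \<Omega> (\<lambda>x. J x $ l)" and SK: "S0 \<Omega> (\<lambda>x. K x $ l)" for l using J K by (auto simp: V0_def)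
  have dW: "divergence W x = w x * Zf x $ p" for x unfolding W_def[abs_def] by (rule divergence_w_tp)
  have pw: "w x * (Ap p x j \<bullet> val k) - Cf p x j k = (\<Sum>l\<in>UNIV. ibp_form W x (j $ l) (k $ l))" for x j k
    by (simp add: inner_val Ap_def Cf_def ibp_form_def dW W_def sum_distrib_left
        sum_subtractf[symmetric] algebra_simps)
  have i1: "integrable L (\<lambda>x. w x * (Ap p x (J x) \<bullet> val (K x)))"
    by (rule bform_integrable[OF bform_w bop_L2[OF bop_Ap LJ] L2_val[OF LK]])
  have i2: "integrable L (\<lambda>x. Cf p x (J x) (K x))" by (rule bform_integrable[OF bform_Cf LJ LK])
  have i3: "integrable L (\<lambda>x. ibp_form W x (J x $ l) (K x $ l))" for l
    by (rule bform_integrable[OF bform_ibp[OF C1W] S0_L2[OF SJ] S0_L2[OF SK]])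
  have "ifm L bw (\<lambda>x. Ap p x (J x)) (\<lambda>x. val (K x)) - ifm L (Cf p) J K
      = (LINT x|L. (\<Sum>l\<in>UNIV. ibp_form W x (J x $ l) (K x $ l)))"
    unfolding ifm_def pw[symmetric] by (rule Bochner_Integration.integral_diff[OF i1 i2, symmetric])
  also have "\<dots> = (\<Sum>l\<in>UNIV. ifm L (ibp_form W) (\<lambda>x. J x $ l) (\<lambda>x. K x $ l))"
    unfolding ifm_def by (rule Bochner_Integration.integral_sum[OF i3])
  also have "\<dots> = 0" by (intro sum.neutral ballI integration_by_parts[OF C1W SJ SK])
  finally show ?thesis by simp
qed

lemma trace_bounds:
  assumes "x \<in> \<Omega>"
  shows "real CARD('n) * \<epsilon> \<le> (\<Sum>p\<in>UNIV. tp p x $ p)" "(\<Sum>p\<in>UNIV. tp p x $ p) \<le> real CARD('n) * \<delta>"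
proof -
  have t: "tp p x $ p = axis p 1 \<bullet> (T x *v axis p 1)" for p by (simp add: tp_def inner_axis')
  have a: "axis p (1::real) \<bullet> (axis p 1 :: real^'n) = 1" for p by (simp add: inner_axis)
  have "(\<Sum>p\<in>(UNIV::'n set). \<epsilon>) \<le> (\<Sum>p\<in>UNIV. tp p x $ p)"
    unfolding t using T_lower[OF assms] by (intro sum_mono) (metis a mult.right_neutral)
  then show "real CARD('n) * \<epsilon> \<le> (\<Sum>p\<in>UNIV. tp p x $ p)" by simp
  have "(\<Sum>p\<in>UNIV. tp p x $ p) \<le> (\<Sum>p\<in>(UNIV::'n set). \<delta>)"
    unfolding t using T_upper[OF assms] by (intro sum_mono) (metis a mult.right_neutral)
  then show "(\<Sum>p\<in>UNIV. tp p x $ p) \<le> real CARD('n) * \<delta>" by simp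
qed

text \<open>A double commutator with x_p has order zero, so the identity is pointwise: all terms
  with derivatives cancel by the symmetry of T. Once the equation of u is tested with the square of
  x_p times u, the second energy becomes the eigenvalue times the squared norm of x_p u.\<close>

lemma Qf_Xj: "Qf x (Xj p x j) (Xj p x j) - Qf x j (Xj p x (Xj p x j))
  = w x * (tp p x $ p * (val j \<bullet> val j) + \<alpha> * (val j $ p)\<^sup>2)"
proof -
  have e: "(T x *v snd (Xj p x j $ l)) \<bullet> snd (Xj p x j $ l)
      = (T x *v snd (j $ l)) \<bullet> snd (Xj p x (Xj p x j) $ l) + tp p x $ p * (fst (j $ l))\<^sup>2" for l
  proof -
    define U where "U = snd (j $ l)"
    define f where "f = fst (j $ l)"
    have s: "(T x *v axis p 1) \<bullet> U = (T x *v U) \<bullet> axis p 1" 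
      unfolding T_sym[of x "axis p 1" U] by (rule inner_commute)
    have t: "(T x *v axis p 1) \<bullet> axis p 1 = tp p x $ p" by (simp add: tp_def inner_axis)
    show ?thesis
      unfolding snd_Xj fst_Xj U_def[symmetric] f_def[symmetric]
      by (simp only: matrix_vector_right_distrib matrix_vector_mult_scaleR inner_add_left inner_add_right
          inner_scaleR_left inner_scaleR_right s t) algebra
  qed
  have v: "val j \<bullet> val j = (\<Sum>l\<in>UNIV. (fst (j $ l))\<^sup>2)" by (simp add: val_def inner_vec_def power2_eq_square)
  show ?thesis
    unfolding Qf_def e dv_Xj v
    by (simp add: sum.distrib sum_distrib_left val_Xj power2_eq_square algebra_simps)
qed

text \<open>The same cancellation for the commutator of L alone; the \<alpha> part of the operator
  takes no part in it, so only the diagonal entry of T remains.\<close>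

lemma Cf_Xj: "Cf p x j (Xj p x j) = - (w x * (tp p x $ p * (val j \<bullet> val j)))"
proof -
  have t: "tp p x \<bullet> axis p 1 = tp p x $ p" by (simp add: inner_axis)
  have "(tp p x \<bullet> snd (j $ l)) * fst (Xj p x j $ l) - fst (j $ l) * (tp p x \<bullet> snd (Xj p x j $ l))
      = - (tp p x $ p * (fst (j $ l))\<^sup>2)" for l
    unfolding fst_Xj snd_Xj by (simp add: inner_add_right t power2_eq_square algebra_simps)
  then show ?thesis by (simp add: Cf_def val_def inner_vec_def sum_negf sum_distrib_left power2_eq_square)
qed

text \<open>Summing over the coordinates replaces the diagonal entries by the trace of T, at most n
  \<delta>, and the \<alpha> terms add up to \<alpha> |u|^2, without a factor n.\<close>

lemma sum_theta_le:
  assumes J: "V0 \<Omega> J"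
  shows "(\<Sum>p\<in>UNIV. ifm L Qf (\<lambda>x. Xj p x (J x)) (\<lambda>x. Xj p x (J x)) - ifm L Qf J (\<lambda>x. Xj p x (Xj p x (J x))))
    \<le> (real CARD('n) * \<delta> + \<alpha>) * ifm L Nf J J"
proof -
  note LJ = V0_L2[OF J] and LX = V0_L2[OF V0_Xj[OF J]] and LXX = V0_L2[OF V0_Xj[OF V0_Xj[OF J]]]
  have i: "integrable L (\<lambda>x. Qf x (Xj p x (J x)) (Xj p x (J x)))" "integrable L (\<lambda>x. Qf x (J x) (Xj p x (Xj p x (J x))))" for p
    by (rule bform_integrable[OF bform_Qf LX LX], rule bform_integrable[OF bform_Qf LJ LXX])
  have "(\<Sum>p\<in>UNIV. ifm L Qf (\<lambda>x. Xj p x (J x)) (\<lambda>x. Xj p x (J x)) - ifm L Qf J (\<lambda>x. Xj p x (Xj p x (J x))))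
      = (LINT x|L. (\<Sum>p\<in>UNIV. Qf x (Xj p x (J x)) (Xj p x (J x)) - Qf x (J x) (Xj p x (Xj p x (J x)))))"
    unfolding ifm_def using i by simp
  also have "\<dots> \<le> (LINT x|L. (real CARD('n) * \<delta> + \<alpha>) * Nf x (J x) (J x))"
  proof (rule integral_mono)
    show "integrable L (\<lambda>x. \<Sum>p\<in>UNIV. Qf x (Xj p x (J x)) (Xj p x (J x)) - Qf x (J x) (Xj p x (Xj p x (J x))))"
      using i by simp
    show "integrable L (\<lambda>x. (real CARD('n) * \<delta> + \<alpha>) * Nf x (J x) (J x))"
      using bform_integrable[OF bform_Nf LJ LJ] by simp
    fix x assume "x \<in> space L"
    then have x: "x \<in> \<Omega>" by simp
    let ?v = "val (J x)"
    have "(\<Sum>p\<in>UNIV. w x * (tp p x $ p * (?v \<bullet> ?v) + \<alpha> * (?v $ p)\<^sup>2))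
        = w x * ((\<Sum>p\<in>UNIV. tp p x $ p) * (?v \<bullet> ?v) + \<alpha> * (?v \<bullet> ?v))"
    proof -
      have "(\<Sum>p\<in>UNIV. (?v $ p)\<^sup>2) = ?v \<bullet> ?v" by (simp add: inner_vec_def power2_eq_square)
      then show ?thesis
        by (simp add: sum.distrib sum_distrib_left[symmetric] sum_distrib_right[symmetric])
    qed
    also have "\<dots> \<le> w x * (real CARD('n) * \<delta> * (?v \<bullet> ?v) + \<alpha> * (?v \<bullet> ?v))"
      using trace_bounds(2)[OF x] w_pos[of x] by (intro mult_left_mono add_right_mono mult_right_mono) auto
    finally show "(\<Sum>p\<in>UNIV. Qf x (Xj p x (J x)) (Xj p x (J x)) - Qf x (J x) (Xj p x (Xj p x (J x))))
        \<le> (real CARD('n) * \<delta> + \<alpha>) * Nf x (J x) (J x)"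
      unfolding Qf_Xj by (simp add: Nf_def algebra_simps)
  qed
  finally show ?thesis by (simp add: ifm_def)
qed

text \<open>The counterpart from below, with the trace of T at least n \<epsilon>. Together with
  \<open>sum_theta_le\<close> it accounts for the ratio of n \<delta> + \<alpha> to n \<epsilon> in
  the constant.\<close>

lemma sum_tau_ge:
  assumes J: "V0 \<Omega> J"
  shows "real CARD('n) * \<epsilon> * ifm L Nf J J \<le> (\<Sum>p\<in>UNIV. - ifm L (Cf p) J (\<lambda>x. Xj p x (J x)))"
proof -
  note LJ = V0_L2[OF J] and LX = V0_L2[OF V0_Xj[OF J]]
  have i: "integrable L (\<lambda>x. Cf p x (J x) (Xj p x (J x)))" for p
    by (rule bform_integrable[OF bform_Cf LJ LX])
  have "real CARD('n) * \<epsilon> * ifm L Nf J J = (LINT x|L. real CARD('n) * \<epsilon> * Nf x (J x) (J x))"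
    by (simp add: ifm_def)
  also have "\<dots> \<le> (LINT x|L. (\<Sum>p\<in>UNIV. - Cf p x (J x) (Xj p x (J x))))"
  proof (rule integral_mono)
    show "integrable L (\<lambda>x. real CARD('n) * \<epsilon> * Nf x (J x) (J x))"
      using bform_integrable[OF bform_Nf LJ LJ] by simp
    show "integrable L (\<lambda>x. \<Sum>p\<in>UNIV. - Cf p x (J x) (Xj p x (J x)))" using i by simp
    fix x assume "x \<in> space L"
    then have x: "x \<in> \<Omega>" by simp
    have "real CARD('n) * \<epsilon> * Nf x (J x) (J x) \<le> (\<Sum>p\<in>UNIV. tp p x $ p) * Nf x (J x) (J x)"
      using trace_bounds(1)[OF x] Nf_nonneg by (intro mult_right_mono) auto
    then show "real CARD('n) * \<epsilon> * Nf x (J x) (J x) \<le> (\<Sum>p\<in>UNIV. - Cf p x (J x) (Xj p x (J x)))"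
      unfolding Cf_Xj minus_minus Nf_def sum_distrib_right by (simp add: mult_ac)
  qed
  also have "\<dots> = (\<Sum>p\<in>UNIV. - ifm L (Cf p) J (\<lambda>x. Xj p x (J x)))"
    unfolding ifm_def using i by simp
  finally show ?thesis .
qed

text \<open>The Cauchy-Schwarz inequality of the form <T a, b>, applied to v and T v, and the bound
  T <= \<delta> I applied to T v; one factor |T v|^2 then cancels.\<close>

lemma T_square_le:
  assumes x: "x \<in> \<Omega>"
  shows "(T x *v v) \<bullet> (T x *v v) \<le> \<delta> * ((T x *v v) \<bullet> v)"
proof -
  define y where "y = T x *v v"
  have "(y \<bullet> y)\<^sup>2 \<le> ((T x *v v) \<bullet> v) * ((T x *v y) \<bullet> y)"
  proof (rule quadratic_nonneg_discriminant)
    fix t :: real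
    have "0 \<le> (T x *v (v - t *\<^sub>R y)) \<bullet> (v - t *\<^sub>R y)" by (rule T_psd)
    also have "(T x *v y) \<bullet> v = y \<bullet> y" unfolding T_sym by (simp add: y_def)
    then have "(T x *v (v - t *\<^sub>R y)) \<bullet> (v - t *\<^sub>R y) = (T x *v v) \<bullet> v - 2 * t * (y \<bullet> y) + t\<^sup>2 * ((T x *v y) \<bullet> y)"
      by (simp add: matrix_vector_mult_diff_distrib matrix_vector_mult_scaleR inner_diff_left inner_diff_right
          y_def[symmetric] power2_eq_square algebra_simps)
    finally show "0 \<le> (T x *v v) \<bullet> v - 2 * t * (y \<bullet> y) + t\<^sup>2 * ((T x *v y) \<bullet> y)" .
  qed (rule T_psd)
  also have "\<dots> \<le> ((T x *v v) \<bullet> v) * (\<delta> * (y \<bullet> y))"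
    using T_upper[OF x, of y] T_psd by (intro mult_left_mono) (auto simp: inner_commute)
  finally have "(y \<bullet> y) * (y \<bullet> y) \<le> (\<delta> * ((T x *v v) \<bullet> v)) * (y \<bullet> y)" by (simp add: power2_eq_square mult_ac)
  moreover have "0 \<le> \<delta> * ((T x *v v) \<bullet> v)" using \<delta>_pos T_psd by simp
  ultimately have "y \<bullet> y \<le> \<delta> * ((T x *v v) \<bullet> v)"
    by (cases "y \<bullet> y = 0") (auto simp: mult_le_cancel_right)
  then show ?thesis by (simp add: y_def)
qed

end

text \<open>The double sums coming from the non-orthogonality cancel: after symmetrizing in \<open>i\<close> and
  \<open>j\<close> they combine into \<open>- (s\<^sub>i + s\<^sub>j) (\<rho> X\<^sup>2 + X c + c\<^sup>2 / (4 \<rho>)) \<le> 0\<close> with \<open>X = (s\<^sub>i - s\<^sub>j) a\<close>.\<close>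

lemma yang_algebra:
  fixes s n \<theta> \<tau> A :: "'i \<Rightarrow> real" and a c :: "'i \<Rightarrow> 'i \<Rightarrow> real"
  assumes s: "\<And>i. i \<in> I \<Longrightarrow> 0 \<le> s i" and \<rho>: "0 < \<rho>"
    and a: "\<And>i j. a i j = a j i" and c: "\<And>i j. c i j = - c j i"
    and 1: "\<And>i. i \<in> I \<Longrightarrow> s i * n i \<le> \<theta> i + (\<Sum>j\<in>I. (s j - s i) * (a i j)\<^sup>2)"
    and 2: "\<And>i r. i \<in> I \<Longrightarrow> 2 * r * (\<tau> i + (\<Sum>j\<in>I. a i j * c i j)) \<le> r\<^sup>2 * n i + A i - (\<Sum>j\<in>I. (c i j)\<^sup>2)"
  shows "(\<Sum>i\<in>I. (s i)\<^sup>2 * \<tau> i) \<le> \<rho> * (\<Sum>i\<in>I. (s i)\<^sup>2 * \<theta> i) + (\<Sum>i\<in>I. s i * A i) / (4 * \<rho>)"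
proof -
  define f where "f i j = \<rho> * (s i)\<^sup>2 * ((s j - s i) * (a i j)\<^sup>2) - s i / (4 * \<rho>) * (c i j)\<^sup>2 - (s i)\<^sup>2 * (a i j * c i j)" for i j
  have row: "(s i)\<^sup>2 * \<tau> i \<le> \<rho> * ((s i)\<^sup>2 * \<theta> i) + s i * A i / (4 * \<rho>) + (\<Sum>j\<in>I. f i j)" if i: "i \<in> I" for i
  proof -
    let ?Y = "\<Sum>j\<in>I. (s j - s i) * (a i j)\<^sup>2" and ?C = "\<Sum>j\<in>I. (c i j)\<^sup>2" and ?B = "\<Sum>j\<in>I. a i j * c i j"
    \<comment> \<open>Hypothesis 2 is taken with r = 2 \<rho> s_i and multiplied by s_i / (4
      \<rho>). The term in n_i then becomes \<open>\<rho> * (s i)\<^sup>2\<close> times s_i n_i, to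
      which hypothesis 1 applies.\<close>
    have "s i / (4 * \<rho>) * (2 * (2 * \<rho> * s i) * (\<tau> i + ?B)) \<le> s i / (4 * \<rho>) * ((2 * \<rho> * s i)\<^sup>2 * n i + A i - ?C)"
      using s[OF i] \<rho> by (intro mult_left_mono 2[OF i]) auto
    moreover have "s i / (4 * \<rho>) * (2 * (2 * \<rho> * s i) * (\<tau> i + ?B)) = (s i)\<^sup>2 * (\<tau> i + ?B)"
      using \<rho> by (simp add: field_simps power2_eq_square)
    moreover have "s i / (4 * \<rho>) * ((2 * \<rho> * s i)\<^sup>2 * n i + A i - ?C)
        = \<rho> * (s i)\<^sup>2 * (s i * n i) + s i * A i / (4 * \<rho>) - s i / (4 * \<rho>) * ?C"
      using \<rho> by (simp add: field_simps power2_eq_square)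
    moreover have "\<rho> * (s i)\<^sup>2 * (s i * n i) \<le> \<rho> * (s i)\<^sup>2 * (\<theta> i + ?Y)"
      using \<rho> by (intro mult_left_mono 1[OF i]) auto
    moreover have "(\<Sum>j\<in>I. f i j) = \<rho> * (s i)\<^sup>2 * ?Y - s i / (4 * \<rho>) * ?C - (s i)\<^sup>2 * ?B"
      by (simp add: f_def sum_subtractf sum_distrib_left)
    ultimately show ?thesis by (simp add: algebra_simps)
  qed
  have neg: "f i j + f j i \<le> 0" if "i \<in> I" "j \<in> I" for i j
  proof -
    have "f i j + f j i = - ((s i + s j) * (\<rho> * ((s i - s j) * a i j)\<^sup>2 + (s i - s j) * a i j * c i j + (c i j)\<^sup>2 / (4 * \<rho>)))"
      unfolding f_def a[of j i] c[of j i] using \<rho> by (simp add: field_simps power2_eq_square)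
    also have "\<rho> * ((s i - s j) * a i j)\<^sup>2 + (s i - s j) * a i j * c i j + (c i j)\<^sup>2 / (4 * \<rho>)
        = (2 * \<rho> * ((s i - s j) * a i j) + c i j)\<^sup>2 / (4 * \<rho>)"
      using \<rho> by (simp add: field_simps power2_eq_square)
    finally have "f i j + f j i = - ((s i + s j) * ((2 * \<rho> * ((s i - s j) * a i j) + c i j)\<^sup>2 / (4 * \<rho>)))" .
    moreover have "0 \<le> (s i + s j) * ((2 * \<rho> * ((s i - s j) * a i j) + c i j)\<^sup>2 / (4 * \<rho>))"
      using s[OF that(1)] s[OF that(2)] \<rho> by (intro mult_nonneg_nonneg) auto
    ultimately show ?thesis by linarith
  qed
  have "2 * (\<Sum>i\<in>I. \<Sum>j\<in>I. f i j) = (\<Sum>i\<in>I. \<Sum>j\<in>I. f i j + f j i)"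
    using sum.swap[of f I I] by (simp add: sum.distrib)
  also have "\<dots> \<le> 0" by (intro sum_nonpos neg)
  finally have F: "(\<Sum>i\<in>I. \<Sum>j\<in>I. f i j) \<le> 0" by simp
  have "(\<Sum>i\<in>I. (s i)\<^sup>2 * \<tau> i) \<le> (\<Sum>i\<in>I. \<rho> * ((s i)\<^sup>2 * \<theta> i) + s i * A i / (4 * \<rho>) + (\<Sum>j\<in>I. f i j))"
    by (intro sum_mono row)
  also have "\<dots> = \<rho> * (\<Sum>i\<in>I. (s i)\<^sup>2 * \<theta> i) + (\<Sum>i\<in>I. s i * A i) / (4 * \<rho>) + (\<Sum>i\<in>I. \<Sum>j\<in>I. f i j)"
    by (simp add: sum.distrib sum_distrib_left sum_divide_distrib)
  finally show ?thesis using F by simp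
qed

section \<open>The squared commutators and Yang's inequality\<close>

context elliptic
begin

text \<open>The origin of the constants: expanding in tr(nabla T) and T(\<nabla>\<eta>), the mixed
  products cancel. What remains is |tr(nabla T)|^2 plus four times the expression under the supremum
  in \<open>const_C0\<close>.\<close>

lemma Zf_square:
  "Zf x \<bullet> Zf x - 2 * divergence (\<lambda>y. T y *v Zf y) x + 2 * (grad \<eta> x \<bullet> (T x *v Zf x))
    = (norm (tr_nabla T x))\<^sup>2 + 4 * (1/2 * divergence (\<lambda>y. T y *v (T y *v grad \<eta> y - tr_nabla T y)) x
        - 1/4 * (norm (T x *v grad \<eta> x))\<^sup>2)"
proof -
  have C: "Ck_on (Suc 0) (\<lambda>y. T y *v Zf y) UNIV" by (rule Ck_on_bilinear[OF bounded_bilinear_mv Ck_T C1_Zf])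
  have "(\<lambda>y. T y *v (T y *v grad \<eta> y - tr_nabla T y)) = (\<lambda>y. - (T y *v Zf y))"
    by (simp add: Zf_def matrix_vector_mult_diff_distrib)
  then have d: "divergence (\<lambda>y. T y *v (T y *v grad \<eta> y - tr_nabla T y)) x = - divergence (\<lambda>y. T y *v Zf y) x"
    using divergence_uminus[OF C] by simp
  have "grad \<eta> x \<bullet> (T x *v Zf x) = (T x *v grad \<eta> x) \<bullet> Zf x" by (simp add: T_sym)
  then show ?thesis unfolding d power2_norm_eq_inner
    by (simp add: Zf_def inner_diff_left inner_diff_right inner_commute algebra_simps)
qed

lemma const_bounds:
  assumes x: "x \<in> \<Omega>"
  shows "Zf x \<bullet> Zf x - 2 * divergence (\<lambda>y. T y *v Zf y) x + 2 * (grad \<eta> x \<bullet> (T x *v Zf x))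
    \<le> (const_T0 \<Omega> T)\<^sup>2 + 4 * const_C0 \<Omega> \<eta> T"
proof -
  \<comment> \<open>A real supremum dominates its members only if they are bounded above, which
    continuity on the bounded domain provides.\<close>
  have bdd: "bdd_above (g ` \<Omega>)" if g: "continuous_on UNIV g" for g :: "real^'n \<Rightarrow> real"
  proof -
    obtain K where "\<And>x. x \<in> \<Omega> \<Longrightarrow> norm (g x) \<le> K"
      by (rule continuous_bounded_on_bounded[OF bounded_\<Omega> g]) blast
    then show ?thesis by (intro bdd_aboveI[of _ K]) (auto simp: abs_le_iff)
  qed
  have C: "Ck_on (Suc 0) (\<lambda>y. T y *v (T y *v grad \<eta> y - tr_nabla T y)) UNIV"
    by (intro Ck_on_bilinear[OF bounded_bilinear_mv Ck_T] Ck_on_diff Ck_tr_nabla C1_grad_\<eta>)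
  have "1/2 * divergence (\<lambda>y. T y *v (T y *v grad \<eta> y - tr_nabla T y)) x - 1/4 * (norm (T x *v grad \<eta> x))\<^sup>2 \<le> const_C0 \<Omega> \<eta> T"
    unfolding const_C0_def
    by (rule cSUP_upper[OF x], rule bdd)
      (intro continuous_intros C1_continuous_divergence[OF C] continuous_T continuous_grad_\<eta>)
  moreover have "norm (tr_nabla T x) \<le> const_T0 \<Omega> T"
    unfolding const_T0_def
    by (rule cSUP_upper[OF x], rule bdd) (intro continuous_intros Ck_on_imp_continuous[OF Ck_tr_nabla])
  then have "(norm (tr_nabla T x))\<^sup>2 \<le> (const_T0 \<Omega> T)\<^sup>2" by (intro power_mono) auto
  ultimately show ?thesis unfolding Zf_square by (intro add_mono mult_left_mono) auto
qed

text \<open>Each component f contributes the square of 2 T \<nabla>f + f Z. The first part costs 4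
  \<delta> times the T energy, which is \<open>Qf\<close> without its \<alpha> term; the mixed part
  is integrated by parts.\<close>

lemma sum_Ap_le:
  assumes J: "V0 \<Omega> J"
  shows "(\<Sum>p\<in>UNIV. ifm L bw (\<lambda>x. Ap p x (J x)) (\<lambda>x. Ap p x (J x)))
    \<le> 4 * \<delta> * (ifm L Qf J J - \<alpha> * ifm L (\<lambda>x a b. w x * (a \<bullet> b)) (\<lambda>x. dv x (J x)) (\<lambda>x. dv x (J x)))
      + ((const_T0 \<Omega> T)\<^sup>2 + 4 * const_C0 \<Omega> \<eta> T) * ifm L Nf J J"
proof -
  define R where "R = (const_T0 \<Omega> T)\<^sup>2 + 4 * const_C0 \<Omega> \<eta> T"
  note LJ = V0_L2[OF J]
  have SJ: "S0 \<Omega> (\<lambda>x. J x $ l)" for l using J by (simp add: V0_def)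
  define W where "W x = w x *\<^sub>R (T x *v Zf x)" for x
  have CTZ: "Ck_on (Suc 0) (\<lambda>y. T y *v Zf y) UNIV" by (rule Ck_on_bilinear[OF bounded_bilinear_mv Ck_T C1_Zf])
  have C1W: "Ck_on (Suc 0) W UNIV" unfolding W_def[abs_def] by (rule Ck_on_scaleR[OF C1_w CTZ])
  have dW: "divergence W x = w x * (divergence (\<lambda>y. T y *v Zf y) x - grad \<eta> x \<bullet> (T x *v Zf x))" for x
    unfolding W_def[abs_def] by (rule divergence_w_scaleR[OF CTZ])
  \<comment> \<open>Twice \<open>ibp_form W\<close> contains exactly the mixed term 4 f <Z, T
    \<nabla>f>. Its zero order part changes |Z|^2 into the quantity bounded in
    \<open>const_bounds\<close>.\<close>
  have pw: "w x * (\<Sum>p\<in>UNIV. Ap p x j \<bullet> Ap p x j)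
      \<le> 4 * \<delta> * (Qf x j j - \<alpha> * (w x * (dv x j \<bullet> dv x j))) + R * Nf x j j + 2 * (\<Sum>l\<in>UNIV. ibp_form W x (j $ l) (j $ l))"
    if x: "x \<in> \<Omega>" for x j
  proof -
    have l: "w x * (\<Sum>p\<in>UNIV. (Ap p x j $ l)\<^sup>2)
      \<le> 4 * \<delta> * (w x * ((T x *v snd (j $ l)) \<bullet> snd (j $ l))) + R * (w x * (fst (j $ l))\<^sup>2) + 2 * ibp_form W x (j $ l) (j $ l)" for l
    proof -
      define U where "U = snd (j $ l)"
      define f where "f = fst (j $ l)"
      define y where "y = T x *v U"
      have "(\<Sum>p\<in>UNIV. (Ap p x j $ l)\<^sup>2) = (2 *\<^sub>R y + f *\<^sub>R Zf x) \<bullet> (2 *\<^sub>R y + f *\<^sub>R Zf x)"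
      proof -
        have "Ap p x j $ l = (2 *\<^sub>R y + f *\<^sub>R Zf x) $ p" for p
          by (simp add: Ap_def tp_inner y_def U_def f_def)
        then show ?thesis by (simp only: inner_vec_def power2_eq_square inner_real_def)
      qed
      also have "\<dots> = 4 * (y \<bullet> y) + 4 * (f * (Zf x \<bullet> y)) + f\<^sup>2 * (Zf x \<bullet> Zf x)"
        by (simp add: inner_add_left inner_add_right inner_commute power2_eq_square algebra_simps)
      finally have 1: "(\<Sum>p\<in>UNIV. (Ap p x j $ l)\<^sup>2) = 4 * (y \<bullet> y) + 4 * (f * (Zf x \<bullet> y)) + f\<^sup>2 * (Zf x \<bullet> Zf x)" .
      have i: "ibp_form W x (j $ l) (j $ l)
          = w x * (2 * (f * (Zf x \<bullet> y)) + f\<^sup>2 * (divergence (\<lambda>y. T y *v Zf y) x - grad \<eta> x \<bullet> (T x *v Zf x)))"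
        unfolding ibp_form_def dW W_def U_def[symmetric] f_def[symmetric]
        by (simp add: T_sym y_def[symmetric] power2_eq_square algebra_simps)
      have "4 * (y \<bullet> y) \<le> 4 * (\<delta> * (y \<bullet> U))" using T_square_le[OF x, of U] by (simp add: y_def)
      moreover have "f\<^sup>2 * (Zf x \<bullet> Zf x - 2 * divergence (\<lambda>y. T y *v Zf y) x + 2 * (grad \<eta> x \<bullet> (T x *v Zf x))) \<le> f\<^sup>2 * R"
        unfolding R_def by (intro mult_left_mono const_bounds[OF x]) auto
      ultimately have "(\<Sum>p\<in>UNIV. (Ap p x j $ l)\<^sup>2) \<le> 4 * (\<delta> * (y \<bullet> U)) + f\<^sup>2 * R
          + 2 * (2 * (f * (Zf x \<bullet> y)) + f\<^sup>2 * (divergence (\<lambda>y. T y *v Zf y) x - grad \<eta> x \<bullet> (T x *v Zf x)))"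
        unfolding 1 by (simp add: algebra_simps)
      from mult_left_mono[OF this less_imp_le[OF w_pos[of x]]] show ?thesis
        unfolding i by (simp add: y_def U_def f_def algebra_simps)
    qed
    have "w x * (\<Sum>p\<in>UNIV. Ap p x j \<bullet> Ap p x j) = (\<Sum>l\<in>UNIV. w x * (\<Sum>p\<in>UNIV. (Ap p x j $ l)\<^sup>2))"
      unfolding inner_vec_def[of "Ap _ x j"] sum_distrib_left by (subst sum.swap) (simp add: power2_eq_square)
    also have "\<dots> \<le> (\<Sum>l\<in>UNIV. 4 * \<delta> * (w x * ((T x *v snd (j $ l)) \<bullet> snd (j $ l))) + R * (w x * (fst (j $ l))\<^sup>2)
        + 2 * ibp_form W x (j $ l) (j $ l))"
      by (intro sum_mono l)
    also have "\<dots> = 4 * \<delta> * (w x * (\<Sum>l\<in>UNIV. (T x *v snd (j $ l)) \<bullet> snd (j $ l)))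
        + R * (w x * (\<Sum>l\<in>UNIV. (fst (j $ l))\<^sup>2)) + 2 * (\<Sum>l\<in>UNIV. ibp_form W x (j $ l) (j $ l))"
      by (simp add: sum.distrib sum_distrib_left)
    also have "w x * (\<Sum>l\<in>UNIV. (fst (j $ l))\<^sup>2) = Nf x j j"
      by (simp add: Nf_def inner_val val_nth power2_eq_square)
    also have "w x * (\<Sum>l\<in>UNIV. (T x *v snd (j $ l)) \<bullet> snd (j $ l)) = Qf x j j - \<alpha> * (w x * (dv x j \<bullet> dv x j))"
      by (simp add: Qf_def algebra_simps)
    finally show ?thesis .
  qed
  have Lv: "L2 L (\<lambda>x. dv x (J x))" by (rule bop_L2[OF bop_dv LJ])
  have iA: "integrable L (\<lambda>x. w x * (Ap p x (J x) \<bullet> Ap p x (J x)))" for p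
    by (rule bform_integrable[OF bform_w bop_L2[OF bop_Ap LJ] bop_L2[OF bop_Ap LJ]])
  have i: "integrable L (\<lambda>x. Qf x (J x) (J x))" "integrable L (\<lambda>x. w x * (dv x (J x) \<bullet> dv x (J x)))" "integrable L (\<lambda>x. Nf x (J x) (J x))"
    by (rule bform_integrable[OF bform_Qf LJ LJ], rule bform_integrable[OF bform_w Lv Lv], rule bform_integrable[OF bform_Nf LJ LJ])
  have i3: "integrable L (\<lambda>x. ibp_form W x (J x $ l) (J x $ l))" for l
    by (rule bform_integrable[OF bform_ibp[OF C1W] S0_L2[OF SJ] S0_L2[OF SJ]])
  have "(\<Sum>p\<in>UNIV. ifm L bw (\<lambda>x. Ap p x (J x)) (\<lambda>x. Ap p x (J x)))
      = (LINT x|L. (\<Sum>p\<in>UNIV. w x * (Ap p x (J x) \<bullet> Ap p x (J x))))"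
    unfolding ifm_def by (rule Bochner_Integration.integral_sum[OF iA, symmetric])
  also have "\<dots> \<le> (LINT x|L. 4 * \<delta> * (Qf x (J x) (J x) - \<alpha> * (w x * (dv x (J x) \<bullet> dv x (J x)))) + R * Nf x (J x) (J x)
      + 2 * (\<Sum>l\<in>UNIV. ibp_form W x (J x $ l) (J x $ l)))"
  proof (rule integral_mono)
    show "integrable L (\<lambda>x. \<Sum>p\<in>UNIV. w x * (Ap p x (J x) \<bullet> Ap p x (J x)))" using iA by simp
    show "integrable L (\<lambda>x. 4 * \<delta> * (Qf x (J x) (J x) - \<alpha> * (w x * (dv x (J x) \<bullet> dv x (J x)))) + R * Nf x (J x) (J x)
      + 2 * (\<Sum>l\<in>UNIV. ibp_form W x (J x $ l) (J x $ l)))" using i i3 by simp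
  qed (use pw in \<open>simp add: sum_distrib_left\<close>)
  also have "\<dots> = 4 * \<delta> * (ifm L Qf J J - \<alpha> * ifm L (\<lambda>x a b. w x * (a \<bullet> b)) (\<lambda>x. dv x (J x)) (\<lambda>x. dv x (J x)))
      + R * ifm L Nf J J + 2 * (\<Sum>l\<in>UNIV. ifm L (ibp_form W) (\<lambda>x. J x $ l) (\<lambda>x. J x $ l))"
    unfolding ifm_def using i i3 by simp
  also have "(\<Sum>l\<in>UNIV. ifm L (ibp_form W) (\<lambda>x. J x $ l) (\<lambda>x. J x $ l)) = 0"
    by (intro sum.neutral ballI integration_by_parts[OF C1W SJ SJ])
  finally show ?thesis by (simp add: R_def)
qed

text \<open>Both hypotheses of \<open>yang_algebra\<close> are provided for one coordinate: the
  first by the Rayleigh quotient of the projected function, the second by a nonnegative square. S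
  stands for the next eigenvalue; only the weak equations, orthonormality and the spectral lower
  bound enter.\<close>

lemma yang_direction:
  fixes \<sigma> :: "nat \<Rightarrow> real" and J :: "nat \<Rightarrow> real^'n \<Rightarrow> 'n vjet" and p :: 'n
  assumes VJ: "\<And>i. i \<in> {1..k} \<Longrightarrow> V0 \<Omega> (J i)"
    and eq: "\<And>i K. i \<in> {1..k} \<Longrightarrow> V0 \<Omega> K \<Longrightarrow> ifm L Qf (J i) K = \<sigma> i * ifm L Nf (J i) K"
    and on: "\<And>i j. i \<in> {1..k} \<Longrightarrow> j \<in> {1..k} \<Longrightarrow> ifm L Nf (J i) (J j) = (if i = j then 1 else 0)"
    and sb: "\<And>W. V0 \<Omega> W \<Longrightarrow> (\<And>j. j \<in> {1..k} \<Longrightarrow> ifm L Nf W (J j) = 0) \<Longrightarrow> S * ifm L Nf W W \<le> ifm L Qf W W"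
    and mono: "\<And>i. i \<in> {1..k} \<Longrightarrow> \<sigma> i \<le> S" and \<rho>: "0 < \<rho>"
  defines "\<theta> \<equiv> \<lambda>i. ifm L Qf (\<lambda>x. Xj p x (J i x)) (\<lambda>x. Xj p x (J i x)) - ifm L Qf (J i) (\<lambda>x. Xj p x (Xj p x (J i x)))"
    and "\<tau> \<equiv> \<lambda>i. - ifm L (Cf p) (J i) (\<lambda>x. Xj p x (J i x))"
    and "A \<equiv> \<lambda>i. ifm L bw (\<lambda>x. Ap p x (J i x)) (\<lambda>x. Ap p x (J i x))"
  shows "(\<Sum>i\<in>{1..k}. (S - \<sigma> i)\<^sup>2 * \<tau> i)
    \<le> \<rho> * (\<Sum>i\<in>{1..k}. (S - \<sigma> i)\<^sup>2 * \<theta> i) + (\<Sum>i\<in>{1..k}. (S - \<sigma> i) * A i) / (4 * \<rho>)"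
proof -
  define I where "I = {1..k}"
  have fI: "finite I" by (simp add: I_def)
  define X where "X i x = Xj p x (J i x)" for i x
  define a where "a i j = ifm L Nf (X i) (J j)" for i j
  define c where "c i j = ifm L (Cf p) (J i) (J j)" for i j
  define P where "P i x = (\<Sum>j\<in>I. a i j *\<^sub>R J j x)" for i x
  define W where "W i x = X i x - P i x" for i x
  note VJ = VJ[folded I_def] and eq = eq[folded I_def] and on = on[folded I_def] and sb = sb[folded I_def]
  have LJ: "L2 L (J i)" if "i \<in> I" for i by (rule V0_L2[OF VJ[OF that]])
  have VX: "V0 \<Omega> (X i)" if "i \<in> I" for i unfolding X_def[abs_def] by (rule V0_Xj[OF VJ[OF that]])
  have LX: "L2 L (X i)" if "i \<in> I" for i by (rule V0_L2[OF VX[OF that]])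
  have VP: "V0 \<Omega> (P i)" for i unfolding P_def[abs_def] by (rule V0_sum[OF VJ])
  have LP: "L2 L (P i)" for i by (rule V0_L2[OF VP])
  have VW: "V0 \<Omega> (W i)" if "i \<in> I" for i unfolding W_def[abs_def] by (rule V0_diff[OF VX[OF that] VP])
  have LW: "L2 L (W i)" if "i \<in> I" for i by (rule V0_L2[OF VW[OF that]])
  \<comment> \<open>Multiplication by x_p is symmetric for the weighted inner product, while the
    commutator is antisymmetric.\<close>
  have a_sym: "a i j = a j i" for i j
    unfolding a_def X_def ifm_def Nf_def val_Xj by (simp add: inner_commute)
  have c_asym: "c i j = - c j i" for i j
    unfolding c_def ifm_def by (subst Cf_antisym) simp
  have NP: "ifm L Nf (P i) K = (\<Sum>j\<in>I. a i j * ifm L Nf (J j) K)" if "L2 L K" for i K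
    unfolding P_def[abs_def] by (rule ifm_sum_left[OF bform_Nf LJ that])
  have QP: "ifm L Qf (P i) K = (\<Sum>j\<in>I. a i j * (\<sigma> j * ifm L Nf (J j) K))" if "V0 \<Omega> K" for i K
  proof -
    have "ifm L Qf (P i) K = (\<Sum>j\<in>I. a i j * ifm L Qf (J j) K)"
      unfolding P_def[abs_def] by (rule ifm_sum_left[OF bform_Qf LJ V0_L2[OF that]])
    also have "\<dots> = (\<Sum>j\<in>I. a i j * (\<sigma> j * ifm L Nf (J j) K))"
      by (intro sum.cong refl arg_cong2[where f="(*)"] eq that)
    finally show ?thesis .
  qed
  have pick: "(\<Sum>j\<in>I. g j * ifm L Nf (J j) (J m)) = g m" if "m \<in> I" for g m
  proof -
    have "(\<Sum>j\<in>I. g j * ifm L Nf (J j) (J m)) = (\<Sum>j\<in>I. if j = m then g m else 0)"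
      by (rule sum.cong) (use on that in auto)
    then show ?thesis using fI that by simp
  qed
  have NJX: "ifm L Nf (J j) (X i) = a i j" for i j unfolding a_def by (rule ifm_Nf_sym)
  have NPJ: "ifm L Nf (P i) (J m) = a i m" if "m \<in> I" for i m
    unfolding NP[OF LJ[OF that]] by (rule pick[OF that])
  have NWJ: "ifm L Nf (W i) (J m) = 0" if "i \<in> I" "m \<in> I" for i m
    unfolding W_def[abs_def] ifm_diff_left[OF bform_Nf LX[OF that(1)] LP LJ[OF that(2)]] NPJ[OF that(2)]
    by (simp add: a_def)
  have NJP: "ifm L Nf (J m) (P i) = a i m" if "m \<in> I" for i m
    using NPJ[OF that] ifm_Nf_sym by metis
  have NWP: "ifm L Nf (W i) (P i) = 0" if "i \<in> I" for i
    using NP[OF LW[OF that], of i] NWJ[OF that] ifm_Nf_sym[of "W i"] by (simp add: sum.neutral)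
  have NPX: "ifm L Nf (P i) (X i) = (\<Sum>j\<in>I. (a i j)\<^sup>2)" if "i \<in> I" for i
    unfolding NP[OF LX[OF that]] NJX by (simp add: power2_eq_square)
  have NPP: "ifm L Nf (P i) (P i) = (\<Sum>j\<in>I. (a i j)\<^sup>2)" for i
    unfolding NP[OF LP] by (rule sum.cong) (simp_all add: NJP power2_eq_square)
  have QPX: "ifm L Qf (P i) (X i) = (\<Sum>j\<in>I. \<sigma> j * (a i j)\<^sup>2)" if "i \<in> I" for i
    unfolding QP[OF VX[OF that]] NJX by (simp add: power2_eq_square mult_ac)
  have QPP: "ifm L Qf (P i) (P i) = (\<Sum>j\<in>I. \<sigma> j * (a i j)\<^sup>2)" for i
    unfolding QP[OF VP] by (rule sum.cong) (simp_all add: NJP power2_eq_square mult_ac)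
  have WW: "ifm L q (W i) (W i) = ifm L q (X i) (X i) - 2 * ifm L q (P i) (X i) + ifm L q (P i) (P i)"
    if "i \<in> I" and q: "bform L q" and sym: "\<And>f g. ifm L q f g = ifm L q g f"
    for i and q :: "real^'n \<Rightarrow> 'n vjet \<Rightarrow> 'n vjet \<Rightarrow> real"
    unfolding W_def[abs_def]
    using sym[of "X i" "P i"] LX[OF that(1)] LP[of i] q
    by (simp add: ifm_diff_left ifm_diff_right L2_diff)
  have NWW: "ifm L Nf (W i) (W i) = ifm L Nf (X i) (X i) - (\<Sum>j\<in>I. (a i j)\<^sup>2)" if "i \<in> I" for i
    unfolding WW[OF that bform_Nf ifm_Nf_sym] NPX[OF that] NPP by simp
  have QWW: "ifm L Qf (W i) (W i) = ifm L Qf (X i) (X i) - (\<Sum>j\<in>I. \<sigma> j * (a i j)\<^sup>2)" if "i \<in> I" for i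
    unfolding WW[OF that bform_Qf ifm_Qf_sym] QPX[OF that] QPP by simp
  \<comment> \<open>The equation of u_i is tested with the square of x_p times u_i.\<close>
  have sXX: "\<sigma> i * ifm L Nf (X i) (X i) = ifm L Qf (J i) (\<lambda>x. Xj p x (X i x))" if "i \<in> I" for i
  proof -
    have "V0 \<Omega> (\<lambda>x. Xj p x (X i x))" by (rule V0_Xj[OF VX[OF that]])
    from eq[OF that this] show ?thesis
      unfolding ifm_def Nf_def X_def val_Xj by (simp add: mult_ac)
  qed
  show ?thesis unfolding I_def[symmetric]
  proof (rule yang_algebra[OF _ \<rho> a_sym c_asym, where n="\<lambda>i. ifm L Nf (W i) (W i)"])
    show "0 \<le> S - \<sigma> i" if "i \<in> I" for i using mono[of i] that by (simp add: I_def)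
    fix i assume i: "i \<in> I"
    have "S * ifm L Nf (W i) (W i) \<le> ifm L Qf (W i) (W i)" by (rule sb[OF VW[OF i] NWJ[OF i]])
    then show "(S - \<sigma> i) * ifm L Nf (W i) (W i) \<le> \<theta> i + (\<Sum>j\<in>I. (S - \<sigma> j - (S - \<sigma> i)) * (a i j)\<^sup>2)"
    proof -
      assume h: "S * ifm L Nf (W i) (W i) \<le> ifm L Qf (W i) (W i)"
      have "\<sigma> i * ifm L Nf (W i) (W i) = ifm L Qf (J i) (\<lambda>x. Xj p x (X i x)) - \<sigma> i * (\<Sum>j\<in>I. (a i j)\<^sup>2)"
        unfolding NWW[OF i] using sXX[OF i] by (simp add: algebra_simps)
      moreover have "\<theta> i = ifm L Qf (X i) (X i) - ifm L Qf (J i) (\<lambda>x. Xj p x (X i x))"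
        by (simp add: \<theta>_def X_def[abs_def])
      moreover have "(\<Sum>j\<in>I. (S - \<sigma> j - (S - \<sigma> i)) * (a i j)\<^sup>2) = \<sigma> i * (\<Sum>j\<in>I. (a i j)\<^sup>2) - (\<Sum>j\<in>I. \<sigma> j * (a i j)\<^sup>2)"
        by (simp add: sum_subtractf sum_distrib_left left_diff_distrib)
      ultimately show ?thesis using h QWW[OF i] by (simp add: left_diff_distrib)
    qed
    fix r :: real
    define y where "y x = Ap p x (J i x)" for x
    \<comment> \<open>The projection of the commutator \<open>y\<close> to the span of the
      eigenfunctions, its coefficients being the c_ij.\<close>
    define z where "z x = (\<Sum>j\<in>I. c i j *\<^sub>R val (J j x))" for x
    define v where "v x = val (W i x)" for x
    have Ly: "L2 L y" unfolding y_def[abs_def] by (rule bop_L2[OF bop_Ap LJ[OF i]])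
    have Lvj: "L2 L (\<lambda>x. val (J j x))" if "j \<in> I" for j by (rule L2_val[OF LJ[OF that]])
    have Lz: "L2 L z" unfolding z_def[abs_def] by (intro L2_sum L2_scaleR Lvj)
    have Lv: "L2 L v" unfolding v_def[abs_def] by (rule L2_val[OF LW[OF i]])
    have bsym: "ifm L bw f g = ifm L bw g f" for f g by (simp add: ifm_def inner_commute)
    have yK: "ifm L bw y (\<lambda>x. val (K x)) = ifm L (Cf p) (J i) K" if "V0 \<Omega> K" for K
      unfolding y_def[abs_def] by (rule Ap_weak_form[OF VJ[OF i] that])
    have zg: "ifm L bw z g = (\<Sum>j\<in>I. c i j * ifm L bw (\<lambda>x. val (J j x)) g)" if "L2 L g" for g
      unfolding z_def[abs_def] by (rule ifm_sum_left[OF bform_w Lvj that])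
    have zy: "ifm L bw z y = (\<Sum>j\<in>I. (c i j)\<^sup>2)"
      unfolding zg[OF Ly] by (rule sum.cong) (simp_all add: bsym[of _ y] yK[OF VJ] c_def power2_eq_square)
    have zz: "ifm L bw z z = (\<Sum>j\<in>I. (c i j)\<^sup>2)"
    proof -
      have "ifm L bw (\<lambda>x. val (J j x)) z = c i j" if "j \<in> I" for j
        unfolding bsym[of _ z] zg[OF Lvj[OF that]] ifm_bw_val by (rule pick[OF that])
      then show ?thesis unfolding zg[OF Lz] by (simp add: power2_eq_square)
    qed
    have zv: "ifm L bw z v = 0"
    proof -
      have "ifm L bw (\<lambda>x. val (J j x)) v = 0" if "j \<in> I" for j
        unfolding v_def[abs_def] ifm_bw_val using NWJ[OF i that] ifm_Nf_sym[of "J j" "W i"] by simp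
      then show ?thesis unfolding zg[OF Lv] by simp
    qed
    have vv: "ifm L bw v v = ifm L Nf (W i) (W i)" unfolding v_def[abs_def] by (rule ifm_bw_val)
    have yv: "ifm L bw y v = - \<tau> i - (\<Sum>j\<in>I. a i j * c i j)"
    proof -
      have "ifm L bw y v = ifm L (Cf p) (J i) (W i)" unfolding v_def[abs_def] by (rule yK[OF VW[OF i]])
      also have "\<dots> = ifm L (Cf p) (J i) (X i) - ifm L (Cf p) (J i) (P i)"
        unfolding W_def[abs_def] by (rule ifm_diff_right[OF bform_Cf LJ[OF i] LX[OF i] LP])
      also have "ifm L (Cf p) (J i) (P i) = (\<Sum>j\<in>I. a i j * c i j)"
        unfolding P_def[abs_def] c_def by (rule ifm_sum_right[OF bform_Cf LJ LJ[OF i]])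
      also have "ifm L (Cf p) (J i) (X i) = - \<tau> i" by (simp add: \<tau>_def X_def[abs_def])
      finally show ?thesis .
    qed
    \<comment> \<open>Since \<open>v\<close> is orthogonal to \<open>z\<close>, the square of r v +
      (y - z) has the same mixed term as that of r v + y but is smaller by |z|^2. This gain is what
      compensates the products a_ij c_ij in \<open>yang_algebra\<close>.\<close>
    define h where "h x = r *\<^sub>R v x + (y x - z x)" for x
    have Lyz: "L2 L (\<lambda>x. y x - z x)" by (rule L2_diff[OF Ly Lz])
    have "0 \<le> ifm L bw h h" unfolding ifm_def by (intro integral_nonneg_AE AE_I2) (simp add: less_imp_le[OF w_pos])
    also have "ifm L bw h h = r * (r * ifm L bw v v + ifm L bw v (\<lambda>x. y x - z x))
        + (r * ifm L bw (\<lambda>x. y x - z x) v + ifm L bw (\<lambda>x. y x - z x) (\<lambda>x. y x - z x))"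
      unfolding h_def[abs_def]
      by (simp only: ifm_add_left[OF bform_w L2_scaleR[OF Lv] Lyz L2_add[OF L2_scaleR[OF Lv] Lyz]]
          ifm_add_right[OF bform_w L2_scaleR[OF Lv] L2_scaleR[OF Lv] Lyz] ifm_add_right[OF bform_w Lyz L2_scaleR[OF Lv] Lyz]
          ifm_scaleR_left[OF bform_w] ifm_scaleR_right[OF bform_w]) (simp add: algebra_simps)
    also have "ifm L bw v (\<lambda>x. y x - z x) = ifm L bw (\<lambda>x. y x - z x) v" by (rule bsym)
    also have "ifm L bw (\<lambda>x. y x - z x) v = - \<tau> i - (\<Sum>j\<in>I. a i j * c i j)"
      unfolding ifm_diff_left[OF bform_w Ly Lz Lv] yv zv by simp
    also have "ifm L bw (\<lambda>x. y x - z x) (\<lambda>x. y x - z x) = A i - (\<Sum>j\<in>I. (c i j)\<^sup>2)"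
      unfolding ifm_diff_left[OF bform_w Ly Lz Lyz] ifm_diff_right[OF bform_w Ly Ly Lz] ifm_diff_right[OF bform_w Lz Ly Lz]
        bsym[of y z] zy zz by (simp add: A_def y_def[abs_def])
    finally show "2 * r * (\<tau> i + (\<Sum>j\<in>I. a i j * c i j)) \<le> r\<^sup>2 * ifm L Nf (W i) (W i) + A i - (\<Sum>j\<in>I. (c i j)\<^sup>2)"
      unfolding vv by (simp add: power2_eq_square algebra_simps)
  qed
qed

end

section \<open>Summation over the coordinates and the recursion\<close>

theorem corollary1p2:
  fixes \<Omega> :: "(real^'n) set"
    and \<eta> :: "real^'n \<Rightarrow> real"
    and T :: "real^'n \<Rightarrow> real^'n^'n"
    and \<epsilon> \<delta> \<alpha> :: real
    and \<sigma> :: "nat \<Rightarrow> real"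
    and u :: "nat \<Rightarrow> real^'n \<Rightarrow> real^'n"
    and k :: nat
  defines "n \<equiv> real CARD('n)"
    and "D0 \<equiv> const_D0 \<Omega> \<eta> T \<alpha> \<delta> u k"
  assumes "smooth_bounded_domain \<Omega>"
    and "Ck_on 2 \<eta> UNIV"
    and "smooth_on T UNIV" and "\<And>x. symmetric_pos_def (T x)"
    and "\<epsilon> > 0" and "\<delta> > 0"
    and "\<And>x. x \<in> \<Omega> \<Longrightarrow> tensor_le (\<epsilon> *\<^sub>R mat 1) (T x) \<and> tensor_le (T x) (\<delta> *\<^sub>R mat 1)"
    and "\<alpha> \<ge> 0"
    and "eigenvalue_sequence \<Omega> \<eta> T \<alpha> \<sigma>"
    and "\<And>i. i \<ge> 1 \<Longrightarrow> u i \<in> eigenspace \<Omega> \<eta> T \<alpha> (\<sigma> i)"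
    and "\<And>i j. i \<ge> 1 \<Longrightarrow> j \<ge> 1 \<Longrightarrow>
           L2_inner (weighted \<Omega> \<eta>) (u i) (u j) = (if i = j then 1 else 0)"
    and "k \<ge> 1"
  shows "\<sigma> (k + 1) + D0
    \<le> (1 + 4 * \<delta> * (n * \<delta> + \<alpha>) / (\<epsilon>\<^sup>2 * n\<^sup>2))
        * real k powr (2 * \<delta> * (n * \<delta> + \<alpha>) / (\<epsilon>\<^sup>2 * n\<^sup>2)) * (\<sigma> 1 + D0)"
proof -
  have C2: "Ck_on (Suc (Suc 0)) \<eta> UNIV" using assms(4) by (simp add: numeral_2_eq_2)
  interpret elliptic \<Omega> \<eta> T \<epsilon> \<delta> \<alpha>
  proof
    show "open \<Omega>" "bounded \<Omega>" using assms(3) by (auto simp: smooth_bounded_domain_def)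
    show "Ck_on (Suc 0) \<eta> UNIV" by (rule Ck_on_pred[OF C2])
  qed (fact C2 assms)+
  note ev = assms(11) and eig = assms(12)
  define J where "J i = weak_jet \<Omega> (u i)" for i
  have VJ: "V0 \<Omega> (J i)" if "1 \<le> i" for i unfolding J_def by (rule eigenspace_V0[OF eig[OF that]])
  have LJ: "L2 L (J i)" if "1 \<le> i" for i by (rule V0_L2[OF VJ[OF that]])
  have uJ: "u i = (\<lambda>x. val (J i x))" for i by (simp add: J_def val_weak_jet)
  have on: "ifm L Nf (J i) (J j) = (if i = j then 1 else 0)" if "1 \<le> i" "1 \<le> j" for i j
    using assms(13)[OF that] L2_inner_M[OF L2_val[OF LJ[OF that(1)]] L2_val[OF LJ[OF that(2)]]]
    unfolding uJ ifm_bw_val by simp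
  have eq: "ifm L Qf (J i) K = \<sigma> i * ifm L Nf (J i) K" if "1 \<le> i" "V0 \<Omega> K" for i K
    unfolding J_def by (rule eigenspace_weak_form[OF eig[OF that(1)] that(2)])
  have n: "0 < n" by (simp add: n_def)
  have nda: "0 < n * \<delta> + \<alpha>" using n assms(8,10) by (simp add: add_pos_nonneg)
  define R where "R = (const_T0 \<Omega> T)\<^sup>2 + 4 * const_C0 \<Omega> \<eta> T"
  define g where "g i = L2_sqnorm M (weak_div_eta \<Omega> \<eta> (u i))" for i
  have D0: "D0 = - \<alpha> * Min (g ` {1..k}) + R / (4 * \<delta>)"
    by (simp add: D0_def const_D0_def g_def R_def)
  have g: "g i = ifm L (\<lambda>x a b. w x * (a \<bullet> b)) (\<lambda>x. dv x (J i x)) (\<lambda>x. dv x (J i x))" if "1 \<le> i" for i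
  proof -
    have "weak_div_eta \<Omega> \<eta> (u i) = (\<lambda>x. dv x (J i x))" by (simp add: J_def dv_weak_jet)
    then show ?thesis unfolding g_def by (simp only: L2_sqnorm_M[OF bop_L2[OF bop_dv LJ[OF that]]])
  qed
  define A where "A p i = ifm L bw (\<lambda>x. Ap p x (J i x)) (\<lambda>x. Ap p x (J i x))" for p i
  \<comment> \<open>\<open>D0\<close> contains the minimum over all indices up to k, so a single
    constant bounds - \<alpha> g i from above for each of them.\<close>
  have A_le: "(\<Sum>p\<in>UNIV. A p i) \<le> 4 * \<delta> * (\<sigma> i + D0)" if i: "i \<in> {1..k}" for i
  proof -
    have i1: "1 \<le> i" using i by simp
    have "(\<Sum>p\<in>UNIV. A p i) \<le> 4 * \<delta> * (\<sigma> i - \<alpha> * g i) + R"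
      using sum_Ap_le[OF VJ[OF i1]] on[OF i1 i1] eq[OF i1 VJ[OF i1]]
      unfolding A_def R_def g[OF i1] by simp
    also have "\<dots> \<le> 4 * \<delta> * (\<sigma> i - \<alpha> * Min (g ` {1..k})) + R"
      using i assms(8,10) by (intro add_right_mono mult_left_mono diff_left_mono Min_le) auto
    also have "\<dots> = 4 * \<delta> * (\<sigma> i + D0)" using assms(8) by (simp add: D0 field_simps)
    finally show ?thesis .
  qed
  have A0: "0 \<le> A p i" for p i
    unfolding A_def ifm_def by (intro integral_nonneg_AE AE_I2) (simp add: less_imp_le[OF w_pos])
  \<comment> \<open>\<open>D0\<close> may be negative, but 4 \<delta> (\<sigma> i + D0) dominates a
    sum of squares; the recursion starts from this nonnegativity.\<close>
  have v0: "0 \<le> \<sigma> i + D0" if "i \<in> {1..k}" for i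
  proof -
    have "0 \<le> (\<Sum>p\<in>UNIV. A p i)" by (intro sum_nonneg A0)
    then have "0 \<le> 4 * \<delta> * (\<sigma> i + D0)" using A_le[OF that] by linarith
    then show ?thesis using assms(8) by (simp add: zero_le_mult_iff)
  qed
  define c where "c = 2 * \<delta> * (n * \<delta> + \<alpha>) / (\<epsilon>\<^sup>2 * n\<^sup>2)"
  have c: "0 < c" using n nda assms(7,8) by (simp add: c_def)
  have Y: "(\<Sum>i=1..j. (\<sigma> (j + 1) + D0 - (\<sigma> i + D0))\<^sup>2)
      \<le> 2 * c * (\<Sum>i=1..j. (\<sigma> (j + 1) + D0 - (\<sigma> i + D0)) * (\<sigma> i + D0))" if j: "1 \<le> j" "j \<le> k" for j
  proof -
    define s where "s i = \<sigma> (j + 1) - \<sigma> i" for i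
    have s: "0 \<le> s i" if "i \<in> {1..j}" for i
      using eigenvalue_sequence_mono[OF ev, of i "j + 1"] that by (simp add: s_def)
    define \<theta> where "\<theta> p i = ifm L Qf (\<lambda>x. Xj p x (J i x)) (\<lambda>x. Xj p x (J i x)) - ifm L Qf (J i) (\<lambda>x. Xj p x (Xj p x (J i x)))" for p i
    define \<tau> where "\<tau> p i = - ifm L (Cf p) (J i) (\<lambda>x. Xj p x (J i x))" for p i
    \<comment> \<open>The maximizer of \<rho> (n \<epsilon> - \<rho> (n \<delta> + \<alpha>)): with
      it the term in \<rho> absorbs half of the left side n \<epsilon> X.\<close>
    define \<rho> where "\<rho> = n * \<epsilon> / (2 * (n * \<delta> + \<alpha>))"
    have \<rho>: "0 < \<rho>" using n nda assms(7) by (simp add: \<rho>_def)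
    have dir: "(\<Sum>i\<in>{1..j}. (s i)\<^sup>2 * \<tau> p i)
        \<le> \<rho> * (\<Sum>i\<in>{1..j}. (s i)\<^sup>2 * \<theta> p i) + (\<Sum>i\<in>{1..j}. s i * A p i) / (4 * \<rho>)" for p
      unfolding s_def \<tau>_def \<theta>_def A_def
    proof (rule yang_direction[OF _ _ _ _ _ \<rho>])
      show "\<sigma> (j + 1) * ifm L Nf W W \<le> ifm L Qf W W"
        if "V0 \<Omega> W" "\<And>m. m \<in> {1..j} \<Longrightarrow> ifm L Nf W (J m) = 0" for W
        by (rule spectral_bound[OF ev eig on[unfolded J_def] that(1)]) (use that(2) in \<open>auto simp: J_def\<close>)
      show "\<sigma> i \<le> \<sigma> (j + 1)" if "i \<in> {1..j}" for i using s[OF that] by (simp add: s_def)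
    qed (use VJ eq on in auto)
    have "n * \<epsilon> * (\<Sum>i\<in>{1..j}. (s i)\<^sup>2) = (\<Sum>i\<in>{1..j}. (s i)\<^sup>2 * (n * \<epsilon>))" by (simp add: sum_distrib_left mult.commute)
    also have "\<dots> \<le> (\<Sum>i\<in>{1..j}. (s i)\<^sup>2 * (\<Sum>p\<in>UNIV. \<tau> p i))"
    proof (intro sum_mono mult_left_mono)
      fix i assume "i \<in> {1..j}"
      then have i: "1 \<le> i" by simp
      show "n * \<epsilon> \<le> (\<Sum>p\<in>UNIV. \<tau> p i)" using sum_tau_ge[OF VJ[OF i]] on[OF i i] by (simp add: \<tau>_def n_def)
    qed simp
    also have "\<dots> = (\<Sum>p\<in>UNIV. \<Sum>i\<in>{1..j}. (s i)\<^sup>2 * \<tau> p i)"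
      unfolding sum_distrib_left by (rule sum.swap)
    also have "\<dots> \<le> (\<Sum>p\<in>UNIV. \<rho> * (\<Sum>i\<in>{1..j}. (s i)\<^sup>2 * \<theta> p i) + (\<Sum>i\<in>{1..j}. s i * A p i) / (4 * \<rho>))"
      by (intro sum_mono dir)
    also have "\<dots> = \<rho> * (\<Sum>p\<in>UNIV. \<Sum>i\<in>{1..j}. (s i)\<^sup>2 * \<theta> p i) + (\<Sum>p\<in>UNIV. \<Sum>i\<in>{1..j}. s i * A p i) / (4 * \<rho>)"
      by (simp only: sum.distrib sum_distrib_left[symmetric] sum_divide_distrib[symmetric])
    also have "(\<Sum>p\<in>UNIV. \<Sum>i\<in>{1..j}. (s i)\<^sup>2 * \<theta> p i) = (\<Sum>i\<in>{1..j}. (s i)\<^sup>2 * (\<Sum>p\<in>UNIV. \<theta> p i))"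
      unfolding sum_distrib_left by (rule sum.swap)
    also have "(\<Sum>p\<in>UNIV. \<Sum>i\<in>{1..j}. s i * A p i) = (\<Sum>i\<in>{1..j}. s i * (\<Sum>p\<in>UNIV. A p i))"
      unfolding sum_distrib_left by (rule sum.swap)
    also have "\<rho> * (\<Sum>i\<in>{1..j}. (s i)\<^sup>2 * (\<Sum>p\<in>UNIV. \<theta> p i)) + (\<Sum>i\<in>{1..j}. s i * (\<Sum>p\<in>UNIV. A p i)) / (4 * \<rho>)
        \<le> \<rho> * (\<Sum>i\<in>{1..j}. (s i)\<^sup>2 * (n * \<delta> + \<alpha>)) + (\<Sum>i\<in>{1..j}. s i * (4 * \<delta> * (\<sigma> i + D0))) / (4 * \<rho>)"
    proof (intro add_mono mult_left_mono divide_right_mono sum_mono)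
      fix i assume ij: "i \<in> {1..j}"
      then have i: "1 \<le> i" "i \<in> {1..k}" using j by auto
      show "(\<Sum>p\<in>UNIV. \<theta> p i) \<le> n * \<delta> + \<alpha>" using sum_theta_le[OF VJ[OF i(1)]] on[OF i(1) i(1)] by (simp add: \<theta>_def n_def)
      show "(\<Sum>p\<in>UNIV. A p i) \<le> 4 * \<delta> * (\<sigma> i + D0)" by (rule A_le[OF i(2)])
      show "0 \<le> s i" by (rule s[OF ij])
    qed (use \<rho> in auto)
    also have "(\<Sum>i\<in>{1..j}. (s i)\<^sup>2 * (n * \<delta> + \<alpha>)) = (\<Sum>i\<in>{1..j}. (s i)\<^sup>2) * (n * \<delta> + \<alpha>)"
      by (simp only: sum_distrib_right)
    also have "(\<Sum>i\<in>{1..j}. s i * (4 * \<delta> * (\<sigma> i + D0))) = 4 * \<delta> * (\<Sum>i\<in>{1..j}. s i * (\<sigma> i + D0))"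
      by (simp add: sum_distrib_left mult_ac)
    finally have ineq: "n * \<epsilon> * X \<le> \<rho> * (X * (n * \<delta> + \<alpha>)) + 4 * \<delta> * Z / (4 * \<rho>)"
      if "X = (\<Sum>i\<in>{1..j}. (s i)\<^sup>2)" "Z = (\<Sum>i\<in>{1..j}. s i * (\<sigma> i + D0))" for X Z unfolding that .
    define X where "X = (\<Sum>i\<in>{1..j}. (s i)\<^sup>2)"
    define Z where "Z = (\<Sum>i\<in>{1..j}. s i * (\<sigma> i + D0))"
    have cancel: "a / (2 * q) * (X * q) = a * X / 2" "4 * \<delta> * Z / (4 * (a / (2 * q))) = 2 * \<delta> * q * Z / a"
      if "0 < q" for a q :: real
      using that by simp_all
    have "\<rho> * (X * (n * \<delta> + \<alpha>)) = n * \<epsilon> * X / 2"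
      "4 * \<delta> * Z / (4 * \<rho>) = 2 * \<delta> * (n * \<delta> + \<alpha>) * Z / (n * \<epsilon>)"
      unfolding \<rho>_def by (rule cancel[OF nda])+
    then have "n * \<epsilon> * X / 2 \<le> 2 * \<delta> * (n * \<delta> + \<alpha>) * Z / (n * \<epsilon>)" using ineq[OF X_def Z_def] by linarith
    \<comment> \<open>Clearing the factor n \<epsilon> / 2 leaves the constant 4 \<delta> (n
      \<delta> + \<alpha>) / (n \<epsilon>)^2, which is 2 c.\<close>
    then have "(n * \<epsilon> * X / 2) * (2 / (n * \<epsilon>)) \<le> (2 * \<delta> * (n * \<delta> + \<alpha>) * Z / (n * \<epsilon>)) * (2 / (n * \<epsilon>))"
      using n assms(7) by (intro mult_right_mono) auto
    moreover have "(n * \<epsilon> * X / 2) * (2 / (n * \<epsilon>)) = X" using n assms(7) by simp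
    moreover have "(2 * \<delta> * (n * \<delta> + \<alpha>) * Z / (n * \<epsilon>)) * (2 / (n * \<epsilon>)) = 2 * c * Z"
      by (simp add: c_def power2_eq_square mult_ac)
    ultimately have "X \<le> 2 * c * Z" by linarith
    then show ?thesis by (simp add: X_def Z_def s_def)
  qed
  have "\<sigma> (k + 1) + D0 \<le> (1 + 2 * c) * real k powr c * (\<sigma> 1 + D0)"
    by (rule cheng_yang_recursion[OF c assms(14), where v="\<lambda>i. \<sigma> i + D0"]) (use v0[of 1] assms(14) Y in auto)
  then show ?thesis by (simp add: c_def mult.assoc)
qed

end
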